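(* Let $d\ge 1$, let $a:\mathbb{R}^d\to[0,+\infty)$ be measurable with $a(x)=a(-x)$ and $\alpha:=\int_{\mathbb{R}^d}a(x)\,dx<+\infty$, and let $\mathcal{K}_\vartheta$, $\mathcal{Q}_\vartheta$, $(L^\odot_\vartheta,\mathcal{D}^\odot_\vartheta)$ and the semigroup $S^\odot_\vartheta$ be as defined in the context. For each $\vartheta\in\mathbb{R}$ and each $k_0\in\mathcal{D}^\odot_\vartheta$, the Cauchy problem $$\frac{d}{dt}k_t=L^\odot_\vartheta k_t,\qquad k_t|_{t=0}=k_0,$$ has a unique classical global solution $k_t\in\mathcal{Q}_\vartheta\subset\mathcal{K}_\vartheta$, and it is given by the formula $$k_t=S^\odot_\vartheta(t)k_0,\qquad t>0.$$ This, in particular, holds if $k_0\in\mathcal{K}_{\vartheta'}$ for some $\vartheta'>\vartheta$. Furthermore, if $k_0$ is the correlation function of some $\mu_0\in\mathcal{P}(\Gamma)$, then, for each $t>0$, there exists a unique $\mu_t\in\mathcal{P}(\Gamma)$ such that $k_t$ is the correlation function of $\mu_t$.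
   Context: Configurations. $\Gamma$ is the set of all $\gamma\subset\mathbb{R}^d$ such that $|\gamma\cap\Lambda|<\infty$ for every compact $\Lambda\subset\mathbb{R}^d$ ($|\cdot|$ is cardinality). It is equipped with the vague topology, i.e., the weakest topology making $\gamma\mapsto\sum_{x\in\gamma}f(x)$ continuous for all compactly supported continuous $f:\mathbb{R}^d\to\mathbb{R}$; $\mathcal{B}(\Gamma)$ is its Borel $\sigma$-field and $\mathcal{P}(\Gamma)$ is the set of probability measures on $\mathcal{B}(\Gamma)$. $\Gamma_0=\bigsqcup_{n\ge0}\Gamma^{(n)}$ is the set of finite configurations, where $\Gamma^{(n)}=\{\gamma\in\Gamma:|\gamma|=n\}$ and $\Gamma^{(0)}=\{\emptyset\}$. For $n\ge 1$, $\Gamma^{(n)}$ is identified with the symmetrization of $\{(x_1,\dots,x_n)\in(\mathbb{R}^d)^n: x_i\ne x_j \text{ for } i\neq j\}$ with its Euclidean topology. A measurable function $G:\Gamma_0\to\mathbb{R}$ is identified with the sequence of symmetric Borel functions $G^{(n)}:(\mathbb{R}^d)^n\to\mathbb{R}$ with $G(\{x_1,\dots,x_n\})=G^{(n)}(x_1,\dots,x_n)$, together with $G^{(0)}=G(\emptyset)\in\mathbb{R}$. A point $x$ is also regarded as the configuration $\{x\}$, so $\eta\setminus x\cup y=(\eta\setminus\{x\})\cup\{y\}$. Lebesgue–Poisson measure. $\lambda$ is the $\sigma$-finite measure on $\Gamma_0$ given by $$\int_{\Gamma_0}G(\eta)\lambda(d\eta)=G^{(0)}+\sum_{n=1}^\infty\frac1{n!}\int_{(\mathbb{R}^d)^n}G^{(n)}(x_1,\dots,x_n)\,dx_1\cdots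 dx_n .$$ Functions equal $\lambda$-a.e. are identified. Pairing: $\langle\!\langle v,u\rangle\!\rangle=\int_{\Gamma_0}v(\eta)u(\eta)\lambda(d\eta)$. Correlation functions. For $\mu\in\mathcal{P}(\Gamma)$ and $n\ge1$, the $n$-th order correlation measure $\chi^{(n)}_\mu$ on $(\mathbb{R}^d)^n$ is determined by $$\int_\Gamma\Big(\sum_{\{x_1,\dots,x_n\}\subset\gamma}G^{(n)}(x_1,\dots,x_n)\Big)\mu(d\gamma)=\frac1{n!}\int_{(\mathbb{R}^d)^n}G^{(n)}(x_1,\dots,x_n)\,\chi^{(n)}_\mu(dx_1,\dots,dx_n)$$ for all bounded, compactly supported, measurable (symmetric) $G^{(n)}:(\mathbb{R}^d)^n\to\mathbb{R}$. A function $k:\Gamma_0\to\mathbb{R}$ is the correlation function of $\mu$ if $k^{(0)}=1$ and, for every $n\ge1$, $\chi_\mu^{(n)}$ is absolutely continuous with respect to Lebesgue measure with Radon–Nikodym derivative $k^{(n)}\in L^\infty((\mathbb{R}^d)^n)$. Spaces. For $\vartheta\in\mathbb{R}$, $\mathcal{K}_\vartheta$ is the real Banach space of (classes of) measurable $u:\Gamma_0\to\mathbb{R}$ with $\|u\|_{\vartheta,\infty}=\mathrm{ess\,sup}_{\eta\in\Gamma_0}|u(\eta)|e^{\vartheta|\eta|}<\infty$, and $\mathcal{G}_\vartheta$ is the real Banach space of (classes of) measurable $v:\Gamma_0\to\mathbb{R}$ with $\|v\|_{\vartheta,1}=\int_{\Gamma_0}|v(\eta)|e^{-\vartheta|\eta|}\lambda(d\eta)<\infty$.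 $\mathcal{K}_\vartheta$ is the topological dual of $\mathcal{G}_\vartheta$ under $\langle\!\langle\cdot,\cdot\rangle\!\rangle$. Operators. Let $\widehat{\mathcal{G}}_\vartheta=\{v\in\mathcal{G}_\vartheta:\ \eta\mapsto\alpha|\eta|v(\eta)\in\mathcal{G}_\vartheta\}$ (a dense linear subset of $\mathcal{G}_\vartheta$), and define $\widehat{L}_\vartheta:\widehat{\mathcal{G}}_\vartheta\to\mathcal{G}_\vartheta$ by $$(\widehat{L}_\vartheta v)(\eta)=-\alpha|\eta|v(\eta)+\sum_{x\in\eta}\int_{\mathbb{R}^d}a(x-y)\,v(\eta\setminus x\cup y)\,dy .$$ Let $(\widehat{L}^*_\vartheta,\mathcal{D}_\vartheta)$ be its adjoint in $\mathcal{K}_\vartheta$: $\mathcal{D}_\vartheta$ is the set of $u\in\mathcal{K}_\vartheta$ for which there is $w\in\mathcal{K}_\vartheta$ with $\langle\!\langle\widehat{L}_\vartheta v,u\rangle\!\rangle=\langle\!\langle v,w\rangle\!\rangle$ for all $v\in\widehat{\mathcal{G}}_\vartheta$, and $\widehat{L}^*_\vartheta u=w$. Let $\mathcal{Q}_\vartheta$ be the closure of $\mathcal{D}_\vartheta$ in $\mathcal{K}_\vartheta$, and let $L^\odot_\vartheta$ be the part of $\widehat{L}^*_\vartheta$ in $\mathcal{Q}_\vartheta$, i.e., the restriction of $\widehat{L}^*_\vartheta$ to $\mathcal{D}^\odot_\vartheta=\{u\in\mathcal{D}_\vartheta:\widehat{L}^*_\vartheta u\in\mathcal{Q}_\vartheta\}$.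 The operator $(L^\odot_\vartheta,\mathcal{D}^\odot_\vartheta)$ is the generator of a $C_0$-semigroup of bounded linear operators on $\mathcal{Q}_\vartheta$, denoted $S^\odot_\vartheta=\{S^\odot_\vartheta(t)\}_{t\ge0}$. Solution. A classical global solution of the Cauchy problem is a function $[0,+\infty)\ni t\mapsto k_t\in\mathcal{Q}_\vartheta$ that is continuously differentiable on $[0,+\infty)$ (in the norm of $\mathcal{K}_\vartheta$), takes values in $\mathcal{D}^\odot_\vartheta$, and satisfies the equation and the initial condition. *)

theory Defs
  imports "HOL-Probability.Probability" "HOL-Probability.Essential_Supremum"
begin

definition borel_of_topology :: "'b topology \<Rightarrow> 'b measure" where
  "borel_of_topology T = sigma (topspace T) {U. openin T U}"

subsection \<open>Locally finite configurations\<close>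

definition configurations :: "'a::euclidean_space set set" where
  "configurations = {\<gamma>. \<forall>\<Lambda>. compact \<Lambda> \<longrightarrow> finite (\<gamma> \<inter> \<Lambda>)}"

text \<open>A configuration may be infinite, so sums over its points are written with
  \<^const>\<open>infsum\<close>; whenever they are used, only finitely many terms are nonzero.\<close>

definition vague_topology :: "'a::euclidean_space set topology" where
  "vague_topology = topology_generated_by
     {{\<gamma> \<in> configurations. (\<Sum>\<^sub>\<infinity>x\<in>\<gamma>. f x) \<in> U} | (f :: 'a \<Rightarrow> real) U.
        continuous_on UNIV f \<and> compact (closure {x. f x \<noteq> 0}) \<and> open U}"

definition config_probs :: "'a::euclidean_space set measure set" where
  "config_probs = {\<mu>. prob_space \<mu> \<and> sets \<mu> = sets (borel_of_topology vague_topology)}"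

subsection \<open>Finite configurations and the Lebesgue--Poisson measure\<close>

text \<open>Elements of \<open>(\<real>\<^sup>d)\<^sup>n\<close> are extensional functions on \<open>{..<n}\<close>. For \<open>n = 0\<close> there is
  exactly one such tuple, and its image is the empty configuration.\<close>

definition finite_configs :: "'a::euclidean_space set set" where
  "finite_configs = {\<eta>. finite \<eta>}"

definition distinct_tuples :: "nat \<Rightarrow> (nat \<Rightarrow> 'a::euclidean_space) set" where
  "distinct_tuples n = {x \<in> {..<n} \<rightarrow>\<^sub>E UNIV. inj_on x {..<n}}"

abbreviation tuple_topology :: "nat \<Rightarrow> (nat \<Rightarrow> 'a::euclidean_space) topology" where
  "tuple_topology n \<equiv> product_topology (\<lambda>_. euclidean) {..<n}"

abbreviation tuple_lborel :: "nat \<Rightarrow> (nat \<Rightarrow> 'a::euclidean_space) measure" where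
  "tuple_lborel n \<equiv> (\<Pi>\<^sub>M i\<in>{..<n}. lborel)"

text \<open>The disjoint union, over \<open>n\<close>, of the quotients of the off-diagonal part of
  \<open>(\<real>\<^sup>d)\<^sup>n\<close> by permutations: the quotient map sends a tuple to its set of entries.\<close>

definition finite_config_topology :: "'a::euclidean_space set topology" where
  "finite_config_topology = topology (\<lambda>U. U \<subseteq> finite_configs \<and>
     (\<forall>n. openin (subtopology (tuple_topology n) (distinct_tuples n))
            {x \<in> distinct_tuples n. x ` {..<n} \<in> U}))"

abbreviation finite_config_space :: "'a::euclidean_space set measure" where
  "finite_config_space \<equiv> borel_of_topology finite_config_topology"

text \<open>Tuples with repeated entries form a null set, so integrating only over distinct
  tuples does not change the integral over \<open>(\<real>\<^sup>d)\<^sup>n\<close>.\<close>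

definition lebesgue_poisson :: "'a::euclidean_space set measure" where
  "lebesgue_poisson = measure_of (space finite_config_space) (sets finite_config_space)
     (\<lambda>A. \<Sum>n. ennreal (1 / fact n) *
        emeasure (tuple_lborel n) {x \<in> distinct_tuples n. x ` {..<n} \<in> A})"

lemma istopology_finite_config:
  "istopology (\<lambda>U :: 'a::euclidean_space set set. U \<subseteq> finite_configs \<and>
     (\<forall>n. openin (subtopology (tuple_topology n) (distinct_tuples n))
            {x \<in> distinct_tuples n. x ` {..<n} \<in> U}))"
  unfolding istopology_def
proof (safe)
  fix S T :: "'a set set" and n
  let ?X = "subtopology (tuple_topology n) (distinct_tuples n) :: (nat \<Rightarrow> 'a) topology"
  assume "\<forall>n. openin (subtopology (tuple_topology n) (distinct_tuples n)) {x \<in> distinct_tuples n. x ` {..<n} \<in> S}"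
    "\<forall>n. openin (subtopology (tuple_topology n) (distinct_tuples n)) {x \<in> distinct_tuples n. x ` {..<n} \<in> T}"
  then have "openin ?X ({x \<in> distinct_tuples n. x ` {..<n} \<in> S} \<inter> {x \<in> distinct_tuples n. x ` {..<n} \<in> T})"
    by blast
  also have "{x \<in> distinct_tuples n. x ` {..<n} \<in> S} \<inter> {x \<in> distinct_tuples n. x ` {..<n} \<in> T} =
      {x \<in> distinct_tuples n. x ` {..<n} \<in> S \<inter> T}"
    by auto
  finally show "openin ?X {x \<in> distinct_tuples n. x ` {..<n} \<in> S \<inter> T}" .
next
  fix \<K> :: "'a set set set" and n
  let ?X = "subtopology (tuple_topology n) (distinct_tuples n) :: (nat \<Rightarrow> 'a) topology"
  assume *: "\<forall>K\<in>\<K>. K \<subseteq> finite_configs \<and> (\<forall>n. openin (subtopology (tuple_topology n) (distinct_tuples n)) {x \<in> distinct_tuples n. x ` {..<n} \<in> K})"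
  have "openin ?X (\<Union>K\<in>\<K>. {x \<in> distinct_tuples n. x ` {..<n} \<in> K})"
    using * by blast
  also have "(\<Union>K\<in>\<K>. {x \<in> distinct_tuples n. x ` {..<n} \<in> K}) =
      {x \<in> distinct_tuples n. x ` {..<n} \<in> \<Union>\<K>}"
    by auto
  finally show "openin ?X {x \<in> distinct_tuples n. x ` {..<n} \<in> \<Union>\<K>}" .
qed blast+

subsection \<open>The spaces\<close>

text \<open>Functions that are equal \<^const>\<open>lebesgue_poisson\<close>-almost everywhere are identified:
  elements of the spaces below are representatives, operators are graphs that are invariant
  under this identification, and equality of elements is equality almost everywhere. Norms
  take extended values, so that functions of infinite norm need no exception.\<close>

definition K_norm :: "real \<Rightarrow> ('a::euclidean_space set \<Rightarrow> real) \<Rightarrow> ereal" where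
  "K_norm \<theta> u = esssup lebesgue_poisson (\<lambda>\<eta>. ereal (\<bar>u \<eta>\<bar> * exp (\<theta> * card \<eta>)))"

definition K_space :: "real \<Rightarrow> ('a::euclidean_space set \<Rightarrow> real) set" where
  "K_space \<theta> = {u \<in> borel_measurable finite_config_space. K_norm \<theta> u < \<infinity>}"

definition G_norm :: "real \<Rightarrow> ('a::euclidean_space set \<Rightarrow> real) \<Rightarrow> ennreal" where
  "G_norm \<theta> v = (\<integral>\<^sup>+\<eta>. ennreal (\<bar>v \<eta>\<bar> * exp (- \<theta> * card \<eta>)) \<partial>lebesgue_poisson)"

definition G_space :: "real \<Rightarrow> ('a::euclidean_space set \<Rightarrow> real) set" where
  "G_space \<theta> = {v \<in> borel_measurable finite_config_space. G_norm \<theta> v < \<infinity>}"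

definition pairing :: "('a::euclidean_space set \<Rightarrow> real) \<Rightarrow> ('a set \<Rightarrow> real) \<Rightarrow> real" where
  "pairing v u = (LINT \<eta>|lebesgue_poisson. v \<eta> * u \<eta>)"

subsection \<open>The operators\<close>

definition total_rate :: "('a::euclidean_space \<Rightarrow> real) \<Rightarrow> real" where
  "total_rate a = (LINT x|lborel. a x)"

definition G_hat :: "('a::euclidean_space \<Rightarrow> real) \<Rightarrow> real \<Rightarrow> ('a set \<Rightarrow> real) set" where
  "G_hat a \<theta> = {v \<in> G_space \<theta>. (\<lambda>\<eta>. total_rate a * card \<eta> * v \<eta>) \<in> G_space \<theta>}"

definition L_hat ::
  "('a::euclidean_space \<Rightarrow> real) \<Rightarrow> ('a set \<Rightarrow> real) \<Rightarrow> 'a set \<Rightarrow> real" where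
  "L_hat a v \<eta> = - total_rate a * card \<eta> * v \<eta>
     + (\<Sum>x\<in>\<eta>. LINT y|lborel. a (x - y) * v ((\<eta> - {x}) \<union> {y}))"

definition adjoint_graph ::
  "('a::euclidean_space \<Rightarrow> real) \<Rightarrow> real \<Rightarrow> (('a set \<Rightarrow> real) \<times> ('a set \<Rightarrow> real)) set" where
  "adjoint_graph a \<theta> = {(u, w). u \<in> K_space \<theta> \<and> w \<in> K_space \<theta> \<and>
     (\<forall>v\<in>G_hat a \<theta>. pairing (L_hat a v) u = pairing v w)}"

definition Q_space :: "('a::euclidean_space \<Rightarrow> real) \<Rightarrow> real \<Rightarrow> ('a set \<Rightarrow> real) set" where
  "Q_space a \<theta> = {u \<in> K_space \<theta>. \<forall>\<epsilon>>0. \<exists>u'\<in>Domain (adjoint_graph a \<theta>).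
     K_norm \<theta> (\<lambda>\<eta>. u \<eta> - u' \<eta>) < ereal \<epsilon>}"

definition sun_graph ::
  "('a::euclidean_space \<Rightarrow> real) \<Rightarrow> real \<Rightarrow> (('a set \<Rightarrow> real) \<times> ('a set \<Rightarrow> real)) set" where
  "sun_graph a \<theta> = {(u, w) \<in> adjoint_graph a \<theta>. w \<in> Q_space a \<theta>}"

abbreviation sun_domain ::
  "('a::euclidean_space \<Rightarrow> real) \<Rightarrow> real \<Rightarrow> ('a set \<Rightarrow> real) set" where
  "sun_domain a \<theta> \<equiv> Domain (sun_graph a \<theta>)"

subsection \<open>Semigroups and classical solutions\<close>

definition C0_semigroup :: "real \<Rightarrow> ('a::euclidean_space set \<Rightarrow> real) set \<Rightarrow>
    (real \<Rightarrow> ('a set \<Rightarrow> real) \<Rightarrow> 'a set \<Rightarrow> real) \<Rightarrow> bool" where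
  "C0_semigroup \<theta> V S \<longleftrightarrow>
     (\<forall>t\<ge>0. \<forall>u\<in>V. S t u \<in> V) \<and>
     (\<forall>t\<ge>0. \<forall>u\<in>V. \<forall>v\<in>V. AE \<eta> in lebesgue_poisson. S t (\<lambda>\<zeta>. u \<zeta> + v \<zeta>) \<eta> = S t u \<eta> + S t v \<eta>) \<and>
     (\<forall>t\<ge>0. \<forall>u\<in>V. \<forall>c. AE \<eta> in lebesgue_poisson. S t (\<lambda>\<zeta>. c * u \<zeta>) \<eta> = c * S t u \<eta>) \<and>
     (\<forall>t\<ge>0. \<exists>C::real. \<forall>u\<in>V. K_norm \<theta> (S t u) \<le> ereal C * K_norm \<theta> u) \<and>
     (\<forall>u\<in>V. AE \<eta> in lebesgue_poisson. S 0 u \<eta> = u \<eta>) \<and>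
     (\<forall>s\<ge>0. \<forall>t\<ge>0. \<forall>u\<in>V. AE \<eta> in lebesgue_poisson. S (s + t) u \<eta> = S s (S t u) \<eta>) \<and>
     (\<forall>u\<in>V. ((\<lambda>t. K_norm \<theta> (\<lambda>\<eta>. S t u \<eta> - u \<eta>)) \<longlongrightarrow> 0) (at_right 0))"

definition generator_graph :: "real \<Rightarrow> ('a::euclidean_space set \<Rightarrow> real) set \<Rightarrow>
    (real \<Rightarrow> ('a set \<Rightarrow> real) \<Rightarrow> 'a set \<Rightarrow> real) \<Rightarrow> (('a set \<Rightarrow> real) \<times> ('a set \<Rightarrow> real)) set" where
  "generator_graph \<theta> V S = {(u, w). u \<in> V \<and> w \<in> V \<and>
     ((\<lambda>h. K_norm \<theta> (\<lambda>\<eta>. (S h u \<eta> - u \<eta>) / h - w \<eta>)) \<longlongrightarrow> 0) (at_right 0)}"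

text \<open>A \<open>C\<^sub>0\<close>-semigroup is determined by its generator, so the choice below only selects
  representatives modulo equality almost everywhere.\<close>

definition sun_semigroup :: "('a::euclidean_space \<Rightarrow> real) \<Rightarrow> real \<Rightarrow>
    real \<Rightarrow> ('a set \<Rightarrow> real) \<Rightarrow> 'a set \<Rightarrow> real" where
  "sun_semigroup a \<theta> = (SOME S. C0_semigroup \<theta> (Q_space a \<theta>) S \<and>
     generator_graph \<theta> (Q_space a \<theta>) S = sun_graph a \<theta>)"

text \<open>In the following definition \<open>k'\<close> is the derivative of \<open>k\<close> on \<open>[0, \<infinity>)\<close>, one-sided at \<open>0\<close>.\<close>

definition classical_solution :: "('a::euclidean_space \<Rightarrow> real) \<Rightarrow> real \<Rightarrow>
    ('a set \<Rightarrow> real) \<Rightarrow> (real \<Rightarrow> 'a set \<Rightarrow> real) \<Rightarrow> bool" where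
  "classical_solution a \<theta> k0 k \<longleftrightarrow>
     (\<exists>k'.
       (\<forall>t\<ge>0. ((\<lambda>s. K_norm \<theta> (\<lambda>\<eta>. (k s \<eta> - k t \<eta>) / (s - t) - k' t \<eta>)) \<longlongrightarrow> 0) (at t within {0..})) \<and>
       (\<forall>t\<ge>0. ((\<lambda>s. K_norm \<theta> (\<lambda>\<eta>. k' s \<eta> - k' t \<eta>)) \<longlongrightarrow> 0) (at t within {0..})) \<and>
       (\<forall>t\<ge>0. (k t, k' t) \<in> sun_graph a \<theta>)) \<and>
     (AE \<eta> in lebesgue_poisson. k 0 \<eta> = k0 \<eta>)"

subsection \<open>Correlation functions\<close>

text \<open>Some enumeration of an \<open>n\<close>-point configuration; it is only used as an argument of
  symmetric functions, so the choice does not matter.\<close>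

definition enum_config :: "nat \<Rightarrow> 'a::euclidean_space set \<Rightarrow> nat \<Rightarrow> 'a" where
  "enum_config n \<eta> = (SOME x. x \<in> distinct_tuples n \<and> x ` {..<n} = \<eta>)"

definition test_functions :: "nat \<Rightarrow> ((nat \<Rightarrow> 'a::euclidean_space) \<Rightarrow> real) set" where
  "test_functions n = {G \<in> borel_measurable (tuple_lborel n).
     (\<exists>C. \<forall>x\<in>{..<n} \<rightarrow>\<^sub>E UNIV. \<bar>G x\<bar> \<le> C) \<and>
     (\<exists>\<Lambda>. compactin (tuple_topology n) \<Lambda> \<and> (\<forall>x\<in>({..<n} \<rightarrow>\<^sub>E UNIV) - \<Lambda>. G x = 0)) \<and>
     (\<forall>\<pi>. \<pi> permutes {..<n} \<longrightarrow> (\<forall>x\<in>{..<n} \<rightarrow>\<^sub>E UNIV. G (x \<circ> \<pi>) = G x))}"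

definition config_sum ::
  "nat \<Rightarrow> ((nat \<Rightarrow> 'a::euclidean_space) \<Rightarrow> real) \<Rightarrow> 'a set \<Rightarrow> real" where
  "config_sum n G \<gamma> =
     (\<Sum>\<^sub>\<infinity>\<eta>\<in>{\<eta>. \<eta> \<subseteq> \<gamma> \<and> finite \<eta> \<and> card \<eta> = n}. G (enum_config n \<eta>))"

text \<open>Correlation measures are symmetric (symmetric test functions only determine the
  symmetrization of a measure). Integrability is required explicitly because the Bochner
  integral of a non-integrable function is \<open>0\<close>.\<close>

definition is_correlation_measure ::
  "'a::euclidean_space set measure \<Rightarrow> nat \<Rightarrow> (nat \<Rightarrow> 'a) measure \<Rightarrow> bool" where
  "is_correlation_measure \<mu> n \<rho> \<longleftrightarrow>
     sets \<rho> = sets (tuple_lborel n :: (nat \<Rightarrow> 'a) measure) \<and>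
     (\<forall>\<pi>. \<pi> permutes {..<n} \<longrightarrow> distr \<rho> \<rho> (\<lambda>x. x \<circ> \<pi>) = \<rho>) \<and>
     (\<forall>G\<in>test_functions n.
        integrable \<mu> (config_sum n G) \<and> integrable \<rho> G \<and>
        (LINT \<gamma>|\<mu>. config_sum n G \<gamma>) = 1 / fact n * (LINT x|\<rho>. G x))"

text \<open>Nonnegativity is required because \<^const>\<open>ennreal\<close> truncates negative numbers to \<open>0\<close>.\<close>

definition is_correlation_function ::
  "'a::euclidean_space set measure \<Rightarrow> ('a set \<Rightarrow> real) \<Rightarrow> bool" where
  "is_correlation_function \<mu> k \<longleftrightarrow>
     k \<in> borel_measurable finite_config_space \<and> k {} = 1 \<and>
     (\<forall>n\<ge>1. \<exists>\<rho>. is_correlation_measure \<mu> n \<rho> \<and>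
        (AE x in tuple_lborel n. 0 \<le> k (x ` {..<n})) \<and>
        \<rho> = density (tuple_lborel n) (\<lambda>x. ennreal (k (x ` {..<n}))) \<and>
        esssup (tuple_lborel n) (\<lambda>x. ereal \<bar>k (x ` {..<n})\<bar>) < \<infinity>)"

end

theory Submission
  imports Defs
begin

text \<open>Let \<open>p\<^sub>t\<close> be the law at time \<open>t\<close> of the compound Poisson process with jump intensity \<open>a\<close>. The
  semigroup is explicit: \<open>(S t u)(\<eta>)\<close> is the expectation of \<open>u\<close> at \<open>\<eta>\<close> with every point displaced by an
  independent jump of law \<open>p\<^sub>t\<close>. The generator preserves the number of points and is bounded on
  \<open>n\<close>-point configurations for every fixed \<open>n\<close>, so the adjoint, its sun part and the semigroup can be
  identified separately for each \<open>n\<close>. If \<open>k\<close> is a classical solution, then \<open>s \<mapsto> S (t - s) (k s)\<close> has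
  derivative \<open>0\<close>; this gives uniqueness, and it identifies any other semigroup with the same generator.

  If \<open>k0\<close> is the correlation function of \<open>\<mu>0\<close>, displace the points of a \<open>\<mu>0\<close>-random configuration
  independently with law \<open>p\<^sub>t\<close>. By the first two factorial moments the displaced points almost surely
  neither accumulate nor coincide, and their law has the correlation function \<open>S t k0\<close>. That law is
  unique, since the bound \<open>k \<le> C exp (- \<theta> n)\<close> makes the inclusion-exclusion series of the void
  probabilities converge absolutely.\<close>

text \<open>On \<open>n\<close>-point configurations the generator has a bound of order
  \<open>2 * \<alpha> * n\<close>, so on \<open>K_space\<close> it is unbounded, and the constants
  in the short-time expansions depend on \<open>n\<close>. Such expansions are used only at fixed
  \<open>n\<close>. What must hold in the norm, for all \<open>n\<close> at once, comes from
  \<open>jump_sg_increment\<close>: there the constant depending on \<open>n\<close> vanishes as the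
  partition is refined.

  The semigroup \<open>sun_semigroup\<close> is chosen by its axioms and its generator, and the
  axioms bound each operator separately. Differentiating \<open>S (t - s) (k s)\<close> requires a
  bound uniform on compact time intervals. This is the reason for the completeness of
  \<open>Q_space\<close> and the uniform boundedness argument.

  The vague topology enters the probabilistic part through its Borel sets. They are generated by the
  events that a bounded Borel set contains no point; these determine a law and make the displaced
  configuration measurable. A configuration has no canonical enumeration, so its points first
  receive measurable labels in the natural numbers, which lets one family of independent jumps serve
  all configurations.\<close>

abbreviation config_borel :: "('a::euclidean_space set \<Rightarrow> 'b::topological_space) set" where
  "config_borel \<equiv> borel_measurable finite_config_space"

abbreviation tuple_borel :: "nat \<Rightarrow> ((nat \<Rightarrow> 'a::euclidean_space) \<Rightarrow> 'b::topological_space) set" where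
  "tuple_borel n \<equiv> borel_measurable (tuple_lborel n)"

abbreviation sector_L1 :: "nat \<Rightarrow> ('a::euclidean_space set \<Rightarrow> real) \<Rightarrow> ennreal" where
  "sector_L1 n u \<equiv> \<integral>\<^sup>+x. ennreal \<bar>u (x ` {..<n})\<bar> \<partial>tuple_lborel n"

abbreviation sector_inner :: "nat \<Rightarrow> ('a::euclidean_space set \<Rightarrow> real) \<Rightarrow> ('a set \<Rightarrow> real) \<Rightarrow> real" where
  "sector_inner n u v \<equiv> LINT x|tuple_lborel n. u (x ` {..<n}) * v (x ` {..<n})"

abbreviation correlation_integral :: "nat \<Rightarrow> ('a::euclidean_space set \<Rightarrow> real) \<Rightarrow> ((nat \<Rightarrow> 'a) \<Rightarrow> ennreal) \<Rightarrow> ennreal" where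
  "correlation_integral n k G \<equiv> \<integral>\<^sup>+x. G x * ennreal (k (x ` {..<n})) \<partial>tuple_lborel n"

abbreviation pointwise_diff :: "('b \<Rightarrow> real) \<Rightarrow> ('b \<Rightarrow> real) \<Rightarrow> 'b \<Rightarrow> real" (infixl "\<ominus>" 65) where
  "u \<ominus> v \<equiv> \<lambda>\<eta>. u \<eta> - v \<eta>"

abbreviation lp_equal :: "('a::euclidean_space set \<Rightarrow> real) \<Rightarrow> ('a set \<Rightarrow> real) \<Rightarrow> bool" (infix "\<doteq>" 50) where
  "u \<doteq> v \<equiv> AE \<eta> in lebesgue_poisson. u \<eta> = v \<eta>"

section \<open>Mixtures of measures\<close>

text \<open>Two measures below are given by \<open>measure_of\<close> with a series of measures: the
  Lebesgue--Poisson measure and the law of the jump process. Countable additivity is an interchange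
  of two series of nonnegative terms, written as Tonelli for counting measures; the integral formula
  then follows from indicators by monotone limits.\<close>

lemma mixture_measure_space:
  fixes c :: "nat \<Rightarrow> ennreal"
  assumes S: "\<And>n. sets (N n) = sets M"
    and P: "\<And>A. A \<in> sets M \<Longrightarrow> f A = (\<Sum>n. c n * emeasure (N n) A)"
  shows "A \<in> sets M \<Longrightarrow> emeasure (measure_of (space M) (sets M) f) A = (\<Sum>n. c n * emeasure (N n) A)"
    and "g \<in> borel_measurable M \<Longrightarrow>
      (\<integral>\<^sup>+x. g x \<partial>measure_of (space M) (sets M) f) = (\<Sum>n. c n * (\<integral>\<^sup>+x. g x \<partial>N n))"
proof -
  let ?L = "measure_of (space M) (sets M) f"
  have em: "emeasure ?L A = (\<Sum>n. c n * emeasure (N n) A)" if A: "A \<in> sets M" for A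
  proof -
    have "emeasure ?L A = f A"
    proof (rule emeasure_measure_of_sigma)
      show "sigma_algebra (space M) (sets M)" ..
      show "positive (sets M) f"
        by (auto simp: positive_def P)
      show "countably_additive (sets M) f"
      proof (rule countably_additiveI)
        fix B :: "nat \<Rightarrow> _ set"
        assume B: "range B \<subseteq> sets M" "disjoint_family B" "\<Union>(range B) \<in> sets M"
        have "(\<Sum>i. f (B i)) = (\<Sum>i. \<Sum>n. c n * emeasure (N n) (B i))"
          using B by (intro suminf_cong P) auto
        also have "\<dots> = (\<integral>\<^sup>+i. \<integral>\<^sup>+n. c n * emeasure (N n) (B i) \<partial>count_space UNIV \<partial>count_space UNIV)"
          by (simp add: nn_integral_count_space_nat)
        also have "\<dots> = (\<integral>\<^sup>+n. \<integral>\<^sup>+i. c n * emeasure (N n) (B i) \<partial>count_space UNIV \<partial>count_space UNIV)"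
          using nn_integral_fst_count_space[of "\<lambda>(i, n). c n * emeasure (N n) (B i)"]
            nn_integral_snd_count_space[of "\<lambda>(i, n). c n * emeasure (N n) (B i)"] by simp
        also have "\<dots> = (\<Sum>n. c n * (\<Sum>i. emeasure (N n) (B i)))"
          by (simp add: nn_integral_count_space_nat)
        also have "\<dots> = (\<Sum>n. c n * emeasure (N n) (\<Union>(range B)))"
          using B S by (subst suminf_emeasure) auto
        finally show "(\<Sum>i. f (B i)) = f (\<Union>(range B))"
          using P[OF B(3)] by simp
      qed
    qed fact
    then show ?thesis using P[OF A] by simp
  qed
  have sL: "sets ?L = sets M" "space ?L = space M"
    by (auto simp: sets.sigma_sets_eq sets.space_closed space_measure_of_conv)
  show "A \<in> sets M \<Longrightarrow> emeasure (measure_of (space M) (sets M) f) A = (\<Sum>n. c n * emeasure (N n) A)"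
    by (rule em)
  assume g: "g \<in> borel_measurable M"
  show "(\<integral>\<^sup>+x. g x \<partial>?L) = (\<Sum>n. c n * (\<integral>\<^sup>+x. g x \<partial>N n))"
    using g
  proof (induction rule: borel_measurable_induct)
    case (cong f g)
    moreover have "(\<integral>\<^sup>+x. f x \<partial>?L) = (\<integral>\<^sup>+x. g x \<partial>?L)"
      by (rule nn_integral_cong) (auto simp: cong sL)
    moreover have "(\<integral>\<^sup>+x. f x \<partial>N n) = (\<integral>\<^sup>+x. g x \<partial>N n)" for n
      by (rule nn_integral_cong) (auto simp: cong sets_eq_imp_space_eq[OF S])
    ultimately show ?case by simp
  next
    case (set A)
    then show ?case by (simp add: em sL S)
  next
    case (mult u c')
    then have "u \<in> borel_measurable (N n)" "u \<in> borel_measurable ?L" for n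
      using S sL by (auto cong: measurable_cong_sets)
    with mult show ?case by (simp add: nn_integral_cmult ac_simps flip: ennreal_suminf_cmult)
  next
    case (add u v)
    then have m: "u \<in> borel_measurable (N n)" "u \<in> borel_measurable ?L" "v \<in> borel_measurable (N n)" "v \<in> borel_measurable ?L" for n
      using S sL by (auto cong: measurable_cong_sets)
    with add show ?case by (simp add: nn_integral_add distrib_left suminf_add)
  next
    case (seq U)
    then have m: "U i \<in> borel_measurable (N n)" "U i \<in> borel_measurable ?L" for i n
      using S sL by (auto cong: measurable_cong_sets)
    have "(\<integral>\<^sup>+x. (SUP i. U i x) \<partial>?L) = (SUP i. \<integral>\<^sup>+x. U i x \<partial>?L)"
      using seq m by (intro nn_integral_monotone_convergence_SUP) auto
    also have "\<dots> = (SUP i. \<Sum>n. c n * (\<integral>\<^sup>+x. U i x \<partial>N n))"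
      using seq by simp
    also have "\<dots> = (\<Sum>n. SUP i. c n * (\<integral>\<^sup>+x. U i x \<partial>N n))"
      using seq(3) by (intro ennreal_suminf_SUP_eq[symmetric])
        (auto simp: incseq_def le_fun_def intro!: mult_left_mono nn_integral_mono)
    also have "\<dots> = (\<Sum>n. c n * (\<integral>\<^sup>+x. (SUP i. U i x) \<partial>N n))"
      using seq m by (simp add: nn_integral_monotone_convergence_SUP SUP_mult_left_ennreal)
    finally show ?case by (simp add: SUP_apply[abs_def] image_comp)
  qed
qed

section \<open>Tuples and finite configurations\<close>

lemma space_tuple: "space (tuple_lborel n) = {..<n} \<rightarrow>\<^sub>E UNIV"
  by (simp add: space_PiM)

text \<open>Second countability: every open set of tuples is the union of the boxes inside it with
  sides in a countable basis, and there are only countably many such boxes.\<close>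

lemma openin_tuple_sets:
  assumes "openin (tuple_topology n) (U :: (nat \<Rightarrow> 'a::euclidean_space) set)"
  shows "U \<in> sets (tuple_lborel n)"
proof -
  obtain \<B> :: "'a set set" where \<B>: "countable \<B>" "topological_basis \<B>"
    using ex_countable_basis by auto
  let ?F = "{PiE {..<n} X | X. X \<in> {..<n} \<rightarrow>\<^sub>E \<B> \<and> PiE {..<n} X \<subseteq> U}"
  have "countable ({..<n} \<rightarrow>\<^sub>E \<B>)"
    using \<B> by (intro countable_PiE) auto
  then have "countable (PiE {..<n} ` ({..<n} \<rightarrow>\<^sub>E \<B>))" by blast
  then have "countable ?F"
    by (rule countable_subset[rotated]) blast
  moreover have "?F \<subseteq> sets (tuple_lborel n)"
  proof safe
    fix X assume "X \<in> {..<n} \<rightarrow>\<^sub>E \<B>"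
    then have "open (X i)" if "i < n" for i
      using \<B>(2) that topological_basis_open by blast
    then show "PiE {..<n} X \<in> sets (tuple_lborel n)"
      by (intro sets_PiM_I_finite) auto
  qed
  moreover have "U = \<Union>?F"
  proof
    show "U \<subseteq> \<Union>?F"
    proof
      fix x assume x: "x \<in> U"
      then obtain V where V: "\<And>i. i < n \<Longrightarrow> open (V i)" "x \<in> PiE {..<n} V" "PiE {..<n} V \<subseteq> U"
        using assms[unfolded openin_product_topology_alt, rule_format, OF x] by (auto simp: lessThan_iff)
      have "\<forall>i\<in>{..<n}. \<exists>B. B \<in> \<B> \<and> x i \<in> B \<and> B \<subseteq> V i"
        using V \<B>(2) by (metis PiE_E lessThan_iff topological_basisE)
      then obtain B where B: "\<And>i. i < n \<Longrightarrow> B i \<in> \<B> \<and> x i \<in> B i \<and> B i \<subseteq> V i"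
        unfolding bchoice_iff by blast
      let ?X = "restrict B {..<n}"
      have "x \<in> PiE {..<n} ?X" using V(2) B by (auto simp: PiE_iff)
      moreover have "PiE {..<n} ?X \<subseteq> U"
        using V(3) B PiE_mono[of "{..<n}" ?X V] by (simp add: subset_trans)
      moreover have "?X \<in> {..<n} \<rightarrow>\<^sub>E \<B>" using B by auto
      ultimately show "x \<in> \<Union>?F"
        by (intro UnionI[of "PiE {..<n} ?X"] CollectI exI[of _ ?X]) simp_all
    qed
  qed blast
  ultimately show ?thesis
    by (metis (no_types, lifting) sets.countable_Union)
qed

lemma coordinates_eq_sets:
  "i < n \<Longrightarrow> j < n \<Longrightarrow> {x \<in> space (tuple_lborel n). x i = (x j :: 'a::euclidean_space)} \<in> sets (tuple_lborel n)"
  by measurable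

lemma distinct_tuples_eq:
  "distinct_tuples n = {x \<in> space (tuple_lborel n :: (nat \<Rightarrow> 'a::euclidean_space) measure). \<forall>i\<in>{..<n}. \<forall>j\<in>{..<n}. i \<noteq> j \<longrightarrow> x i \<noteq> x j}"
  unfolding distinct_tuples_def space_tuple inj_on_def by auto

lemma distinct_tuples_sets [measurable]:
  "distinct_tuples n \<in> sets (tuple_lborel n :: (nat \<Rightarrow> 'a::euclidean_space) measure)"
  unfolding distinct_tuples_eq
  by (intro sets.sets_Collect_finite_All sets.sets_Collect_imp sets.sets_Collect_const sets.sets_Collect_neg coordinates_eq_sets) auto

lemma distinct_tuplesD:
  "x \<in> distinct_tuples n \<Longrightarrow> inj_on x {..<n}"
  "x \<in> distinct_tuples n \<Longrightarrow> card (x ` {..<n}) = n"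
  "x \<in> distinct_tuples n \<Longrightarrow> x \<in> space (tuple_lborel n)"
  by (auto simp: distinct_tuples_def card_image space_tuple)

lemma openin_finite_config:
  "openin finite_config_topology U \<longleftrightarrow> U \<subseteq> finite_configs \<and>
     (\<forall>n. openin (subtopology (tuple_topology n) (distinct_tuples n))
            {x \<in> distinct_tuples n. x ` {..<n} \<in> (U :: 'a::euclidean_space set set)})"
  unfolding finite_config_topology_def
  by (subst topology_inverse') (rule istopology_finite_config, simp)

lemma topspace_finite_config: "topspace finite_config_topology = (finite_configs :: 'a::euclidean_space set set)"
proof
  have "openin finite_config_topology (finite_configs :: 'a set set)"
    unfolding openin_finite_config
  proof (intro conjI allI)
    fix n
    have "{x \<in> distinct_tuples n. x ` {..<n} \<in> finite_configs} =
        topspace (subtopology (tuple_topology n) (distinct_tuples n :: (nat \<Rightarrow> 'a) set))"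
      by (auto simp: finite_configs_def distinct_tuples_def)
    then show "openin (subtopology (tuple_topology n) (distinct_tuples n :: (nat \<Rightarrow> 'a) set)) {x \<in> distinct_tuples n. x ` {..<n} \<in> finite_configs}"
      by (metis openin_topspace)
  qed simp
  then show "(finite_configs :: 'a set set) \<subseteq> topspace finite_config_topology"
    by (simp add: openin_subset)
qed (simp add: openin_finite_config topspace_def, blast)

lemma space_borel_of_topology: "space (borel_of_topology T) = topspace T"
  unfolding borel_of_topology_def by (rule space_measure_of) (auto dest: openin_subset)

lemma sets_borel_of_topology: "sets (borel_of_topology T) = sigma_sets (topspace T) {U. openin T U}"
  unfolding borel_of_topology_def by (rule sets_measure_of) (auto dest: openin_subset)

lemma space_finite_config: "space finite_config_space = finite_configs"
  by (simp add: space_borel_of_topology topspace_finite_config)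

lemma openin_finite_config_sets:
  "openin finite_config_topology U \<Longrightarrow> U \<in> sets finite_config_space"
  by (simp add: sets_borel_of_topology)

text \<open>A tuple with a repeated entry is reduced to a shorter tuple by dropping one copy.\<close>

lemma image_open_sets:
  assumes U: "openin finite_config_topology (U :: 'a::euclidean_space set set)"
  shows "{x \<in> space (tuple_lborel n). x ` {..<n} \<in> U} \<in> sets (tuple_lborel n)"
proof -
  have D: "{x \<in> distinct_tuples n. x ` {..<n} \<in> U} \<in> sets (tuple_lborel n)" for n
  proof -
    obtain T where "openin (tuple_topology n) T" "{x \<in> distinct_tuples n. x ` {..<n} \<in> U} = T \<inter> distinct_tuples n"
      using U unfolding openin_finite_config openin_subtopology by metis
    then show ?thesis using openin_tuple_sets by (metis distinct_tuples_sets sets.Int)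
  qed
  show ?thesis
  proof (induction n)
    case 0
    have "{x \<in> space (tuple_lborel 0). x ` {..<0} \<in> U} = {x \<in> distinct_tuples 0. x ` {..<0} \<in> U}"
      by (auto simp: distinct_tuples_def space_PiM)
    then show ?case using D[of 0] by (simp only:)
  next
    case (Suc n)
    \<comment> \<open>\<open>?s j\<close> enumerates the indices other than \<open>j\<close> in
      increasing order, and \<open>?r j\<close> deletes the entry at \<open>j\<close>. The topology
      constrains \<open>U\<close> on tuples with distinct entries only, so the other tuples have to
      be brought to shorter ones.\<close>
    let ?s = "\<lambda>j k. if k < j then k else Suc k"
    let ?r = "\<lambda>j x. \<lambda>k\<in>{..<n}. x (?s j k)"
    let ?N = "\<lambda>i j. {x \<in> space (tuple_lborel (Suc n)). x i = x j} \<inter>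
        (?r j -` {x \<in> space (tuple_lborel n). x ` {..<n} \<in> U} \<inter> space (tuple_lborel (Suc n)))"
    have r: "?r j \<in> tuple_lborel (Suc n) \<rightarrow>\<^sub>M (tuple_lborel n :: (nat \<Rightarrow> 'a) measure)" for j
      by (intro measurable_restrict) (auto intro!: measurable_component_singleton)
    have im: "?r j x ` {..<n} = x ` {..<Suc n}" if "i < Suc n" "j < Suc n" "i \<noteq> j" "x i = x j" for i j and x :: "nat \<Rightarrow> 'a"
    proof -
      have "?s j ` {..<n} = {..<Suc n} - {j}"
      proof
        show "{..<Suc n} - {j} \<subseteq> ?s j ` {..<n}"
        proof
          fix k assume k: "k \<in> {..<Suc n} - {j}"
          show "k \<in> ?s j ` {..<n}"
          proof (cases "k < j")
            case True then show ?thesis using k that by (auto intro!: image_eqI[of _ _ k])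
          next
            case False then show ?thesis using k that by (auto intro!: image_eqI[of _ _ "k - 1"])
          qed
        qed
      qed (use that in auto)
      moreover have "?r j x ` {..<n} = x ` (?s j ` {..<n})"
        unfolding image_image by (auto simp: image_def)
      moreover have "x ` ({..<Suc n} - {j}) = x ` {..<Suc n}"
        using that by (auto simp: image_def) (metis lessThan_iff Diff_iff singletonD)+
      ultimately show ?thesis by simp
    qed
    have "{x \<in> space (tuple_lborel (Suc n)). x ` {..<Suc n} \<in> U} =
      {x \<in> distinct_tuples (Suc n). x ` {..<Suc n} \<in> U} \<union>
      (\<Union>i\<in>{..<Suc n}. \<Union>j\<in>{..<Suc n} - {i}. ?N i j)" (is "?A = ?B \<union> ?C")
    proof
      show "?A \<subseteq> ?B \<union> ?C"
      proof
        fix x assume x: "x \<in> ?A"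
        show "x \<in> ?B \<union> ?C"
        proof (cases "x \<in> distinct_tuples (Suc n)")
          case False
          then obtain i j where ij: "i < Suc n" "j < Suc n" "i \<noteq> j" "x i = x j"
            using x unfolding distinct_tuples_eq by auto
          moreover have "?r j x \<in> space (tuple_lborel n)"
            using x measurable_space[OF r] by blast
          ultimately have "x \<in> ?N i j" using x im[OF ij] by simp
          then show ?thesis using ij by blast
        qed (use x in simp)
      qed
      show "?B \<union> ?C \<subseteq> ?A"
      proof safe
        fix x assume "x \<in> distinct_tuples (Suc n)" then show "x \<in> space (tuple_lborel (Suc n))"
          by (simp add: distinct_tuplesD)
      next
        fix x i j assume *: "i < Suc n" "j < Suc n" "j \<noteq> i" "x i = x j" "?r j x ` {..<n} \<in> U"
        then show "x ` {..<Suc n} \<in> U" using im[of i j x] by metis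
      qed
    qed
    moreover have "?N i j \<in> sets (tuple_lborel (Suc n))" if "i < Suc n" "j < Suc n" for i j
      using that by (intro sets.Int coordinates_eq_sets measurable_sets[OF r] Suc)
    ultimately show ?case
      using D by (auto intro!: sets.Un sets.finite_UN)
  qed
qed

lemma measurable_image_config [measurable]:
  "(\<lambda>x. x ` {..<n}) \<in> tuple_lborel n \<rightarrow>\<^sub>M (finite_config_space :: 'a::euclidean_space set measure)"
  unfolding borel_of_topology_def
proof (rule measurable_measure_of)
  fix U :: "'a set set" assume "U \<in> {U. openin finite_config_topology U}"
  then show "(\<lambda>x. x ` {..<n}) -` U \<inter> space (tuple_lborel n) \<in> sets (tuple_lborel n)"
    using image_open_sets[of U n] by (simp add: vimage_def Int_def conj_commute)
qed (auto simp: topspace_finite_config finite_configs_def openin_finite_config)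

lemma finite_points_separated:
  fixes F :: "'a::metric_space set"
  assumes "finite F"
  obtains e where "e > 0" "\<And>x y. x \<in> F \<Longrightarrow> y \<in> F \<Longrightarrow> x \<noteq> y \<Longrightarrow> e \<le> dist x y"
proof -
  \<comment> \<open>The element \<open>1\<close> keeps the set nonempty when \<open>F\<close> has at
    most one point.\<close>
  let ?D = "insert 1 {dist x y | x y. x \<in> F \<and> y \<in> F \<and> x \<noteq> y}"
  have "finite ((\<lambda>(x, y). dist x y) ` (F \<times> F))" using assms by simp
  then have fin: "finite ?D" by (rule finite_subset[rotated, OF finite.insertI]) auto
  show thesis
  proof (rule that)
    show "Min ?D > 0" using fin by (subst Min_gr_iff) auto
    show "Min ?D \<le> dist x y" if "x \<in> F" "y \<in> F" "x \<noteq> y" for x y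
      using that fin by (intro Min_le) auto
  qed
qed

text \<open>Balls around the points, with half of a lower bound for their distances as radius, are
  disjoint, and basis sets fit inside. This separation isolates the points of a configuration in the
  measurability arguments for tuples, for vague cells and for labels.\<close>

lemma finite_points_disjoint_basis:
  fixes F :: "'a::metric_space set"
  assumes "finite F" "topological_basis \<B>" "\<And>x. x \<in> F \<Longrightarrow> open (V x)" "\<And>x. x \<in> F \<Longrightarrow> x \<in> V x"
  obtains B where "\<And>x. x \<in> F \<Longrightarrow> B x \<in> \<B> \<and> x \<in> B x \<and> B x \<subseteq> V x"
    "\<And>x y. x \<in> F \<Longrightarrow> y \<in> F \<Longrightarrow> x \<noteq> y \<Longrightarrow> B x \<inter> B y = {}"
proof -
  obtain e where e: "e > 0" "\<And>x y. x \<in> F \<Longrightarrow> y \<in> F \<Longrightarrow> x \<noteq> y \<Longrightarrow> e \<le> dist x y"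
    using finite_points_separated[OF assms(1)] by metis
  have "\<exists>B. B \<in> \<B> \<and> x \<in> B \<and> B \<subseteq> V x \<inter> ball x (e/2)" if "x \<in> F" for x
    using topological_basisE[OF assms(2), of "V x \<inter> ball x (e/2)" x] that assms(3,4) e(1)
    by (metis IntI centre_in_ball half_gt_zero open_Int open_ball)
  then obtain B where B: "\<And>x. x \<in> F \<Longrightarrow> B x \<in> \<B> \<and> x \<in> B x \<and> B x \<subseteq> V x \<inter> ball x (e/2)"
    by metis
  have "B x \<inter> B y = {}" if "x \<in> F" "y \<in> F" "x \<noteq> y" for x y
  proof -
    have "ball x (e/2) \<inter> ball y (e/2) = {}"
    proof (rule ccontr)
      assume "ball x (e/2) \<inter> ball y (e/2) \<noteq> {}"
      then obtain z where "dist x z < e/2" "dist y z < e/2" by auto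
      then have "dist x y < e" using dist_triangle2[of x y z] by linarith
      then show False using e(2)[OF that] by simp
    qed
    then show ?thesis using B[OF that(1)] B[OF that(2)] by blast
  qed
  then show thesis using B that by blast
qed

text \<open>The permutation is the inverse of \<open>x\<close> composed with \<open>y\<close>,
  continued by the identity because \<open>permutes\<close> demands fixed points outside
  \<open>{..<n}\<close>.\<close>

lemma tuples_same_image:
  assumes "x \<in> distinct_tuples n" "y \<in> distinct_tuples n" "x ` {..<n} = y ` {..<n}"
  obtains \<pi> where "\<pi> permutes {..<n}" "y = x \<circ> \<pi>"
proof -
  let ?\<pi> = "\<lambda>i. if i < n then inv_into {..<n} x (y i) else i"
  have x: "inj_on x {..<n}" "x \<in> extensional {..<n}" and y: "inj_on y {..<n}" "y \<in> extensional {..<n}"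
    using assms by (auto simp: distinct_tuples_def PiE_iff)
  have yx: "y i \<in> x ` {..<n}" if "i < n" for i using assms(3) that by blast
  have "bij_betw (inv_into {..<n} x) (x ` {..<n}) {..<n}"
    by (simp add: bij_betw_inv_into inj_on_imp_bij_betw x(1))
  moreover have "bij_betw y {..<n} (x ` {..<n})"
    using y(1) assms(3) by (simp add: bij_betw_def)
  ultimately have "bij_betw (inv_into {..<n} x \<circ> y) {..<n} {..<n}"
    using bij_betw_trans by blast
  then have "bij_betw ?\<pi> {..<n} {..<n}"
    by (rule bij_betw_cong[THEN iffD1, rotated]) auto
  then have "?\<pi> permutes {..<n}"
    by (rule bij_imp_permutes) auto
  moreover have "y = x \<circ> ?\<pi>"
    using x(2) y(2) yx by (auto simp: fun_eq_iff f_inv_into_f extensional_def)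
  ultimately show thesis using that by blast
qed

lemma tuple_permute_continuous:
  assumes "\<pi> permutes {..<n}"
  shows "continuous_map (tuple_topology n) (tuple_topology n) (\<lambda>x. x \<circ> \<pi>)"
  unfolding continuous_map_componentwise
proof (intro conjI ballI)
  show "(\<lambda>x. x \<circ> \<pi>) ` topspace (tuple_topology n) \<subseteq> extensional {..<n}"
    using assms by (auto simp: extensional_def PiE_iff permutes_def)
  fix k assume "k \<in> {..<n}"
  then have "\<pi> k \<in> {..<n}" using permutes_in_image[OF assms] by blast
  then show "continuous_map (tuple_topology n) euclidean (\<lambda>x. (x \<circ> \<pi>) k)"
    unfolding o_apply by (rule continuous_map_product_projection)
qed

text \<open>The quotient map from distinct tuples is open: the preimage of an image is the union of
  the open sets obtained by permuting the entries, and tuples of a different length have a different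
  number of points.\<close>

lemma image_openin_finite_config:
  assumes V: "openin (tuple_topology n) V" "V \<subseteq> distinct_tuples n"
  shows "openin finite_config_topology ((\<lambda>x. x ` {..<n}) ` (V :: (nat \<Rightarrow> 'a::euclidean_space) set))"
  unfolding openin_finite_config
proof (intro conjI allI)
  show "(\<lambda>x. x ` {..<n}) ` V \<subseteq> finite_configs" by (auto simp: finite_configs_def)
  fix m
  let ?W = "{x \<in> distinct_tuples m. x ` {..<m} \<in> (\<lambda>x. x ` {..<n}) ` V}"
  show "openin (subtopology (tuple_topology m) (distinct_tuples m)) ?W"
  proof (cases "m = n")
    case False
    have "x ` {..<m} \<noteq> y ` {..<n}" if "x \<in> distinct_tuples m" "y \<in> V" for x y :: "nat \<Rightarrow> 'a"
      using distinct_tuplesD(2)[of x m] distinct_tuplesD(2)[of y n] that V(2) False by auto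
    then have "?W = {}" by blast
    then show ?thesis by (simp only: openin_empty)
  next
    case True
    have "?W = (\<Union>\<pi>\<in>{\<pi>. \<pi> permutes {..<n}}. {x \<in> topspace (tuple_topology n). x \<circ> \<pi> \<in> V}) \<inter> distinct_tuples n"
    proof (intro equalityI subsetI)
      fix x assume "x \<in> ?W"
      then obtain y where y: "x \<in> distinct_tuples n" "y \<in> V" "x ` {..<n} = y ` {..<n}"
        using True by auto
      then obtain \<pi> where "\<pi> permutes {..<n}" "y = x \<circ> \<pi>"
        using tuples_same_image[of x n y] V(2) by blast
      then show "x \<in> (\<Union>\<pi>\<in>{\<pi>. \<pi> permutes {..<n}}. {x \<in> topspace (tuple_topology n). x \<circ> \<pi> \<in> V}) \<inter> distinct_tuples n"
        using y by (auto simp: distinct_tuples_def)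
    next
      fix x assume "x \<in> (\<Union>\<pi>\<in>{\<pi>. \<pi> permutes {..<n}}. {x \<in> topspace (tuple_topology n). x \<circ> \<pi> \<in> V}) \<inter> distinct_tuples n"
      then obtain \<pi> where \<pi>: "\<pi> permutes {..<n}" "x \<circ> \<pi> \<in> V" "x \<in> distinct_tuples n" by blast
      have "(x \<circ> \<pi>) ` {..<n} = x ` {..<n}"
        using permutes_image[OF \<pi>(1)] by (metis image_comp)
      then have "x ` {..<n} \<in> (\<lambda>x. x ` {..<n}) ` V"
        using \<pi>(2) by (metis image_eqI)
      then show "x \<in> ?W" using True \<pi> by blast
    qed
    moreover have "openin (tuple_topology n) (\<Union>\<pi>\<in>{\<pi>. \<pi> permutes {..<n}}. {x \<in> topspace (tuple_topology n). x \<circ> \<pi> \<in> V})"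
      using openin_continuous_map_preimage[OF tuple_permute_continuous V(1)] by blast
    ultimately show ?thesis
      unfolding openin_subtopology using True by blast
  qed
qed

text \<open>On a box with pairwise disjoint open sides the map from tuples to configurations has a
  measurable inverse, reading off the \<open>i\<close>-th entry as the point in the \<open>i\<close>-th side.\<close>

lemma image_box_sets:
  fixes X :: "nat \<Rightarrow> 'a::euclidean_space set"
  assumes X: "\<And>i. i < n \<Longrightarrow> open (X i)" "\<And>i j. i < n \<Longrightarrow> j < n \<Longrightarrow> i \<noteq> j \<Longrightarrow> X i \<inter> X j = {}"
    and P: "P \<in> sets (tuple_lborel n)"
  shows "(\<lambda>x. x ` {..<n}) ` (P \<inter> PiE {..<n} X) \<in> sets finite_config_space"
proof -
  let ?q = "\<lambda>x :: nat \<Rightarrow> 'a. x ` {..<n}"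
  let ?Q = "?q ` PiE {..<n} X"
  have inter: "?q x \<inter> X i = {x i}" if "x \<in> PiE {..<n} X" "i < n" for x i
    using that X(2) by (fastforce simp: PiE_iff)
  have dist: "PiE {..<n} X \<subseteq> distinct_tuples n"
    using X(2) by (force simp: distinct_tuples_def PiE_iff inj_on_def)
  have op: "?q ` ({x. x i \<in> U} \<inter> PiE {..<n} X) \<in> sets finite_config_space"
    if "open U" "i < n" for i U
  proof -
    have "{x. x i \<in> U} \<inter> PiE {..<n} X = PiE {..<n} (X(i := X i \<inter> U))"
    proof (intro equalityI subsetI)
      fix x assume x: "x \<in> {x. x i \<in> U} \<inter> PiE {..<n} X"
      show "x \<in> PiE {..<n} (X(i := X i \<inter> U))"
        by (rule PiE_I) (use x in \<open>auto intro: PiE_arb\<close>)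
    next
      fix x assume x: "x \<in> PiE {..<n} (X(i := X i \<inter> U))"
      have *: "x j \<in> (X(i := X i \<inter> U)) j" if "j < n" for j
        using PiE_mem[OF x] that by blast
      have "x j \<in> X j" if "j < n" for j
        using *[OF that] by (cases "j = i") auto
      moreover have "x i \<in> U" using *[OF that(2)] by simp
      ultimately show "x \<in> {x. x i \<in> U} \<inter> PiE {..<n} X"
        using PiE_arb[OF x] by (auto intro!: PiE_I)
    qed
    moreover have "openin (tuple_topology n) (PiE {..<n} (X(i := X i \<inter> U)))"
      using that X(1) by (simp add: openin_PiE_gen open_Int)
    ultimately show ?thesis
      using image_openin_finite_config[of n "{x. x i \<in> U} \<inter> PiE {..<n} X"] dist
      by (metis le_infI2 openin_finite_config_sets)
  qed
  have Q: "?Q \<in> sets finite_config_space"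
    using dist X(1) by (intro openin_finite_config_sets image_openin_finite_config) (auto simp: openin_PiE_gen)
  let ?r = "\<lambda>\<eta>. \<lambda>i\<in>{..<n}. the_elem (\<eta> \<inter> X i)"
  have r: "?r \<in> restrict_space finite_config_space ?Q \<rightarrow>\<^sub>M tuple_lborel n"
  proof (intro measurable_restrict)
    fix i assume i: "i \<in> {..<n}"
    have "(\<lambda>\<eta>. the_elem (\<eta> \<inter> X i)) \<in> borel_measurable (restrict_space finite_config_space ?Q)"
    proof (rule borel_measurableI)
      fix U :: "'a set" assume U: "open U"
      have "(\<lambda>\<eta>. the_elem (\<eta> \<inter> X i)) -` U \<inter> space (restrict_space finite_config_space ?Q) =
          ?q ` ({x. x i \<in> U} \<inter> PiE {..<n} X)"
        using inter i by (auto simp: space_restrict_space space_finite_config finite_configs_def)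
      then show "(\<lambda>\<eta>. the_elem (\<eta> \<inter> X i)) -` U \<inter> space (restrict_space finite_config_space ?Q)
          \<in> sets (restrict_space finite_config_space ?Q)"
        using op[OF U, of i] i Q by (auto simp: sets_restrict_space_iff)
    qed
    then show "(\<lambda>\<eta>. the_elem (\<eta> \<inter> X i)) \<in> restrict_space finite_config_space ?Q \<rightarrow>\<^sub>M lborel"
      by simp
  qed
  have "?r (?q x) = x" if "x \<in> PiE {..<n} X" for x
  proof
    fix i show "?r (?q x) i = x i"
      using inter[OF that, of i] that by (cases "i < n") (auto simp: PiE_iff extensional_def)
  qed
  then have "?q ` (P \<inter> PiE {..<n} X) = ?r -` P \<inter> space (restrict_space finite_config_space ?Q)"
    by (auto simp: space_restrict_space space_finite_config finite_configs_def image_iff simp del: restrict_apply)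
  then show ?thesis
    using measurable_sets[OF r P] Q by (auto simp: sets_restrict_space_iff)
qed

text \<open>Countably many boxes with disjoint sides from a basis cover the distinct tuples, and
  \<open>image_box_sets\<close> maps their measurable parts to measurable sets. Together with
  \<open>measurable_image_config\<close> this reduces measurability on configurations to
  measurability on tuples.\<close>

lemma finite_config_setsI:
  assumes A: "A \<subseteq> (finite_configs :: 'a::euclidean_space set set)"
    and m: "\<And>n. {x \<in> distinct_tuples n. x ` {..<n} \<in> A} \<in> sets (tuple_lborel n)"
  shows "A \<in> sets finite_config_space"
proof -
  obtain \<B> :: "'a set set" where \<B>: "countable \<B>" "topological_basis \<B>"
    using ex_countable_basis by auto
  let ?P = "\<lambda>n. {x \<in> distinct_tuples n. x ` {..<n} \<in> A}"
  let ?X = "\<lambda>n :: nat. {X \<in> {..<n} \<rightarrow>\<^sub>E \<B>. \<forall>i<n. \<forall>j<n. i \<noteq> j \<longrightarrow> X i \<inter> X j = {}}"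
  have "A = (\<Union>n. \<Union>X\<in>?X n. (\<lambda>x. x ` {..<n}) ` (?P n \<inter> PiE {..<n} X))"
  proof (intro equalityI subsetI)
    fix \<eta> assume \<eta>: "\<eta> \<in> A"
    then have fin: "finite \<eta>" using A by (auto simp: finite_configs_def)
    then obtain h where h: "bij_betw h {..<card \<eta>} \<eta>"
      using ex_bij_betw_nat_finite[OF fin] by (auto simp: atLeast0LessThan)
    let ?n = "card \<eta>" and ?x = "restrict h {..<card \<eta>}"
    have x: "?x \<in> distinct_tuples ?n" "?x ` {..<?n} = \<eta>"
      using h by (auto simp: distinct_tuples_def bij_betw_def)
    obtain B where B: "\<And>x. x \<in> \<eta> \<Longrightarrow> B x \<in> \<B> \<and> x \<in> B x \<and> B x \<subseteq> UNIV"
      "\<And>x y. x \<in> \<eta> \<Longrightarrow> y \<in> \<eta> \<Longrightarrow> x \<noteq> y \<Longrightarrow> B x \<inter> B y = {}"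
      using finite_points_disjoint_basis[OF fin \<B>(2), of "\<lambda>_. UNIV"] by auto
    let ?X = "\<lambda>i\<in>{..<?n}. B (?x i)"
    have xi: "?x i \<in> \<eta>" if "i < ?n" for i using x(2) that by blast
    have "?x \<in> PiE {..<?n} ?X" using B(1) xi by auto
    moreover have "?X \<in> {..<?n} \<rightarrow>\<^sub>E \<B>" using B(1) xi by auto
    moreover have "?X i \<inter> ?X j = {}" if "i < ?n" "j < ?n" "i \<noteq> j" for i j
    proof -
      have "?x i \<noteq> ?x j" using inj_on_contraD[OF distinct_tuplesD(1)[OF x(1)] that(3)] that(1,2) by blast
      then show ?thesis using B(2)[OF xi[OF that(1)] xi[OF that(2)]] that(1,2) by simp
    qed
    ultimately have "?X \<in> {X \<in> {..<?n} \<rightarrow>\<^sub>E \<B>. \<forall>i<?n. \<forall>j<?n. i \<noteq> j \<longrightarrow> X i \<inter> X j = {}}" "?x \<in> ?P ?n \<inter> PiE {..<?n} ?X"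
      using x \<eta> by (simp_all del: restrict_apply)
    then show "\<eta> \<in> (\<Union>n. \<Union>X\<in>{X \<in> {..<n} \<rightarrow>\<^sub>E \<B>. \<forall>i<n. \<forall>j<n. i \<noteq> j \<longrightarrow> X i \<inter> X j = {}}.
        (\<lambda>x. x ` {..<n}) ` (?P n \<inter> PiE {..<n} X))"
      using x(2) by (intro UN_I[of ?n] UN_I[of ?X] image_eqI[of _ _ ?x]) (simp_all only: UNIV_I)
  qed auto
  note A_eq = this
  have cX: "countable (?X n)" for n
    by (rule countable_subset[OF _ countable_PiE[of "{..<n}" "\<lambda>_. \<B>"]]) (auto simp: \<B>(1))
  have box: "(\<lambda>x. x ` {..<n}) ` (?P n \<inter> PiE {..<n} X) \<in> sets finite_config_space" if "X \<in> ?X n" for n X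
    using that topological_basis_open[OF \<B>(2)] by (intro image_box_sets m) (auto simp: PiE_iff)
  show ?thesis
    by (subst A_eq, intro sets.countable_UN''[OF countableI_type] sets.countable_UN''[OF cX] box)
qed

text \<open>The form in which measurability of functions on configurations is proved below: a
  formula on tuples suffices, and it may ignore the diagonals, where the formulas for
  \<open>L_hat\<close> and \<open>jump_sg\<close> are not claimed.\<close>

lemma measurable_configI:
  fixes f :: "'a::euclidean_space set \<Rightarrow> 'b::topological_space"
  assumes g: "\<And>n. g n \<in> tuple_borel n"
    and f: "\<And>n x. x \<in> distinct_tuples n \<Longrightarrow> f (x ` {..<n}) = g n x"
  shows "f \<in> config_borel"
proof (rule borel_measurableI)
  fix S :: "'b set" assume S: "open S"
  show "f -` S \<inter> space finite_config_space \<in> sets finite_config_space"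
  proof (rule finite_config_setsI)
    fix n
    have "{x \<in> distinct_tuples n. x ` {..<n} \<in> f -` S \<inter> space finite_config_space} =
        distinct_tuples n \<inter> (g n -` S \<inter> space (tuple_lborel n))"
      using f by (auto simp: distinct_tuplesD space_finite_config finite_configs_def)
    then show "{x \<in> distinct_tuples n. x ` {..<n} \<in> f -` S \<inter> space finite_config_space} \<in> sets (tuple_lborel n)"
      using measurable_sets[OF g, of S n] S by auto
  qed (auto simp: space_finite_config)
qed

section \<open>The Lebesgue--Poisson measure\<close>

interpretation lborel_product: product_sigma_finite "\<lambda>_ :: nat. lborel :: 'a::euclidean_space measure" ..

text \<open>With all other coordinates fixed, the exceptional values of coordinate \<open>i\<close>
  form the single point \<open>x j\<close>; Tonelli does the rest.\<close>

lemma AE_coordinates_neq: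
  assumes "i < n" "j < n" "i \<noteq> j"
  shows "AE x in tuple_lborel n. x i \<noteq> (x j :: 'a::euclidean_space)"
proof -
  let ?N = "{x \<in> space (tuple_lborel n). x i = (x j :: 'a)}"
  let ?I = "{..<n} - {i}"
  have ins: "insert i ?I = {..<n}" using assms by auto
  have "emeasure (tuple_lborel n) ?N = (\<integral>\<^sup>+x. indicator ?N x \<partial>PiM (insert i ?I) (\<lambda>_. lborel))"
    unfolding ins using nn_integral_indicator[OF coordinates_eq_sets[OF assms(1,2)]] by (rule sym)
  also have "\<dots> = (\<integral>\<^sup>+x. \<integral>\<^sup>+y. indicator ?N (x(i := y)) \<partial>lborel \<partial>PiM ?I (\<lambda>_. lborel))"
  proof (rule lborel_product.product_nn_integral_insert)
    show "indicator ?N \<in> borel_measurable (PiM (insert i ?I) (\<lambda>_. lborel))"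
      unfolding ins by (rule borel_measurable_indicator[OF coordinates_eq_sets[OF assms(1,2)]])
  qed simp_all
  also have "\<dots> = (\<integral>\<^sup>+x. \<integral>\<^sup>+y. indicator {x j :: 'a} y \<partial>lborel \<partial>PiM ?I (\<lambda>_. lborel))"
  proof (intro nn_integral_cong)
    fix x y assume "x \<in> space (PiM ?I (\<lambda>_. lborel :: 'a measure))"
    then have "x(i := y) \<in> space (tuple_lborel n)"
      using assms by (auto simp: space_PiM PiE_iff extensional_def)
    then show "indicator ?N (x(i := y)) = (indicator {x j} y :: ennreal)"
      using assms by (auto simp: indicator_def)
  qed
  also have "\<dots> = 0" by simp
  finally show ?thesis
    using coordinates_eq_sets[OF assms(1,2)] by (subst AE_iff_measurable[OF _ refl]) auto
qed

lemma AE_distinct: "AE x in tuple_lborel n. x \<in> distinct_tuples n"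
proof -
  have "AE x in tuple_lborel n. \<forall>i\<in>{..<n}. \<forall>j\<in>{..<n}. i \<noteq> j \<longrightarrow> x i \<noteq> (x j :: 'a)"
    by (intro AE_finite_allI) (auto intro: AE_coordinates_neq)
  with AE_space show ?thesis
    by eventually_elim (auto simp: distinct_tuples_eq)
qed

lemma sets_lebesgue_poisson [simp, measurable_cong]: "sets lebesgue_poisson = sets finite_config_space"
  by (simp add: lebesgue_poisson_def sets.sigma_sets_eq)

lemma space_lebesgue_poisson: "space lebesgue_poisson = finite_configs"
  unfolding lebesgue_poisson_def space_finite_config[symmetric] by (rule space_measure_of) (rule sets.space_closed)

text \<open>Since repeated entries form a null set, each term of the definition is also the image of
  full Lebesgue measure under the quotient map, which puts the definition in the form required by
  \<open>mixture_measure_space\<close>.\<close>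

lemma lebesgue_poisson_mixture:
  assumes "A \<in> sets (finite_config_space :: 'a::euclidean_space set measure)"
  shows "(\<Sum>n. ennreal (1 / fact n) * emeasure (tuple_lborel n) {x \<in> distinct_tuples n. x ` {..<n} \<in> A}) =
    (\<Sum>n. ennreal (1 / fact n) * emeasure (distr (tuple_lborel n) finite_config_space (\<lambda>x. x ` {..<n})) A)"
proof (intro suminf_cong arg_cong2[where f="(*)"] refl)
  fix n
  have m: "{x \<in> space (tuple_lborel n). x ` {..<n} \<in> A} \<in> sets (tuple_lborel n)"
    using measurable_sets[OF measurable_image_config assms, of n] by (simp add: vimage_def Int_def conj_commute)
  have "{x \<in> distinct_tuples n. x ` {..<n} \<in> A} = distinct_tuples n \<inter> {x \<in> space (tuple_lborel n). x ` {..<n} \<in> A}"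
    by (auto simp: distinct_tuplesD)
  then have "emeasure (tuple_lborel n) {x \<in> distinct_tuples n. x ` {..<n} \<in> A} =
     emeasure (tuple_lborel n) {x \<in> space (tuple_lborel n). x ` {..<n} \<in> A}"
    using m AE_distinct[of n] by (intro emeasure_eq_AE) (auto elim: AE_mp)
  then show "emeasure (tuple_lborel n) {x \<in> distinct_tuples n. x ` {..<n} \<in> A} =
      emeasure (distr (tuple_lborel n) finite_config_space (\<lambda>x. x ` {..<n})) A"
    using assms by (simp add: emeasure_distr vimage_def Int_def conj_commute)
qed

lemma emeasure_lebesgue_poisson:
  assumes "A \<in> sets (finite_config_space :: 'a::euclidean_space set measure)"
  shows "emeasure lebesgue_poisson A =
    (\<Sum>n. ennreal (1 / fact n) * emeasure (tuple_lborel n) {x \<in> space (tuple_lborel n). x ` {..<n} \<in> A})"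
  unfolding lebesgue_poisson_def
  using mixture_measure_space(1)[where N="\<lambda>n. distr (tuple_lborel n) finite_config_space (\<lambda>x. x ` {..<n})", OF _ lebesgue_poisson_mixture assms] assms
  by (simp add: emeasure_distr vimage_def Int_def conj_commute)

lemma nn_integral_lebesgue_poisson:
  assumes "g \<in> borel_measurable (finite_config_space :: 'a::euclidean_space set measure)"
  shows "(\<integral>\<^sup>+\<eta>. g \<eta> \<partial>lebesgue_poisson) =
    (\<Sum>n. ennreal (1 / fact n) * (\<integral>\<^sup>+x. g (x ` {..<n}) \<partial>tuple_lborel n))"
  unfolding lebesgue_poisson_def
  using mixture_measure_space(2)[where N="\<lambda>n. distr (tuple_lborel n) finite_config_space (\<lambda>x. x ` {..<n})", OF _ lebesgue_poisson_mixture assms] assms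
  by (simp add: nn_integral_distr)

text \<open>A series of nonnegative terms with positive weights vanishes only if every term does.
  The case \<open>n = 0\<close> is a point mass, so equality almost everywhere fixes the value at
  the empty configuration.\<close>

lemma AE_lebesgue_poisson_iff:
  assumes "{\<eta> \<in> finite_configs. P \<eta>} \<in> sets (finite_config_space :: 'a::euclidean_space set measure)"
  shows "(AE \<eta> in lebesgue_poisson. P \<eta>) \<longleftrightarrow> (\<forall>n. AE x in tuple_lborel n. P (x ` {..<n}))"
proof -
  have N: "{\<eta> \<in> finite_configs. \<not> P \<eta>} \<in> sets (finite_config_space :: 'a set measure)"
    using sets.compl_sets[OF assms] by (simp add: space_finite_config set_diff_eq) (metis (no_types, lifting) Collect_cong)
  have e: "{x \<in> space (tuple_lborel n). \<not> P (x ` {..<n})} = {x \<in> space (tuple_lborel n). x ` {..<n} \<in> {\<eta> \<in> finite_configs. \<not> P \<eta>}}" for n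
    by (auto simp: finite_configs_def)
  have m: "{x \<in> space (tuple_lborel n). \<not> P (x ` {..<n})} \<in> sets (tuple_lborel n)" for n
    unfolding e using measurable_sets[OF measurable_image_config N, of n] by (simp add: vimage_def Int_def conj_commute)
  have "(AE \<eta> in lebesgue_poisson. P \<eta>) \<longleftrightarrow> emeasure lebesgue_poisson {\<eta> \<in> finite_configs. \<not> P \<eta>} = 0"
    using N by (subst AE_iff_measurable[OF _ refl]) (auto simp: space_lebesgue_poisson)
  also have "\<dots> \<longleftrightarrow> (\<forall>n. emeasure (tuple_lborel n) {x \<in> space (tuple_lborel n). \<not> P (x ` {..<n})} = 0)"
    unfolding emeasure_lebesgue_poisson[OF N] e[symmetric] by (simp add: suminf_eq_zero_iff)
  also have "\<dots> \<longleftrightarrow> (\<forall>n. AE x in tuple_lborel n. P (x ` {..<n}))"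
    using m by (intro all_cong1 AE_iff_measurable[OF _ refl, symmetric])
  finally show ?thesis .
qed

lemma sums_enn2real:
  assumes "(\<Sum>n. a n) < (top :: ennreal)"
  shows "(\<lambda>n. enn2real (a n)) sums enn2real (\<Sum>n. a n)"
proof -
  have "a n < top" for n
    using assms ennreal_suminf_lessD by blast
  then have a: "a n = ennreal (enn2real (a n))" for n by simp
  have s: "summable (\<lambda>n. enn2real (a n))"
    using assms a by (intro summable_suminf_not_top) auto
  have "(\<Sum>n. a n) = ennreal (\<Sum>n. enn2real (a n))"
    unfolding suminf_cong[OF a] by (rule suminf_ennreal_eq) (auto intro: summable_sums s)
  then show ?thesis
    using summable_sums[OF s] by (simp add: suminf_nonneg[OF s])
qed

lemma integrable_lebesgue_poisson_tuple:
  fixes f :: "'a::euclidean_space set \<Rightarrow> real"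
  assumes "integrable lebesgue_poisson f"
  shows "integrable (tuple_lborel n) (\<lambda>x. f (x ` {..<n}))"
proof -
  have m: "f \<in> config_borel"
    using assms by (auto cong: measurable_cong_sets)
  have "(\<Sum>n. ennreal (1 / fact n) * (\<integral>\<^sup>+x. norm (f (x ` {..<n})) \<partial>tuple_lborel n)) < top"
    using assms m nn_integral_lebesgue_poisson[of "\<lambda>\<eta>. norm (f \<eta>)"] by (simp add: integrable_iff_bounded)
  then have "ennreal (1 / fact n) * (\<integral>\<^sup>+x. norm (f (x ` {..<n})) \<partial>tuple_lborel n) < top"
    by (rule ennreal_suminf_lessD)
  then have "(\<integral>\<^sup>+x. norm (f (x ` {..<n})) \<partial>tuple_lborel n) < \<infinity>"
    by (auto simp: ennreal_mult_less_top)
  then show ?thesis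
    using m by (intro integrableI_bounded) auto
qed

text \<open>The series formula for nonnegative functions is applied to the positive and to the
  negative part, both of finite integral.\<close>

lemma integral_lebesgue_poisson_sums:
  fixes f :: "'a::euclidean_space set \<Rightarrow> real"
  assumes f: "integrable lebesgue_poisson f"
  shows "(\<lambda>n. 1 / fact n * (LINT x|tuple_lborel n. f (x ` {..<n}))) sums (LINT \<eta>|lebesgue_poisson. f \<eta>)"
proof -
  have m: "f \<in> config_borel"
    using assms by (auto cong: measurable_cong_sets)
  have *: "(\<lambda>n. enn2real (ennreal (1 / fact n) * (\<integral>\<^sup>+x. g (x ` {..<n}) \<partial>tuple_lborel n))) sums enn2real (\<integral>\<^sup>+\<eta>. g \<eta> \<partial>lebesgue_poisson)"
    if "(\<integral>\<^sup>+\<eta>. g \<eta> \<partial>lebesgue_poisson) < top" "g \<in> config_borel" for g :: "'a set \<Rightarrow> ennreal"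
    using that sums_enn2real by (simp add: nn_integral_lebesgue_poisson)
  have "(\<integral>\<^sup>+\<eta>. ennreal (f \<eta>) \<partial>lebesgue_poisson) < top" "(\<integral>\<^sup>+\<eta>. ennreal (- f \<eta>) \<partial>lebesgue_poisson) < top"
    using f unfolding real_integrable_def by (auto simp: less_top)
  from sums_diff[OF *[OF this(1)] *[OF this(2)]] m
  have "(\<lambda>n. 1 / fact n * (enn2real (\<integral>\<^sup>+x. f (x ` {..<n}) \<partial>tuple_lborel n) - enn2real (\<integral>\<^sup>+x. - f (x ` {..<n}) \<partial>tuple_lborel n)))
     sums (LINT \<eta>|lebesgue_poisson. f \<eta>)"
    unfolding real_lebesgue_integral_def[OF f] by (simp add: enn2real_mult right_diff_distrib)
  then show ?thesis
    by (subst real_lebesgue_integral_def[OF integrable_lebesgue_poisson_tuple[OF f]])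
qed

section \<open>Sector bounds\<close>

text \<open>All operators below preserve the number of points, so norm estimates are carried out
  separately on each set of \<open>n\<close>-point configurations.\<close>

definition sector_bound :: "nat \<Rightarrow> ('a::euclidean_space set \<Rightarrow> real) \<Rightarrow> real \<Rightarrow> bool" where
  "sector_bound n u c \<longleftrightarrow> (AE x in tuple_lborel n. \<bar>u (x ` {..<n})\<bar> \<le> c)"

lemma emeasure_tuple_lborel_nonzero: "emeasure (tuple_lborel n :: (nat \<Rightarrow> 'a::euclidean_space) measure) (space (tuple_lborel n)) \<noteq> 0"
proof -
  have "emeasure (tuple_lborel n :: (nat \<Rightarrow> 'a) measure) (\<Pi>\<^sub>E i\<in>{..<n}. UNIV) = (\<Prod>i<n. emeasure (lborel :: 'a measure) UNIV)"
    by (rule lborel_product.emeasure_PiM) auto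
  then show ?thesis by (simp add: space_PiM emeasure_lborel_UNIV)
qed

text \<open>The space of tuples has positive measure, so an absolute value cannot be bounded almost
  everywhere by a negative constant.\<close>

lemma sector_bound_nonneg: "sector_bound n (u :: 'a::euclidean_space set \<Rightarrow> real) c \<Longrightarrow> 0 \<le> c"
proof (rule ccontr)
  assume "sector_bound n u c" "\<not> 0 \<le> c"
  then have "AE x in (tuple_lborel n :: (nat \<Rightarrow> 'a) measure). False"
    unfolding sector_bound_def by (auto elim: AE_mp)
  then show False
    using emeasure_tuple_lborel_nonzero AE_iff_measurable[of "space (tuple_lborel n)" "tuple_lborel n" "\<lambda>_. False"] by auto
qed

lemma sector_bound_mono: "sector_bound n u c \<Longrightarrow> c \<le> c' \<Longrightarrow> sector_bound n u c'"
  unfolding sector_bound_def by (auto elim!: AE_mp)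

lemma sector_bound_add: "sector_bound n u c \<Longrightarrow> sector_bound n v c' \<Longrightarrow> sector_bound n (\<lambda>\<eta>. u \<eta> + v \<eta>) (c + c')"
  unfolding sector_bound_def by (erule (1) eventually_elim2) linarith

lemma sector_bound_diff: "sector_bound n u c \<Longrightarrow> sector_bound n v c' \<Longrightarrow> sector_bound n (u \<ominus> v) (c + c')"
  unfolding sector_bound_def by (erule (1) eventually_elim2) linarith

lemma sector_bound_mult: "sector_bound n u c \<Longrightarrow> sector_bound n (\<lambda>\<eta>. r * u \<eta>) (\<bar>r\<bar> * c)"
  unfolding sector_bound_def by (erule eventually_mono) (simp add: abs_mult mult_left_mono)

text \<open>Countably many null sets, one for each \<open>1 / (k + 1)\<close>, suffice. This is how
  identities are obtained from limits: an error that can be made arbitrarily small at fixed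
  \<open>n\<close> is an error \<open>0\<close>.\<close>

lemma sector_bound_all_eps:
  assumes "\<And>e. 0 < e \<Longrightarrow> sector_bound n u (c + e)"
  shows "sector_bound n u c"
proof -
  have "AE x in tuple_lborel n. \<forall>k. \<bar>u (x ` {..<n})\<bar> \<le> c + 1 / real (Suc k)"
    unfolding AE_all_countable using assms unfolding sector_bound_def by simp
  then show ?thesis
    unfolding sector_bound_def
  proof eventually_elim
    case (elim x)
    show ?case
    proof (rule field_le_epsilon)
      fix e :: real assume "e > 0"
      then obtain k where "1 / real (Suc k) < e" using nat_approx_posE by metis
      then show "\<bar>u (x ` {..<n})\<bar> \<le> c + e" using elim[rule_format, of k] by linarith
    qed
  qed
qed

text \<open>No control of the growth in \<open>n\<close>: the identities between operators are
  checked for each \<open>n\<close> separately.\<close>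

definition locally_bounded :: "('a::euclidean_space set \<Rightarrow> real) \<Rightarrow> bool" where
  "locally_bounded u \<longleftrightarrow> u \<in> config_borel \<and> (\<forall>n. \<exists>c. sector_bound n u c)"

lemma locally_bounded_measurable [measurable_dest]: "locally_bounded u \<Longrightarrow> u \<in> config_borel"
  by (simp add: locally_bounded_def)

lemma locally_bounded_sector: "locally_bounded u \<Longrightarrow> \<exists>c. sector_bound n u c"
  by (simp add: locally_bounded_def)

lemma locally_boundedE:
  assumes "locally_bounded u"
  obtains c where "\<And>n. sector_bound n u (c n)" "u \<in> config_borel"
  using assms unfolding locally_bounded_def by metis

lemma locally_boundedI:
  "u \<in> config_borel \<Longrightarrow> (\<And>n. sector_bound n u (c n)) \<Longrightarrow> locally_bounded u"
  unfolding locally_bounded_def by blast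

lemma locally_bounded_diff: "locally_bounded u \<Longrightarrow> locally_bounded v \<Longrightarrow> locally_bounded (u \<ominus> v)"
  by (elim locally_boundedE, rule locally_boundedI[OF _ sector_bound_diff]) auto

lemma locally_bounded_mult: "locally_bounded u \<Longrightarrow> locally_bounded (\<lambda>\<eta>. r * u \<eta>)"
  unfolding locally_bounded_def by (auto intro: sector_bound_mult)

lemma AE_lebesgue_poisson_eq_iff:
  fixes u w :: "'a::euclidean_space set \<Rightarrow> real"
  assumes [measurable]: "u \<in> config_borel" "w \<in> config_borel"
  shows "(u \<doteq> w) \<longleftrightarrow> (\<forall>n. sector_bound n (u \<ominus> w) 0)"
proof -
  have "{\<eta> \<in> space finite_config_space. u \<eta> = w \<eta>} \<in> sets finite_config_space"
    by measurable
  then show ?thesis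
    unfolding sector_bound_def by (subst AE_lebesgue_poisson_iff) (simp_all add: space_finite_config)
qed

text \<open>On almost every \<open>n\<close>-tuple the cardinality is \<open>n\<close>, so the
  weight is the constant \<open>exp (\<theta> * n)\<close>. This equivalence is the bridge between
  the norm and the sector estimates.\<close>

lemma K_norm_le_iff:
  assumes [measurable]: "u \<in> borel_measurable (finite_config_space :: 'a::euclidean_space set measure)"
  shows "K_norm \<theta> u \<le> ereal C \<longleftrightarrow> (\<forall>n. sector_bound n u (C * exp (- \<theta> * real n)))"
proof -
  have c[measurable]: "(\<lambda>\<eta> :: 'a set. real (card \<eta>)) \<in> config_borel"
    by (rule measurable_configI[of "\<lambda>n _. real n"]) (simp_all add: distinct_tuplesD)
  have "{\<eta> \<in> space finite_config_space. \<bar>u \<eta>\<bar> * exp (\<theta> * real (card \<eta>)) \<le> C} \<in> sets finite_config_space"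
    by measurable
  then have m: "{\<eta> \<in> finite_configs. \<bar>u \<eta>\<bar> * exp (\<theta> * real (card \<eta>)) \<le> C} \<in> sets finite_config_space"
    by (simp add: space_finite_config)
  have f: "(\<lambda>\<eta>. ereal (\<bar>u \<eta>\<bar> * exp (\<theta> * card \<eta>))) \<in> borel_measurable lebesgue_poisson"
    by measurable
  have "K_norm \<theta> u \<le> ereal C \<longleftrightarrow> (AE \<eta> in lebesgue_poisson. \<bar>u \<eta>\<bar> * exp (\<theta> * card \<eta>) \<le> C)"
  proof
    assume "K_norm \<theta> u \<le> ereal C"
    then show "AE \<eta> in lebesgue_poisson. \<bar>u \<eta>\<bar> * exp (\<theta> * card \<eta>) \<le> C"
      using esssup_AE[of "\<lambda>\<eta>. ereal (\<bar>u \<eta>\<bar> * exp (\<theta> * card \<eta>))" lebesgue_poisson]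
      unfolding K_norm_def by (auto elim!: eventually_mono dest: order_trans)
  next
    assume "AE \<eta> in lebesgue_poisson. \<bar>u \<eta>\<bar> * exp (\<theta> * card \<eta>) \<le> C"
    then show "K_norm \<theta> u \<le> ereal C"
      unfolding K_norm_def by (intro esssup_I f) simp
  qed
  also have "\<dots> \<longleftrightarrow> (\<forall>n. AE x in tuple_lborel n. \<bar>u (x ` {..<n})\<bar> * exp (\<theta> * card (x ` {..<n})) \<le> C)"
    by (rule AE_lebesgue_poisson_iff[OF m])
  also have "\<dots> \<longleftrightarrow> (\<forall>n. sector_bound n u (C * exp (- \<theta> * real n)))"
    unfolding sector_bound_def
  proof (intro all_cong1 eventually_subst)
    fix n show "AE x in tuple_lborel n. (\<bar>u (x ` {..<n})\<bar> * exp (\<theta> * card (x ` {..<n})) \<le> C) = (\<bar>u (x ` {..<n})\<bar> \<le> C * exp (- \<theta> * real n))"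
      using AE_distinct[of n]
      by eventually_elim (simp add: distinct_tuplesD exp_minus field_simps)
  qed
  finally show ?thesis .
qed

lemma K_spaceD:
  assumes "u \<in> K_space \<theta>"
  shows "u \<in> config_borel" "\<exists>C\<ge>0. K_norm \<theta> u \<le> ereal C"
proof -
  show "u \<in> config_borel"
    using assms by (simp add: K_space_def)
  have "K_norm \<theta> u < \<infinity>" using assms by (simp add: K_space_def)
  then obtain C where "K_norm \<theta> u \<le> ereal C"
    by (cases "K_norm \<theta> u") auto
  then have "K_norm \<theta> u \<le> ereal (max 0 C)"
    by (metis ereal_less_eq(3) max.cobounded2 order_trans)
  then show "\<exists>C\<ge>0. K_norm \<theta> u \<le> ereal C" by (intro exI[of _ "max 0 C"]) simp
qed

lemma K_spaceI:
  "u \<in> config_borel \<Longrightarrow> K_norm \<theta> u \<le> ereal C \<Longrightarrow> u \<in> K_space \<theta>"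
  by (auto simp: K_space_def)

lemma K_space_locally_bounded: "u \<in> K_space \<theta> \<Longrightarrow> locally_bounded u"
  using K_spaceD[of u \<theta>] K_norm_le_iff[of u \<theta>] unfolding locally_bounded_def by blast

lemma K_norm_nonneg:
  assumes [measurable]: "u \<in> borel_measurable (finite_config_space :: 'a::euclidean_space set measure)"
  shows "0 \<le> K_norm \<theta> u"
proof (rule ccontr)
  assume "\<not> 0 \<le> K_norm \<theta> u"
  then obtain C where C: "K_norm \<theta> u < ereal C" "ereal C < 0"
    using ereal_dense2[of "K_norm \<theta> u" 0] by (auto simp: not_le)
  then have "sector_bound 0 u (C * exp (- \<theta> * real 0))"
    using K_norm_le_iff[of u \<theta> C] assms order.strict_implies_order by blast
  then show False using sector_bound_nonneg[of 0 u] C by force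
qed

lemma K_norm_tendsto_0_iff:
  assumes "eventually (\<lambda>t. f t \<in> config_borel) F"
  shows "((\<lambda>t. K_norm \<theta> (f t)) \<longlongrightarrow> 0) F \<longleftrightarrow> (\<forall>e>0. eventually (\<lambda>t. K_norm \<theta> (f t) \<le> ereal e) F)"
proof
  assume L: "((\<lambda>t. K_norm \<theta> (f t)) \<longlongrightarrow> 0) F"
  show "\<forall>e>0. eventually (\<lambda>t. K_norm \<theta> (f t) \<le> ereal e) F"
  proof safe
    fix e :: real assume "e > 0"
    then show "eventually (\<lambda>t. K_norm \<theta> (f t) \<le> ereal e) F"
      using order_tendstoD(2)[OF L, of "ereal e"] by (auto elim!: eventually_mono)
  qed
next
  assume R: "\<forall>e>0. eventually (\<lambda>t. K_norm \<theta> (f t) \<le> ereal e) F"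
  show "((\<lambda>t. K_norm \<theta> (f t)) \<longlongrightarrow> 0) F"
  proof (rule order_tendstoI)
    fix y :: ereal assume "y < 0"
    then show "eventually (\<lambda>t. y < K_norm \<theta> (f t)) F"
      by (intro eventually_mono[OF assms] less_le_trans[OF _ K_norm_nonneg])
  next
    fix y :: ereal assume "0 < y"
    then obtain e where e: "0 < ereal e" "ereal e < y" using ereal_dense2 by blast
    then have "eventually (\<lambda>t. K_norm \<theta> (f t) \<le> ereal e) F" using R by simp
    then show "eventually (\<lambda>t. K_norm \<theta> (f t) < y) F"
      using e(2) by (auto elim!: eventually_mono)
  qed
qed

section \<open>Moving one point\<close>

interpretation lborel_tuple_pair: pair_sigma_finite "tuple_lborel n :: (nat \<Rightarrow> 'a::euclidean_space) measure" "lborel :: 'a measure" for n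
  by (intro pair_sigma_finite.intro lborel_product.sigma_finite sigma_finite_lborel) simp

lemma tuple_update_measurable:
  assumes "i < n" "f \<in> N \<rightarrow>\<^sub>M tuple_lborel n" "g \<in> N \<rightarrow>\<^sub>M borel"
  shows "(\<lambda>w. (f w)(i := (g w :: 'a::euclidean_space))) \<in> N \<rightarrow>\<^sub>M tuple_lborel n"
  using assms by (intro measurable_fun_upd[of "{..<n}" "{..<n}"]) auto

lemma tuple_component_measurable:
  "i < n \<Longrightarrow> f \<in> N \<rightarrow>\<^sub>M tuple_lborel n \<Longrightarrow> (\<lambda>w. f w i :: 'a::euclidean_space) \<in> borel_measurable N"
  using measurable_compose[OF _ measurable_component_singleton[of i "{..<n}" "\<lambda>_. lborel :: 'a measure"], of f N] by simp

lemma tuple_swap_measurable: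
  assumes i: "i < n"
  shows "(\<lambda>(x, y). (x(i := y), x i)) \<in> tuple_lborel n \<Otimes>\<^sub>M lborel \<rightarrow>\<^sub>M tuple_lborel n \<Otimes>\<^sub>M (lborel :: 'a::euclidean_space measure)"
  unfolding case_prod_beta
  by (intro measurable_Pair tuple_update_measurable[OF i] measurable_fst measurable_snd)
    (auto intro!: tuple_component_measurable[OF i] measurable_fst)

text \<open>After coordinate \<open>i\<close> is split off, the map exchanges two Lebesgue
  variables, which is Tonelli. The symmetry of the jump operator under the pairing rests on this
  invariance together with \<open>a (- x) = a x\<close>.\<close>

lemma distr_tuple_swap:
  fixes n :: nat
  assumes i: "i < n"
  shows "distr (tuple_lborel n \<Otimes>\<^sub>M lborel) (tuple_lborel n \<Otimes>\<^sub>M lborel) (\<lambda>(x, y). (x(i := y), x i)) =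
    tuple_lborel n \<Otimes>\<^sub>M (lborel :: 'a::euclidean_space measure)"
proof (rule measure_eqI)
  have s[measurable]: "(\<lambda>w. (fst w)(i := snd w)) \<in> tuple_lborel n \<Otimes>\<^sub>M (lborel :: 'a measure) \<rightarrow>\<^sub>M tuple_lborel n"
    by (rule tuple_update_measurable[OF i]) measurable
  have [measurable]: "(\<lambda>w. fst w i) \<in> tuple_lborel n \<Otimes>\<^sub>M (lborel :: 'a measure) \<rightarrow>\<^sub>M borel"
    by (rule tuple_component_measurable[OF i]) measurable
  have sw[measurable]: "(\<lambda>(x, y). (x(i := y), x i)) \<in> tuple_lborel n \<Otimes>\<^sub>M (lborel :: 'a measure) \<rightarrow>\<^sub>M tuple_lborel n \<Otimes>\<^sub>M lborel"
    by (intro tuple_swap_measurable i)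
  let ?I = "{..<n} - {i}"
  have ins: "insert i ?I = {..<n}" using i by auto
  have I: "finite ?I" "i \<notin> ?I" by auto
  have upd: "(\<lambda>(z, y). x(i := y)) \<in> lborel \<Otimes>\<^sub>M lborel \<rightarrow>\<^sub>M (tuple_lborel n :: (nat \<Rightarrow> 'a) measure)" if "x \<in> space (PiM ?I (\<lambda>_. lborel))" for x :: "nat \<Rightarrow> 'a"
    unfolding case_prod_beta using that i
    by (intro measurable_fun_upd[of "{..<n}" ?I]) auto
  fix A assume A: "A \<in> sets (distr (tuple_lborel n \<Otimes>\<^sub>M (lborel :: 'a measure)) (tuple_lborel n \<Otimes>\<^sub>M lborel) (\<lambda>(x, y). (x(i := y), x i)))"
  then have A'[measurable]: "A \<in> sets (tuple_lborel n \<Otimes>\<^sub>M (lborel :: 'a measure))" by simp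
  have fold: "(\<integral>\<^sup>+x. \<integral>\<^sup>+y. f (x, y) \<partial>lborel \<partial>tuple_lborel n) = (\<integral>\<^sup>+x. \<integral>\<^sup>+z. \<integral>\<^sup>+y. f (x(i := z), y) \<partial>lborel \<partial>lborel \<partial>PiM ?I (\<lambda>_. lborel))"
    if f[measurable]: "f \<in> borel_measurable (tuple_lborel n \<Otimes>\<^sub>M (lborel :: 'a measure))" for f :: "(nat \<Rightarrow> 'a) \<times> 'a \<Rightarrow> ennreal"
    using lborel_product.product_nn_integral_insert[OF I, of "\<lambda>x. \<integral>\<^sup>+y. f (x, y) \<partial>lborel"] unfolding ins by simp
  have "emeasure (distr (tuple_lborel n \<Otimes>\<^sub>M lborel) (tuple_lborel n \<Otimes>\<^sub>M (lborel :: 'a measure)) (\<lambda>(x, y). (x(i := y), x i))) A =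
      (\<integral>\<^sup>+w. indicator A ((\<lambda>(x, y). (x(i := y), x i)) w) \<partial>(tuple_lborel n \<Otimes>\<^sub>M lborel))"
    by (subst nn_integral_distr[OF sw, symmetric]) (use A in simp_all)
  also have "\<dots> = (\<integral>\<^sup>+x. \<integral>\<^sup>+y. indicator A (x(i := y), x i) \<partial>lborel \<partial>tuple_lborel n)"
    by (subst lborel.nn_integral_fst[symmetric]) (use measurable_compose[OF sw] in simp_all)
  also have "\<dots> = (\<integral>\<^sup>+x. \<integral>\<^sup>+z. \<integral>\<^sup>+y. indicator A (x(i := y), z) \<partial>lborel \<partial>lborel \<partial>PiM ?I (\<lambda>_. lborel))"
    using fold[of "\<lambda>w. indicator A ((\<lambda>(x, y). (x(i := y), x i)) w)"] measurable_compose[OF sw] by simp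
  also have "\<dots> = (\<integral>\<^sup>+x. \<integral>\<^sup>+y. \<integral>\<^sup>+z. indicator A (x(i := y), z) \<partial>lborel \<partial>lborel \<partial>PiM ?I (\<lambda>_. lborel))"
  proof (rule nn_integral_cong)
    fix x assume x: "x \<in> space (PiM ?I (\<lambda>_. lborel :: 'a measure))"
    have "(\<lambda>w. (x(i := snd w), fst w)) \<in> lborel \<Otimes>\<^sub>M lborel \<rightarrow>\<^sub>M (tuple_lborel n \<Otimes>\<^sub>M (lborel :: 'a measure))"
      using upd[OF x] unfolding case_prod_beta by (intro measurable_Pair) simp_all
    then have "(\<lambda>(z, y). indicator A (x(i := y), z) :: ennreal) \<in> borel_measurable (lborel \<Otimes>\<^sub>M lborel)"
      unfolding case_prod_beta by (rule measurable_compose) simp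
    then show "(\<integral>\<^sup>+z. \<integral>\<^sup>+y. indicator A (x(i := y), z) \<partial>lborel \<partial>lborel) = (\<integral>\<^sup>+y. \<integral>\<^sup>+z. indicator A (x(i := y), z) \<partial>lborel \<partial>lborel)"
      by (rule lborel_pair.Fubini'[symmetric])
  qed
  also have "\<dots> = (\<integral>\<^sup>+x. \<integral>\<^sup>+y. indicator A (x, y) \<partial>lborel \<partial>tuple_lborel n)"
    using fold[of "indicator A"] by simp
  also have "\<dots> = emeasure (tuple_lborel n \<Otimes>\<^sub>M lborel) A"
    using A' by (subst lborel.nn_integral_fst) simp_all
  finally show "emeasure (distr (tuple_lborel n \<Otimes>\<^sub>M lborel) (tuple_lborel n \<Otimes>\<^sub>M lborel) (\<lambda>(x, y). (x(i := y), x i))) A =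
     emeasure (tuple_lborel n \<Otimes>\<^sub>M (lborel :: 'a measure)) A" .
qed simp

lemma nn_integral_tuple_swap:
  assumes i: "i < n" and f: "f \<in> borel_measurable (tuple_lborel n \<Otimes>\<^sub>M (lborel :: 'a::euclidean_space measure))"
  shows "(\<integral>\<^sup>+x. \<integral>\<^sup>+y. f (x(i := y), x i) \<partial>lborel \<partial>tuple_lborel n) = (\<integral>\<^sup>+x. \<integral>\<^sup>+y. f (x, y) \<partial>lborel \<partial>tuple_lborel n)"
proof -
  have "(\<integral>\<^sup>+x. \<integral>\<^sup>+y. f (x, y) \<partial>lborel \<partial>tuple_lborel n) = (\<integral>\<^sup>+w. f w \<partial>(tuple_lborel n \<Otimes>\<^sub>M lborel))"
    using f by (rule lborel.nn_integral_fst)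
  also have "\<dots> = (\<integral>\<^sup>+w. f ((\<lambda>(x, y). (x(i := y), x i)) w) \<partial>(tuple_lborel n \<Otimes>\<^sub>M lborel))"
    by (subst distr_tuple_swap[OF i, symmetric], subst nn_integral_distr) (use f tuple_swap_measurable[OF i] in simp_all)
  also have "\<dots> = (\<integral>\<^sup>+x. \<integral>\<^sup>+y. f (x(i := y), x i) \<partial>lborel \<partial>tuple_lborel n)"
    using lborel.nn_integral_fst[OF measurable_compose[OF tuple_swap_measurable[OF i] f], symmetric] by simp
  finally show ?thesis by simp
qed

text \<open>Under the swap the updated tuple becomes a plain tuple, so the null set for
  \<open>P\<close> gives a null set of pairs. Operators that move one point are thereby well defined
  on classes of functions.\<close>

lemma AE_tuple_update:
  assumes i: "i < n" and P: "AE x in (tuple_lborel n :: (nat \<Rightarrow> 'a::euclidean_space) measure). P x"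
  shows "AE x in tuple_lborel n. AE y in lborel. P (x(i := y))"
proof -
  obtain N where N: "{x \<in> space (tuple_lborel n). \<not> P x} \<subseteq> N" "N \<in> null_sets (tuple_lborel n)"
    using P unfolding eventually_ae_filter by auto
  have Nm[measurable]: "N \<in> sets (tuple_lborel n)" using N(2) by auto
  have m: "(\<lambda>w. indicator N (fst w) :: ennreal) \<in> borel_measurable (tuple_lborel n \<Otimes>\<^sub>M (lborel :: 'a measure))"
    by measurable
  have m2: "(\<lambda>(x, y). indicator N (x(i := y)) :: ennreal) \<in> borel_measurable (tuple_lborel n \<Otimes>\<^sub>M (lborel :: 'a measure))"
    using measurable_compose[OF tuple_swap_measurable[OF i] m] by (simp add: case_prod_beta)
  have "(\<integral>\<^sup>+x. \<integral>\<^sup>+y. indicator N (x(i := y)) \<partial>(lborel :: 'a measure) \<partial>tuple_lborel n) = (\<integral>\<^sup>+x. \<integral>\<^sup>+(y :: 'a). indicator N x \<partial>lborel \<partial>tuple_lborel n)"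
    using nn_integral_tuple_swap[OF i m] by simp
  also have "\<dots> = 0"
    using AE_not_in[OF N(2)] by (subst nn_integral_0_iff_AE) (auto elim!: AE_mp)
  finally have "AE x in tuple_lborel n. (\<integral>\<^sup>+y. indicator N (x(i := y)) \<partial>(lborel :: 'a measure)) = 0"
    using m2 by (subst (asm) nn_integral_0_iff_AE) auto
  with AE_space show ?thesis
  proof eventually_elim
    case (elim x)
    have mx: "(\<lambda>y. indicator N (x(i := y)) :: ennreal) \<in> borel_measurable lborel"
      using measurable_compose[OF measurable_Pair1'[OF elim(1)] m2] by simp
    have sp: "x(i := y) \<in> space (tuple_lborel n)" for y
      using elim(1) i by (auto simp: space_PiM PiE_iff extensional_def)
    have "AE y in lborel. indicator N (x(i := y)) = (0 :: ennreal)"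
      using elim(2) mx by (subst (asm) nn_integral_0_iff_AE) auto
    then show ?case
      using N(1) sp by (auto simp: indicator_def elim!: AE_mp split: if_splits)
  qed
qed

section \<open>The jump generator\<close>

lemma nn_integral_lborel_translate:
  fixes f :: "'a::euclidean_space \<Rightarrow> ennreal"
  assumes "f \<in> borel_measurable borel"
  shows "(\<integral>\<^sup>+x. f (c + x) \<partial>lborel) = (\<integral>\<^sup>+x. f x \<partial>lborel)"
proof -
  have "(\<integral>\<^sup>+x. f x \<partial>lborel) = (\<integral>\<^sup>+x. f x \<partial>distr lborel borel ((+) c))"
    by (simp add: lborel_distr_plus)
  also have "\<dots> = (\<integral>\<^sup>+x. f (c + x) \<partial>lborel)"
    using assms by (subst nn_integral_distr) auto
  finally show ?thesis by simp
qed

lemma integral_lborel_translate: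
  fixes f :: "'a::euclidean_space \<Rightarrow> real"
  assumes "f \<in> borel_measurable borel"
  shows "(LINT x|lborel. f (c + x)) = (LINT x|lborel. f x)"
    and "integrable lborel (\<lambda>x. f (c + x)) \<longleftrightarrow> integrable lborel f"
proof -
  have "(LINT x|lborel. f x) = (LINT x|distr lborel borel ((+) c). f x)"
    by (simp add: lborel_distr_plus)
  also have "\<dots> = (LINT x|lborel. f (c + x))"
    using assms by (subst integral_distr) auto
  finally show "(LINT x|lborel. f (c + x)) = (LINT x|lborel. f x)" by simp
  have "integrable (distr lborel borel ((+) c)) f \<longleftrightarrow> integrable lborel (\<lambda>x. f (c + x))"
    using assms by (intro integrable_distr_eq) auto
  then show "integrable lborel (\<lambda>x. f (c + x)) \<longleftrightarrow> integrable lborel f"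
    by (simp add: lborel_distr_plus)
qed

declare fun_upd_image [simp del]

locale jump_kernel =
  fixes a :: "'a::euclidean_space \<Rightarrow> real"
  assumes a_measurable [measurable]: "a \<in> borel_measurable borel"
    and a_nonneg: "0 \<le> a x"
    and a_sym: "a (- x) = a x"
    and a_integrable: "integrable lborel a"
begin

abbreviation \<alpha> :: real where "\<alpha> \<equiv> total_rate a"

abbreviation jump_term :: "nat \<Rightarrow> ('a set \<Rightarrow> real) \<Rightarrow> (nat \<Rightarrow> 'a) \<Rightarrow> nat \<Rightarrow> real" where
  "jump_term n u x i \<equiv> LINT y|lborel. a (x i - y) * u ((x(i := y)) ` {..<n})"

lemma rate_nonneg: "0 \<le> \<alpha>"
  unfolding total_rate_def by (intro integral_nonneg_AE) (auto simp: a_nonneg)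

lemma a_diff_commute: "a (x - y) = a (y - x)"
  using a_sym[of "x - y"] by simp

lemma nn_integral_a: "(\<integral>\<^sup>+y. a (x - y) \<partial>lborel) = ennreal \<alpha>"
proof -
  have "(\<integral>\<^sup>+y. a (x - y) \<partial>lborel) = (\<integral>\<^sup>+y. a (- x + y) \<partial>lborel)"
    by (simp add: a_diff_commute)
  also have "\<dots> = (\<integral>\<^sup>+y. a y \<partial>lborel)"
    by (rule nn_integral_lborel_translate) measurable
  also have "\<dots> = ennreal \<alpha>"
    unfolding total_rate_def using a_integrable a_nonneg by (intro nn_integral_eq_integral) auto
  finally show ?thesis .
qed

lemma a_integrable_diff: "integrable lborel (\<lambda>y. a (x - y))" "(LINT y|lborel. a (x - y)) = \<alpha>"
proof -
  have *: "(\<lambda>y. a (x - y)) = (\<lambda>y. a (- x + y))"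
    by (simp add: a_diff_commute fun_eq_iff)
  show "integrable lborel (\<lambda>y. a (x - y))" "(LINT y|lborel. a (x - y)) = \<alpha>"
    unfolding * using integral_lborel_translate[of a "- x"] a_integrable by (auto simp: total_rate_def)
qed

lemma integral_a_bounded:
  assumes [measurable]: "f \<in> borel_measurable borel" and "AE y in lborel. \<bar>f y\<bar> \<le> c"
  shows "integrable lborel (\<lambda>y. a (x - y) * f y)" "\<bar>LINT y|lborel. a (x - y) * f y\<bar> \<le> \<alpha> * c"
proof -
  have b: "AE y in lborel. norm (a (x - y) * f y) \<le> a (x - y) * c"
    using assms(2) by eventually_elim (simp add: abs_mult a_nonneg mult_left_mono)
  have i: "integrable lborel (\<lambda>y. a (x - y) * c)" using a_integrable_diff by simp
  show I: "integrable lborel (\<lambda>y. a (x - y) * f y)"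
  proof (rule Bochner_Integration.integrable_bound[OF i])
    show "AE y in lborel. norm (a (x - y) * f y) \<le> norm (a (x - y) * c)"
      using b by eventually_elim simp
  qed measurable
  have "\<bar>LINT y|lborel. a (x - y) * f y\<bar> \<le> (LINT y|lborel. a (x - y) * c)"
    using b by (intro order_trans[OF integral_abs_bound] integral_mono_AE[OF integrable_abs[OF I] i]) simp
  then show "\<bar>LINT y|lborel. a (x - y) * f y\<bar> \<le> \<alpha> * c"
    by (simp add: a_integrable_diff)
qed

text \<open>The entries are distinct, so a sum over points is a sum over indices, and replacing a
  point is an update of the tuple. The new point may coincide with another entry, which makes the
  set smaller on both sides alike.\<close>

lemma L_hat_tuple:
  assumes x: "x \<in> distinct_tuples n"
  shows "L_hat a v (x ` {..<n}) = - \<alpha> * real n * v (x ` {..<n}) +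
    (\<Sum>i<n. LINT y|lborel. a (x i - y) * v ((x(i := y)) ` {..<n}))"
proof -
  have inj: "inj_on x {..<n}" using x by (rule distinct_tuplesD)
  have "x ` {..<n} - {x i} \<union> {y} = (x(i := y)) ` {..<n}" if "i < n" for i y
  proof -
    have "x ` {..<n} - {x i} = x ` ({..<n} - {i})"
      using inj that by (auto simp: inj_on_def)
    moreover have "(x(i := y)) ` {..<n} = insert y (x ` ({..<n} - {i}))"
      using that by (subst fun_upd_image) simp
    ultimately show ?thesis by auto
  qed
  then have "(\<Sum>z\<in>x ` {..<n}. LINT y|lborel. a (z - y) * v (x ` {..<n} - {z} \<union> {y})) =
      (\<Sum>i<n. LINT y|lborel. a (x i - y) * v ((x(i := y)) ` {..<n}))"
    by (subst sum.reindex[OF inj]) (auto intro!: sum.cong)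
  then show ?thesis
    unfolding L_hat_def using distinct_tuplesD(2)[OF x] by simp
qed

lemma tuple_update_config_measurable:
  assumes v: "v \<in> config_borel" and i: "i < n"
  shows "(\<lambda>(x, y). v ((x(i := y)) ` {..<n})) \<in> borel_measurable (tuple_lborel n \<Otimes>\<^sub>M (lborel :: 'a measure))"
proof -
  have "(\<lambda>w. v ((fst w) ` {..<n})) \<in> borel_measurable (tuple_lborel n \<Otimes>\<^sub>M (lborel :: 'a measure))"
    by (rule measurable_compose[OF measurable_compose[OF measurable_fst measurable_image_config] v])
  from measurable_compose[OF tuple_swap_measurable[OF i] this] show ?thesis
    by (simp add: case_prod_beta)
qed

lemma jump_integrand_measurable:
  assumes v: "v \<in> config_borel" and i: "i < n"
  shows "(\<lambda>(x, y). a (x i - y) * v ((x(i := y)) ` {..<n})) \<in> borel_measurable (tuple_lborel n \<Otimes>\<^sub>M lborel)"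
proof -
  have [measurable]: "(\<lambda>w. fst w i) \<in> borel_measurable (tuple_lborel n \<Otimes>\<^sub>M (lborel :: 'a measure))"
    by (rule tuple_component_measurable[OF i measurable_fst])
  have [measurable]: "(\<lambda>w. v ((fst w)(i := snd w) ` {..<n})) \<in> borel_measurable (tuple_lborel n \<Otimes>\<^sub>M lborel)"
    using tuple_update_config_measurable[OF v i] by (simp add: case_prod_beta)
  show ?thesis unfolding case_prod_beta by measurable
qed

lemma L_hat_measurable:
  assumes v: "v \<in> config_borel"
  shows "L_hat a v \<in> config_borel"
proof (rule measurable_configI)
  fix n
  have [measurable]: "(\<lambda>x. v (x ` {..<n})) \<in> tuple_borel n"
    using v by measurable
  have "(\<lambda>x. LINT y|lborel. a (x i - y) * v ((x(i := y)) ` {..<n})) \<in> tuple_borel n" if "i < n" for i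
    using jump_integrand_measurable[OF v that] by (intro lborel.borel_measurable_lebesgue_integral) simp
  then show "(\<lambda>x. - \<alpha> * real n * v (x ` {..<n}) + (\<Sum>i<n. LINT y|lborel. a (x i - y) * v ((x(i := y)) ` {..<n})))
      \<in> tuple_borel n"
    by (intro borel_measurable_add borel_measurable_sum) auto
qed (rule L_hat_tuple)

text \<open>The jump integral evaluates \<open>v\<close> at tuples with one moved entry, where the
  bound holds for almost all \<open>x\<close> and almost all \<open>y\<close>; the null sets for the
  finitely many \<open>i\<close> are united.\<close>

lemma AE_update_bound:
  fixes v :: "'a set \<Rightarrow> real"
  assumes v: "v \<in> config_borel" and b: "sector_bound n v c"
  shows "AE x in tuple_lborel n. \<forall>i<n. (\<lambda>y. v ((x(i := y)) ` {..<n})) \<in> borel_measurable borel \<and> (AE y in lborel. \<bar>v ((x(i := y)) ` {..<n})\<bar> \<le> c)"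
proof -
  have "AE x in tuple_lborel n. \<forall>i\<in>{..<n}. (AE y in lborel. \<bar>v ((x(i := y)) ` {..<n})\<bar> \<le> c)"
    using b unfolding sector_bound_def by (intro AE_finite_allI AE_tuple_update) auto
  with AE_space show ?thesis
  proof eventually_elim
    case (elim x)
    have "(\<lambda>y. v ((x(i := y)) ` {..<n})) \<in> borel_measurable borel" if "i < n" for i
      using measurable_compose[OF measurable_Pair1'[OF elim(1)] tuple_update_config_measurable[OF v that]] by simp
    then show ?case using elim(2) by auto
  qed
qed

text \<open>The loss term and the gain term contribute \<open>\<alpha> * n * c\<close> each. The
  growth of this factor in \<open>n\<close> is what makes the generator unbounded.\<close>

lemma sector_bound_L_hat:
  assumes v: "v \<in> config_borel" and b: "sector_bound n v c"
  shows "sector_bound n (L_hat a v) (2 * \<alpha> * real n * c)"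
  using AE_update_bound[OF assms] AE_distinct[of n] b unfolding sector_bound_def
proof eventually_elim
  case (elim x)
  have "\<bar>L_hat a v (x ` {..<n})\<bar> \<le> \<alpha> * real n * \<bar>v (x ` {..<n})\<bar> + (\<Sum>i<n. \<bar>LINT y|lborel. a (x i - y) * v ((x(i := y)) ` {..<n})\<bar>)"
    unfolding L_hat_tuple[OF elim(2)] using rate_nonneg
    by (intro order_trans[OF abs_triangle_ineq] add_mono sum_abs) (simp add: abs_mult)
  also have "\<dots> \<le> \<alpha> * real n * c + (\<Sum>i<n. \<alpha> * c)"
    using elim rate_nonneg integral_a_bounded(2) by (intro add_mono sum_mono mult_left_mono) auto
  finally show ?case by (simp add: algebra_simps)
qed

text \<open>Linearity is an almost everywhere statement: the integrals split where the jump
  integrands are integrable, and \<open>AE_update_bound\<close> provides this for almost every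
  tuple.\<close>

lemma L_hat_diff:
  assumes u: "locally_bounded u" and v: "locally_bounded v"
  shows "sector_bound n (\<lambda>\<eta>. L_hat a (u \<ominus> v) \<eta> - (L_hat a u \<eta> - L_hat a v \<eta>)) 0"
proof -
  obtain c c' where b: "sector_bound n u c" "sector_bound n v c'"
    using u v locally_bounded_sector by metis
  show ?thesis
    using AE_update_bound[OF locally_bounded_measurable[OF u] b(1)]
      AE_update_bound[OF locally_bounded_measurable[OF v] b(2)] AE_distinct[of n]
    unfolding sector_bound_def
  proof eventually_elim
    case (elim x)
    have "(LINT y|lborel. a (x i - y) * (u ((x(i := y)) ` {..<n}) - v ((x(i := y)) ` {..<n}))) =
        jump_term n u x i - jump_term n v x i" if "i < n" for i
      using elim(1)[rule_format, OF that] elim(2)[rule_format, OF that] integral_a_bounded(1)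
      by (subst Bochner_Integration.integral_diff[symmetric]) (auto simp: right_diff_distrib)
    then show ?case
      unfolding L_hat_tuple[OF elim(3)] by (simp add: right_diff_distrib sum_subtractf)
  qed
qed

lemma locally_bounded_L_hat: "locally_bounded u \<Longrightarrow> locally_bounded (L_hat a u)"
  unfolding locally_bounded_def using L_hat_measurable sector_bound_L_hat by blast

text \<open>The swap of \<open>x i\<close> and \<open>y\<close> leaves \<open>v\<close> at the
  unmoved tuple, and the kernel then integrates to \<open>\<alpha>\<close> in the free
  variable.\<close>

lemma nn_integral_jump_swap:
  assumes v: "v \<in> config_borel" and i: "i < n"
  shows "(\<integral>\<^sup>+x. \<integral>\<^sup>+y. ennreal \<bar>a (x i - y) * v ((x(i := y)) ` {..<n})\<bar> \<partial>lborel \<partial>tuple_lborel n) =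
    ennreal \<alpha> * sector_L1 n v"
proof -
  let ?f = "\<lambda>w. ennreal \<bar>a (snd w - fst w i) * v (fst w ` {..<n})\<bar>"
  have [measurable]: "(\<lambda>w. fst w i) \<in> borel_measurable (tuple_lborel n \<Otimes>\<^sub>M (lborel :: 'a measure))"
    by (rule tuple_component_measurable[OF i measurable_fst])
  have [measurable]: "(\<lambda>w. v ((fst w) ` {..<n})) \<in> borel_measurable (tuple_lborel n \<Otimes>\<^sub>M (lborel :: 'a measure))"
    by (rule measurable_compose[OF measurable_compose[OF measurable_fst measurable_image_config] v])
  have [measurable]: "(\<lambda>x. v (x ` {..<n})) \<in> tuple_borel n"
    using v by measurable
  have f: "?f \<in> borel_measurable (tuple_lborel n \<Otimes>\<^sub>M lborel)" by measurable
  have "(\<integral>\<^sup>+x. \<integral>\<^sup>+y. ennreal \<bar>a (x i - y) * v ((x(i := y)) ` {..<n})\<bar> \<partial>lborel \<partial>tuple_lborel n) =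
     (\<integral>\<^sup>+x. \<integral>\<^sup>+y. ?f (x, y) \<partial>lborel \<partial>tuple_lborel n)"
    by (subst nn_integral_tuple_swap[OF i f, symmetric]) simp
  also have "\<dots> = (\<integral>\<^sup>+x. ennreal \<bar>v (x ` {..<n})\<bar> * (\<integral>\<^sup>+y. a (x i - y) \<partial>lborel) \<partial>tuple_lborel n)"
    by (subst nn_integral_cmult[symmetric])
      (auto simp: abs_mult a_nonneg ennreal_mult mult.commute a_diff_commute intro!: nn_integral_cong)
  also have "\<dots> = ennreal \<alpha> * sector_L1 n v"
    unfolding nn_integral_a by (subst nn_integral_multc) (auto simp: mult.commute)
  finally show ?thesis .
qed

text \<open>The integral counterpart of \<open>sector_bound_L_hat\<close>, with the same factor: by
  the symmetry of \<open>a\<close>, gain and loss cost the same here too.\<close>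

lemma nn_integral_L_hat_le:
  assumes v[measurable]: "v \<in> config_borel"
  shows "sector_L1 n (L_hat a v) \<le> ennreal (2 * \<alpha> * real n) * sector_L1 n v"
proof -
  have [measurable]: "(\<lambda>x. v (x ` {..<n})) \<in> tuple_borel n"
    using v by measurable
  have m: "(\<lambda>x. \<integral>\<^sup>+y. ennreal \<bar>a (x i - y) * v ((x(i := y)) ` {..<n})\<bar> \<partial>lborel) \<in> tuple_borel n" if "i < n" for i
    using measurable_compose[OF jump_integrand_measurable[OF v that], of "\<lambda>r. ennreal \<bar>r\<bar>" borel]
    by (intro lborel.borel_measurable_nn_integral) (simp add: case_prod_beta)
  \<comment> \<open>For a non-integrable \<open>f\<close> the left side is \<open>0\<close>.\<close>
  have le: "ennreal \<bar>LINT y|lborel. f y\<bar> \<le> (\<integral>\<^sup>+y. \<bar>f y\<bar> \<partial>lborel)" for f :: "'a \<Rightarrow> real"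
  proof (cases "integrable lborel f")
    case True
    have "ennreal \<bar>LINT y|lborel. f y\<bar> \<le> ennreal (LINT y|lborel. \<bar>f y\<bar>)"
      by (intro ennreal_leI integral_abs_bound)
    then show ?thesis using True nn_integral_eq_integral[of lborel "\<lambda>y. \<bar>f y\<bar>"] by simp
  qed (simp add: not_integrable_integral_eq)
  have "sector_L1 n (L_hat a v) \<le>
    (\<integral>\<^sup>+x. ennreal (\<alpha> * real n) * ennreal \<bar>v (x ` {..<n})\<bar> + (\<Sum>i<n. \<integral>\<^sup>+y. ennreal \<bar>a (x i - y) * v ((x(i := y)) ` {..<n})\<bar> \<partial>lborel) \<partial>tuple_lborel n)"
  proof (rule nn_integral_mono_AE)
    show "AE x in tuple_lborel n. ennreal \<bar>L_hat a v (x ` {..<n})\<bar> \<le>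
       ennreal (\<alpha> * real n) * ennreal \<bar>v (x ` {..<n})\<bar> + (\<Sum>i<n. \<integral>\<^sup>+y. ennreal \<bar>a (x i - y) * v ((x(i := y)) ` {..<n})\<bar> \<partial>lborel)"
      using AE_distinct[of n]
    proof eventually_elim
      case (elim x)
      have "\<bar>L_hat a v (x ` {..<n})\<bar> \<le> \<alpha> * real n * \<bar>v (x ` {..<n})\<bar> + (\<Sum>i<n. \<bar>LINT y|lborel. a (x i - y) * v ((x(i := y)) ` {..<n})\<bar>)"
        unfolding L_hat_tuple[OF elim] using rate_nonneg
        by (intro order_trans[OF abs_triangle_ineq] add_mono sum_abs) (simp add: abs_mult)
      then have "ennreal \<bar>L_hat a v (x ` {..<n})\<bar> \<le> ennreal (\<alpha> * real n * \<bar>v (x ` {..<n})\<bar> + (\<Sum>i<n. \<bar>LINT y|lborel. a (x i - y) * v ((x(i := y)) ` {..<n})\<bar>))"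
        by (rule ennreal_leI)
      also have "\<dots> = ennreal (\<alpha> * real n) * ennreal \<bar>v (x ` {..<n})\<bar> + (\<Sum>i<n. ennreal \<bar>LINT y|lborel. a (x i - y) * v ((x(i := y)) ` {..<n})\<bar>)"
        using rate_nonneg by (simp add: ennreal_plus sum_nonneg ennreal_mult[symmetric] sum_ennreal)
      also have "\<dots> \<le> ennreal (\<alpha> * real n) * ennreal \<bar>v (x ` {..<n})\<bar> + (\<Sum>i<n. \<integral>\<^sup>+y. ennreal \<bar>a (x i - y) * v ((x(i := y)) ` {..<n})\<bar> \<partial>lborel)"
        by (intro add_left_mono sum_mono le)
      finally show ?case .
    qed
  qed
  also have "\<dots> = ennreal (\<alpha> * real n) * sector_L1 n v + (\<Sum>i<n. ennreal \<alpha> * sector_L1 n v)"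
  proof -
    have "(\<integral>\<^sup>+x. (\<Sum>i<n. \<integral>\<^sup>+y. ennreal \<bar>a (x i - y) * v ((x(i := y)) ` {..<n})\<bar> \<partial>lborel) \<partial>tuple_lborel n) =
       (\<Sum>i<n. ennreal \<alpha> * sector_L1 n v)"
      by (subst nn_integral_sum, rule m, simp, intro sum.cong refl nn_integral_jump_swap[OF v], simp)
    moreover have "(\<integral>\<^sup>+x. ennreal (\<alpha> * real n) * ennreal \<bar>v (x ` {..<n})\<bar> \<partial>tuple_lborel n) = ennreal (\<alpha> * real n) * sector_L1 n v"
      by (rule nn_integral_cmult) measurable
    moreover have "(\<lambda>x. ennreal (\<alpha> * real n) * ennreal \<bar>v (x ` {..<n})\<bar>) \<in> tuple_borel n"
      by measurable
    ultimately show ?thesis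
      using m by (subst nn_integral_add) auto
  qed
  also have "\<dots> = ennreal (2 * \<alpha> * real n) * sector_L1 n v"
  proof -
    have "ennreal (2 * \<alpha> * real n) = ennreal (\<alpha> * real n) + of_nat n * ennreal \<alpha>"
      using rate_nonneg by (simp add: ennreal_of_nat_eq_real_of_nat ennreal_mult[symmetric] ennreal_plus[symmetric] del: ennreal_plus)
    then show ?thesis by (simp add: distrib_right mult.assoc del: ennreal_plus)
  qed
  finally show ?thesis .
qed

section \<open>The adjoint\<close>

text \<open>The swap carries \<open>?F\<close> to \<open>?G\<close> because \<open>a\<close> is
  even, and the diagonal parts agree, so on \<open>n\<close>-point functions \<open>L_hat\<close> is
  its own transpose. Pairing an integrable with a bounded function makes all double integrals
  converge absolutely, as Fubini requires.\<close>

lemma tuple_pairing: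
  assumes v: "v \<in> config_borel" "integrable (tuple_lborel n) (\<lambda>x. v (x ` {..<n}))"
    and u: "u \<in> config_borel" "sector_bound n u c"
  shows "sector_inner n (L_hat a v) u =
    sector_inner n v (L_hat a u)"
proof -
  let ?M = "tuple_lborel n \<Otimes>\<^sub>M (lborel :: 'a measure)"
  let ?F = "\<lambda>i w. a (fst w i - snd w) * v (((fst w)(i := snd w)) ` {..<n}) * u (fst w ` {..<n})"
  let ?G = "\<lambda>i w. v (fst w ` {..<n}) * (a (fst w i - snd w) * u (((fst w)(i := snd w)) ` {..<n}))"
  have [measurable]: "(\<lambda>x. v (x ` {..<n})) \<in> tuple_borel n" "(\<lambda>x. u (x ` {..<n})) \<in> tuple_borel n"
    using v u by measurable
  have mu: "(\<lambda>w. u (fst w ` {..<n})) \<in> borel_measurable ?M" "(\<lambda>w. v (fst w ` {..<n})) \<in> borel_measurable ?M"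
    by measurable
  have F: "integrable ?M (?F i)" if i: "i < n" for i
  proof (rule integrableI_bounded)
    have mF: "(\<lambda>w. a (fst w i - snd w) * v (((fst w)(i := snd w)) ` {..<n})) \<in> borel_measurable ?M"
      using jump_integrand_measurable[OF v(1) i] by (simp add: case_prod_beta)
    show m: "?F i \<in> borel_measurable ?M"
      using mF mu by simp
    have "(\<integral>\<^sup>+w. norm (?F i w) \<partial>?M) = (\<integral>\<^sup>+x. \<integral>\<^sup>+y. norm (?F i (x, y)) \<partial>lborel \<partial>tuple_lborel n)"
      using m by (intro lborel.nn_integral_fst[symmetric]) simp
    also have "\<dots> \<le> (\<integral>\<^sup>+x. \<integral>\<^sup>+y. ennreal \<bar>a (x i - y) * v ((x(i := y)) ` {..<n})\<bar> * ennreal c \<partial>lborel \<partial>tuple_lborel n)"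
    proof (rule nn_integral_mono_AE)
      show "AE x in tuple_lborel n. (\<integral>\<^sup>+y. norm (?F i (x, y)) \<partial>lborel) \<le> (\<integral>\<^sup>+y. ennreal \<bar>a (x i - y) * v ((x(i := y)) ` {..<n})\<bar> * ennreal c \<partial>lborel)"
        using u(2) unfolding sector_bound_def
      proof eventually_elim
        case (elim x)
        then show ?case
          by (intro nn_integral_mono) (auto simp: abs_mult ennreal_mult[symmetric] intro!: ennreal_leI mult_left_mono)
      qed
    qed
    also have "\<dots> = (\<integral>\<^sup>+w. ennreal \<bar>a (fst w i - snd w) * v (((fst w)(i := snd w)) ` {..<n})\<bar> * ennreal c \<partial>?M)"
      using mF by (subst lborel.nn_integral_fst[symmetric]) simp_all
    also have "\<dots> = (\<integral>\<^sup>+w. ennreal \<bar>a (fst w i - snd w) * v (((fst w)(i := snd w)) ` {..<n})\<bar> \<partial>?M) * ennreal c"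
      using mF by (intro nn_integral_multc) simp
    also have "\<dots> = ennreal \<alpha> * sector_L1 n v * ennreal c"
      using mF nn_integral_jump_swap[OF v(1) i] by (subst lborel.nn_integral_fst[symmetric]) simp_all
    also have "\<dots> < \<infinity>"
      using v(2) by (simp add: integrable_iff_bounded ennreal_mult_less_top)
    finally show "(\<integral>\<^sup>+w. norm (?F i w) \<partial>?M) < \<infinity>" .
  qed
  have swap: "?F i ((\<lambda>(x, y). (x(i := y), x i)) w) = ?G i w" for i w
    by (cases w) (simp add: a_diff_commute mult.commute mult.left_commute)
  have G: "integrable ?M (?G i)" "(LINT w|?M. ?F i w) = (LINT w|?M. ?G i w)" if i: "i < n" for i
  proof -
    note mF = borel_measurable_integrable[OF F[OF i]]
    have "integrable (distr ?M ?M (\<lambda>(x, y). (x(i := y), x i))) (?F i)"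
      using F[OF i] by (simp only: distr_tuple_swap[OF i])
    then show "integrable ?M (?G i)"
      using integrable_distr_eq[OF tuple_swap_measurable[OF i] mF] unfolding swap by simp
    have "(LINT w|?M. ?F i w) = (LINT w|distr ?M ?M (\<lambda>(x, y). (x(i := y), x i)). ?F i w)"
      by (simp only: distr_tuple_swap[OF i])
    also have "\<dots> = (LINT w|?M. ?G i w)"
      using integral_distr[OF tuple_swap_measurable[OF i] mF] unfolding swap .
    finally show "(LINT w|?M. ?F i w) = (LINT w|?M. ?G i w)" .
  qed
  have Fx: "(LINT x|tuple_lborel n. jump_term n v x i * u (x ` {..<n})) = (LINT w|?M. ?F i w)"
    "integrable (tuple_lborel n) (\<lambda>x. jump_term n v x i * u (x ` {..<n}))" if i: "i < n" for i
    using lborel_tuple_pair.integral_fst'[OF F[OF i]] lborel_tuple_pair.integrable_fst'[OF F[OF i]] by simp_all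
  have Gx: "(LINT x|tuple_lborel n. v (x ` {..<n}) * jump_term n u x i) = (LINT w|?M. ?G i w)"
    "integrable (tuple_lborel n) (\<lambda>x. v (x ` {..<n}) * jump_term n u x i)" if i: "i < n" for i
    using lborel_tuple_pair.integral_fst'[OF G(1)[OF i]] lborel_tuple_pair.integrable_fst'[OF G(1)[OF i]] by simp_all
  have uv: "integrable (tuple_lborel n) (\<lambda>x. v (x ` {..<n}) * u (x ` {..<n}))"
  proof (rule Bochner_Integration.integrable_bound[OF integrable_mult_left[OF v(2), of c]])
    show "AE x in tuple_lborel n. norm (v (x ` {..<n}) * u (x ` {..<n})) \<le> norm (v (x ` {..<n}) * c)"
      using u(2) unfolding sector_bound_def
      by eventually_elim (auto simp: abs_mult intro!: mult_left_mono)
  qed measurable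
  have "sector_inner n (L_hat a v) u =
      (LINT x|tuple_lborel n. (- \<alpha> * real n) * (v (x ` {..<n}) * u (x ` {..<n})) + (\<Sum>i<n. jump_term n v x i * u (x ` {..<n})))"
  proof (rule integral_cong_AE)
    show "AE x in tuple_lborel n. L_hat a v (x ` {..<n}) * u (x ` {..<n}) = (- \<alpha> * real n) * (v (x ` {..<n}) * u (x ` {..<n})) + (\<Sum>i<n. jump_term n v x i * u (x ` {..<n}))"
      using AE_distinct[of n] by eventually_elim (simp add: L_hat_tuple algebra_simps sum_distrib_right sum_distrib_left)
    show "(\<lambda>x. L_hat a v (x ` {..<n}) * u (x ` {..<n})) \<in> tuple_borel n"
      using L_hat_measurable[OF v(1)] by measurable
  qed (use uv Fx(2) in \<open>auto intro!: borel_measurable_integrable Bochner_Integration.integrable_add integrable_mult_right Bochner_Integration.integrable_sum\<close>)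
  also have "\<dots> = (- \<alpha> * real n) * sector_inner n v u + (\<Sum>i<n. LINT w|?M. ?F i w)"
    using uv Fx by (subst Bochner_Integration.integral_add) (auto simp: Bochner_Integration.integral_sum)
  also have "\<dots> = (- \<alpha> * real n) * sector_inner n v u + (\<Sum>i<n. LINT w|?M. ?G i w)"
    using G(2) by simp
  also have "\<dots> = (LINT x|tuple_lborel n. (- \<alpha> * real n) * (v (x ` {..<n}) * u (x ` {..<n})) + (\<Sum>i<n. v (x ` {..<n}) * jump_term n u x i))"
    using uv Gx by (subst Bochner_Integration.integral_add) (auto simp: Bochner_Integration.integral_sum)
  also have "\<dots> = sector_inner n v (L_hat a u)"
  proof (rule integral_cong_AE)
    show "AE x in tuple_lborel n. (- \<alpha> * real n) * (v (x ` {..<n}) * u (x ` {..<n})) + (\<Sum>i<n. v (x ` {..<n}) * jump_term n u x i) = v (x ` {..<n}) * L_hat a u (x ` {..<n})"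
      using AE_distinct[of n] by eventually_elim (simp add: L_hat_tuple algebra_simps sum_distrib_right sum_distrib_left)
    show "(\<lambda>x. v (x ` {..<n}) * L_hat a u (x ` {..<n})) \<in> tuple_borel n"
      using L_hat_measurable[OF u(1)] by measurable
  qed (use uv Gx(2) in \<open>auto intro!: borel_measurable_integrable Bochner_Integration.integrable_add integrable_mult_right Bochner_Integration.integrable_sum\<close>)
  finally show ?thesis .
qed

text \<open>Such functions lie in \<open>G_hat\<close> for every weight, since a single
  \<open>n\<close> is involved. They localise the adjoint identity to \<open>n\<close>-point
  configurations.\<close>

definition sector_test :: "nat \<Rightarrow> ('a set \<Rightarrow> real) \<Rightarrow> bool" where
  "sector_test n v \<longleftrightarrow> v \<in> config_borel \<and> (\<forall>m. m \<noteq> n \<longrightarrow> sector_bound m v 0) \<and>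
     integrable (tuple_lborel n) (\<lambda>x. v (x ` {..<n}))"

lemma card_measurable [measurable]: "(\<lambda>\<eta> :: 'a set. real (card \<eta>)) \<in> config_borel"
  by (rule measurable_configI[of "\<lambda>n _. real n"]) (simp_all add: distinct_tuplesD)

lemma G_norm_eq:
  fixes v :: "'a set \<Rightarrow> real"
  assumes [measurable]: "v \<in> config_borel"
  shows "G_norm \<theta> v = (\<Sum>n. ennreal (1 / fact n) * (ennreal (exp (- \<theta> * real n)) * sector_L1 n v))"
proof -
  have "G_norm \<theta> v = (\<Sum>n. ennreal (1 / fact n) * (\<integral>\<^sup>+x. ennreal (\<bar>v (x ` {..<n})\<bar> * exp (- \<theta> * card (x ` {..<n}))) \<partial>(tuple_lborel n :: (nat \<Rightarrow> 'a) measure)))"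
    unfolding G_norm_def by (rule nn_integral_lebesgue_poisson) measurable
  also have "\<dots> = (\<Sum>n. ennreal (1 / fact n) * (\<integral>\<^sup>+x. ennreal (exp (- \<theta> * real n)) * ennreal \<bar>v (x ` {..<n})\<bar> \<partial>(tuple_lborel n :: (nat \<Rightarrow> 'a) measure)))"
  proof (intro suminf_cong arg_cong2[where f="(*)"] refl nn_integral_cong_AE)
    fix n show "AE x in (tuple_lborel n :: (nat \<Rightarrow> 'a) measure). ennreal (\<bar>v (x ` {..<n})\<bar> * exp (- \<theta> * card (x ` {..<n}))) =
        ennreal (exp (- \<theta> * real n)) * ennreal \<bar>v (x ` {..<n})\<bar>"
      using AE_distinct[of n] by eventually_elim (simp add: distinct_tuplesD ennreal_mult mult.commute)
  qed
  also have "\<dots> = (\<Sum>n. ennreal (1 / fact n) * (ennreal (exp (- \<theta> * real n)) * sector_L1 n v))"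
    by (intro suminf_cong arg_cong2[where f="(*)"] refl nn_integral_cmult) measurable
  finally show ?thesis .
qed

text \<open>Comparison with the series of \<open>G_norm\<close>; what matters is that
  \<open>K\<close> is the same for all \<open>n\<close>.\<close>

lemma integrable_lebesgue_poissonI:
  fixes f v :: "'a set \<Rightarrow> real"
  assumes f: "f \<in> config_borel"
    and b: "\<And>n. sector_L1 n f \<le> ennreal K * (ennreal (exp (- \<theta> * real n)) * sector_L1 n v)"
    and v: "v \<in> G_space \<theta>"
  shows "integrable lebesgue_poisson f"
proof (rule integrableI_bounded)
  have "(\<integral>\<^sup>+\<eta>. ennreal (norm (f \<eta>)) \<partial>lebesgue_poisson) = (\<Sum>n. ennreal (1 / fact n) * (\<integral>\<^sup>+x. ennreal (norm (f (x ` {..<n}))) \<partial>tuple_lborel n))"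
    using f by (intro nn_integral_lebesgue_poisson) measurable
  also have "\<dots> \<le> (\<Sum>n. ennreal (1 / fact n) * (ennreal K * (ennreal (exp (- \<theta> * real n)) * sector_L1 n v)))"
    using b by (intro suminf_le mult_left_mono) (auto intro: summableI)
  also have "\<dots> = ennreal K * G_norm \<theta> v"
    using v by (subst G_norm_eq) (auto simp: G_space_def mult.left_commute[of _ "ennreal K"])
  also have "\<dots> < \<infinity>"
    using v by (simp add: G_space_def ennreal_mult_less_top)
  finally show "(\<integral>\<^sup>+\<eta>. ennreal (norm (f \<eta>)) \<partial>lebesgue_poisson) < \<infinity>" .
qed (use f in simp)

lemma nn_integral_sector_bound_le:
  fixes f u :: "'a set \<Rightarrow> real"
  assumes f[measurable]: "f \<in> config_borel" and u: "sector_bound n u c"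
  shows "(\<integral>\<^sup>+x. ennreal \<bar>f (x ` {..<n}) * u (x ` {..<n})\<bar> \<partial>tuple_lborel n) \<le> ennreal c * sector_L1 n f"
proof -
  have c: "0 \<le> c" using u by (rule sector_bound_nonneg)
  have "(\<integral>\<^sup>+x. ennreal \<bar>f (x ` {..<n}) * u (x ` {..<n})\<bar> \<partial>tuple_lborel n) \<le> (\<integral>\<^sup>+x. ennreal c * ennreal \<bar>f (x ` {..<n})\<bar> \<partial>(tuple_lborel n :: (nat \<Rightarrow> 'a) measure))"
  proof (rule nn_integral_mono_AE)
    show "AE x in tuple_lborel n. ennreal \<bar>f (x ` {..<n}) * u (x ` {..<n})\<bar> \<le> ennreal c * ennreal \<bar>f (x ` {..<n})\<bar>"
      using u unfolding sector_bound_def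
    proof eventually_elim
      case (elim x)
      have "\<bar>f (x ` {..<n}) * u (x ` {..<n})\<bar> \<le> c * \<bar>f (x ` {..<n})\<bar>"
        using mult_left_mono[OF elim, of "\<bar>f (x ` {..<n})\<bar>"] by (simp add: abs_mult mult.commute)
      then show ?case using c by (simp add: ennreal_mult[symmetric] ennreal_leI)
    qed
  qed
  also have "\<dots> = ennreal c * sector_L1 n f"
    using f by (intro nn_integral_cmult) measurable
  finally show ?thesis .
qed

lemma pairing_sums:
  fixes v w :: "'a set \<Rightarrow> real"
  assumes v: "v \<in> G_space \<theta>" and w: "w \<in> K_space \<theta>"
  shows "(\<lambda>n. 1 / fact n * sector_inner n v w) sums pairing v w"
proof -
  obtain C where C: "0 \<le> C" "K_norm \<theta> w \<le> ereal C" and [measurable]: "w \<in> config_borel"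
    using K_spaceD[OF w] by auto
  have vm[measurable]: "v \<in> config_borel" using v by (simp add: G_space_def)
  show ?thesis
    unfolding pairing_def
  proof (rule integral_lebesgue_poisson_sums, rule integrable_lebesgue_poissonI[OF _ _ v])
    fix n
    have "sector_bound n w (C * exp (- \<theta> * real n))" using C K_norm_le_iff[of w \<theta> C] by simp
    from nn_integral_sector_bound_le[OF vm this]
    show "(\<integral>\<^sup>+x. ennreal \<bar>v (x ` {..<n}) * w (x ` {..<n})\<bar> \<partial>tuple_lborel n) \<le> ennreal C * (ennreal (exp (- \<theta> * real n)) * sector_L1 n v)"
      using C by (simp add: ennreal_mult mult.assoc)
  qed measurable
qed

text \<open>The factor \<open>n\<close> in the bound for \<open>L_hat\<close> is paid by the second
  condition in \<open>G_hat\<close>: the dominating function is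
  \<open>\<alpha> * card \<eta> * v \<eta>\<close> rather than \<open>v\<close>.\<close>

lemma pairing_L_hat_sums:
  assumes v: "v \<in> G_hat a \<theta>" and u: "u \<in> K_space \<theta>"
  shows "(\<lambda>n. 1 / fact n * sector_inner n (L_hat a v) u) sums pairing (L_hat a v) u"
proof -
  obtain C where C: "0 \<le> C" "K_norm \<theta> u \<le> ereal C" and [measurable]: "u \<in> config_borel"
    using K_spaceD[OF u] by auto
  have vm: "v \<in> config_borel" and v': "(\<lambda>\<eta>. \<alpha> * card \<eta> * v \<eta>) \<in> G_space \<theta>"
    using v by (auto simp: G_hat_def G_space_def)
  note [measurable] = vm and Lm[measurable] = L_hat_measurable[OF vm]
  show ?thesis
    unfolding pairing_def
  proof (rule integral_lebesgue_poisson_sums, rule integrable_lebesgue_poissonI[OF _ _ v'])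
    fix n
    let ?e = "exp (- \<theta> * real n)"
    have "sector_bound n u (C * ?e)" using C K_norm_le_iff[of u \<theta> C] by simp
    from nn_integral_sector_bound_le[OF Lm this]
    have "(\<integral>\<^sup>+x. ennreal \<bar>L_hat a v (x ` {..<n}) * u (x ` {..<n})\<bar> \<partial>tuple_lborel n) \<le> ennreal (C * ?e) * (ennreal (2 * \<alpha> * real n) * sector_L1 n v)"
      by (rule order_trans) (intro mult_left_mono nn_integral_L_hat_le vm, simp)
    also have "\<dots> = ennreal (2 * C) * (ennreal ?e * (\<integral>\<^sup>+x. ennreal (\<alpha> * real n) * ennreal \<bar>v (x ` {..<n})\<bar> \<partial>tuple_lborel n))"
      using C rate_nonneg by (subst nn_integral_cmult) (measurable, simp add: ennreal_mult mult_ac)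
    also have "(\<integral>\<^sup>+x. ennreal (\<alpha> * real n) * ennreal \<bar>v (x ` {..<n})\<bar> \<partial>tuple_lborel n) = (\<integral>\<^sup>+x. ennreal \<bar>\<alpha> * card (x ` {..<n}) * v (x ` {..<n})\<bar> \<partial>tuple_lborel n)"
    proof (rule nn_integral_cong_AE)
      show "AE x in tuple_lborel n. ennreal (\<alpha> * real n) * ennreal \<bar>v (x ` {..<n})\<bar> = ennreal \<bar>\<alpha> * card (x ` {..<n}) * v (x ` {..<n})\<bar>"
        using AE_distinct[of n] by eventually_elim (simp add: distinct_tuplesD ennreal_mult abs_mult rate_nonneg)
    qed
    finally show "(\<integral>\<^sup>+x. ennreal \<bar>L_hat a v (x ` {..<n}) * u (x ` {..<n})\<bar> \<partial>tuple_lborel n) \<le>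
      ennreal (2 * C) * (ennreal ?e * (\<integral>\<^sup>+x. ennreal \<bar>\<alpha> * card (x ` {..<n}) * v (x ` {..<n})\<bar> \<partial>tuple_lborel n))" .
  qed measurable
qed

lemma G_space_integrable_tuple:
  fixes v :: "'a set \<Rightarrow> real"
  assumes v: "v \<in> G_space \<theta>"
  shows "integrable (tuple_lborel n) (\<lambda>x. v (x ` {..<n}))"
proof (rule integrableI_bounded)
  have vm[measurable]: "v \<in> config_borel" using v by (simp add: G_space_def)
  have "ennreal (1 / fact n) * (ennreal (exp (- \<theta> * real n)) * sector_L1 n v) < top"
  proof -
    have "(\<Sum>n. ennreal (1 / fact n) * (ennreal (exp (- \<theta> * real n)) * sector_L1 n v)) < top"
      using v unfolding G_norm_eq[OF vm, symmetric] by (simp add: G_space_def)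
    from ennreal_suminf_lessD[OF this, of n] show ?thesis .
  qed
  then show "(\<integral>\<^sup>+x. ennreal (norm (v (x ` {..<n}))) \<partial>tuple_lborel n) < \<infinity>"
    by (auto simp: ennreal_mult_less_top)
  show "(\<lambda>x. v (x ` {..<n})) \<in> tuple_borel n" by measurable
qed

lemma sector_test_G_space:
  assumes "sector_test n v"
  shows "v \<in> G_space \<theta>"
proof -
  have vm[measurable]: "v \<in> config_borel" and z: "\<And>m. m \<noteq> n \<Longrightarrow> sector_bound m v 0"
    and i: "integrable (tuple_lborel n) (\<lambda>x. v (x ` {..<n}))"
    using assms by (auto simp: sector_test_def)
  have "(\<integral>\<^sup>+x. ennreal \<bar>v (x ` {..<m})\<bar> \<partial>tuple_lborel m) = 0" if "m \<noteq> n" for m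
  proof -
    have "AE x in tuple_lborel m. ennreal \<bar>v (x ` {..<m})\<bar> = 0"
      using z[OF that] unfolding sector_bound_def by eventually_elim simp
    then show ?thesis by (subst nn_integral_0_iff_AE) measurable
  qed
  then have "G_norm \<theta> v = (\<Sum>m. if m = n then ennreal (1 / fact n) * (ennreal (exp (- \<theta> * real n)) * sector_L1 n v) else 0)"
    unfolding G_norm_eq[OF vm] by (intro suminf_cong) auto
  also have "\<dots> = ennreal (1 / fact n) * (ennreal (exp (- \<theta> * real n)) * sector_L1 n v)"
    by (subst suminf_finite[of "{n}"]) auto
  also have "\<dots> < \<infinity>"
    using i by (simp add: integrable_iff_bounded ennreal_mult_less_top)
  finally show ?thesis using vm by (simp add: G_space_def)
qed

lemma sector_test_mult_card:
  assumes "sector_test n v"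
  shows "sector_test n (\<lambda>\<eta>. \<alpha> * card \<eta> * v \<eta>)"
proof -
  have vm[measurable]: "v \<in> config_borel" and z: "\<And>m. m \<noteq> n \<Longrightarrow> sector_bound m v 0"
    and i: "integrable (tuple_lborel n) (\<lambda>x. v (x ` {..<n}))"
    using assms by (auto simp: sector_test_def)
  have "sector_bound m (\<lambda>\<eta>. \<alpha> * card \<eta> * v \<eta>) 0" if "m \<noteq> n" for m
    using z[OF that] unfolding sector_bound_def by eventually_elim simp
  moreover have "integrable (tuple_lborel n) (\<lambda>x. \<alpha> * card (x ` {..<n}) * v (x ` {..<n}))"
  proof (subst integrable_cong_AE)
    show "AE x in tuple_lborel n. \<alpha> * card (x ` {..<n}) * v (x ` {..<n}) = \<alpha> * real n * v (x ` {..<n})"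
      using AE_distinct[of n] by eventually_elim (simp add: distinct_tuplesD)
    show "integrable (tuple_lborel n) (\<lambda>x. \<alpha> * real n * v (x ` {..<n}))" using i by simp
    show "(\<lambda>x. \<alpha> * card (x ` {..<n}) * v (x ` {..<n})) \<in> tuple_borel n"
      by (rule measurable_compose[OF measurable_image_config, of "\<lambda>\<eta>. \<alpha> * card \<eta> * v \<eta>"]) measurable
  qed measurable
  ultimately show ?thesis unfolding sector_test_def by simp
qed

lemma sector_test_G_hat: "sector_test n v \<Longrightarrow> v \<in> G_hat a \<theta>"
  using sector_test_G_space sector_test_mult_card unfolding G_hat_def by blast

lemma sector_test_L_hat:
  assumes "sector_test n v"
  shows "sector_test n (L_hat a v)"
proof -
  have vm: "v \<in> config_borel" and z: "\<And>m. m \<noteq> n \<Longrightarrow> sector_bound m v 0"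
    and i: "integrable (tuple_lborel n) (\<lambda>x. v (x ` {..<n}))"
    using assms by (auto simp: sector_test_def)
  note [measurable] = L_hat_measurable[OF vm]
  have "sector_L1 n (L_hat a v) < \<infinity>"
    using i by (intro le_less_trans[OF nn_integral_L_hat_le[OF vm]]) (simp add: integrable_iff_bounded ennreal_mult_less_top)
  then have "integrable (tuple_lborel n) (\<lambda>x. L_hat a v (x ` {..<n}))"
    by (intro integrableI_bounded) simp_all
  then show ?thesis
    using sector_bound_L_hat[OF vm z] L_hat_measurable[OF vm] unfolding sector_test_def by auto
qed

lemma integrable_sector_mult:
  assumes "sector_test n v" "w \<in> config_borel" "sector_bound n w c"
  shows "integrable (tuple_lborel n) (\<lambda>x. v (x ` {..<n}) * w (x ` {..<n}))"
proof -
  have [measurable]: "v \<in> config_borel" and i: "integrable (tuple_lborel n) (\<lambda>x. v (x ` {..<n}))"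
    using assms by (auto simp: sector_test_def)
  note [measurable] = assms(2)
  show ?thesis
  proof (rule Bochner_Integration.integrable_bound[OF integrable_mult_left[OF i, of c]])
    show "AE x in tuple_lborel n. norm (v (x ` {..<n}) * w (x ` {..<n})) \<le> norm (v (x ` {..<n}) * c)"
      using assms(3) unfolding sector_bound_def
      by eventually_elim (auto simp: abs_mult intro!: mult_left_mono)
  qed measurable
qed

lemma pairing_sector:
  assumes v: "sector_test n v" and w: "w \<in> K_space \<theta>"
  shows "pairing v w = 1 / fact n * sector_inner n v w"
proof -
  note [measurable] = K_spaceD(1)[OF w]
  have [measurable]: "v \<in> config_borel" using v by (simp add: sector_test_def)
  have "(LINT x|tuple_lborel m. v (x ` {..<m}) * w (x ` {..<m})) = 0" if "m \<noteq> n" for m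
  proof (rule integral_eq_zero_AE)
    have "sector_bound m v 0" using v that by (simp add: sector_test_def)
    then show "AE x in tuple_lborel m. v (x ` {..<m}) * w (x ` {..<m}) = 0"
      unfolding sector_bound_def by eventually_elim simp
  qed
  then have "(\<lambda>m. 1 / fact m * (LINT x|tuple_lborel m. v (x ` {..<m}) * w (x ` {..<m}))) =
     (\<lambda>m. if m = n then 1 / fact m * (LINT x|tuple_lborel m. v (x ` {..<m}) * w (x ` {..<m})) else 0)"
    by (auto simp: fun_eq_iff)
  then have "(\<lambda>m. 1 / fact m * (LINT x|tuple_lborel m. v (x ` {..<m}) * w (x ` {..<m}))) sums (1 / fact n * sector_inner n v w)"
    using sums_single[of n "\<lambda>m. 1 / fact m * (LINT x|tuple_lborel m. v (x ` {..<m}) * w (x ` {..<m}))"]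
    by (simp only:)
  then show ?thesis
    using pairing_sums[OF sector_test_G_space[OF v] w] sums_unique2 by blast
qed

text \<open>Testing with the sign of \<open>w\<close>, cut off to configurations of \<open>n\<close>
  points in a ball, turns the pairing into the integral of the absolute value of \<open>w\<close>
  over that part; balls of integer radius exhaust the space.\<close>

lemma sector_tests_separate:
  assumes w: "locally_bounded w"
    and z: "\<And>v. sector_test n v \<Longrightarrow> sector_inner n v w = 0"
  shows "sector_bound n w 0"
proof -
  note wm[measurable] = locally_bounded_measurable[OF w]
  obtain c where c: "sector_bound n w c" using w locally_bounded_sector by blast
  have *: "AE x in tuple_lborel n. (\<forall>i<n. x i \<in> ball 0 (real R)) \<longrightarrow> w (x ` {..<n}) = 0" for R :: nat
  proof -
    let ?B = "\<lambda>m. {x \<in> space (tuple_lborel m :: (nat \<Rightarrow> 'a) measure). \<forall>i\<in>{..<m}. x i \<in> ball 0 (real R)}"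
    have B_eq: "?B m = PiE {..<m} (\<lambda>_. ball 0 (real R))" for m
      unfolding space_PiM PiE_def Pi_def by auto
    have B[measurable]: "?B m \<in> sets (tuple_lborel m)" for m
      unfolding B_eq by (intro sets_PiM_I_finite) auto
    let ?v = "\<lambda>\<eta> :: 'a set. if card \<eta> = n \<and> \<eta> \<subseteq> ball 0 (real R) then sgn (w \<eta>) else 0"
    let ?g = "\<lambda>m x. (if m = n then 1 else 0) * (indicator (?B m) x * sgn (w (x ` {..<m})))"
    have vg: "?v (x ` {..<m}) = ?g m x" if "x \<in> distinct_tuples m" for m and x :: "nat \<Rightarrow> 'a"
      using distinct_tuplesD[OF that] by (auto simp: indicator_def)
    have g: "?g m \<in> borel_measurable (tuple_lborel m)" for m by measurable
    have vm: "?v \<in> config_borel"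
      by (rule measurable_configI[OF g vg])
    have fin: "emeasure (tuple_lborel n :: (nat \<Rightarrow> 'a) measure) (?B n) < \<infinity>"
      unfolding B_eq by (subst lborel_product.emeasure_PiM) (use emeasure_lborel_ball_finite[of "0 :: 'a" "real R"] in \<open>auto simp: less_top power_less_top_ennreal\<close>)
    have AEv: "AE x in tuple_lborel m. ?v (x ` {..<m}) = ?g m x" for m
      using AE_distinct[of m] by eventually_elim (rule vg)
    have v: "sector_test n ?v"
      unfolding sector_test_def
    proof (intro conjI allI impI vm)
      fix m assume "m \<noteq> n" then show "sector_bound m ?v 0"
        using AEv[of m] unfolding sector_bound_def by (auto elim!: eventually_mono)
    next
      have "integrable (tuple_lborel n) (\<lambda>x. indicator (?B n) x :: real)"
        using fin by (intro integrable_real_indicator) auto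
      then have "integrable (tuple_lborel n) (?g n)"
        by (rule Bochner_Integration.integrable_bound[OF _ g]) (auto simp: indicator_def sgn_if)
      then show "integrable (tuple_lborel n) (\<lambda>x. ?v (x ` {..<n}))"
        using integrable_cong_AE[OF measurable_compose[OF measurable_image_config vm] g AEv] by (simp only:)
    qed
    have "sector_inner n ?v w = (LINT x|tuple_lborel n. indicator (?B n) x * \<bar>w (x ` {..<n})\<bar>)"
    proof (rule integral_cong_AE)
      show "AE x in tuple_lborel n. ?v (x ` {..<n}) * w (x ` {..<n}) = indicator (?B n) x * \<bar>w (x ` {..<n})\<bar>"
        using AEv[of n] by eventually_elim (simp add: abs_sgn mult.commute)
    qed (use measurable_compose[OF measurable_image_config vm, of n] in measurable)
    moreover have "integrable (tuple_lborel n) (\<lambda>x. indicator (?B n) x * \<bar>w (x ` {..<n})\<bar>)"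
      by (rule Bochner_Integration.integrable_bound[OF integrable_sector_mult[OF v wm c]])
        (measurable, rule eventually_mono[OF AEv[of n]], simp add: abs_mult sgn_if)
    ultimately have "AE x in tuple_lborel n. indicator (?B n) x * \<bar>w (x ` {..<n})\<bar> = 0"
      using z[OF v] integral_nonneg_eq_0_iff_AE[of "tuple_lborel n" "\<lambda>x. indicator (?B n) x * \<bar>w (x ` {..<n})\<bar>"]
      by (simp only: AE_I2 mult_nonneg_nonneg indicator_pos_le abs_ge_zero simp_thms)
    with AE_space show ?thesis
      by eventually_elim (auto simp: indicator_def split: if_splits)
  qed
  have "AE x in tuple_lborel n. \<forall>R :: nat. (\<forall>i<n. x i \<in> ball 0 (real R)) \<longrightarrow> w (x ` {..<n}) = 0"
    unfolding AE_all_countable using * by blast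
  then show ?thesis
    unfolding sector_bound_def
  proof eventually_elim
    case (elim x)
    obtain R :: nat where R: "(\<Sum>i<n. norm (x i)) < real R" using reals_Archimedean2 by blast
    have "x i \<in> ball 0 (real R)" if "i < n" for i
      using member_le_sum[of i "{..<n}" "\<lambda>i. norm (x i)"] that R by simp
    then show ?case using elim by auto
  qed
qed

text \<open>Test functions on one sector give the equation for each \<open>n\<close>; conversely the
  sector identities are summed with \<open>pairing_sums\<close> and
  \<open>pairing_L_hat_sums\<close>. The adjoint is thus \<open>L_hat\<close> itself on its maximal
  domain in \<open>K_space\<close>, and membership becomes an equation for each \<open>n\<close>
  plus two norm bounds.\<close>

theorem adjoint_graph_iff:
  "(u, w) \<in> adjoint_graph a \<theta> \<longleftrightarrow> u \<in> K_space \<theta> \<and> w \<in> K_space \<theta> \<and> (\<forall>n. sector_bound n (w \<ominus> L_hat a u) 0)"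
proof (cases "u \<in> K_space \<theta> \<and> w \<in> K_space \<theta>")
  case True
  then have u: "u \<in> K_space \<theta>" and w: "w \<in> K_space \<theta>" by auto
  note um[measurable] = K_spaceD(1)[OF u] and wm[measurable] = K_spaceD(1)[OF w]
  note Lm[measurable] = L_hat_measurable[OF um]
  obtain c where c: "\<And>n. sector_bound n u (c n)"
    using locally_boundedE[OF K_space_locally_bounded[OF u]] by metis
  show ?thesis
  proof
    assume "(u, w) \<in> adjoint_graph a \<theta>"
    then have adj: "pairing (L_hat a v) u = pairing v w" if "v \<in> G_hat a \<theta>" for v
      using that by (simp add: adjoint_graph_def)
    have "sector_bound n (w \<ominus> L_hat a u) 0" for n
    proof (rule sector_tests_separate)
      show "locally_bounded (w \<ominus> L_hat a u)"
        using K_space_locally_bounded u w by (intro locally_bounded_diff locally_bounded_L_hat) auto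
      fix v assume v: "sector_test n v"
      then have vm: "v \<in> config_borel" "integrable (tuple_lborel n) (\<lambda>x. v (x ` {..<n}))"
        by (auto simp: sector_test_def)
      have "1 / fact n * sector_inner n v (L_hat a u) = 1 / fact n * sector_inner n v w"
        using adj[OF sector_test_G_hat[OF v]] tuple_pairing[OF vm um c]
        unfolding pairing_sector[OF v w] pairing_sector[OF sector_test_L_hat[OF v] u] by simp
      moreover obtain cw where "sector_bound n w cw" using locally_bounded_sector[OF K_space_locally_bounded[OF w]] by blast
      ultimately show "(LINT x|tuple_lborel n. v (x ` {..<n}) * (w (x ` {..<n}) - L_hat a u (x ` {..<n}))) = 0"
        using integrable_sector_mult[OF v wm] integrable_sector_mult[OF v Lm sector_bound_L_hat[OF um c]]
        by (simp add: right_diff_distrib Bochner_Integration.integral_diff)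
    qed
    then show "u \<in> K_space \<theta> \<and> w \<in> K_space \<theta> \<and> (\<forall>n. sector_bound n (w \<ominus> L_hat a u) 0)"
      using u w by blast
  next
    assume "u \<in> K_space \<theta> \<and> w \<in> K_space \<theta> \<and> (\<forall>n. sector_bound n (w \<ominus> L_hat a u) 0)"
    then have eq: "\<And>n. sector_bound n (w \<ominus> L_hat a u) 0" by blast
    have "pairing (L_hat a v) u = pairing v w" if v: "v \<in> G_hat a \<theta>" for v
    proof -
      have vG: "v \<in> G_space \<theta>" using v by (simp add: G_hat_def)
      then have vm[measurable]: "v \<in> config_borel" by (simp add: G_space_def)
      have "sector_inner n (L_hat a v) u = sector_inner n v w" for n
        unfolding tuple_pairing[OF vm G_space_integrable_tuple[OF vG] um c]
      proof (rule integral_cong_AE)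
        show "AE x in tuple_lborel n. v (x ` {..<n}) * L_hat a u (x ` {..<n}) = v (x ` {..<n}) * w (x ` {..<n})"
          using eq[of n] unfolding sector_bound_def by eventually_elim simp
      qed measurable
      then show ?thesis
        using pairing_sums[OF vG w] pairing_L_hat_sums[OF v u] sums_unique2 by simp
    qed
    then show "(u, w) \<in> adjoint_graph a \<theta>"
      using u w by (simp add: adjoint_graph_def)
  qed
qed (auto simp: adjoint_graph_def)

end

section \<open>The law of a single jump process\<close>

lemma suminf_swap_ennreal:
  fixes f :: "nat \<Rightarrow> nat \<Rightarrow> ennreal"
  shows "(\<Sum>i. \<Sum>n. f i n) = (\<Sum>n. \<Sum>i. f i n)"
proof -
  have "(\<Sum>i. \<Sum>n. f i n) = (\<integral>\<^sup>+i. \<integral>\<^sup>+n. f i n \<partial>count_space UNIV \<partial>count_space UNIV)"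
    by (simp add: nn_integral_count_space_nat)
  also have "\<dots> = (\<integral>\<^sup>+n. \<integral>\<^sup>+i. f i n \<partial>count_space UNIV \<partial>count_space UNIV)"
    using nn_integral_fst_count_space[of "\<lambda>(i, n). f i n"] nn_integral_snd_count_space[of "\<lambda>(i, n). f i n"] by simp
  finally show ?thesis by (simp add: nn_integral_count_space_nat)
qed

lemma suminf_diagonal_ennreal:
  fixes f :: "nat \<Rightarrow> nat \<Rightarrow> ennreal"
  shows "(\<Sum>m. \<Sum>k. f m k) = (\<Sum>n. \<Sum>m\<le>n. f m (n - m))"
proof -
  have "(\<Sum>k. f m k) = (\<Sum>n. if m \<le> n then f m (n - m) else 0)" for m
    using suminf_offset[of "\<lambda>n. if m \<le> n then f m (n - m) else 0" m] by (simp add: summableI)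
  then have "(\<Sum>m. \<Sum>k. f m k) = (\<Sum>n. \<Sum>m. if m \<le> n then f m (n - m) else 0)"
    by (simp add: suminf_swap_ennreal[of "\<lambda>m n. if m \<le> n then f m (n - m) else 0"])
  also have "\<dots> = (\<Sum>n. \<Sum>m\<le>n. f m (n - m))"
    by (intro suminf_cong, subst suminf_finite[of "{.._}"]) (auto intro!: sum.cong)
  finally show ?thesis .
qed

context jump_kernel
begin

text \<open>Convolution powers of the measure with density \<open>a\<close>, left with their total
  mass \<open>\<alpha> ^ m\<close>; without normalisation the case \<open>\<alpha> = 0\<close> is
  included.\<close>

fun jump_power :: "nat \<Rightarrow> 'a measure" where
  "jump_power 0 = return borel 0"
| "jump_power (Suc m) = distr (density lborel (\<lambda>x. ennreal (a x)) \<Otimes>\<^sub>M jump_power m) borel (\<lambda>(x, y). x + y)"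

lemma sets_jump_power [simp, measurable_cong]: "sets (jump_power m) = sets borel"
  by (cases m) auto

lemma space_jump_power [simp]: "space (jump_power m) = UNIV"
  by (cases m) auto

lemma emeasure_jump_density: "emeasure (density lborel (\<lambda>x. ennreal (a x))) UNIV = ennreal \<alpha>"
  using nn_integral_a[of 0] a_sym by (simp add: emeasure_density)

lemma emeasure_jump_power_UNIV: "emeasure (jump_power m) UNIV = ennreal (\<alpha> ^ m)"
  and finite_jump_power: "finite_measure (jump_power m)"
proof (induction m)
  case 0
  { case 1 show ?case by simp }
  { case 2 show ?case by (intro finite_measureI) simp }
next
  case (Suc m)
  interpret finite_measure "jump_power m" by fact
  have eq: "emeasure (jump_power (Suc m)) UNIV = ennreal (\<alpha> ^ Suc m)"
  proof -
    have "emeasure (jump_power (Suc m)) UNIV = emeasure (density lborel (\<lambda>x. ennreal (a x)) \<Otimes>\<^sub>M jump_power m) (UNIV \<times> UNIV)"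
      by (simp add: emeasure_distr space_pair_measure)
    also have "\<dots> = ennreal \<alpha> * ennreal (\<alpha> ^ m)"
      by (subst emeasure_pair_measure_Times) (auto simp: emeasure_jump_density Suc)
    finally show ?thesis by (simp add: ennreal_mult rate_nonneg)
  qed
  { case 1 show ?case by (rule eq) }
  { case 2 show ?case by (intro finite_measureI) (simp add: eq del: jump_power.simps) }
qed

lemma nn_integral_jump_power_Suc:
  assumes [measurable]: "f \<in> borel_measurable borel"
  shows "(\<integral>\<^sup>+x. f x \<partial>jump_power (Suc m)) = (\<integral>\<^sup>+x. ennreal (a x) * (\<integral>\<^sup>+y. f (x + y) \<partial>jump_power m) \<partial>lborel)"
proof -
  interpret finite_measure "jump_power m" by (rule finite_jump_power)
  have "(\<integral>\<^sup>+x. f x \<partial>jump_power (Suc m)) = (\<integral>\<^sup>+w. f (fst w + snd w) \<partial>(density lborel (\<lambda>x. ennreal (a x)) \<Otimes>\<^sub>M jump_power m))"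
    by (simp add: nn_integral_distr case_prod_beta)
  also have "\<dots> = (\<integral>\<^sup>+x. \<integral>\<^sup>+y. f (x + y) \<partial>jump_power m \<partial>density lborel (\<lambda>x. ennreal (a x)))"
    by (subst nn_integral_fst[symmetric]) simp_all
  also have "\<dots> = (\<integral>\<^sup>+x. ennreal (a x) * (\<integral>\<^sup>+y. f (x + y) \<partial>jump_power m) \<partial>lborel)"
    by (subst nn_integral_density) simp_all
  finally show ?thesis .
qed

text \<open>Associativity of convolution, by induction on the first exponent.\<close>

lemma nn_integral_jump_power_add:
  assumes "f \<in> borel_measurable borel"
  shows "(\<integral>\<^sup>+x. \<integral>\<^sup>+y. f (x + y) \<partial>jump_power k \<partial>jump_power m) = (\<integral>\<^sup>+x. f x \<partial>jump_power (m + k))"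
  using assms
proof (induction m arbitrary: f)
  case 0
  interpret finite_measure "jump_power k" by (rule finite_jump_power)
  note [measurable] = 0
  show ?case by (simp add: nn_integral_return)
next
  case (Suc m)
  note [measurable] = Suc.prems
  interpret finite_measure "jump_power k" by (rule finite_jump_power)
  have "(\<integral>\<^sup>+x. \<integral>\<^sup>+y. f (x + y) \<partial>jump_power k \<partial>jump_power (Suc m)) =
    (\<integral>\<^sup>+z. ennreal (a z) * (\<integral>\<^sup>+x. \<integral>\<^sup>+y. f (z + x + y) \<partial>jump_power k \<partial>jump_power m) \<partial>lborel)"
    by (subst nn_integral_jump_power_Suc) simp_all
  also have "\<dots> = (\<integral>\<^sup>+z. ennreal (a z) * (\<integral>\<^sup>+x. f (z + x) \<partial>jump_power (m + k)) \<partial>lborel)"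
    using Suc.IH[of "\<lambda>x. f (_ + x)"] by (simp add: add.assoc)
  also have "\<dots> = (\<integral>\<^sup>+x. f x \<partial>jump_power (Suc m + k))"
    by (subst add_Suc, subst nn_integral_jump_power_Suc) simp_all
  finally show ?case .
qed

text \<open>Multiplied by \<open>\<alpha> ^ m\<close> this is the Poisson probability of
  \<open>m\<close> jumps; that factor is the mass of \<open>jump_power m\<close>. The absolute value
  of \<open>t\<close> makes \<open>jump_law\<close> a probability measure for every real
  \<open>t\<close>, while the semigroup law is claimed for nonnegative times.\<close>

definition jump_weight :: "real \<Rightarrow> nat \<Rightarrow> real" where
  "jump_weight t m = exp (- \<alpha> * \<bar>t\<bar>) * (\<bar>t\<bar> ^ m / fact m)"

definition jump_law :: "real \<Rightarrow> 'a measure" where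
  "jump_law t = measure_of (space borel) (sets borel)
     (\<lambda>A. \<Sum>m. ennreal (jump_weight t m) * emeasure (jump_power m) A)"

lemma jump_weight_nonneg: "0 \<le> jump_weight t m"
  by (simp add: jump_weight_def)

lemma sets_jump_law [simp, measurable_cong]: "sets (jump_law t) = sets borel"
  unfolding jump_law_def by (metis sets.sets_measure_of_eq)

lemma space_jump_law [simp]: "space (jump_law t) = UNIV"
  unfolding jump_law_def by (metis sets.space_measure_of_eq space_borel)

lemma emeasure_jump_law: "A \<in> sets borel \<Longrightarrow> emeasure (jump_law t) A = (\<Sum>m. ennreal (jump_weight t m) * emeasure (jump_power m) A)"
  unfolding jump_law_def by (rule mixture_measure_space(1)) auto

lemma nn_integral_jump_law: "f \<in> borel_measurable borel \<Longrightarrow> (\<integral>\<^sup>+x. f x \<partial>jump_law t) = (\<Sum>m. ennreal (jump_weight t m) * (\<integral>\<^sup>+x. f x \<partial>jump_power m))"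
  unfolding jump_law_def by (rule mixture_measure_space(2)) auto

lemma jump_weight_sums: "(\<lambda>m. jump_weight t m * \<alpha> ^ m) sums 1"
proof -
  have "(\<lambda>m. exp (- \<alpha> * \<bar>t\<bar>) * ((\<alpha> * \<bar>t\<bar>) ^ m /\<^sub>R fact m)) sums (exp (- \<alpha> * \<bar>t\<bar>) * exp (\<alpha> * \<bar>t\<bar>))"
    by (intro sums_mult exp_converges)
  moreover have "exp (- \<alpha> * \<bar>t\<bar>) * ((\<alpha> * \<bar>t\<bar>) ^ m /\<^sub>R fact m) = jump_weight t m * \<alpha> ^ m" for m
    by (simp add: jump_weight_def power_mult_distrib field_simps)
  ultimately show ?thesis by (simp add: exp_minus)
qed

lemma prob_space_jump_law: "prob_space (jump_law t)"
proof
  have "(\<Sum>m. ennreal (jump_weight t m) * emeasure (jump_power m) UNIV) = (\<Sum>m. ennreal (jump_weight t m * \<alpha> ^ m))"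
    by (simp add: emeasure_jump_power_UNIV ennreal_mult jump_weight_nonneg rate_nonneg)
  also have "\<dots> = ennreal 1"
    by (rule suminf_ennreal_eq[OF _ jump_weight_sums]) (simp add: jump_weight_nonneg rate_nonneg)
  finally show "emeasure (jump_law t) (space (jump_law t)) = 1"
    by (simp add: emeasure_jump_law)
qed

sublocale jl: prob_space "jump_law t" for t
  by (rule prob_space_jump_law)

sublocale jlp: product_prob_space "\<lambda>_ :: nat. jump_law t" for t
  by standard

text \<open>The binomial formula, in the form of the Cauchy product of two exponential
  series.\<close>

lemma jump_weight_add:
  assumes "0 \<le> s" "0 \<le> t"
  shows "jump_weight (s + t) n = (\<Sum>m\<le>n. jump_weight s m * jump_weight t (n - m))"
proof -
  have "jump_weight (s + t) n = exp (- \<alpha> * s) * exp (- \<alpha> * t) * ((s + t) ^ n /\<^sub>R fact n)"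
    using assms by (simp add: jump_weight_def divide_inverse algebra_simps exp_add[symmetric])
  also have "\<dots> = exp (- \<alpha> * s) * exp (- \<alpha> * t) * (\<Sum>m\<le>n. (s ^ m /\<^sub>R fact m) * (t ^ (n - m) /\<^sub>R fact (n - m)))"
    by (subst exp_series_add_commuting) simp_all
  also have "\<dots> = (\<Sum>m\<le>n. jump_weight s m * jump_weight t (n - m))"
    using assms unfolding sum_distrib_left jump_weight_def by (intro sum.cong) (simp_all add: divide_inverse)
  finally show ?thesis .
qed

text \<open>Terms with equal total number of jumps are collected along the diagonals
  \<open>m + k = n\<close>; their convolution powers coincide, and their weights add up by
  \<open>jump_weight_add\<close>.\<close>

lemma jump_law_add:
  assumes st: "0 \<le> s" "0 \<le> t" and f[measurable]: "f \<in> borel_measurable borel"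
  shows "(\<integral>\<^sup>+x. \<integral>\<^sup>+y. f (x + y) \<partial>jump_law t \<partial>jump_law s) = (\<integral>\<^sup>+x. f x \<partial>jump_law (s + t))"
proof -
  have m: "(\<lambda>x. \<integral>\<^sup>+y. f (x + y) \<partial>jump_power k) \<in> borel_measurable borel" for k
  proof -
    interpret finite_measure "jump_power k" by (rule finite_jump_power)
    show ?thesis by measurable
  qed
  have "(\<integral>\<^sup>+x. \<integral>\<^sup>+y. f (x + y) \<partial>jump_law t \<partial>jump_law s) =
      (\<Sum>m. ennreal (jump_weight s m) * (\<integral>\<^sup>+x. \<integral>\<^sup>+y. f (x + y) \<partial>jump_law t \<partial>jump_power m))"
    by (rule nn_integral_jump_law) measurable
  also have "\<dots> = (\<Sum>m. ennreal (jump_weight s m) * (\<Sum>k. ennreal (jump_weight t k) * (\<integral>\<^sup>+x. f x \<partial>jump_power (m + k))))"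
  proof (intro suminf_cong arg_cong2[where f="(*)"] refl)
    fix m
    have "(\<integral>\<^sup>+x. \<integral>\<^sup>+y. f (x + y) \<partial>jump_law t \<partial>jump_power m) = (\<integral>\<^sup>+x. (\<Sum>k. ennreal (jump_weight t k) * (\<integral>\<^sup>+y. f (x + y) \<partial>jump_power k)) \<partial>jump_power m)"
      by (intro nn_integral_cong nn_integral_jump_law) simp
    also have "\<dots> = (\<Sum>k. ennreal (jump_weight t k) * (\<integral>\<^sup>+x. \<integral>\<^sup>+y. f (x + y) \<partial>jump_power k \<partial>jump_power m))"
      using m by (subst nn_integral_suminf) (auto simp: nn_integral_cmult)
    finally show "(\<integral>\<^sup>+x. \<integral>\<^sup>+y. f (x + y) \<partial>jump_law t \<partial>jump_power m) = (\<Sum>k. ennreal (jump_weight t k) * (\<integral>\<^sup>+x. f x \<partial>jump_power (m + k)))"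
      by (simp add: nn_integral_jump_power_add[OF f])
  qed
  also have "\<dots> = (\<Sum>m. \<Sum>k. ennreal (jump_weight s m * jump_weight t k) * (\<integral>\<^sup>+x. f x \<partial>jump_power (m + k)))"
    by (simp add: jump_weight_nonneg ennreal_mult mult.assoc)
  also have "\<dots> = (\<Sum>n. \<Sum>m\<le>n. ennreal (jump_weight s m * jump_weight t (n - m)) * (\<integral>\<^sup>+x. f x \<partial>jump_power n))"
    by (subst suminf_diagonal_ennreal) simp
  also have "\<dots> = (\<Sum>n. ennreal (jump_weight (s + t) n) * (\<integral>\<^sup>+x. f x \<partial>jump_power n))"
    by (simp add: jump_weight_add[OF st] sum_distrib_right[symmetric] sum_ennreal jump_weight_nonneg)
  also have "\<dots> = (\<integral>\<^sup>+x. f x \<partial>jump_law (s + t))"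
    by (rule nn_integral_jump_law[symmetric, OF f])
  finally show ?thesis .
qed

lemma jump_law_integrable:
  fixes f :: "'a \<Rightarrow> real"
  assumes "f \<in> borel_measurable borel" "\<And>x. \<bar>f x\<bar> \<le> c"
  shows "integrable (jump_law t) f"
  using assms by (intro jl.integrable_const_bound[of _ c]) auto

lemma integrable_a_mult:
  fixes f :: "'a \<Rightarrow> real"
  assumes [measurable]: "f \<in> borel_measurable borel" and "\<And>x. \<bar>f x\<bar> \<le> c"
  shows "integrable lborel (\<lambda>x. a x * f x)" "\<bar>LINT x|lborel. a x * f x\<bar> \<le> \<alpha> * c"
  using integral_a_bounded[of f c 0] assms a_sym by auto

text \<open>To first order in \<open>h\<close> only no jump or one jump matters. The remainder has
  three parts, each at most \<open>(\<alpha> * h)\<^sup>2 * c\<close>: two or more jumps, and the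
  errors of expanding \<open>exp (- \<alpha> * h)\<close> in the terms with no jump and with one
  jump. Nonnegativity allows the series to be handled with extended nonnegative values.\<close>

lemma jump_law_short_time_nonneg:
  fixes f :: "'a \<Rightarrow> real"
  assumes f[measurable]: "f \<in> borel_measurable borel" and b: "\<And>x. 0 \<le> f x" "\<And>x. f x \<le> c" and h: "0 \<le> h"
  shows "\<bar>(LINT x|jump_law h. f x) - f 0 - h * (LINT x|lborel. a x * (f x - f 0))\<bar> \<le> 3 * (\<alpha> * h)\<^sup>2 * c"
proof -
  let ?x = "\<alpha> * h"
  have c: "0 \<le> c" using b[of 0] by linarith
  have x: "0 \<le> ?x" using rate_nonneg h by simp
  define I where "I = (LINT x|lborel. a x * f x)"
  have fa: "integrable lborel (\<lambda>x. a x * f x)"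
    using integrable_a_mult(1)[of f c] b by auto
  have I: "0 \<le> I" "I \<le> \<alpha> * c"
    using integrable_a_mult(2)[of f c] b a_nonneg unfolding I_def by (auto intro!: integral_nonneg_AE)
  define g where "g m = (\<integral>\<^sup>+x. f x \<partial>jump_power m)" for m
  have g0: "g 0 = ennreal (f 0)" unfolding g_def by (simp add: nn_integral_return)
  have g1: "g 1 = ennreal I"
  proof -
    have "g 1 = (\<integral>\<^sup>+x. ennreal (a x) * ennreal (f x) \<partial>lborel)"
      unfolding g_def One_nat_def by (subst nn_integral_jump_power_Suc) (simp_all add: nn_integral_return)
    also have "\<dots> = (\<integral>\<^sup>+x. ennreal (a x * f x) \<partial>lborel)"
      using a_nonneg b by (simp add: ennreal_mult)
    also have "\<dots> = ennreal I"
      unfolding I_def using fa a_nonneg b by (intro nn_integral_eq_integral) auto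
    finally show ?thesis .
  qed
  have gle: "g m \<le> ennreal (c * \<alpha> ^ m)" for m
  proof -
    have "g m \<le> (\<integral>\<^sup>+x. ennreal c \<partial>jump_power m)"
      unfolding g_def using b by (intro nn_integral_mono ennreal_leI) auto
    then show ?thesis
      using c rate_nonneg by (simp add: emeasure_jump_power_UNIV ennreal_mult)
  qed
  define r where "r = (\<Sum>m. ennreal (jump_weight h (m + 2)) * g (m + 2))"
  have w: "jump_weight h 0 = exp (- ?x)" "jump_weight h 1 = exp (- ?x) * h"
    using h by (simp_all add: jump_weight_def)
  have tail: "(\<lambda>m. jump_weight h (m + 2) * \<alpha> ^ (m + 2)) sums (1 - exp (- ?x) * (1 + ?x))"
  proof -
    have "(\<lambda>m. jump_weight h (m + 2) * \<alpha> ^ (m + 2)) sums (1 - (\<Sum>m<2. jump_weight h m * \<alpha> ^ m))"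
      using jump_weight_sums[of h] by (rule sums_iff_shift'[THEN iffD2])
    moreover have "(\<Sum>m<2. jump_weight h m * \<alpha> ^ m) = exp (- ?x) * (1 + ?x)"
      using w by (simp add: numeral_2_eq_2 algebra_simps)
    ultimately show ?thesis by simp
  qed
  have ex: "1 - ?x \<le> exp (- ?x)" using exp_ge_add_one_self[of "- ?x"] by simp
  have "(1 - ?x) * (1 + ?x) \<le> exp (- ?x) * (1 + ?x)"
    using ex x by (intro mult_right_mono) auto
  then have tail_le: "1 - exp (- ?x) * (1 + ?x) \<le> ?x\<^sup>2"
    by (simp add: algebra_simps power2_eq_square)
  have "r \<le> (\<Sum>m. ennreal (c * (jump_weight h (m + 2) * \<alpha> ^ (m + 2))))"
    unfolding r_def
  proof (intro suminf_le summableI)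
    fix m show "ennreal (jump_weight h (m + 2)) * g (m + 2) \<le> ennreal (c * (jump_weight h (m + 2) * \<alpha> ^ (m + 2)))"
      using mult_left_mono[OF gle[of "m + 2"], of "ennreal (jump_weight h (m + 2))"] jump_weight_nonneg[of h "m + 2"]
      by (simp add: ennreal_mult'[symmetric] mult_ac)
  qed
  also have "\<dots> = ennreal (c * (1 - exp (- ?x) * (1 + ?x)))"
    using sums_mult[OF tail, of c] c rate_nonneg jump_weight_nonneg by (intro suminf_ennreal_eq) auto
  also have "\<dots> \<le> ennreal (c * ?x\<^sup>2)"
    using tail_le c by (intro ennreal_leI mult_left_mono)
  finally have r: "r \<le> ennreal (c * ?x\<^sup>2)" .
  then obtain \<rho> where \<rho>: "r = ennreal \<rho>" "0 \<le> \<rho>"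
    by (metis ennreal_cases ennreal_less_top neq_top_trans top.not_eq_extremum)
  then have \<rho>le: "\<rho> \<le> c * ?x\<^sup>2" using r c by (simp add: ennreal_le_iff)
  have "ennreal (LINT x|jump_law h. f x) = (\<integral>\<^sup>+x. f x \<partial>jump_law h)"
    using b jump_law_integrable[of f c h] by (intro nn_integral_eq_integral[symmetric]) auto
  also have "\<dots> = (\<Sum>m. ennreal (jump_weight h m) * g m)"
    unfolding g_def by (rule nn_integral_jump_law) measurable
  also have "\<dots> = r + (\<Sum>m<2. ennreal (jump_weight h m) * g m)"
    unfolding r_def by (rule suminf_offset) (rule summableI)
  also have "\<dots> = ennreal (\<rho> + (exp (- ?x) * f 0 + exp (- ?x) * h * I))"
    using w g0 g1 \<rho> b I h by (simp add: numeral_2_eq_2 ennreal_mult ennreal_plus)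
  finally have main: "(LINT x|jump_law h. f x) = \<rho> + (exp (- ?x) * f 0 + exp (- ?x) * h * I)"
    using \<rho> b I h by (subst (asm) ennreal_inj) (auto intro!: integral_nonneg_AE)
  have J: "(LINT x|lborel. a x * (f x - f 0)) = I - \<alpha> * f 0"
    unfolding right_diff_distrib using fa a_integrable by (subst Bochner_Integration.integral_diff) (auto simp: I_def total_rate_def)
  \<comment> \<open>Multiplied by \<open>1 + ?x\<close>, the left side is at most \<open>1\<close>
    and the right side is \<open>1 + ?x ^ 3\<close>.\<close>
  have ex2: "exp (- ?x) \<le> 1 - ?x + ?x\<^sup>2"
  proof -
    have "0 \<le> (1 - exp (- ?x)) * 1" using x by simp
    have "exp (- ?x) * (1 + ?x) \<le> exp (- ?x) * exp ?x"
      using exp_ge_add_one_self[of ?x] by (intro mult_left_mono) auto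
    then have e1: "exp (- ?x) * (1 + ?x) \<le> 1" by (simp add: exp_minus)
    have "1 \<le> (1 - ?x + ?x\<^sup>2) * (1 + ?x)"
      using zero_le_power[OF x, of 3] by (simp add: algebra_simps power2_eq_square power3_eq_cube)
    with e1 have "exp (- ?x) * (1 + ?x) \<le> (1 - ?x + ?x\<^sup>2) * (1 + ?x)" by linarith
    then show ?thesis using x by (simp add: mult_le_cancel_right)
  qed
  have t1: "\<bar>(exp (- ?x) - 1 + ?x) * f 0\<bar> \<le> ?x\<^sup>2 * c"
    unfolding abs_mult using ex ex2 b[of 0] by (intro mult_mono) auto
  have t2: "\<bar>(exp (- ?x) - 1) * (h * I)\<bar> \<le> ?x * (?x * c)"
  proof -
    have "\<bar>h * I\<bar> \<le> ?x * c" using I h mult_left_mono[OF I(2) h] by (simp add: abs_mult mult_ac)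
    moreover have "\<bar>exp (- ?x) - 1\<bar> \<le> ?x" using ex x by (simp add: abs_if)
    ultimately show ?thesis unfolding abs_mult[of "exp (- ?x) - 1"] using x by (intro mult_mono) auto
  qed
  have "(LINT x|jump_law h. f x) - f 0 - h * (LINT x|lborel. a x * (f x - f 0)) =
      \<rho> + (exp (- ?x) - 1 + ?x) * f 0 + (exp (- ?x) - 1) * (h * I)"
    unfolding main J by (simp add: algebra_simps)
  then have "\<bar>(LINT x|jump_law h. f x) - f 0 - h * (LINT x|lborel. a x * (f x - f 0))\<bar> \<le> c * ?x\<^sup>2 + ?x\<^sup>2 * c + ?x * (?x * c)"
    using t1 t2 \<rho>le \<rho>(2) by linarith
  then show ?thesis by (simp add: power2_eq_square algebra_simps)
qed

text \<open>Adding \<open>c\<close> makes the function nonnegative with bound \<open>2 * c\<close>,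
  which doubles the constant. The generator term sees only differences of values and the law has
  mass one, so nothing else changes.\<close>

lemma jump_law_short_time:
  fixes f :: "'a \<Rightarrow> real"
  assumes f[measurable]: "f \<in> borel_measurable borel" and b: "\<And>x. \<bar>f x\<bar> \<le> c" and h: "0 \<le> h"
  shows "\<bar>(LINT x|jump_law h. f x) - f 0 - h * (LINT x|lborel. a x * (f x - f 0))\<bar> \<le> 6 * \<alpha>\<^sup>2 * h\<^sup>2 * c"
proof -
  have "0 \<le> f x + c" "f x + c \<le> 2 * c" for x using b[of x] by linarith+
  from jump_law_short_time_nonneg[of "\<lambda>x. f x + c" "2 * c" h, OF _ this h]
  have "\<bar>(LINT x|jump_law h. f x + c) - (f 0 + c) - h * (LINT x|lborel. a x * ((f x + c) - (f 0 + c)))\<bar> \<le> 3 * (\<alpha> * h)\<^sup>2 * (2 * c)"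
    by simp
  moreover have "(LINT x|jump_law h. f x + c) = (LINT x|jump_law h. f x) + c"
    using jump_law_integrable[OF f b] by (simp add: Bochner_Integration.integral_add jl.prob_space[of h, unfolded space_jump_law])
  ultimately show ?thesis by (simp add: power_mult_distrib mult_ac)
qed

end

section \<open>Independent jumps\<close>

lemma tuple_translate:
  assumes z: "z \<in> space (tuple_lborel n :: (nat \<Rightarrow> 'a::euclidean_space) measure)"
  shows "distr (tuple_lborel n) (tuple_lborel n) (\<lambda>x. \<lambda>i\<in>{..<n}. x i + z i) = (tuple_lborel n :: (nat \<Rightarrow> 'a) measure)"
proof (rule lborel_product.PiM_eqI)
  have m: "(\<lambda>x. \<lambda>i\<in>{..<n}. x i + z i) \<in> tuple_lborel n \<rightarrow>\<^sub>M (tuple_lborel n :: (nat \<Rightarrow> 'a) measure)"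
    by (intro measurable_restrict borel_measurable_add measurable_component_singleton borel_measurable_const) auto
  fix A :: "nat \<Rightarrow> 'a set" assume A: "\<And>i. i \<in> {..<n} \<Longrightarrow> A i \<in> sets lborel"
  have "(\<lambda>x. \<lambda>i\<in>{..<n}. x i + z i) -` PiE {..<n} A \<inter> space (tuple_lborel n) = PiE {..<n} (\<lambda>i. {y. z i + y \<in> A i})"
    unfolding space_PiM PiE_def Pi_def by (auto simp: add.commute)
  moreover have el: "emeasure lborel {y. z i + y \<in> A i} = emeasure lborel (A i)" and es: "{y. z i + y \<in> A i} \<in> sets lborel" if "i < n" for i
  proof -
    have "emeasure lborel (A i) = emeasure (distr lborel borel ((+) (z i))) (A i)"
      by (simp add: lborel_distr_plus)
    then show "emeasure lborel {y. z i + y \<in> A i} = emeasure lborel (A i)"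
      using A[of i] that by (subst (asm) emeasure_distr) (auto simp: vimage_def)
    have "(\<lambda>y. z i + y) -` A i \<inter> space borel \<in> sets borel"
      using A[of i] that by (intro measurable_sets[of _ borel borel]) auto
    then show "{y. z i + y \<in> A i} \<in> sets lborel" by (simp add: vimage_def)
  qed
  moreover have "emeasure (tuple_lborel n) (PiE {..<n} (\<lambda>i. {y. z i + y \<in> A i})) = (\<Prod>i\<in>{..<n}. emeasure lborel (A i))"
    using el es by (subst lborel_product.emeasure_PiM) auto
  ultimately show "emeasure (distr (tuple_lborel n) (tuple_lborel n) (\<lambda>x. \<lambda>i\<in>{..<n}. x i + z i)) (PiE {..<n} A) = (\<Prod>i\<in>{..<n}. emeasure lborel (A i))"
    using A by (subst emeasure_distr[OF m])
      (simp_all only: sets_PiM_I_finite finite_lessThan)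
qed simp_all

lemma nn_integral_tuple_translate:
  assumes z: "z \<in> space (tuple_lborel n :: (nat \<Rightarrow> 'a::euclidean_space) measure)"
    and f: "f \<in> tuple_borel n"
  shows "(\<integral>\<^sup>+x. f (\<lambda>i\<in>{..<n}. x i + z i) \<partial>tuple_lborel n) = (\<integral>\<^sup>+x. f x \<partial>tuple_lborel n)"
proof -
  have m: "(\<lambda>x. \<lambda>i\<in>{..<n}. x i + z i) \<in> tuple_lborel n \<rightarrow>\<^sub>M (tuple_lborel n :: (nat \<Rightarrow> 'a) measure)"
    by (intro measurable_restrict borel_measurable_add measurable_component_singleton borel_measurable_const) auto
  show ?thesis
    using nn_integral_distr[OF m, of f] f unfolding tuple_translate[OF z] by simp
qed

text \<open>Changing \<open>u\<close> on a null set makes it bounded everywhere, so that integrals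
  over jumps converge at every tuple and the estimates for single coordinates apply
  pointwise.\<close>

lemma sector_representative:
  fixes u :: "'a::euclidean_space set \<Rightarrow> real"
  assumes [measurable]: "u \<in> config_borel" and b: "sector_bound n u c"
  obtains u' where "u' \<in> config_borel" "\<And>\<eta>. \<bar>u' \<eta>\<bar> \<le> c" "sector_bound n (u \<ominus> u') 0"
proof
  let ?u = "\<lambda>\<eta>. if \<bar>u \<eta>\<bar> \<le> c then u \<eta> else 0"
  show "?u \<in> config_borel" by measurable
  show "\<bar>?u \<eta>\<bar> \<le> c" for \<eta> using sector_bound_nonneg[OF b] by auto
  show "sector_bound n (u \<ominus> ?u) 0"
    using b unfolding sector_bound_def by eventually_elim simp
qed

context jump_kernel
begin

abbreviation tuple_law :: "real \<Rightarrow> nat \<Rightarrow> (nat \<Rightarrow> 'a) measure" where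
  "tuple_law t n \<equiv> (\<Pi>\<^sub>M i\<in>{..<n}. jump_law t)"

abbreviation tuple_shift :: "nat \<Rightarrow> (nat \<Rightarrow> 'a) \<Rightarrow> (nat \<Rightarrow> 'a) \<Rightarrow> nat \<Rightarrow> 'a" where
  "tuple_shift n x z \<equiv> (\<lambda>i\<in>{..<n}. x i + z i)"

sublocale tl: prob_space "tuple_law t n" for t n
  by (intro prob_space_PiM prob_space_jump_law)

sublocale tlp: pair_sigma_finite "tuple_lborel n :: (nat \<Rightarrow> 'a) measure" "tuple_law t n" for t n
  by (intro pair_sigma_finite.intro lborel_product.sigma_finite tl.sigma_finite_measure) simp

lemma space_tuple_law: "space (tuple_law t n) = space (tuple_lborel n)"
  by (simp add: space_PiM)

lemma sets_tuple_law [measurable_cong]: "sets (tuple_law t n) = sets (tuple_lborel n :: (nat \<Rightarrow> 'a) measure)"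
  by (intro sets_PiM_cong) auto

abbreviation shift_space :: "real \<Rightarrow> nat \<Rightarrow> ((nat \<Rightarrow> 'a) \<times> (nat \<Rightarrow> 'a)) measure" where
  "shift_space t n \<equiv> tuple_lborel n \<Otimes>\<^sub>M tuple_law t n"

lemma tuple_shift_measurable:
  "(\<lambda>w. tuple_shift n (fst w) (snd w)) \<in> shift_space t n \<rightarrow>\<^sub>M tuple_lborel n"
proof (intro measurable_restrict)
  fix i assume i: "i \<in> {..<n}"
  have "(\<lambda>w. fst w i) \<in> borel_measurable (shift_space t n)"
    "(\<lambda>w. snd w i) \<in> borel_measurable (shift_space t n)"
    using i by (auto intro!: tuple_component_measurable[of i n] simp: measurable_cong_sets[OF refl sets_tuple_law[symmetric]])
  from borel_measurable_add[OF this]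
  show "(\<lambda>w. fst w i + snd w i) \<in> shift_space t n \<rightarrow>\<^sub>M lborel" by simp
qed

lemma tuple_shift_section_measurable:
  assumes "x \<in> space (tuple_lborel n)"
  shows "tuple_shift n x \<in> tuple_law t n \<rightarrow>\<^sub>M tuple_lborel n"
  using measurable_compose[OF measurable_Pair1'[OF assms] tuple_shift_measurable] by simp

lemma tuple_shift_space: "tuple_shift n x z \<in> space (tuple_lborel n)"
  by (simp add: space_PiM)

text \<open>For each fixed displacement the shift preserves Lebesgue measure, so Tonelli gives a
  null set of pairs. Hence displacement acts on classes of functions, even though the jump law has
  an atom at \<open>0\<close>.\<close>

lemma AE_tuple_shift:
  assumes P: "AE x in tuple_lborel n. P x"
  shows "AE x in tuple_lborel n. AE z in tuple_law t n. P (tuple_shift n x z)"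
proof -
  obtain N where N: "{x \<in> space (tuple_lborel n). \<not> P x} \<subseteq> N" "N \<in> null_sets (tuple_lborel n)"
    using P unfolding eventually_ae_filter by auto
  have Nm[measurable]: "N \<in> sets (tuple_lborel n)" using N(2) by auto
  have m: "(\<lambda>w. indicator N (tuple_shift n (fst w) (snd w)) :: ennreal) \<in> borel_measurable (shift_space t n)"
    by (rule measurable_compose[OF tuple_shift_measurable]) measurable
  have "(\<integral>\<^sup>+x. \<integral>\<^sup>+z. indicator N (tuple_shift n x z) \<partial>tuple_law t n \<partial>tuple_lborel n) =
      (\<integral>\<^sup>+z. \<integral>\<^sup>+x. indicator N (tuple_shift n x z) \<partial>tuple_lborel n \<partial>tuple_law t n)"
    using m by (intro tlp.Fubini'[symmetric]) (simp add: case_prod_beta)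
  also have "\<dots> = (\<integral>\<^sup>+z. \<integral>\<^sup>+x. indicator N x \<partial>tuple_lborel n \<partial>tuple_law t n)"
    by (intro nn_integral_cong nn_integral_tuple_translate) (simp_all add: space_tuple_law)
  also have "\<dots> = 0"
    using N(2) by (simp add: null_setsD1)
  finally have "AE x in tuple_lborel n. (\<integral>\<^sup>+z. indicator N (tuple_shift n x z) \<partial>tuple_law t n) = 0"
    using m by (subst (asm) nn_integral_0_iff_AE) (auto intro!: tl.borel_measurable_nn_integral simp: case_prod_beta)
  with AE_space show ?thesis
  proof eventually_elim
    case (elim x)
    have "(\<lambda>z. indicator N (tuple_shift n x z) :: ennreal) \<in> borel_measurable (tuple_law t n)"
      using measurable_compose[OF measurable_Pair1'[OF elim(1)] m] by simp
    then have "AE z in tuple_law t n. indicator N (tuple_shift n x z) = (0 :: ennreal)"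
      using elim(2) by (subst (asm) nn_integral_0_iff_AE) auto
    then show ?case
    proof eventually_elim
      case (elim z)
      then show ?case using N(1) tuple_shift_space[where n=n and x=x and z=z] by (auto simp: indicator_def split: if_splits)
    qed
  qed
qed

text \<open>Every point of the configuration \<open>\<eta>\<close> jumps independently; the increments are indexed by the
  points themselves, so that no enumeration of \<open>\<eta>\<close> is involved.\<close>

definition jump_sg :: "real \<Rightarrow> ('a set \<Rightarrow> real) \<Rightarrow> 'a set \<Rightarrow> real" where
  "jump_sg t u \<eta> = (LINT z|(\<Pi>\<^sub>M x\<in>\<eta>. jump_law t). u ((\<lambda>x. x + z x) ` \<eta>))"

lemma config_shift_measurable:
  assumes u: "u \<in> config_borel"
  shows "(\<lambda>w. u ((tuple_shift n (fst w) (snd w)) ` {..<n})) \<in> borel_measurable (shift_space t n)"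
  by (rule measurable_compose[OF measurable_compose[OF tuple_shift_measurable measurable_image_config] u])

lemma config_shift_section_measurable:
  assumes "u \<in> config_borel" "x \<in> space (tuple_lborel n)"
  shows "(\<lambda>z. u ((tuple_shift n x z) ` {..<n})) \<in> borel_measurable (tuple_law t n)"
  by (rule measurable_compose[OF measurable_compose[OF tuple_shift_section_measurable[OF assms(2)] measurable_image_config] assms(1)])

text \<open>Reading the noise along the injective \<open>x\<close> replaces points by positions as
  indices; the factors are identical, so the law is unchanged.\<close>

lemma jump_sg_tuple:
  assumes u: "u \<in> config_borel" and x: "x \<in> distinct_tuples n"
  shows "jump_sg t u (x ` {..<n}) = (LINT z|tuple_law t n. u ((tuple_shift n x z) ` {..<n}))"
proof -
  have inj: "inj_on x {..<n}" using x by (rule distinct_tuplesD)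
  have d: "distr (\<Pi>\<^sub>M y\<in>x ` {..<n}. jump_law t) (tuple_law t n) (\<lambda>\<omega>. \<lambda>i\<in>{..<n}. \<omega> (x i)) = tuple_law t n"
    by (rule distr_PiM_reindex) (use inj prob_space_jump_law in auto)
  have m: "(\<lambda>\<omega>. \<lambda>i\<in>{..<n}. \<omega> (x i)) \<in> (\<Pi>\<^sub>M y\<in>x ` {..<n}. jump_law t) \<rightarrow>\<^sub>M tuple_law t n"
    by (intro measurable_restrict measurable_component_singleton) auto
  have "(LINT z|tuple_law t n. u ((tuple_shift n x z) ` {..<n})) =
      (LINT \<omega>|(\<Pi>\<^sub>M y\<in>x ` {..<n}. jump_law t). u ((tuple_shift n x (\<lambda>i\<in>{..<n}. \<omega> (x i))) ` {..<n}))"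
    by (subst d[symmetric], rule integral_distr[OF m])
      (rule config_shift_section_measurable[OF u], use x in \<open>simp add: distinct_tuplesD\<close>)
  also have "\<dots> = jump_sg t u (x ` {..<n})"
    unfolding jump_sg_def by (intro Bochner_Integration.integral_cong refl arg_cong[where f=u]) (auto simp: image_iff)
  finally show ?thesis by simp
qed

lemma jump_sg_measurable:
  assumes u: "u \<in> config_borel"
  shows "jump_sg t u \<in> config_borel"
proof (rule measurable_configI)
  show "jump_sg t u (x ` {..<n}) = (LINT z|tuple_law t n. u ((tuple_shift n x z) ` {..<n}))" if "x \<in> distinct_tuples n" for n x
    by (rule jump_sg_tuple[OF u that])
  fix n
  show "(\<lambda>x. LINT z|tuple_law t n. u ((tuple_shift n x z) ` {..<n})) \<in> tuple_borel n"
    using config_shift_measurable[OF u] by (intro tl.borel_measurable_lebesgue_integral) (simp add: case_prod_beta)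
qed

text \<open>An average of values is bounded by the same constant, which makes \<open>jump_sg\<close>
  a contraction for every \<open>n\<close> and hence in every weighted norm.\<close>

lemma sector_bound_jump_sg:
  assumes u: "u \<in> config_borel" and b: "sector_bound n u c"
  shows "sector_bound n (jump_sg t u) c"
  using AE_distinct[of n] AE_tuple_shift[OF b[unfolded sector_bound_def], where t=t] unfolding sector_bound_def
proof eventually_elim
  case (elim x)
  note m = config_shift_section_measurable[OF u distinct_tuplesD(3)[OF elim(1)], where t=t]
  have "integrable (tuple_law t n) (\<lambda>z. u ((tuple_shift n x z) ` {..<n}))"
    using elim(2) m by (intro tl.integrable_const_bound[of _ c]) auto
  then have "\<bar>LINT z|tuple_law t n. u ((tuple_shift n x z) ` {..<n})\<bar> \<le> (LINT z|tuple_law t n. c)"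
    using elim(2) by (intro order_trans[OF integral_abs_bound] integral_mono_AE integrable_abs) auto
  then show ?case
    unfolding jump_sg_tuple[OF u elim(1)] by (simp add: tl.prob_space)
qed

lemma jump_sg_nonneg:
  assumes u: "u \<in> config_borel" and b: "AE x in tuple_lborel n. 0 \<le> u (x ` {..<n})"
  shows "AE x in tuple_lborel n. 0 \<le> jump_sg t u (x ` {..<n})"
  using AE_distinct[of n] AE_tuple_shift[OF b, where t=t]
proof eventually_elim
  case (elim x)
  then show ?case unfolding jump_sg_tuple[OF u elim(1)] by (intro integral_nonneg_AE) auto
qed

lemma jump_sg_cong:
  assumes u: "u \<in> config_borel" and v: "v \<in> config_borel"
    and b: "sector_bound n (u \<ominus> v) 0"
  shows "sector_bound n (jump_sg t u \<ominus> jump_sg t v) 0"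
  using AE_distinct[of n] AE_tuple_shift[OF b[unfolded sector_bound_def], where t=t] unfolding sector_bound_def
proof eventually_elim
  case (elim x)
  have "(LINT z|tuple_law t n. u ((tuple_shift n x z) ` {..<n})) = (LINT z|tuple_law t n. v ((tuple_shift n x z) ` {..<n}))"
    using elim by (intro integral_cong_AE config_shift_section_measurable u v) (auto simp: distinct_tuplesD)
  then show ?case unfolding jump_sg_tuple[OF u elim(1)] jump_sg_tuple[OF v elim(1)] by simp
qed

lemma L_hat_cong:
  assumes u: "u \<in> config_borel" and v: "v \<in> config_borel"
    and b: "sector_bound n (u \<ominus> v) 0"
  shows "sector_bound n (L_hat a u \<ominus> L_hat a v) 0"
proof -
  have "AE x in tuple_lborel n. \<forall>i\<in>{..<n}. AE y in lborel. \<bar>u ((x(i := y)) ` {..<n}) - v ((x(i := y)) ` {..<n})\<bar> \<le> 0"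
    using b unfolding sector_bound_def by (intro AE_finite_allI AE_tuple_update) auto
  with AE_distinct[of n] b show ?thesis
    unfolding sector_bound_def
  proof eventually_elim
    case (elim x)
    have "jump_term n u x i = jump_term n v x i" if "i < n" for i
    proof (rule integral_cong_AE)
      note p = measurable_Pair1'[OF distinct_tuplesD(3)[OF elim(1)]]
      show "(\<lambda>y. a (x i - y) * u ((x(i := y)) ` {..<n})) \<in> borel_measurable lborel"
        "(\<lambda>y. a (x i - y) * v ((x(i := y)) ` {..<n})) \<in> borel_measurable lborel"
        using measurable_compose[OF p jump_integrand_measurable[OF u that]] measurable_compose[OF p jump_integrand_measurable[OF v that]] by simp_all
      show "AE y in lborel. a (x i - y) * u ((x(i := y)) ` {..<n}) = a (x i - y) * v ((x(i := y)) ` {..<n})"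
        using elim(3)[rule_format, of i] that by auto
    qed
    then show ?case using elim(2) unfolding L_hat_tuple[OF elim(1)] by simp
  qed
qed

lemma jump_sg_scale: "jump_sg t (\<lambda>\<eta>. c * u \<eta>) \<eta> = c * jump_sg t u \<eta>"
  by (simp add: jump_sg_def)

lemma jump_sg_add:
  assumes u: "locally_bounded u" and v: "locally_bounded v"
  shows "sector_bound n (\<lambda>\<eta>. jump_sg t (\<lambda>\<zeta>. u \<zeta> + v \<zeta>) \<eta> - (jump_sg t u \<eta> + jump_sg t v \<eta>)) 0"
proof -
  note um = locally_bounded_measurable[OF u] and vm = locally_bounded_measurable[OF v]
  note uv = borel_measurable_add[OF um vm]
  obtain c c' where b: "sector_bound n u c" "sector_bound n v c'"
    using u v locally_bounded_sector by metis
  show ?thesis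
    using AE_distinct[of n] AE_tuple_shift[OF b(1)[unfolded sector_bound_def], where t=t] AE_tuple_shift[OF b(2)[unfolded sector_bound_def], where t=t]
    unfolding sector_bound_def
  proof eventually_elim
    case (elim x)
    have "integrable (tuple_law t n) (\<lambda>z. u ((tuple_shift n x z) ` {..<n}))"
      "integrable (tuple_law t n) (\<lambda>z. v ((tuple_shift n x z) ` {..<n}))"
      using elim config_shift_section_measurable[OF um, where n=n and x=x and t=t] config_shift_section_measurable[OF vm, where n=n and x=x and t=t]
      by (auto intro!: tl.integrable_const_bound simp: distinct_tuplesD)
    then show ?case
      unfolding jump_sg_tuple[OF um elim(1)] jump_sg_tuple[OF vm elim(1)] jump_sg_tuple[OF uv elim(1)] by simp
  qed
qed

lemma jump_sg_diff:
  assumes u: "locally_bounded u" and v: "locally_bounded v"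
  shows "sector_bound n (\<lambda>\<eta>. jump_sg t (u \<ominus> v) \<eta> - (jump_sg t u \<eta> - jump_sg t v \<eta>)) 0"
  using jump_sg_add[OF u locally_bounded_mult[OF v, of "-1"], where n=n and t=t] unfolding jump_sg_scale by simp

lemma locally_bounded_jump_sg: "locally_bounded u \<Longrightarrow> locally_bounded (jump_sg t u)"
  unfolding locally_bounded_def using jump_sg_measurable sector_bound_jump_sg by blast

text \<open>It suffices to compare boxes, on which the product structure reduces the claim to
  \<open>jump_law_add\<close> in each coordinate.\<close>

lemma tuple_law_add:
  assumes st: "0 \<le> s" "0 \<le> t"
  shows "distr (tuple_law s n \<Otimes>\<^sub>M tuple_law t n) (tuple_law (s + t) n) (\<lambda>w. tuple_shift n (fst w) (snd w)) = tuple_law (s + t) n"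
proof (rule jlp.PiM_eqI)
  have m: "(\<lambda>w. tuple_shift n (fst w) (snd w)) \<in> tuple_law s n \<Otimes>\<^sub>M tuple_law t n \<rightarrow>\<^sub>M tuple_law (s + t) n"
    using tuple_shift_measurable[where n=n and t=t] sets_tuple_law by (simp cong: measurable_cong_sets sets_pair_measure_cong)
  fix A :: "nat \<Rightarrow> 'a set" assume A: "\<And>i. i \<in> {..<n} \<Longrightarrow> A i \<in> sets (jump_law (s + t))"
  have A': "A i \<in> sets borel" if "i < n" for i using A[of i] that by simp
  have PA: "PiE {..<n} A \<in> sets (tuple_law (s + t) n)" using A by (intro sets_PiM_I_finite) auto
  have m': "(\<lambda>y. \<integral>\<^sup>+z. indicator (A i) (y + z) \<partial>jump_law t) \<in> borel_measurable borel" if "i < n" for i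
    using A'[OF that] by measurable
  have ind: "indicator (PiE {..<n} A) (tuple_shift n y z) = (\<Prod>i<n. indicator (A i) (y i + z i) :: ennreal)" for y z
  proof (cases "\<forall>i<n. y i + z i \<in> A i")
    case True then show ?thesis by (auto simp: indicator_def PiE_iff)
  next
    case False
    then obtain i where "i < n" "y i + z i \<notin> A i" by auto
    then have "tuple_shift n y z \<notin> PiE {..<n} A" "(\<Prod>i<n. indicator (A i) (y i + z i) :: ennreal) = 0"
      by (auto simp: PiE_iff indicator_def intro!: prod_zero)
    then show ?thesis by simp
  qed
  have "emeasure (distr (tuple_law s n \<Otimes>\<^sub>M tuple_law t n) (tuple_law (s + t) n) (\<lambda>w. tuple_shift n (fst w) (snd w))) (PiE {..<n} A) =
      (\<integral>\<^sup>+w. indicator (PiE {..<n} A) (tuple_shift n (fst w) (snd w)) \<partial>(tuple_law s n \<Otimes>\<^sub>M tuple_law t n))"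
    using nn_integral_distr[OF m, of "indicator (PiE {..<n} A)"] PA by simp
  also have "\<dots> = (\<integral>\<^sup>+y. \<integral>\<^sup>+z. indicator (PiE {..<n} A) (tuple_shift n y z) \<partial>tuple_law t n \<partial>tuple_law s n)"
    by (subst tl.nn_integral_fst[symmetric]) (use measurable_compose[OF m, of "indicator (PiE {..<n} A)"] PA in auto)
  also have "\<dots> = (\<integral>\<^sup>+y. (\<Prod>i<n. \<integral>\<^sup>+z. indicator (A i) (y i + z) \<partial>jump_law t) \<partial>tuple_law s n)"
    unfolding ind using A' by (intro nn_integral_cong jlp.product_nn_integral_prod) auto
  also have "\<dots> = (\<Prod>i<n. \<integral>\<^sup>+y. \<integral>\<^sup>+z. indicator (A i) (y + z) \<partial>jump_law t \<partial>jump_law s)"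
    using m' by (intro jlp.product_nn_integral_prod) auto
  also have "\<dots> = (\<Prod>i<n. emeasure (jump_law (s + t)) (A i))"
    using A' by (intro prod.cong refl) (simp add: jump_law_add[OF st])
  finally show "emeasure (distr (tuple_law s n \<Otimes>\<^sub>M tuple_law t n) (tuple_law (s + t) n) (\<lambda>w. tuple_shift n (fst w) (snd w))) (PiE {..<n} A) =
     (\<Prod>i\<in>{..<n}. emeasure (jump_law (s + t)) (A i))" .
qed simp_all

text \<open>Two independent displacements add up to one by \<open>tuple_law_add\<close>. Fubini is
  applied to a bounded representative; by \<open>jump_sg_cong\<close> both sides depend on the class
  of \<open>u\<close> only.\<close>

lemma jump_sg_semigroup:
  assumes st: "0 \<le> s" "0 \<le> t" and u: "u \<in> config_borel" and b: "sector_bound n u c"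
  shows "sector_bound n (jump_sg (s + t) u \<ominus> jump_sg s (jump_sg t u)) 0"
proof -
  obtain v where v[measurable]: "v \<in> config_borel" and vb: "\<And>\<eta>. \<bar>v \<eta>\<bar> \<le> c" and uv: "sector_bound n (u \<ominus> v) 0"
    using sector_representative[OF u b] by metis
  note Tv = jump_sg_measurable[OF v]
  have "sector_bound n (jump_sg (s + t) v \<ominus> jump_sg s (jump_sg t v)) 0"
    \<comment> \<open>The inner operator is evaluated at the displaced tuple, and
      \<open>jump_sg_tuple\<close> applies there only if its entries are again distinct.\<close>
    using AE_distinct[of n] AE_tuple_shift[OF AE_distinct, where n=n and t=s] unfolding sector_bound_def
  proof eventually_elim
    case (elim x)
    note xs = distinct_tuplesD(3)[OF elim(1)]
    have m: "(\<lambda>w. tuple_shift n (fst w) (snd w)) \<in> tuple_law s n \<Otimes>\<^sub>M tuple_law t n \<rightarrow>\<^sub>M tuple_law (s + t) n"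
      using tuple_shift_measurable[where n=n and t=t] sets_tuple_law by (simp cong: measurable_cong_sets sets_pair_measure_cong)
    interpret P: pair_prob_space "tuple_law s n" "tuple_law t n" ..
    let ?F = "\<lambda>w. v ((tuple_shift n x (tuple_shift n (fst w) (snd w))) ` {..<n})"
    have mF: "?F \<in> borel_measurable (tuple_law s n \<Otimes>\<^sub>M tuple_law t n)"
      by (rule measurable_compose[OF m config_shift_section_measurable[OF v xs]])
    have iF: "integrable (tuple_law s n \<Otimes>\<^sub>M tuple_law t n) ?F"
      using mF vb by (intro P.integrable_const_bound[of _ c]) auto
    have "jump_sg s (jump_sg t v) (x ` {..<n}) = (LINT y|tuple_law s n. LINT z|tuple_law t n. v ((tuple_shift n (tuple_shift n x y) z) ` {..<n}))"
      unfolding jump_sg_tuple[OF Tv elim(1)]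
    proof (rule integral_cong_AE)
      show "(\<lambda>y. LINT z|tuple_law t n. v ((tuple_shift n (tuple_shift n x y) z) ` {..<n})) \<in> borel_measurable (tuple_law s n)"
      proof (rule tl.borel_measurable_lebesgue_integral)
        have "(\<lambda>w. tuple_shift n (tuple_shift n x (fst w)) (snd w)) \<in> tuple_law s n \<Otimes>\<^sub>M tuple_law t n \<rightarrow>\<^sub>M tuple_lborel n"
          using measurable_compose[OF measurable_Pair[OF measurable_compose[OF measurable_fst tuple_shift_section_measurable[OF xs]] measurable_snd] tuple_shift_measurable] by simp
        then show "(\<lambda>(y, z). v ((tuple_shift n (tuple_shift n x y) z) ` {..<n})) \<in> borel_measurable (tuple_law s n \<Otimes>\<^sub>M tuple_law t n)"
          unfolding case_prod_beta by (intro measurable_compose[OF measurable_compose[OF _ measurable_image_config] v]) simp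
      qed
      show "AE y in tuple_law s n. jump_sg t v ((tuple_shift n x y) ` {..<n}) = (LINT z|tuple_law t n. v ((tuple_shift n (tuple_shift n x y) z) ` {..<n}))"
        using elim(2) by eventually_elim (rule jump_sg_tuple[OF v])
    qed (rule config_shift_section_measurable[OF Tv xs])
    also have "\<dots> = (LINT y|tuple_law s n. LINT z|tuple_law t n. ?F (y, z))"
      by (intro Bochner_Integration.integral_cong refl arg_cong[where f=v]) (auto simp: add.assoc)
    also have "\<dots> = (LINT w|(tuple_law s n \<Otimes>\<^sub>M tuple_law t n). ?F w)"
      by (rule P.integral_fst'[OF iF])
    also have "\<dots> = (LINT z|distr (tuple_law s n \<Otimes>\<^sub>M tuple_law t n) (tuple_law (s + t) n) (\<lambda>w. tuple_shift n (fst w) (snd w)). v ((tuple_shift n x z) ` {..<n}))"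
      by (rule integral_distr[OF m config_shift_section_measurable[OF v xs], symmetric])
    also have "\<dots> = jump_sg (s + t) v (x ` {..<n})"
      by (simp only: tuple_law_add[OF st] jump_sg_tuple[OF v elim(1)])
    finally show ?case by simp
  qed
  moreover have "sector_bound n (jump_sg (s + t) u \<ominus> jump_sg (s + t) v) 0"
    by (rule jump_sg_cong[OF u v uv])
  moreover have "sector_bound n (jump_sg s (jump_sg t u) \<ominus> jump_sg s (jump_sg t v)) 0"
    by (intro jump_sg_cong jump_sg_measurable u v uv)
  ultimately show ?thesis
    unfolding sector_bound_def by eventually_elim simp
qed

end

section \<open>Short-time behaviour\<close>

context jump_kernel
begin

text \<open>Points with index outside \<open>I\<close> stay put, which makes an induction on \<open>I\<close> possible.\<close>

definition partial_jump :: "nat set \<Rightarrow> real \<Rightarrow> ((nat \<Rightarrow> 'a) \<Rightarrow> real) \<Rightarrow> (nat \<Rightarrow> 'a) \<Rightarrow> real" where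
  "partial_jump I h f x = (LINT z|(\<Pi>\<^sub>M i\<in>I. jump_law h). f (\<lambda>i. if i \<in> I then x i + z i else x i))"

text \<open>The jump operator acting on coordinate \<open>j\<close> alone, in terms of the increment
  \<open>z = y - x j\<close>. Summed over all coordinates it becomes \<open>L_hat\<close> on
  tuples.\<close>

definition coordinate_generator :: "nat \<Rightarrow> ((nat \<Rightarrow> 'a) \<Rightarrow> real) \<Rightarrow> (nat \<Rightarrow> 'a) \<Rightarrow> real" where
  "coordinate_generator j f x = (LINT z|lborel. a z * (f (x(j := x j + z)) - f x))"

definition coordinate_jump :: "nat \<Rightarrow> real \<Rightarrow> ((nat \<Rightarrow> 'a) \<Rightarrow> real) \<Rightarrow> (nat \<Rightarrow> 'a) \<Rightarrow> real" where
  "coordinate_jump j h f x = (LINT z|jump_law h. f (x(j := x j + z)))"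

lemma coordinate_shift_measurable:
  assumes j: "j < n" and S: "sets S = sets (borel :: 'a measure)"
  shows "(\<lambda>w. (fst w)(j := fst w j + snd w)) \<in> tuple_lborel n \<Otimes>\<^sub>M S \<rightarrow>\<^sub>M tuple_lborel n"
proof (rule tuple_update_measurable[OF j measurable_fst])
  have "(\<lambda>w. fst w j) \<in> borel_measurable (tuple_lborel n \<Otimes>\<^sub>M S)" "snd \<in> borel_measurable (tuple_lborel n \<Otimes>\<^sub>M S)"
    using measurable_snd[of "tuple_lborel n" S]
    by (auto intro!: tuple_component_measurable[OF j] simp: measurable_cong_sets[OF refl S])
  then show "(\<lambda>w. fst w j + snd w) \<in> borel_measurable (tuple_lborel n \<Otimes>\<^sub>M S)"
    by (rule borel_measurable_add)
qed

lemma partial_shift_measurable: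
  assumes I: "I \<subseteq> {..<n}"
  shows "(\<lambda>w. (\<lambda>i. if i \<in> I then fst w i + snd w i else fst w i)) \<in> tuple_lborel n \<Otimes>\<^sub>M (\<Pi>\<^sub>M i\<in>I. jump_law h) \<rightarrow>\<^sub>M tuple_lborel n"
proof -
  have "(\<lambda>w. (\<lambda>i\<in>{..<n}. if i \<in> I then fst w i + snd w i else fst w i)) \<in> tuple_lborel n \<Otimes>\<^sub>M (\<Pi>\<^sub>M i\<in>I. jump_law h) \<rightarrow>\<^sub>M tuple_lborel n"
  proof (rule measurable_restrict)
    fix i assume i: "i \<in> {..<n}"
    have f: "(\<lambda>w. fst w i) \<in> borel_measurable (tuple_lborel n \<Otimes>\<^sub>M (\<Pi>\<^sub>M i\<in>I. jump_law h))"
      using i by (intro tuple_component_measurable[OF _ measurable_fst]) auto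
    have s: "(\<lambda>w. snd w i) \<in> borel_measurable (tuple_lborel n \<Otimes>\<^sub>M (\<Pi>\<^sub>M i\<in>I. jump_law h))" if "i \<in> I"
      using measurable_compose[OF measurable_snd measurable_component_singleton[OF that, of "\<lambda>_. jump_law h"]] by (simp cong: measurable_cong_sets)
    show "(\<lambda>w. if i \<in> I then fst w i + snd w i else fst w i) \<in> tuple_lborel n \<Otimes>\<^sub>M (\<Pi>\<^sub>M i\<in>I. jump_law h) \<rightarrow>\<^sub>M lborel"
      using borel_measurable_add[OF f s] f by (cases "i \<in> I") auto
  qed
  note m = this
  have eq: "(\<lambda>i\<in>{..<n}. if i \<in> I then fst w i + snd w i else fst w i) = (\<lambda>i. if i \<in> I then fst w i + snd w i else fst w i)"
    if "w \<in> space (tuple_lborel n \<Otimes>\<^sub>M (\<Pi>\<^sub>M i\<in>I. jump_law h))" for w :: "(nat \<Rightarrow> 'a) \<times> (nat \<Rightarrow> 'a)"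
  proof -
    have "fst w \<in> space (tuple_lborel n :: (nat \<Rightarrow> 'a) measure)" using that by (auto simp: space_pair_measure)
    then have "fst w i = undefined" if "\<not> i < n" for i using that by (auto simp: space_PiM PiE_iff extensional_def)
    moreover have "i < n" if "i \<in> I" for i using that I by blast
    ultimately show ?thesis by (auto simp: restrict_def fun_eq_iff)
  qed
  show ?thesis
    by (rule measurable_cong[THEN iffD1, OF eq m])
qed

lemma coordinate_space: "j < n \<Longrightarrow> x \<in> space (tuple_lborel n) \<Longrightarrow> x(j := y) \<in> space (tuple_lborel n :: (nat \<Rightarrow> 'a) measure)"
  by (auto simp: space_PiM PiE_iff extensional_def)

lemma coordinate_section_measurable:
  fixes f :: "(nat \<Rightarrow> 'a) \<Rightarrow> real"
  assumes "j < n" "f \<in> tuple_borel n" "x \<in> space (tuple_lborel n)"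
  shows "(\<lambda>z. f (x(j := x j + z))) \<in> borel_measurable borel"
  using measurable_compose[OF measurable_compose[OF measurable_Pair1'[OF assms(3)] coordinate_shift_measurable[OF assms(1), of borel]] assms(2)]
  by simp

lemma coordinate_generator_measurable:
  assumes j: "j < n" and f: "f \<in> tuple_borel n"
  shows "coordinate_generator j f \<in> tuple_borel n"
  unfolding coordinate_generator_def
proof (rule lborel.borel_measurable_lebesgue_integral)
  have [measurable]: "(\<lambda>w. f ((fst w)(j := fst w j + snd w))) \<in> borel_measurable (tuple_lborel n \<Otimes>\<^sub>M lborel)"
    by (rule measurable_compose[OF coordinate_shift_measurable[OF j] f]) simp
  have [measurable]: "(\<lambda>w. f (fst w)) \<in> borel_measurable (tuple_lborel n \<Otimes>\<^sub>M (lborel :: 'a measure))"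
    by (rule measurable_compose[OF measurable_fst f])
  show "(\<lambda>(x, z). a z * (f (x(j := x j + z)) - f x)) \<in> borel_measurable (tuple_lborel n \<Otimes>\<^sub>M lborel)"
    unfolding case_prod_beta by measurable
qed

lemma coordinate_jump_measurable:
  assumes j: "j < n" and f: "f \<in> tuple_borel n"
  shows "coordinate_jump j h f \<in> tuple_borel n"
  unfolding coordinate_jump_def
proof (rule jl.borel_measurable_lebesgue_integral)
  show "(\<lambda>(x, z). f (x(j := x j + z))) \<in> borel_measurable (tuple_lborel n \<Otimes>\<^sub>M jump_law h)"
    unfolding case_prod_beta by (rule measurable_compose[OF coordinate_shift_measurable[OF j] f]) simp
qed

lemma coordinate_generator_bound:
  assumes "j < n" "f \<in> tuple_borel n" "x \<in> space (tuple_lborel n)" "\<And>x. x \<in> space (tuple_lborel n) \<Longrightarrow> \<bar>f x\<bar> \<le> c"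
  shows "\<bar>coordinate_generator j f x\<bar> \<le> 2 * \<alpha> * c"
proof -
  have "\<bar>f (x(j := x j + z)) - f x\<bar> \<le> 2 * c" for z
    using assms(4)[OF coordinate_space[OF assms(1,3)], of "x j + z"] assms(4)[OF assms(3)] by linarith
  then show ?thesis
    using integrable_a_mult(2)[of "\<lambda>z. f (x(j := x j + z)) - f x" "2 * c"] coordinate_section_measurable[OF assms(1,2,3)]
    unfolding coordinate_generator_def by (simp add: mult_ac)
qed

lemma coordinate_jump_short_time:
  assumes "j < n" "f \<in> tuple_borel n" "x \<in> space (tuple_lborel n)" "\<And>x. x \<in> space (tuple_lborel n) \<Longrightarrow> \<bar>f x\<bar> \<le> c" "0 \<le> h"
  shows "\<bar>coordinate_jump j h f x - f x - h * coordinate_generator j f x\<bar> \<le> 6 * \<alpha>\<^sup>2 * h\<^sup>2 * c"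
  using jump_law_short_time[OF coordinate_section_measurable[OF assms(1-3)] assms(4)[OF coordinate_space[OF assms(1,3)]] assms(5)]
  unfolding coordinate_jump_def coordinate_generator_def by simp

lemma partial_jump_integrable:
  assumes "I \<subseteq> {..<n}" "f \<in> tuple_borel n" "x \<in> space (tuple_lborel n)" "\<And>x. x \<in> space (tuple_lborel n) \<Longrightarrow> \<bar>f x\<bar> \<le> c"
  shows "integrable (\<Pi>\<^sub>M i\<in>I. jump_law h) (\<lambda>z. f (\<lambda>i. if i \<in> I then x i + z i else x i))"
    and "\<bar>partial_jump I h f x\<bar> \<le> c"
proof -
  have ps: "prob_space (\<Pi>\<^sub>M i\<in>I. jump_law h)"
    by (intro prob_space_PiM prob_space_jump_law)
  have m: "(\<lambda>z. (\<lambda>i. if i \<in> I then x i + z i else x i)) \<in> (\<Pi>\<^sub>M i\<in>I. jump_law h) \<rightarrow>\<^sub>M tuple_lborel n"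
    using measurable_compose[OF measurable_Pair1'[OF assms(3)] partial_shift_measurable[OF assms(1), of h]] by (simp only: fst_conv snd_conv)
  have b: "\<bar>f (\<lambda>i. if i \<in> I then x i + z i else x i)\<bar> \<le> c" if "z \<in> space (\<Pi>\<^sub>M i\<in>I. jump_law h)" for z
    using measurable_space[OF m that] assms(4) by blast
  show i: "integrable (\<Pi>\<^sub>M i\<in>I. jump_law h) (\<lambda>z. f (\<lambda>i. if i \<in> I then x i + z i else x i))"
    using b measurable_compose[OF m assms(2)] by (intro finite_measure.integrable_const_bound[OF prob_space.finite_measure[OF ps], of _ c]) auto
  have "\<bar>partial_jump I h f x\<bar> \<le> (LINT z|(\<Pi>\<^sub>M i\<in>I. jump_law h). c)"
    unfolding partial_jump_def using b i by (intro order_trans[OF integral_abs_bound] integral_mono integrable_abs) auto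
  then show "\<bar>partial_jump I h f x\<bar> \<le> c" using prob_space.prob_space[OF ps] by simp
qed

lemma partial_jump_insert:
  assumes I: "finite I" "j \<notin> I" "insert j I \<subseteq> {..<n}" and f: "f \<in> tuple_borel n" and x: "x \<in> space (tuple_lborel n)"
    and b: "\<And>x. x \<in> space (tuple_lborel n) \<Longrightarrow> \<bar>f x\<bar> \<le> c"
  shows "partial_jump (insert j I) h f x = partial_jump I h (coordinate_jump j h f) x"
proof -
  have "partial_jump (insert j I) h f x =
    (LINT z|(\<Pi>\<^sub>M i\<in>I. jump_law h). LINT y|jump_law h. f (\<lambda>i. if i \<in> insert j I then x i + (z(j := y)) i else x i))"
    unfolding partial_jump_def
    by (rule jlp.product_integral_insert[OF I(1,2) partial_jump_integrable(1)[OF I(3) f x b]])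
  also have "\<dots> = partial_jump I h (coordinate_jump j h f) x"
    unfolding partial_jump_def coordinate_jump_def
    using I(2) by (intro Bochner_Integration.integral_cong refl arg_cong[where f=f]) auto
  finally show ?thesis .
qed

text \<open>The operator for \<open>I\<close> is applied to the expansion of the jump of coordinate
  \<open>j\<close>: identity, plus \<open>h\<close> times its generator, plus a remainder of order
  \<open>h\<^sup>2\<close>. The induction hypothesis handles the first two pieces. The constant
  depends on \<open>I\<close> alone, hence its place before the quantifiers over \<open>f\<close>,
  \<open>c\<close> and \<open>h\<close>.\<close>

lemma partial_jump_short_time:
  assumes "finite I" "I \<subseteq> {..<n}"
  shows "\<exists>K\<ge>0. \<forall>h f c x. 0 \<le> h \<longrightarrow> h \<le> 1 \<longrightarrow> f \<in> tuple_borel n \<longrightarrow>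
     (\<forall>x\<in>space (tuple_lborel n). \<bar>f x\<bar> \<le> c) \<longrightarrow> x \<in> space (tuple_lborel n) \<longrightarrow>
     \<bar>partial_jump I h f x - f x - h * (\<Sum>i\<in>I. coordinate_generator i f x)\<bar> \<le> K * h\<^sup>2 * c"
  using assms
proof (induction I rule: finite_induct)
  case empty
  have "partial_jump {} h f x = f x" for h f x
    unfolding partial_jump_def by (simp add: PiM_empty lebesgue_integral_count_space_finite)
  then show ?case by (intro exI[of _ 0]) simp
next
  case (insert j I)
  then have jn: "j < n" and In: "I \<subseteq> {..<n}" by auto
  obtain K where K0: "0 \<le> K" and K: "\<And>h f c x. 0 \<le> h \<Longrightarrow> h \<le> 1 \<Longrightarrow> f \<in> tuple_borel n \<Longrightarrow>
     (\<And>x. x \<in> space (tuple_lborel n) \<Longrightarrow> \<bar>f x\<bar> \<le> c) \<Longrightarrow> x \<in> space (tuple_lborel n) \<Longrightarrow>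
     \<bar>partial_jump I h f x - f x - h * (\<Sum>i\<in>I. coordinate_generator i f x)\<bar> \<le> K * h\<^sup>2 * c"
    using insert.IH[OF In] by blast
  \<comment> \<open>The summands come from the induction hypothesis for \<open>f\<close>, from
    replacing \<open>partial_jump I h ?G\<close> by \<open>?G\<close>, where \<open>?G\<close> is
    bounded by \<open>2 * \<alpha> * c\<close>, and from the remainder of the single jump.\<close>
  let ?K = "K + 4 * \<alpha>\<^sup>2 * card I + 2 * \<alpha> * K + 6 * \<alpha>\<^sup>2"
  show ?case
  proof (intro exI[of _ ?K] conjI allI impI)
    show "0 \<le> ?K" using K0 rate_nonneg by simp
    fix h c :: real and f :: "(nat \<Rightarrow> 'a) \<Rightarrow> real" and x :: "nat \<Rightarrow> 'a"
    assume h: "0 \<le> h" "h \<le> 1" and f: "f \<in> tuple_borel n"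
      and b': "\<forall>x\<in>space (tuple_lborel n). \<bar>f x\<bar> \<le> c" and x: "x \<in> space (tuple_lborel n)"
    have b: "\<And>x. x \<in> space (tuple_lborel n) \<Longrightarrow> \<bar>f x\<bar> \<le> c" using b' by blast
    have c: "0 \<le> c" using b[OF x] by linarith
    let ?G = "coordinate_generator j f" and ?P = "coordinate_jump j h f"
    let ?r = "\<lambda>x. ?P x - f x - h * ?G x"
    note Gm = coordinate_generator_measurable[OF jn f] and Pm = coordinate_jump_measurable[OF jn f, of h]
    have rm: "?r \<in> tuple_borel n" using Gm Pm f by measurable
    have Gb: "\<And>x. x \<in> space (tuple_lborel n) \<Longrightarrow> \<bar>?G x\<bar> \<le> 2 * \<alpha> * c"
      by (rule coordinate_generator_bound[OF jn f _ b])
    have rb: "\<And>x. x \<in> space (tuple_lborel n) \<Longrightarrow> \<bar>?r x\<bar> \<le> 6 * \<alpha>\<^sup>2 * h\<^sup>2 * c"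
      by (rule coordinate_jump_short_time[OF jn f _ b h(1)])
    have "partial_jump I h (\<lambda>x. f x + (h * ?G x + ?r x)) x = partial_jump I h f x + (h * partial_jump I h ?G x + partial_jump I h ?r x)"
      unfolding partial_jump_def
      using partial_jump_integrable(1)[OF In f x b] partial_jump_integrable(1)[OF In Gm x Gb] partial_jump_integrable(1)[OF In rm x rb]
      by (simp only: Bochner_Integration.integral_add Bochner_Integration.integrable_add integrable_mult_right integral_mult_right_zero)
    moreover have "(\<lambda>x. f x + (h * ?G x + ?r x)) = ?P" by (simp add: fun_eq_iff)
    ultimately have split: "partial_jump (insert j I) h f x = partial_jump I h f x + (h * partial_jump I h ?G x + partial_jump I h ?r x)"
      using partial_jump_insert[OF insert.hyps insert.prems f x b] by simp
    have sumG: "\<bar>\<Sum>i\<in>I. coordinate_generator i ?G x\<bar> \<le> card I * (2 * \<alpha> * (2 * \<alpha> * c))"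
      using In by (intro order_trans[OF sum_abs] sum_bounded_above coordinate_generator_bound[OF _ Gm x Gb]) auto
    have e1: "\<bar>partial_jump I h f x - f x - h * (\<Sum>i\<in>I. coordinate_generator i f x)\<bar> \<le> K * h\<^sup>2 * c"
      by (rule K[OF h f b x])
    have e2: "\<bar>partial_jump I h ?G x - ?G x\<bar> \<le> h * (card I * (2 * \<alpha> * (2 * \<alpha> * c))) + K * h * (2 * \<alpha> * c)"
    proof -
      have "\<bar>partial_jump I h ?G x - ?G x - h * (\<Sum>i\<in>I. coordinate_generator i ?G x)\<bar> \<le> K * h\<^sup>2 * (2 * \<alpha> * c)"
        by (rule K[OF h Gm Gb x])
      moreover have "\<bar>h * (\<Sum>i\<in>I. coordinate_generator i ?G x)\<bar> \<le> h * (card I * (2 * \<alpha> * (2 * \<alpha> * c)))"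
        unfolding abs_mult using h sumG by (intro mult_mono) auto
      \<comment> \<open>Here \<open>h \<le> 1\<close> lets one power of \<open>h\<close> be dropped;
        the outer factor \<open>h\<close> in front of this term restores the order.\<close>
      moreover have "K * h\<^sup>2 * (2 * \<alpha> * c) \<le> K * h * (2 * \<alpha> * c)"
        using h K0 c rate_nonneg by (intro mult_right_mono mult_left_mono) (auto simp: power2_eq_square mult_left_le)
      ultimately show ?thesis by linarith
    qed
    then have e2': "\<bar>h * (partial_jump I h ?G x - ?G x)\<bar> \<le> h * (h * (card I * (2 * \<alpha> * (2 * \<alpha> * c))) + K * h * (2 * \<alpha> * c))"
      unfolding abs_mult using h by (intro mult_mono) auto
    have e3: "\<bar>partial_jump I h ?r x\<bar> \<le> 6 * \<alpha>\<^sup>2 * h\<^sup>2 * c"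
      by (rule partial_jump_integrable(2)[OF In rm x rb])
    have "partial_jump (insert j I) h f x - f x - h * (\<Sum>i\<in>insert j I. coordinate_generator i f x) =
      (partial_jump I h f x - f x - h * (\<Sum>i\<in>I. coordinate_generator i f x)) + h * (partial_jump I h ?G x - ?G x) + partial_jump I h ?r x"
      unfolding split using insert.hyps by (simp add: algebra_simps)
    then have "\<bar>partial_jump (insert j I) h f x - f x - h * (\<Sum>i\<in>insert j I. coordinate_generator i f x)\<bar> \<le>
       K * h\<^sup>2 * c + h * (h * (card I * (2 * \<alpha> * (2 * \<alpha> * c))) + K * h * (2 * \<alpha> * c)) + 6 * \<alpha>\<^sup>2 * h\<^sup>2 * c"
      using e1 e2' e3 by linarith
    also have "\<dots> = ?K * h\<^sup>2 * c"
      by (simp add: algebra_simps power2_eq_square)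
    finally show "\<bar>partial_jump (insert j I) h f x - f x - h * (\<Sum>i\<in>insert j I. coordinate_generator i f x)\<bar> \<le> ?K * h\<^sup>2 * c" .
  qed
qed

text \<open>All \<open>n\<close> coordinates jump, and the substitution \<open>y = x i + z\<close>
  together with the symmetry of \<open>a\<close> identifies the sum of the coordinate generators
  with \<open>L_hat\<close>. The constant depends on \<open>n\<close>, so this expansion by itself
  gives no statement in the norm of \<open>K_space\<close>.\<close>

lemma jump_sg_short_time:
  "\<exists>K\<ge>0. \<forall>h u c. 0 \<le> h \<longrightarrow> h \<le> 1 \<longrightarrow> u \<in> config_borel \<longrightarrow> sector_bound n u c \<longrightarrow>
    sector_bound n (\<lambda>\<eta>. jump_sg h u \<eta> - u \<eta> - h * L_hat a u \<eta>) (K * h\<^sup>2 * c)"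
proof -
  obtain K where K0: "0 \<le> K" and K: "\<And>h f c x. 0 \<le> h \<Longrightarrow> h \<le> 1 \<Longrightarrow> f \<in> tuple_borel n \<Longrightarrow>
     (\<And>x. x \<in> space (tuple_lborel n) \<Longrightarrow> \<bar>f x\<bar> \<le> c) \<Longrightarrow> x \<in> space (tuple_lborel n) \<Longrightarrow>
     \<bar>partial_jump {..<n} h f x - f x - h * (\<Sum>i<n. coordinate_generator i f x)\<bar> \<le> K * h\<^sup>2 * c"
    using partial_jump_short_time[of "{..<n}" n] by auto
  show ?thesis
  proof (intro exI[of _ K] conjI K0 allI impI)
    fix h c :: real and u :: "'a set \<Rightarrow> real"
    assume h: "0 \<le> h" "h \<le> 1" and u: "u \<in> config_borel" and b: "sector_bound n u c"
    obtain v where v[measurable]: "v \<in> config_borel" and vb: "\<And>\<eta>. \<bar>v \<eta>\<bar> \<le> c" and uv: "sector_bound n (u \<ominus> v) 0"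
      using sector_representative[OF u b] by metis
    let ?f = "\<lambda>x. v (x ` {..<n})"
    have f: "?f \<in> tuple_borel n" by measurable
    have "sector_bound n (\<lambda>\<eta>. jump_sg h v \<eta> - v \<eta> - h * L_hat a v \<eta>) (K * h\<^sup>2 * c)"
      using AE_distinct[of n] unfolding sector_bound_def
    proof eventually_elim
      case (elim x)
      note xs = distinct_tuplesD(3)[OF elim]
      have "(\<lambda>i. if i \<in> {..<n} then x i + z i else x i) = tuple_shift n x z" for z
        using xs by (auto simp: space_PiM PiE_iff extensional_def fun_eq_iff)
      then have P: "partial_jump {..<n} h ?f x = jump_sg h v (x ` {..<n})"
        unfolding partial_jump_def jump_sg_tuple[OF v elim] by simp
      have G: "coordinate_generator i ?f x = jump_term n v x i - \<alpha> * v (x ` {..<n})" if "i < n" for i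
      proof -
        have m: "(\<lambda>y. a (x i - y) * v ((x(i := y)) ` {..<n})) \<in> borel_measurable borel"
          using measurable_compose[OF measurable_Pair1'[OF xs] jump_integrand_measurable[OF v that]] by simp
        have e: "a (x i - (x i + z)) * v ((x(i := x i + z)) ` {..<n}) = a z * v ((x(i := x i + z)) ` {..<n})" for z
          by (simp add: a_sym)
        have "jump_term n v x i = (LINT z|lborel. a z * v ((x(i := x i + z)) ` {..<n}))"
          using integral_lborel_translate(1)[OF m, of "x i"] unfolding e by simp
        moreover have "coordinate_generator i ?f x = (LINT z|lborel. a z * v ((x(i := x i + z)) ` {..<n})) - (LINT z|lborel. a z * v (x ` {..<n}))"
          unfolding coordinate_generator_def right_diff_distrib
          using integrable_a_mult(1)[OF coordinate_section_measurable[OF that f xs], of c] vb a_integrable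
          by (intro Bochner_Integration.integral_diff) auto
        ultimately show ?thesis by (simp add: total_rate_def)
      qed
      have "(\<Sum>i<n. coordinate_generator i ?f x) = L_hat a v (x ` {..<n})"
        unfolding L_hat_tuple[OF elim] by (simp add: G sum_subtractf)
      then show ?case
        using K[OF h f vb xs] P by simp
    qed
    with uv jump_sg_cong[OF u v uv, of h] L_hat_cong[OF u v uv]
    show "sector_bound n (\<lambda>\<eta>. jump_sg h u \<eta> - u \<eta> - h * L_hat a u \<eta>) (K * h\<^sup>2 * c)"
      unfolding sector_bound_def by eventually_elim simp
  qed
qed

lemma jump_sg_0:
  assumes "u \<in> config_borel" "sector_bound n u c"
  shows "sector_bound n (jump_sg 0 u \<ominus> u) 0"
  using jump_sg_short_time[of n] assms by force

lemma jump_sg_commute: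
  assumes s: "0 \<le> s" and t: "0 \<le> t" and u: "u \<in> config_borel" "sector_bound n u c"
  shows "sector_bound n (jump_sg s (jump_sg t u) \<ominus> jump_sg t (jump_sg s u)) 0"
  using jump_sg_semigroup[OF s t u] jump_sg_semigroup[OF t s u] unfolding add.commute[of t s] sector_bound_def
  by eventually_elim linarith

text \<open>\<open>jump_sg t\<close> commutes with \<open>jump_sg h\<close>, hence with difference
  quotients, and at fixed \<open>n\<close> both sides are limits of such quotients.\<close>

lemma L_hat_jump_sg_commute:
  assumes t: "0 \<le> t" and u: "locally_bounded u"
  shows "sector_bound n (L_hat a (jump_sg t u) \<ominus> jump_sg t (L_hat a u)) 0"
proof (rule sector_bound_all_eps)
  fix e :: real assume e: "0 < e"
  note um = locally_bounded_measurable[OF u]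
  obtain c where c: "sector_bound n u c" using locally_bounded_sector[OF u] by blast
  have c0: "0 \<le> c" using c by (rule sector_bound_nonneg)
  obtain K where K0: "0 \<le> K" and K: "\<And>h u c. 0 \<le> h \<Longrightarrow> h \<le> 1 \<Longrightarrow> u \<in> config_borel \<Longrightarrow> sector_bound n u c \<Longrightarrow>
    sector_bound n (\<lambda>\<eta>. jump_sg h u \<eta> - u \<eta> - h * L_hat a u \<eta>) (K * h\<^sup>2 * c)"
    using jump_sg_short_time[of n] by blast
  \<comment> \<open>Chosen so that the two remainders, of total size \<open>2 * K * h * c\<close>
    after division by \<open>h\<close>, stay below \<open>e\<close>; the summand \<open>1\<close>
    keeps the denominator positive.\<close>
  define h where "h = min 1 (e / (2 * K * c + 1))"
  have h: "0 < h" "h \<le> 1" using e K0 c0 by (auto simp: h_def intro!: divide_pos_pos add_nonneg_pos)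
  have "2 * K * h * c \<le> e"
  proof -
    have "h \<le> e / (2 * K * c + 1)" by (simp add: h_def)
    moreover have "0 < 2 * K * c + 1" using K0 c0 by (intro add_nonneg_pos) auto
    ultimately have "h * (2 * K * c + 1) \<le> e" by (simp only: pos_le_divide_eq)
    then show ?thesis using h by (simp add: algebra_simps)
  qed
  note Tm = jump_sg_measurable[OF um, of t] and Lm = L_hat_measurable[OF um]
  have lbs: "locally_bounded (jump_sg h u)" "locally_bounded (L_hat a u)" "locally_bounded (\<lambda>\<eta>. h * L_hat a u \<eta>)"
    using u by (auto intro!: locally_bounded_jump_sg locally_bounded_L_hat locally_bounded_mult)
  have A: "sector_bound n (\<lambda>\<eta>. jump_sg h (jump_sg t u) \<eta> - jump_sg t u \<eta> - h * L_hat a (jump_sg t u) \<eta>) (K * h\<^sup>2 * c)"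
    using h by (intro K Tm sector_bound_jump_sg um c) auto
  have B: "sector_bound n (jump_sg t (\<lambda>\<eta>. jump_sg h u \<eta> - u \<eta> - h * L_hat a u \<eta>)) (K * h\<^sup>2 * c)"
    using h lbs u by (intro sector_bound_jump_sg K um c) (auto intro!: locally_bounded_measurable locally_bounded_diff)
  have D1: "sector_bound n (\<lambda>\<eta>. jump_sg t (\<lambda>\<zeta>. (jump_sg h u \<zeta> - u \<zeta>) - h * L_hat a u \<zeta>) \<eta> - (jump_sg t (jump_sg h u \<ominus> u) \<eta> - jump_sg t (\<lambda>\<eta>. h * L_hat a u \<eta>) \<eta>)) 0"
    using lbs u by (intro jump_sg_diff locally_bounded_diff) auto
  have D2: "sector_bound n (\<lambda>\<eta>. jump_sg t (jump_sg h u \<ominus> u) \<eta> - (jump_sg t (jump_sg h u) \<eta> - jump_sg t u \<eta>)) 0"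
    using lbs u by (intro jump_sg_diff) auto
  have D3: "sector_bound n (jump_sg h (jump_sg t u) \<ominus> jump_sg t (jump_sg h u)) 0"
    using h t by (intro jump_sg_commute[OF _ _ um c]) auto
  have "sector_bound n (\<lambda>\<eta>. h * (L_hat a (jump_sg t u) \<eta> - jump_sg t (L_hat a u) \<eta>)) (2 * (K * h\<^sup>2 * c))"
    using A B D1 D2 D3 unfolding sector_bound_def jump_sg_scale right_diff_distrib by eventually_elim linarith
  from sector_bound_mult[OF this, of "1 / h"] h
  have "sector_bound n (L_hat a (jump_sg t u) \<ominus> jump_sg t (L_hat a u)) (2 * K * h * c)"
    by (simp add: power2_eq_square mult_ac)
  then show "sector_bound n (L_hat a (jump_sg t u) \<ominus> jump_sg t (L_hat a u)) (0 + e)"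
    using \<open>2 * K * h * c \<le> e\<close> by (auto elim: sector_bound_mono)
qed

text \<open>The semigroup identity over a partition of \<open>[0, h]\<close> takes the place of
  \<open>S h u - u = \<integral>\<^sub>0\<^sup>h S s w ds\<close>.\<close>

lemma jump_sg_increment:
  assumes h: "0 \<le> h" and u: "locally_bounded u" and w: "locally_bounded w" and wu: "sector_bound n (w \<ominus> L_hat a u) 0"
    and s: "\<And>s. 0 \<le> s \<Longrightarrow> s \<le> h \<Longrightarrow> sector_bound n (jump_sg s w \<ominus> w) e"
  shows "sector_bound n (\<lambda>\<eta>. jump_sg h u \<eta> - u \<eta> - h * w \<eta>) (h * e)"
proof (rule sector_bound_all_eps)
  fix e' :: real assume e': "0 < e'"
  note um = locally_bounded_measurable[OF u] and wm = locally_bounded_measurable[OF w]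
  obtain c where c: "sector_bound n u c" using locally_bounded_sector[OF u] by blast
  have c0: "0 \<le> c" using c by (rule sector_bound_nonneg)
  obtain K where K0: "0 \<le> K" and K: "\<And>h u c. 0 \<le> h \<Longrightarrow> h \<le> 1 \<Longrightarrow> u \<in> config_borel \<Longrightarrow> sector_bound n u c \<Longrightarrow>
    sector_bound n (\<lambda>\<eta>. jump_sg h u \<eta> - u \<eta> - h * L_hat a u \<eta>) (K * h\<^sup>2 * c)"
    using jump_sg_short_time[of n] by blast
  \<comment> \<open>The partition has \<open>N\<close> steps of length \<open>d\<close>. The first
    summand gives \<open>d \<le> 1\<close>, the second makes the accumulated remainders
    \<open>N * (K * d\<^sup>2 * c)\<close> at most \<open>e'\<close>.\<close>
  obtain N :: nat where N: "h + K * h\<^sup>2 * c / e' + 1 < real N" using reals_Archimedean2 by blast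
  define d where "d = h / real N"
  have p: "0 \<le> K * h\<^sup>2 * c / e'" using K0 c0 e' by simp
  then have N0: "0 < real N" "h \<le> real N" "K * h\<^sup>2 * c / e' \<le> real N" using N h by linarith+
  have d: "0 \<le> d" "d \<le> 1" "real N * d = h" using h N0 by (auto simp: d_def)
  let ?v = "\<lambda>\<eta>. jump_sg d u \<eta> - u \<eta> - d * w \<eta>"
  have lb: "locally_bounded (jump_sg d u)" "locally_bounded (\<lambda>\<eta>. d * w \<eta>)" "locally_bounded (jump_sg d u \<ominus> u)"
    using u w by (auto intro!: locally_bounded_jump_sg locally_bounded_mult locally_bounded_diff)
  have v: "sector_bound n ?v (K * d\<^sup>2 * c)"
    using K[OF d(1,2) um c] wu unfolding sector_bound_def
  proof eventually_elim
    case (elim x)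
    then have "w (x ` {..<n}) = L_hat a u (x ` {..<n})" by simp
    then show ?case using elim by simp
  qed
  have vm: "?v \<in> config_borel"
    using lb by (auto intro!: locally_bounded_measurable locally_bounded_diff)
  have "k \<le> N \<Longrightarrow> sector_bound n (\<lambda>\<eta>. jump_sg (real k * d) u \<eta> - u \<eta> - real k * d * w \<eta>) (real k * (K * d\<^sup>2 * c + d * e))" for k
  proof (induction k)
    case 0
    then show ?case using jump_sg_0[OF um c] by simp
  next
    case (Suc k)
    let ?s = "real k * d"
    have s0: "0 \<le> ?s" "?s \<le> h"
    proof -
      show "0 \<le> ?s" using d by simp
      have "?s \<le> real N * d" using Suc.prems d(1) by (intro mult_right_mono) auto
      then show "?s \<le> h" using d(3) by simp
    qed
    have sd: "real (Suc k) * d = ?s + d" by (simp add: algebra_simps)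
    \<comment> \<open>One more step of length \<open>d\<close> adds \<open>jump_sg ?s\<close> of
      \<open>d * w\<close> plus the remainder \<open>?v\<close>. Contractivity bounds the image of
      \<open>?v\<close>, and the assumption with bound \<open>e\<close> replaces
      \<open>jump_sg ?s w\<close> by \<open>w\<close>.\<close>
    have "sector_bound n (jump_sg ?s ?v) (K * d\<^sup>2 * c)"
      by (rule sector_bound_jump_sg[OF vm v])
    moreover have "sector_bound n (\<lambda>\<eta>. jump_sg ?s (\<lambda>\<zeta>. (jump_sg d u \<zeta> - u \<zeta>) - d * w \<zeta>) \<eta> - (jump_sg ?s (jump_sg d u \<ominus> u) \<eta> - jump_sg ?s (\<lambda>\<eta>. d * w \<eta>) \<eta>)) 0"
      using lb by (intro jump_sg_diff)
    moreover have "sector_bound n (\<lambda>\<eta>. jump_sg ?s (jump_sg d u \<ominus> u) \<eta> - (jump_sg ?s (jump_sg d u) \<eta> - jump_sg ?s u \<eta>)) 0"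
      using lb u by (intro jump_sg_diff)
    moreover have "sector_bound n (jump_sg (?s + d) u \<ominus> jump_sg ?s (jump_sg d u)) 0"
      by (rule jump_sg_semigroup[OF s0(1) d(1) um c])
    moreover have "sector_bound n (\<lambda>\<eta>. d * (jump_sg ?s w \<eta> - w \<eta>)) (d * e)"
      using sector_bound_mult[OF s[OF s0], of d] d(1) by simp
    moreover have "sector_bound n (\<lambda>\<eta>. jump_sg ?s u \<eta> - u \<eta> - ?s * w \<eta>) (real k * (K * d\<^sup>2 * c + d * e))"
      using Suc by simp
    ultimately show ?case
      unfolding sector_bound_def sd jump_sg_scale right_diff_distrib
    proof eventually_elim
      case (elim x)
      have "(?s + d) * w (x ` {..<n}) = ?s * w (x ` {..<n}) + d * w (x ` {..<n})"
        "real (Suc k) * (K * d\<^sup>2 * c + d * e) = real k * (K * d\<^sup>2 * c + d * e) + K * d\<^sup>2 * c + d * e"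
        by (simp_all add: algebra_simps)
      then show ?case using elim by linarith
    qed
  qed
  from this[of N] have "sector_bound n (\<lambda>\<eta>. jump_sg h u \<eta> - u \<eta> - h * w \<eta>) (real N * (K * d\<^sup>2 * c + d * e))"
    by (simp add: d(3))
  moreover have "real N * (K * d\<^sup>2 * c + d * e) \<le> h * e + e'"
  proof -
    have "real N * (K * d\<^sup>2 * c + d * e) = K * (real N * d) * d * c + real N * d * e"
      by (simp add: algebra_simps power2_eq_square)
    also have "\<dots> = K * h\<^sup>2 * c / real N + h * e"
      unfolding d(3) by (simp add: d_def power2_eq_square)
    also have "K * h\<^sup>2 * c / real N \<le> e'"
      using N0 e' by (simp add: field_simps)
    finally show ?thesis by simp
  qed
  ultimately show "sector_bound n (\<lambda>\<eta>. jump_sg h u \<eta> - u \<eta> - h * w \<eta>) (h * e + e')"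
    by (rule sector_bound_mono)
qed

end

section \<open>The semigroup on the sun-dual space\<close>

context jump_kernel
begin

lemma K_space_norm:
  fixes u :: "'a set \<Rightarrow> real"
  assumes "u \<in> K_space \<theta>"
  obtains C where "K_norm \<theta> u = ereal C" "0 \<le> C" "\<And>n. sector_bound n u (C * exp (- \<theta> * real n))"
proof -
  have m: "u \<in> config_borel" using assms by (rule K_spaceD)
  obtain C where C: "K_norm \<theta> u = ereal C"
    using K_norm_nonneg[OF m, of \<theta>] assms by (cases "K_norm \<theta> u") (auto simp: K_space_def)
  moreover have "0 \<le> C" using K_norm_nonneg[OF m, of \<theta>] C by simp
  moreover have "\<forall>n. sector_bound n u (C * exp (- \<theta> * real n))"
    using K_norm_le_iff[OF m, of \<theta> C] C by simp
  ultimately show thesis using that by blast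
qed

lemma K_norm_leI:
  fixes u :: "'a set \<Rightarrow> real"
  assumes "u \<in> config_borel" "\<And>n. sector_bound n u (C * exp (- \<theta> * real n))"
  shows "K_norm \<theta> u \<le> ereal C"
  using assms K_norm_le_iff by blast

lemma K_norm_leD:
  fixes u :: "'a set \<Rightarrow> real"
  assumes "u \<in> config_borel" "K_norm \<theta> u \<le> ereal C"
  shows "sector_bound n u (C * exp (- \<theta> * real n))"
  using assms K_norm_le_iff by blast

lemma K_norm_triangle:
  fixes u v :: "'a set \<Rightarrow> real"
  assumes "u \<in> config_borel" "v \<in> config_borel"
    and "K_norm \<theta> u \<le> ereal C" "K_norm \<theta> v \<le> ereal C'"
  shows "K_norm \<theta> (\<lambda>\<eta>. u \<eta> + v \<eta>) \<le> ereal (C + C')" "K_norm \<theta> (u \<ominus> v) \<le> ereal (C + C')"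
proof -
  have b: "sector_bound n u (C * exp (- \<theta> * real n))" "sector_bound n v (C' * exp (- \<theta> * real n))" for n
    using assms K_norm_le_iff by blast+
  show "K_norm \<theta> (\<lambda>\<eta>. u \<eta> + v \<eta>) \<le> ereal (C + C')"
    using assms b by (intro K_norm_leI) (auto simp: distrib_right intro!: sector_bound_add)
  show "K_norm \<theta> (u \<ominus> v) \<le> ereal (C + C')"
    using assms b by (intro K_norm_leI) (auto simp: distrib_right intro!: sector_bound_diff)
qed

lemma K_norm_mult:
  fixes u :: "'a set \<Rightarrow> real"
  assumes "u \<in> config_borel" "K_norm \<theta> u \<le> ereal C"
  shows "K_norm \<theta> (\<lambda>\<eta>. c * u \<eta>) \<le> ereal (\<bar>c\<bar> * C)"
proof -
  have "sector_bound n u (C * exp (- \<theta> * real n))" for n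
    using assms K_norm_le_iff by blast
  then have "sector_bound n (\<lambda>\<eta>. c * u \<eta>) (\<bar>c\<bar> * C * exp (- \<theta> * real n))" for n
    using sector_bound_mult[of n u _ c] by (simp add: mult.assoc)
  then show ?thesis using assms by (intro K_norm_leI) auto
qed

lemma K_norm_AE_cong_le:
  fixes u v :: "'a set \<Rightarrow> real"
  assumes "v \<in> config_borel" "u \<in> config_borel" "K_norm \<theta> u \<le> ereal C" "\<And>n. sector_bound n (v \<ominus> u) 0"
  shows "K_norm \<theta> v \<le> ereal C"
proof (rule K_norm_leI[OF assms(1)])
  fix n
  have "sector_bound n u (C * exp (- \<theta> * real n))" using assms K_norm_le_iff by blast
  with assms(4)[of n] show "sector_bound n v (C * exp (- \<theta> * real n))"
    unfolding sector_bound_def by eventually_elim simp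
qed

lemma K_space_diff:
  fixes u v :: "'a set \<Rightarrow> real"
  assumes u: "u \<in> K_space \<theta>" and v: "v \<in> K_space \<theta>"
  shows "(u \<ominus> v) \<in> K_space \<theta>"
proof -
  obtain C C' where "K_norm \<theta> u \<le> ereal C" "K_norm \<theta> v \<le> ereal C'" using K_spaceD(2)[OF u] K_spaceD(2)[OF v] by blast
  from K_norm_triangle(2)[OF K_spaceD(1)[OF u] K_spaceD(1)[OF v] this]
  show ?thesis using K_spaceD(1)[OF u] K_spaceD(1)[OF v] by (intro K_spaceI) auto
qed

lemma K_space_add:
  fixes u v :: "'a set \<Rightarrow> real"
  assumes u: "u \<in> K_space \<theta>" and v: "v \<in> K_space \<theta>"
  shows "(\<lambda>\<eta>. u \<eta> + v \<eta>) \<in> K_space \<theta>"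
proof -
  obtain C C' where "K_norm \<theta> u \<le> ereal C" "K_norm \<theta> v \<le> ereal C'" using K_spaceD(2)[OF u] K_spaceD(2)[OF v] by blast
  from K_norm_triangle(1)[OF K_spaceD(1)[OF u] K_spaceD(1)[OF v] this]
  show ?thesis using K_spaceD(1)[OF u] K_spaceD(1)[OF v] by (intro K_spaceI) auto
qed

lemma K_space_mult:
  fixes u :: "'a set \<Rightarrow> real"
  assumes u: "u \<in> K_space \<theta>"
  shows "(\<lambda>\<eta>. c * u \<eta>) \<in> K_space \<theta>"
proof -
  obtain C where "K_norm \<theta> u \<le> ereal C" using K_spaceD[OF u] by blast
  then show ?thesis using K_norm_mult[of u \<theta> C c] K_spaceD[OF u] by (intro K_spaceI) auto
qed

lemma K_norm_jump_sg:
  assumes "u \<in> config_borel" "K_norm \<theta> u \<le> ereal C"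
  shows "K_norm \<theta> (jump_sg t u) \<le> ereal C"
  using assms K_norm_le_iff by (intro K_norm_leI jump_sg_measurable sector_bound_jump_sg) blast+

lemma K_space_jump_sg:
  fixes u :: "'a set \<Rightarrow> real"
  assumes u: "u \<in> K_space \<theta>"
  shows "jump_sg t u \<in> K_space \<theta>"
proof -
  obtain C where "K_norm \<theta> u \<le> ereal C" using K_spaceD(2)[OF u] by blast
  then show ?thesis using K_spaceD(1)[OF u] by (intro K_spaceI jump_sg_measurable K_norm_jump_sg)
qed

lemma Q_spaceD:
  assumes "u \<in> Q_space a \<theta>"
  shows "u \<in> K_space \<theta>" "u \<in> config_borel"
  using assms by (auto simp: Q_space_def dest: K_spaceD)

lemma Q_space_approx:
  assumes "u \<in> Q_space a \<theta>" "0 < e"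
  obtains v w where "(v, w) \<in> adjoint_graph a \<theta>" "K_norm \<theta> (u \<ominus> v) \<le> ereal e"
  using assms unfolding Q_space_def by (auto dest!: spec[of _ e] intro: order.strict_implies_order)

lemma Q_spaceI:
  assumes "u \<in> K_space \<theta>" "\<And>e. 0 < e \<Longrightarrow> \<exists>v w. (v, w) \<in> adjoint_graph a \<theta> \<and> K_norm \<theta> (u \<ominus> v) \<le> ereal e"
  shows "u \<in> Q_space a \<theta>"
  unfolding Q_space_def
proof (intro CollectI conjI allI impI assms(1))
  fix e :: real assume e: "0 < e"
  obtain v w where "(v, w) \<in> adjoint_graph a \<theta>" "K_norm \<theta> (u \<ominus> v) \<le> ereal (e / 2)"
    using assms(2)[of "e / 2"] e by auto
  moreover have "ereal (e / 2) < ereal e" using e by simp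
  ultimately show "\<exists>u'\<in>Domain (adjoint_graph a \<theta>). K_norm \<theta> (u \<ominus> u') < ereal e"
    by (meson DomainI le_less_trans)
qed

lemma adjoint_graph_K_space: "(u, w) \<in> adjoint_graph a \<theta> \<Longrightarrow> u \<in> K_space \<theta> \<and> w \<in> K_space \<theta>"
  by (simp add: adjoint_graph_def)

lemma adjoint_graph_Q: "(u, w) \<in> adjoint_graph a \<theta> \<Longrightarrow> u \<in> Q_space a \<theta>"
proof (rule Q_spaceI)
  assume uw: "(u, w) \<in> adjoint_graph a \<theta>"
  then show "u \<in> K_space \<theta>" by (simp add: adjoint_graph_def)
  fix e :: real assume "0 < e"
  then have "K_norm \<theta> (u \<ominus> u) \<le> ereal e"
    by (intro K_norm_leI) (auto simp: sector_bound_def)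
  with uw show "\<exists>v w. (v, w) \<in> adjoint_graph a \<theta> \<and> K_norm \<theta> (u \<ominus> v) \<le> ereal e" by blast
qed

text \<open>By \<open>adjoint_graph_iff\<close> only the equation for each \<open>n\<close> has to
  be preserved besides the norm bounds, and there \<open>L_hat\<close> commutes with the semigroup.
  Hence the domain, and with it its closure \<open>Q_space\<close>, is invariant.\<close>

lemma adjoint_graph_jump_sg:
  assumes uw: "(u, w) \<in> adjoint_graph a \<theta>" and t: "0 \<le> t"
  shows "(jump_sg t u, jump_sg t w) \<in> adjoint_graph a \<theta>"
proof -
  have u: "u \<in> K_space \<theta>" and w: "w \<in> K_space \<theta>" and wu: "\<And>n. sector_bound n (w \<ominus> L_hat a u) 0"
    using uw by (auto simp: adjoint_graph_iff)
  have "sector_bound n (jump_sg t w \<ominus> L_hat a (jump_sg t u)) 0" for n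
    using jump_sg_cong[OF K_spaceD(1)[OF w] L_hat_measurable[OF K_spaceD(1)[OF u]] wu, of n t]
      L_hat_jump_sg_commute[OF t K_space_locally_bounded[OF u], of n]
    unfolding sector_bound_def by eventually_elim linarith
  then show ?thesis
    unfolding adjoint_graph_iff using K_space_jump_sg u w by blast
qed

text \<open>The bound in \<open>jump_sg_increment\<close> contains no constant depending on
  \<open>n\<close>, so it passes from the sectors to the norm.\<close>

lemma K_norm_jump_sg_increment:
  assumes uw: "(u, w) \<in> adjoint_graph a \<theta>" and h: "0 \<le> h"
    and s: "\<And>s. 0 \<le> s \<Longrightarrow> s \<le> h \<Longrightarrow> K_norm \<theta> (jump_sg s w \<ominus> w) \<le> ereal e"
  shows "K_norm \<theta> (\<lambda>\<eta>. jump_sg h u \<eta> - u \<eta> - h * w \<eta>) \<le> ereal (h * e)"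
proof (rule K_norm_leI)
  have u: "u \<in> K_space \<theta>" and w: "w \<in> K_space \<theta>" and wu: "\<And>n. sector_bound n (w \<ominus> L_hat a u) 0"
    using uw by (auto simp: adjoint_graph_iff)
  note [measurable] = K_spaceD(1)[OF u] K_spaceD(1)[OF w] jump_sg_measurable
  show "(\<lambda>\<eta>. jump_sg h u \<eta> - u \<eta> - h * w \<eta>) \<in> config_borel"
    by measurable
  fix n
  have "sector_bound n (jump_sg s w \<ominus> w) (e * exp (- \<theta> * real n))" if "0 \<le> s" "s \<le> h" for s
    by (rule K_norm_leD[OF _ s[OF that]]) measurable
  from jump_sg_increment[OF h K_space_locally_bounded[OF u] K_space_locally_bounded[OF w] wu this]
  show "sector_bound n (\<lambda>\<eta>. jump_sg h u \<eta> - u \<eta> - h * w \<eta>) (h * e * exp (- \<theta> * real n))"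
    by (simp add: mult.assoc)
qed

text \<open>By contractivity \<open>jump_sg s w \<ominus> w\<close> has norm at most
  \<open>2 * C\<close>, and the term \<open>h * w\<close> adds one more \<open>C\<close>.\<close>

lemma K_norm_jump_sg_Lipschitz:
  assumes uw: "(u, w) \<in> adjoint_graph a \<theta>" and h: "0 \<le> h" and C: "K_norm \<theta> w \<le> ereal C"
  shows "K_norm \<theta> (jump_sg h u \<ominus> u) \<le> ereal (3 * h * C)"
proof -
  have u: "u \<in> K_space \<theta>" and w: "w \<in> K_space \<theta>" using uw adjoint_graph_K_space by auto
  note [measurable] = K_spaceD(1)[OF u] K_spaceD(1)[OF w] jump_sg_measurable
  have "K_norm \<theta> (jump_sg s w \<ominus> w) \<le> ereal (C + C)" for s
    by (intro K_norm_triangle K_norm_jump_sg C) measurable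
  then have "K_norm \<theta> (\<lambda>\<eta>. jump_sg h u \<eta> - u \<eta> - h * w \<eta>) \<le> ereal (h * (C + C))"
    by (intro K_norm_jump_sg_increment[OF uw h])
  moreover have "K_norm \<theta> (\<lambda>\<eta>. h * w \<eta>) \<le> ereal (\<bar>h\<bar> * C)"
    by (intro K_norm_mult C) measurable
  ultimately have "K_norm \<theta> (\<lambda>\<eta>. (jump_sg h u \<eta> - u \<eta> - h * w \<eta>) + h * w \<eta>) \<le> ereal (h * (C + C) + \<bar>h\<bar> * C)"
    by (intro K_norm_triangle) measurable
  then show ?thesis using h by (simp add: algebra_simps)
qed

lemma jump_sg_K_diff:
  assumes "u \<in> K_space \<theta>" "v \<in> K_space \<theta>" "K_norm \<theta> (u \<ominus> v) \<le> ereal C"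
  shows "K_norm \<theta> (jump_sg t u \<ominus> jump_sg t v) \<le> ereal C"
proof (rule K_norm_AE_cong_le)
  note [measurable] = K_spaceD(1)[OF assms(1)] K_spaceD(1)[OF assms(2)] jump_sg_measurable
  show "K_norm \<theta> (jump_sg t (u \<ominus> v)) \<le> ereal C"
    by (intro K_norm_jump_sg assms(3)) measurable
  show "sector_bound n (jump_sg t u \<ominus> jump_sg t v \<ominus> jump_sg t (u \<ominus> v)) 0" for n
    using jump_sg_diff[OF K_space_locally_bounded[OF assms(1)] K_space_locally_bounded[OF assms(2)], of n t]
    unfolding sector_bound_def by eventually_elim simp
qed (auto intro!: jump_sg_measurable borel_measurable_diff K_spaceD(1)[OF assms(1)] K_spaceD(1)[OF assms(2)])

lemma Q_space_jump_sg:
  assumes u: "u \<in> Q_space a \<theta>" and t: "0 \<le> t"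
  shows "jump_sg t u \<in> Q_space a \<theta>"
proof (rule Q_spaceI)
  note uK = Q_spaceD(1)[OF u]
  then show "jump_sg t u \<in> K_space \<theta>" by (rule K_space_jump_sg)
  fix e :: real assume "0 < e"
  then obtain v w where vw: "(v, w) \<in> adjoint_graph a \<theta>" "K_norm \<theta> (u \<ominus> v) \<le> ereal e"
    using Q_space_approx[OF u] by metis
  then show "\<exists>v w. (v, w) \<in> adjoint_graph a \<theta> \<and> K_norm \<theta> (jump_sg t u \<ominus> v) \<le> ereal e"
    using adjoint_graph_jump_sg[OF vw(1) t] jump_sg_K_diff[OF uK _ vw(2)] adjoint_graph_K_space[OF vw(1)] by blast
qed

text \<open>\<open>Q_space\<close> is the closure of the domain of the adjoint, on which
  \<open>K_norm_jump_sg_Lipschitz\<close> applies, and contractivity transports the approximation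
  error.\<close>

lemma jump_sg_strongly_continuous:
  assumes u: "u \<in> Q_space a \<theta>" and e: "0 < e"
  obtains d where "0 < d" "\<And>s. 0 \<le> s \<Longrightarrow> s \<le> d \<Longrightarrow> K_norm \<theta> (jump_sg s u \<ominus> u) \<le> ereal e"
proof -
  obtain v w where vw: "(v, w) \<in> adjoint_graph a \<theta>" "K_norm \<theta> (u \<ominus> v) \<le> ereal (e / 3)"
    using Q_space_approx[OF u, of "e / 3"] e by auto
  have v: "v \<in> K_space \<theta>" and w: "w \<in> K_space \<theta>" using vw adjoint_graph_K_space by auto
  obtain C where C: "0 \<le> C" "K_norm \<theta> w \<le> ereal C" using K_spaceD[OF w] by auto
  \<comment> \<open>Makes the Lipschitz term \<open>3 * s * C\<close> at most \<open>e / 3\<close>,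
    also for \<open>C = 0\<close>.\<close>
  let ?d = "e / (9 * C + 1)"
  have D: "0 < 9 * C + 1" using C by simp
  note [measurable] = K_spaceD(1)[OF v] Q_spaceD(2)[OF u] jump_sg_measurable
  show thesis
  proof (rule that)
    show "0 < ?d" using e D by simp
    fix s assume s: "0 \<le> s" "s \<le> ?d"
    have "s * (9 * C + 1) \<le> e" using s(2) D by (simp only: pos_le_divide_eq)
    then have "3 * s * C \<le> e / 3" using s(1) by (simp add: algebra_simps)
    have "K_norm \<theta> (\<lambda>\<eta>. (jump_sg s u \<eta> - jump_sg s v \<eta>) + (jump_sg s v \<eta> - v \<eta>) - (u \<eta> - v \<eta>)) \<le> ereal (e / 3 + 3 * s * C + e / 3)"
      by (intro K_norm_triangle jump_sg_K_diff Q_spaceD(1)[OF u] v vw K_norm_jump_sg_Lipschitz[OF vw(1) s(1) C(2)]) measurable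
    then have "K_norm \<theta> (jump_sg s u \<ominus> u) \<le> ereal (e / 3 + 3 * s * C + e / 3)"
      by simp
    also have "\<dots> \<le> ereal e" using \<open>3 * s * C \<le> e / 3\<close> by simp
    finally show "K_norm \<theta> (jump_sg s u \<ominus> u) \<le> ereal e" .
  qed
qed

theorem jump_sg_C0_semigroup: "C0_semigroup \<theta> (Q_space a \<theta>) jump_sg"
  unfolding C0_semigroup_def
proof (intro conjI allI impI ballI)
  note [measurable] = Q_spaceD(2) jump_sg_measurable
  show "jump_sg t u \<in> Q_space a \<theta>" if "0 \<le> t" "u \<in> Q_space a \<theta>" for t u
    using that by (rule Q_space_jump_sg[rotated])
  show "AE \<eta> in lebesgue_poisson. jump_sg t (\<lambda>\<zeta>. u \<zeta> + v \<zeta>) \<eta> = jump_sg t u \<eta> + jump_sg t v \<eta>"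
    if "u \<in> Q_space a \<theta>" "v \<in> Q_space a \<theta>" for t u v
    using that by (subst AE_lebesgue_poisson_eq_iff)
      (auto intro!: jump_sg_add jump_sg_measurable borel_measurable_add K_space_locally_bounded dest: Q_spaceD)
  show "AE \<eta> in lebesgue_poisson. jump_sg t (\<lambda>\<zeta>. c * u \<zeta>) \<eta> = c * jump_sg t u \<eta>" for t c u
    by (simp add: jump_sg_scale)
  show "\<exists>C. \<forall>u\<in>Q_space a \<theta>. K_norm \<theta> (jump_sg t u) \<le> ereal C * K_norm \<theta> u" for t
  proof (intro exI[of _ 1] ballI)
    fix u assume "u \<in> Q_space a \<theta>"
    then obtain C where "K_norm \<theta> u = ereal C" using K_space_norm[OF Q_spaceD(1)] by metis
    then show "K_norm \<theta> (jump_sg t u) \<le> ereal 1 * K_norm \<theta> u"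
      using K_norm_jump_sg[OF Q_spaceD(2)[OF \<open>u \<in> Q_space a \<theta>\<close>], of \<theta> C t] by simp
  qed
  show "jump_sg 0 u \<doteq> u" if u: "u \<in> Q_space a \<theta>" for u
    using locally_bounded_sector[OF K_space_locally_bounded[OF Q_spaceD(1)[OF u]]] jump_sg_0[OF Q_spaceD(2)[OF u]]
    by (subst AE_lebesgue_poisson_eq_iff) (auto intro!: jump_sg_measurable Q_spaceD(2)[OF u])
  show "jump_sg (s + t) u \<doteq> jump_sg s (jump_sg t u)"
    if "0 \<le> s" "0 \<le> t" and u: "u \<in> Q_space a \<theta>" for s t u
    using locally_bounded_sector[OF K_space_locally_bounded[OF Q_spaceD(1)[OF u]]] jump_sg_semigroup[OF that(1,2) Q_spaceD(2)[OF u]]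
    by (subst AE_lebesgue_poisson_eq_iff) (auto intro!: jump_sg_measurable Q_spaceD(2)[OF u])
  show "((\<lambda>t. K_norm \<theta> (jump_sg t u \<ominus> u)) \<longlongrightarrow> 0) (at_right 0)" if u: "u \<in> Q_space a \<theta>" for u
  proof (subst K_norm_tendsto_0_iff)
    show "\<forall>\<^sub>F t in at_right 0. (jump_sg t u \<ominus> u) \<in> config_borel"
      by (intro always_eventually allI borel_measurable_diff jump_sg_measurable Q_spaceD(2)[OF u])
    show "\<forall>e>0. \<forall>\<^sub>F t in at_right 0. K_norm \<theta> (jump_sg t u \<ominus> u) \<le> ereal e"
    proof safe
      fix e :: real assume "0 < e"
      then obtain d where "0 < d" "\<And>s. 0 \<le> s \<Longrightarrow> s \<le> d \<Longrightarrow> K_norm \<theta> (jump_sg s u \<ominus> u) \<le> ereal e"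
        using jump_sg_strongly_continuous[OF u] by metis
      then show "\<forall>\<^sub>F t in at_right 0. K_norm \<theta> (jump_sg t u \<ominus> u) \<le> ereal e"
        unfolding eventually_at_right_field by (intro exI[of _ d]) auto
    qed
  qed
qed

text \<open>For \<open>w\<close> in \<open>Q_space\<close> the error in
  \<open>K_norm_jump_sg_increment\<close> tends to \<open>0\<close> by strong continuity; this is
  where the sun part enters in place of the full adjoint. Conversely, convergence in norm implies
  convergence for each \<open>n\<close>, and there the limit can only be
  \<open>L_hat a u\<close>.\<close>

theorem jump_sg_generator: "generator_graph \<theta> (Q_space a \<theta>) jump_sg = sun_graph a \<theta>"
proof (intro equalityI subrelI)
  fix u w assume uw: "(u, w) \<in> sun_graph a \<theta>"
  then have ad: "(u, w) \<in> adjoint_graph a \<theta>" and wQ: "w \<in> Q_space a \<theta>" by (auto simp: sun_graph_def)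
  have uQ: "u \<in> Q_space a \<theta>" using ad by (rule adjoint_graph_Q)
  note [measurable] = Q_spaceD(2)[OF uQ] Q_spaceD(2)[OF wQ] jump_sg_measurable
  have "((\<lambda>h. K_norm \<theta> (\<lambda>\<eta>. (jump_sg h u \<eta> - u \<eta>) / h - w \<eta>)) \<longlongrightarrow> 0) (at_right 0)"
  proof (subst K_norm_tendsto_0_iff)
    show "\<forall>\<^sub>F h in at_right 0. (\<lambda>\<eta>. (jump_sg h u \<eta> - u \<eta>) / h - w \<eta>) \<in> config_borel"
      by (intro always_eventually allI) measurable
    show "\<forall>e>0. \<forall>\<^sub>F h in at_right 0. K_norm \<theta> (\<lambda>\<eta>. (jump_sg h u \<eta> - u \<eta>) / h - w \<eta>) \<le> ereal e"
    proof safe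
      fix e :: real assume e: "0 < e"
      then obtain d where d: "0 < d" "\<And>s. 0 \<le> s \<Longrightarrow> s \<le> d \<Longrightarrow> K_norm \<theta> (jump_sg s w \<ominus> w) \<le> ereal e"
        using jump_sg_strongly_continuous[OF wQ] by metis
      have "K_norm \<theta> (\<lambda>\<eta>. (jump_sg h u \<eta> - u \<eta>) / h - w \<eta>) \<le> ereal e" if h: "0 < h" "h < d" for h
      proof -
        have "K_norm \<theta> (\<lambda>\<eta>. jump_sg h u \<eta> - u \<eta> - h * w \<eta>) \<le> ereal (h * e)"
          using h d by (intro K_norm_jump_sg_increment[OF ad]) auto
        then have "K_norm \<theta> (\<lambda>\<eta>. 1 / h * (jump_sg h u \<eta> - u \<eta> - h * w \<eta>)) \<le> ereal (\<bar>1 / h\<bar> * (h * e))"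
          by (intro K_norm_mult) measurable
        then show ?thesis using h by (simp add: diff_divide_distrib)
      qed
      then show "\<forall>\<^sub>F h in at_right 0. K_norm \<theta> (\<lambda>\<eta>. (jump_sg h u \<eta> - u \<eta>) / h - w \<eta>) \<le> ereal e"
        unfolding eventually_at_right_field using d(1) by auto
    qed
  qed
  then show "(u, w) \<in> generator_graph \<theta> (Q_space a \<theta>) jump_sg"
    using uQ wQ by (simp add: generator_graph_def)
next
  fix u w assume "(u, w) \<in> generator_graph \<theta> (Q_space a \<theta>) jump_sg"
  then have uQ: "u \<in> Q_space a \<theta>" and wQ: "w \<in> Q_space a \<theta>"
    and lim: "((\<lambda>h. K_norm \<theta> (\<lambda>\<eta>. (jump_sg h u \<eta> - u \<eta>) / h - w \<eta>)) \<longlongrightarrow> 0) (at_right 0)"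
    by (auto simp: generator_graph_def)
  note um[measurable] = Q_spaceD(2)[OF uQ] and wm[measurable] = Q_spaceD(2)[OF wQ] and [measurable] = jump_sg_measurable
  have "sector_bound n (w \<ominus> L_hat a u) 0" for n
  proof (rule sector_bound_all_eps)
    fix e :: real assume e: "0 < e"
    obtain c where c: "sector_bound n u c" using locally_bounded_sector[OF K_space_locally_bounded[OF Q_spaceD(1)[OF uQ]]] by blast
    have c0: "0 \<le> c" using c by (rule sector_bound_nonneg)
    obtain K where K0: "0 \<le> K" and K: "\<And>h u c. 0 \<le> h \<Longrightarrow> h \<le> 1 \<Longrightarrow> u \<in> config_borel \<Longrightarrow> sector_bound n u c \<Longrightarrow>
      sector_bound n (\<lambda>\<eta>. jump_sg h u \<eta> - u \<eta> - h * L_hat a u \<eta>) (K * h\<^sup>2 * c)"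
      using jump_sg_short_time[of n] by blast
    \<comment> \<open>Undoes the weight \<open>exp (- \<theta> * n)\<close> at the fixed
      \<open>n\<close>, leaving \<open>e / 2\<close>.\<close>
    define e' where "e' = e / 2 * exp (\<theta> * real n)"
    have e': "0 < e'" using e by (simp add: e'_def)
    have "\<forall>\<^sub>F h in at_right 0. K_norm \<theta> (\<lambda>\<eta>. (jump_sg h u \<eta> - u \<eta>) / h - w \<eta>) \<le> ereal e'"
      using lim e' by (subst (asm) K_norm_tendsto_0_iff) (auto intro!: always_eventually)
    then obtain b where b: "0 < b" "\<And>h. 0 < h \<Longrightarrow> h < b \<Longrightarrow> K_norm \<theta> (\<lambda>\<eta>. (jump_sg h u \<eta> - u \<eta>) / h - w \<eta>) \<le> ereal e'"
      unfolding eventually_at_right_field by auto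
    define h where "h = min (b / 2) (min 1 (e / (2 * (K * c + 1))))"
    have Kc: "0 < 2 * (K * c + 1)" using K0 c0 by (simp add: add_nonneg_pos)
    have h: "0 < h" "h < b" "h \<le> 1" "h \<le> e / (2 * (K * c + 1))" using b(1) e Kc by (auto simp: h_def)
    have Khc: "K * h * c \<le> e / 2"
    proof -
      have "h * (2 * (K * c + 1)) \<le> e" using h(4) Kc by (simp only: pos_le_divide_eq)
      then show ?thesis using h(1) by (simp add: algebra_simps)
    qed
    have "sector_bound n (\<lambda>\<eta>. (jump_sg h u \<eta> - u \<eta>) / h - w \<eta>) (e' * exp (- \<theta> * real n))"
      by (rule K_norm_leD[OF _ b(2)[OF h(1,2)]]) measurable
    moreover have "e' * exp (- \<theta> * real n) = e / 2"
      by (simp add: e'_def exp_minus)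
    moreover have "sector_bound n (\<lambda>\<eta>. 1 / h * (jump_sg h u \<eta> - u \<eta> - h * L_hat a u \<eta>)) (\<bar>1 / h\<bar> * (K * h\<^sup>2 * c))"
      using h by (intro sector_bound_mult K um c) auto
    moreover have "\<bar>1 / h\<bar> * (K * h\<^sup>2 * c) = K * h * c" using h by (simp add: power2_eq_square)
    moreover have "1 / h * (jump_sg h u \<eta> - u \<eta> - h * L_hat a u \<eta>) = (jump_sg h u \<eta> - u \<eta>) / h - L_hat a u \<eta>" for \<eta>
      using h by (simp add: field_simps)
    ultimately have "sector_bound n (\<lambda>\<eta>. (jump_sg h u \<eta> - u \<eta>) / h - w \<eta>) (e / 2)"
      "sector_bound n (\<lambda>\<eta>. (jump_sg h u \<eta> - u \<eta>) / h - L_hat a u \<eta>) (K * h * c)" by (simp_all only:)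
    then show "sector_bound n (w \<ominus> L_hat a u) (0 + e)"
      unfolding sector_bound_def by eventually_elim (use Khc in linarith)
  qed
  then show "(u, w) \<in> sun_graph a \<theta>"
    using wQ Q_spaceD(1)[OF uQ] Q_spaceD(1)[OF wQ] by (simp add: sun_graph_def adjoint_graph_iff)
qed

text \<open>\<open>jump_sg\<close> witnesses that the choice is not vacuous. These two properties
  are all that is used of the chosen semigroup.\<close>

lemma sun_semigroup_spec:
  "C0_semigroup \<theta> (Q_space a \<theta>) (sun_semigroup a \<theta>)"
  "generator_graph \<theta> (Q_space a \<theta>) (sun_semigroup a \<theta>) = sun_graph a \<theta>"
proof -
  have "C0_semigroup \<theta> (Q_space a \<theta>) (sun_semigroup a \<theta>) \<and> generator_graph \<theta> (Q_space a \<theta>) (sun_semigroup a \<theta>) = sun_graph a \<theta>"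
    unfolding sun_semigroup_def by (rule someI[of _ jump_sg]) (simp add: jump_sg_C0_semigroup jump_sg_generator)
  then show "C0_semigroup \<theta> (Q_space a \<theta>) (sun_semigroup a \<theta>)"
    "generator_graph \<theta> (Q_space a \<theta>) (sun_semigroup a \<theta>) = sun_graph a \<theta>" by auto
qed

text \<open>The factor \<open>n\<close> lost by \<open>L_hat\<close> is absorbed by the gap between
  the weights, since \<open>x * exp (- x) \<le> 1\<close> yields \<open>n * exp (- (\<theta>' -
  \<theta>) * n) \<le> 1 / (\<theta>' - \<theta>)\<close>.\<close>

lemma K_space_adjoint_graph:
  assumes u: "u \<in> K_space \<theta>'" and "\<theta> < \<theta>'"
  shows "(u, L_hat a u) \<in> adjoint_graph a \<theta>"
proof -
  obtain C where C: "0 \<le> C" "\<And>n. sector_bound n u (C * exp (- \<theta>' * real n))"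
    using K_space_norm[OF u] by metis
  note um = K_spaceD(1)[OF u]
  let ?d = "\<theta>' - \<theta>"
  have d: "0 < ?d" using assms by simp
  have e: "exp (- \<theta>' * real n) = exp (- ?d * real n) * exp (- \<theta> * real n)" for n
    by (simp add: exp_add[symmetric] algebra_simps)
  have "u \<in> K_space \<theta>"
  proof (rule K_spaceI[OF um K_norm_leI[OF um]])
    fix n show "sector_bound n u (C * exp (- \<theta> * real n))"
      using C d by (intro sector_bound_mono[OF C(2)]) (auto simp: mult_left_mono mult_right_mono)
  qed
  moreover have "L_hat a u \<in> K_space \<theta>"
  proof (rule K_spaceI[OF L_hat_measurable[OF um] K_norm_leI[OF L_hat_measurable[OF um]]])
    fix n
    define x where "x = ?d * real n"
    have "x \<le> exp x" using exp_ge_add_one_self[of x] by linarith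
    then have "x * exp (- x) \<le> exp x * exp (- x)" by (intro mult_right_mono) auto
    then have "x * exp (- x) \<le> 1" by (simp add: exp_minus)
    then have "real n * exp (- ?d * real n) * ?d \<le> 1"
      unfolding x_def minus_mult_left by (simp only: mult.commute mult.left_commute)
    then have "real n * exp (- ?d * real n) \<le> 1 / ?d"
      using d by (simp only: pos_le_divide_eq)
    then have "2 * \<alpha> * C * (real n * exp (- ?d * real n)) * exp (- \<theta> * real n) \<le> 2 * \<alpha> * C * (1 / ?d) * exp (- \<theta> * real n)"
      using C rate_nonneg by (intro mult_right_mono mult_left_mono) auto
    then have "2 * \<alpha> * real n * (C * exp (- \<theta>' * real n)) \<le> 2 * \<alpha> * C * (1 / ?d) * exp (- \<theta> * real n)"
      unfolding e by (simp add: mult_ac)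
    then show "sector_bound n (L_hat a u) (2 * \<alpha> * C * (1 / ?d) * exp (- \<theta> * real n))"
      by (rule sector_bound_mono[OF sector_bound_L_hat[OF um C(2)]])
  qed
  ultimately show ?thesis
    by (simp add: adjoint_graph_iff sector_bound_def)
qed

text \<open>The image under \<open>L_hat\<close> has to lie in \<open>Q_space\<close>, for which
  membership in the domain of the adjoint is enough. So the gap is spent in two halves, one for each
  application of \<open>L_hat\<close>.\<close>

theorem K_space_sun_domain:
  assumes "\<theta> < \<theta>'"
  shows "K_space \<theta>' \<subseteq> sun_domain a \<theta>"
proof
  fix u :: "'a set \<Rightarrow> real" assume u: "u \<in> K_space \<theta>'"
  let ?m = "(\<theta> + \<theta>') / 2"
  have m: "\<theta> < ?m" "?m < \<theta>'" using assms by (auto simp: field_simps)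
  have "(u, L_hat a u) \<in> adjoint_graph a ?m" by (rule K_space_adjoint_graph[OF u m(2)])
  then have "L_hat a u \<in> K_space ?m" by (simp add: adjoint_graph_def)
  then have "(L_hat a u, L_hat a (L_hat a u)) \<in> adjoint_graph a \<theta>" by (rule K_space_adjoint_graph[OF _ m(1)])
  then have "L_hat a u \<in> Q_space a \<theta>" by (rule adjoint_graph_Q)
  with K_space_adjoint_graph[OF u assms] show "u \<in> sun_domain a \<theta>"
    by (auto simp: sun_graph_def)
qed

end

section \<open>Classical solutions\<close>

context jump_kernel
begin

text \<open>An infinite norm would become \<open>0\<close> under \<open>real_of_ereal\<close>, so
  this is a norm on \<open>K_space\<close> only, and it is used there.\<close>

definition K_nrm :: "real \<Rightarrow> ('a set \<Rightarrow> real) \<Rightarrow> real" where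
  "K_nrm \<theta> u = real_of_ereal (K_norm \<theta> u)"

lemma K_norm_eq_nrm: "u \<in> K_space \<theta> \<Longrightarrow> K_norm \<theta> u = ereal (K_nrm \<theta> u)"
  by (elim K_space_norm) (simp add: K_nrm_def)

lemma K_nrm_nonneg: "u \<in> K_space \<theta> \<Longrightarrow> 0 \<le> K_nrm \<theta> u"
  by (elim K_space_norm) (simp add: K_nrm_def)

lemma K_nrm_le_iff: "u \<in> K_space \<theta> \<Longrightarrow> K_nrm \<theta> u \<le> C \<longleftrightarrow> K_norm \<theta> u \<le> ereal C"
  by (simp add: K_norm_eq_nrm)

lemma K_nrm_sector: "u \<in> K_space \<theta> \<Longrightarrow> sector_bound n u (K_nrm \<theta> u * exp (- \<theta> * real n))"
  by (elim K_space_norm) (simp add: K_nrm_def)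

lemma K_nrm_leI: "u \<in> K_space \<theta> \<Longrightarrow> (\<And>n. sector_bound n u (C * exp (- \<theta> * real n))) \<Longrightarrow> K_nrm \<theta> u \<le> C"
  using K_norm_leI K_nrm_le_iff K_spaceD(1) by blast

lemma K_nrm_add: "u \<in> K_space \<theta> \<Longrightarrow> v \<in> K_space \<theta> \<Longrightarrow> K_nrm \<theta> (\<lambda>\<eta>. u \<eta> + v \<eta>) \<le> K_nrm \<theta> u + K_nrm \<theta> v"
  by (subst K_nrm_le_iff[OF K_space_add]) (auto intro!: K_norm_triangle dest: K_spaceD simp: K_norm_eq_nrm)

lemma K_nrm_diff: "u \<in> K_space \<theta> \<Longrightarrow> v \<in> K_space \<theta> \<Longrightarrow> K_nrm \<theta> (u \<ominus> v) \<le> K_nrm \<theta> u + K_nrm \<theta> v"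
  by (subst K_nrm_le_iff[OF K_space_diff]) (auto intro!: K_norm_triangle dest: K_spaceD simp: K_norm_eq_nrm)

lemma K_nrm_mult_le: "u \<in> K_space \<theta> \<Longrightarrow> K_nrm \<theta> (\<lambda>\<eta>. c * u \<eta>) \<le> \<bar>c\<bar> * K_nrm \<theta> u"
  by (subst K_nrm_le_iff[OF K_space_mult]) (auto intro!: K_norm_mult dest: K_spaceD simp: K_norm_eq_nrm)

lemma K_nrm_AE_cong_le:
  assumes u: "u \<in> K_space \<theta>" and v: "v \<in> K_space \<theta>" and uv: "v \<doteq> u"
  shows "K_nrm \<theta> v \<le> K_nrm \<theta> u"
  unfolding K_nrm_le_iff[OF v]
proof (rule K_norm_AE_cong_le[OF K_spaceD(1)[OF v] K_spaceD(1)[OF u]])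
  show "K_norm \<theta> u \<le> ereal (K_nrm \<theta> u)" by (simp add: K_norm_eq_nrm[OF u])
  show "sector_bound n (v \<ominus> u) 0" for n
    using uv AE_lebesgue_poisson_eq_iff[OF K_spaceD(1)[OF v] K_spaceD(1)[OF u]] by blast
qed

lemma K_nrm_mult:
  assumes u: "u \<in> K_space \<theta>"
  shows "K_nrm \<theta> (\<lambda>\<eta>. c * u \<eta>) = \<bar>c\<bar> * K_nrm \<theta> u"
proof (cases "c = 0")
  case True
  then show ?thesis
    using K_nrm_mult_le[OF u, of 0] K_nrm_nonneg[OF K_space_mult[OF u, of 0]] by simp
next
  case False
  have "K_nrm \<theta> (\<lambda>\<eta>. 1 / c * (c * u \<eta>)) \<le> \<bar>1 / c\<bar> * K_nrm \<theta> (\<lambda>\<eta>. c * u \<eta>)"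
    by (rule K_nrm_mult_le[OF K_space_mult[OF u]])
  then have "\<bar>c\<bar> * K_nrm \<theta> u \<le> K_nrm \<theta> (\<lambda>\<eta>. c * u \<eta>)"
    using False by (simp add: field_simps)
  then show ?thesis using K_nrm_mult_le[OF u, of c] by simp
qed

lemma K_nrm_tendsto_0_iff:
  assumes "eventually (\<lambda>t. f t \<in> K_space \<theta>) F"
  shows "((\<lambda>t. K_norm \<theta> (f t)) \<longlongrightarrow> 0) F \<longleftrightarrow> ((\<lambda>t. K_nrm \<theta> (f t)) \<longlongrightarrow> 0) F"
proof -
  have "((\<lambda>t. K_norm \<theta> (f t)) \<longlongrightarrow> 0) F \<longleftrightarrow> ((\<lambda>t. ereal (K_nrm \<theta> (f t))) \<longlongrightarrow> ereal 0) F"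
    unfolding zero_ereal_def by (rule tendsto_cong, rule eventually_mono[OF assms], rule K_norm_eq_nrm)
  then show ?thesis by simp
qed

abbreviation quot_error :: "(real \<Rightarrow> 'a set \<Rightarrow> real) \<Rightarrow> ('a set \<Rightarrow> real) \<Rightarrow> real \<Rightarrow> real \<Rightarrow> 'a set \<Rightarrow> real" where
  "quot_error f w t s \<equiv> \<lambda>\<eta>. (f s \<eta> - f t \<eta>) / (s - t) - w \<eta>"

lemma quot_error_K_space:
  assumes "f s \<in> K_space \<theta>" "f t \<in> K_space \<theta>" "w \<in> K_space \<theta>"
  shows "quot_error f w t s \<in> K_space \<theta>"
  using K_space_diff[OF K_space_mult[OF K_space_diff[OF assms(1,2)], of "1 / (s - t)"] assms(3)] by simp

lemma K_nrm_tendsto_0_within: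
  assumes "\<And>s. 0 \<le> s \<Longrightarrow> f s \<in> K_space \<theta>"
  shows "((\<lambda>s. K_norm \<theta> (f s)) \<longlongrightarrow> 0) (at t within {0..}) \<longleftrightarrow> ((\<lambda>s. K_nrm \<theta> (f s)) \<longlongrightarrow> 0) (at t within {0..})"
  by (rule K_nrm_tendsto_0_iff) (simp add: eventually_at_filter always_eventually assms)

lemma K_nrm_squeeze:
  assumes "(g \<longlongrightarrow> 0) (at t within A)" "\<And>s. s \<in> A \<Longrightarrow> f s \<in> K_space \<theta>"
    and "\<And>s. s \<in> A \<Longrightarrow> s \<noteq> t \<Longrightarrow> K_nrm \<theta> (f s) \<le> g s"
  shows "((\<lambda>s. K_nrm \<theta> (f s)) \<longlongrightarrow> 0) (at t within A)"
  by (rule Lim_null_comparison[OF _ assms(1)])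
    (simp add: eventually_at_filter always_eventually assms(2,3) K_nrm_nonneg)

lemma K_nrm_abs_diff:
  assumes u: "u \<in> K_space \<theta>" and v: "v \<in> K_space \<theta>"
  shows "\<bar>K_nrm \<theta> u - K_nrm \<theta> v\<bar> \<le> K_nrm \<theta> (u \<ominus> v)"
  using K_nrm_add[OF K_space_diff[OF u v] v] K_nrm_diff[OF u K_space_diff[OF u v]] by simp

lemma K_nrm_0_AE:
  assumes u: "u \<in> K_space \<theta>" and v: "v \<in> K_space \<theta>" and "K_nrm \<theta> (u \<ominus> v) = 0"
  shows "u \<doteq> v"
  using K_nrm_sector[OF K_space_diff[OF u v]] assms(3) AE_lebesgue_poisson_eq_iff[OF K_spaceD(1)[OF u] K_spaceD(1)[OF v]] by simp

lemma K_nrm_self: "u \<in> K_space \<theta> \<Longrightarrow> K_nrm \<theta> (u \<ominus> u) = 0"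
  using K_nrm_mult[of u \<theta> 0] by simp

lemma adjoint_graph_linear:
  assumes 1: "(u, w) \<in> adjoint_graph a \<theta>" and 2: "(u', w') \<in> adjoint_graph a \<theta>"
  shows "(\<lambda>\<eta>. u \<eta> - u' \<eta>, \<lambda>\<eta>. w \<eta> - w' \<eta>) \<in> adjoint_graph a \<theta>"
proof -
  have K: "u \<in> K_space \<theta>" "w \<in> K_space \<theta>" "u' \<in> K_space \<theta>" "w' \<in> K_space \<theta>"
    and L: "\<And>n. sector_bound n (w \<ominus> L_hat a u) 0" "\<And>n. sector_bound n (w' \<ominus> L_hat a u') 0"
    using 1 2 by (auto simp: adjoint_graph_iff)
  have "sector_bound n (w \<ominus> w' \<ominus> L_hat a (u \<ominus> u')) 0" for n
    using L(1)[of n] L(2)[of n] L_hat_diff[OF K_space_locally_bounded[OF K(1)] K_space_locally_bounded[OF K(3)], of n]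
    unfolding sector_bound_def by eventually_elim linarith
  then show ?thesis using K by (simp add: adjoint_graph_iff K_space_diff)
qed

lemma adjoint_graph_scale:
  assumes 1: "(u, w) \<in> adjoint_graph a \<theta>"
  shows "(\<lambda>\<eta>. c * u \<eta>, \<lambda>\<eta>. c * w \<eta>) \<in> adjoint_graph a \<theta>"
proof -
  have "pairing v (\<lambda>\<eta>. c * f \<eta>) = c * pairing v f" for v f :: "'a set \<Rightarrow> real"
    unfolding pairing_def by (simp add: mult.left_commute)
  then show ?thesis using 1 by (simp add: adjoint_graph_def K_space_mult)
qed

lemma Q_space_diff:
  assumes u: "u \<in> Q_space a \<theta>" and v: "v \<in> Q_space a \<theta>"
  shows "(u \<ominus> v) \<in> Q_space a \<theta>"
proof (rule Q_spaceI)
  note uK = Q_spaceD(1)[OF u] and vK = Q_spaceD(1)[OF v]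
  show "(u \<ominus> v) \<in> K_space \<theta>" by (rule K_space_diff[OF uK vK])
  fix e :: real assume e: "0 < e"
  obtain u1 w1 where 1: "(u1, w1) \<in> adjoint_graph a \<theta>" "K_norm \<theta> (u \<ominus> u1) \<le> ereal (e / 2)"
    using Q_space_approx[OF u, of "e / 2"] e by auto
  obtain v1 w2 where 2: "(v1, w2) \<in> adjoint_graph a \<theta>" "K_norm \<theta> (v \<ominus> v1) \<le> ereal (e / 2)"
    using Q_space_approx[OF v, of "e / 2"] e by auto
  have K: "u1 \<in> K_space \<theta>" "v1 \<in> K_space \<theta>" using 1 2 adjoint_graph_K_space by auto
  have "K_norm \<theta> (\<lambda>\<eta>. (u \<eta> - u1 \<eta>) - (v \<eta> - v1 \<eta>)) \<le> ereal (e / 2 + e / 2)"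
    using uK vK K by (intro K_norm_triangle 1 2 borel_measurable_diff) (auto dest: K_spaceD)
  moreover have "(\<lambda>\<eta>. (u \<eta> - u1 \<eta>) - (v \<eta> - v1 \<eta>)) = (\<lambda>\<eta>. (u \<eta> - v \<eta>) - (u1 \<eta> - v1 \<eta>))"
    by (simp add: fun_eq_iff)
  ultimately show "\<exists>v' w. (v', w) \<in> adjoint_graph a \<theta> \<and> K_norm \<theta> (u \<ominus> v \<ominus> v') \<le> ereal e"
    using adjoint_graph_linear[OF 1(1) 2(1)] by (intro exI[of _ "\<lambda>\<eta>. u1 \<eta> - v1 \<eta>"] exI[of _ "\<lambda>\<eta>. w1 \<eta> - w2 \<eta>"]) simp
qed

lemma Q_space_scale:
  assumes u: "u \<in> Q_space a \<theta>"
  shows "(\<lambda>\<eta>. c * u \<eta>) \<in> Q_space a \<theta>"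
proof (rule Q_spaceI)
  note uK = Q_spaceD(1)[OF u]
  show "(\<lambda>\<eta>. c * u \<eta>) \<in> K_space \<theta>" by (rule K_space_mult[OF uK])
  fix e :: real assume e: "0 < e"
  obtain u1 w1 where 1: "(u1, w1) \<in> adjoint_graph a \<theta>" "K_norm \<theta> (u \<ominus> u1) \<le> ereal (e / (\<bar>c\<bar> + 1))"
    using Q_space_approx[OF u, of "e / (\<bar>c\<bar> + 1)"] e by auto
  have "u1 \<in> K_space \<theta>" using 1 adjoint_graph_K_space by auto
  then have "K_norm \<theta> (\<lambda>\<eta>. c * (u \<eta> - u1 \<eta>)) \<le> ereal (\<bar>c\<bar> * (e / (\<bar>c\<bar> + 1)))"
    using uK by (intro K_norm_mult 1 borel_measurable_diff) (auto dest: K_spaceD)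
  also have "\<bar>c\<bar> * (e / (\<bar>c\<bar> + 1)) \<le> e" using e by (simp add: field_simps)
  finally have "K_norm \<theta> (\<lambda>\<eta>. c * u \<eta> - c * u1 \<eta>) \<le> ereal e" by (simp add: right_diff_distrib)
  then show "\<exists>v' w. (v', w) \<in> adjoint_graph a \<theta> \<and> K_norm \<theta> (\<lambda>\<eta>. c * u \<eta> - v' \<eta>) \<le> ereal e"
    using adjoint_graph_scale[OF 1(1), of c] by blast
qed

lemma Q_space_add:
  assumes "u \<in> Q_space a \<theta>" "v \<in> Q_space a \<theta>"
  shows "(\<lambda>\<eta>. u \<eta> + v \<eta>) \<in> Q_space a \<theta>"
  using Q_space_diff[OF assms(1) Q_space_scale[OF assms(2), of "-1"]] by simp

text \<open>The Riesz--Fischer argument, in the form used by the gliding hump: the bounds on the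
  increments at least halve, so the limit is within \<open>2 * d m\<close> of the term
  \<open>m\<close>. The bounds for all \<open>m\<close> hold outside one null set, where the
  sequence is Cauchy; elsewhere \<open>lim\<close> only has to be measurable.\<close>

lemma Q_space_complete:
  fixes x :: "nat \<Rightarrow> 'a set \<Rightarrow> real"
  assumes x: "\<And>m. x m \<in> Q_space a \<theta>" and d: "\<And>m. 0 < d m" "\<And>m. d (Suc m) \<le> d m / 2"
    and b: "\<And>m. K_nrm \<theta> (x (Suc m) \<ominus> x m) \<le> d m"
  obtains y where "y \<in> Q_space a \<theta>" "\<And>m. K_nrm \<theta> (y \<ominus> x m) \<le> 2 * d m"
proof -
  note xK = Q_spaceD(1)[OF x] and xm[measurable] = Q_spaceD(2)[OF x]
  have step: "sector_bound n (x (Suc m) \<ominus> x m) (d m * exp (- \<theta> * real n))" for n m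
    using K_nrm_sector[OF K_space_diff[OF xK[of "Suc m"] xK[of m]], of n] b[of m]
    by (auto elim!: sector_bound_mono intro: mult_right_mono)
  have d0: "d \<longlonglongrightarrow> 0"
  proof -
    have "d m \<le> d 0 * (1 / 2) ^ m" for m
    proof (induction m)
      case (Suc m)
      then show ?case using d(2)[of m] by simp
    qed simp
    moreover have "(\<lambda>m. d 0 * (1 / 2) ^ m) \<longlonglongrightarrow> d 0 * 0"
      by (intro tendsto_mult tendsto_const LIMSEQ_realpow_zero) auto
    ultimately show ?thesis
      by (intro tendsto_sandwich[of "\<lambda>_. 0" d sequentially "\<lambda>m. d 0 * (1 / 2) ^ m"]) (auto intro!: always_eventually less_imp_le[OF d(1)])
  qed
  define y where "y \<eta> = lim (\<lambda>m. x m \<eta>)" for \<eta>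
  have ym[measurable]: "y \<in> config_borel"
    unfolding y_def[abs_def] by measurable
  have yb: "sector_bound n (y \<ominus> x k) (2 * d k * exp (- \<theta> * real n))" for n k
  proof -
    have "AE z in tuple_lborel n. \<forall>m. \<bar>x (Suc m) (z ` {..<n}) - x m (z ` {..<n})\<bar> \<le> d m * exp (- \<theta> * real n)"
      unfolding AE_all_countable using step unfolding sector_bound_def by blast
    then show ?thesis
      unfolding sector_bound_def
    proof eventually_elim
      case (elim z)
      let ?e = "exp (- \<theta> * real n)" and ?x = "\<lambda>m. x m (z ` {..<n})"
      \<comment> \<open>Halving gives \<open>d m \<le> 2 * (d m - d (Suc m))\<close>, and the
        right-hand sides telescope.\<close>
      have tele: "\<bar>?x (k + j) - ?x k\<bar> \<le> 2 * (d k - d (k + j)) * ?e" for k j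
      proof (induction j)
        case (Suc j)
        have "\<bar>?x (k + Suc j) - ?x (k + j)\<bar> \<le> d (k + j) * ?e" using elim by simp
        moreover have "d (k + j) * ?e \<le> 2 * (d (k + j) - d (k + Suc j)) * ?e"
          using d(2)[of "k + j"] by (intro mult_right_mono) auto
        ultimately have "\<bar>?x (k + Suc j) - ?x k\<bar> \<le> 2 * (d k - d (k + j)) * ?e + 2 * (d (k + j) - d (k + Suc j)) * ?e"
          using Suc by linarith
        then show ?case by (simp add: algebra_simps)
      qed simp
      have tele': "\<bar>?x m - ?x k\<bar> \<le> 2 * d k * ?e" if "k \<le> m" for k m
      proof -
        have "\<bar>?x m - ?x k\<bar> \<le> 2 * (d k - d m) * ?e" using tele[of k "m - k"] that by simp
        also have "\<dots> \<le> 2 * d k * ?e" using d(1)[of m] by (intro mult_right_mono) auto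
        finally show ?thesis .
      qed
      have "Cauchy ?x"
      proof (rule metric_CauchyI)
        fix \<epsilon> :: real assume "0 < \<epsilon>"
        have "(\<lambda>m. 4 * d m * ?e) \<longlonglongrightarrow> 4 * 0 * ?e" by (intro tendsto_intros d0)
        then have "\<forall>\<^sub>F m in sequentially. 4 * d m * ?e < \<epsilon>"
          using \<open>0 < \<epsilon>\<close> by (intro order_tendstoD(2)[where y="4 * 0 * ?e"]) auto
        then obtain M where M: "4 * d M * ?e < \<epsilon>" by (auto simp: eventually_sequentially)
        have "dist (?x m) (?x l) < \<epsilon>" if "M \<le> m" "M \<le> l" for m l
          using tele'[OF that(1)] tele'[OF that(2)] M unfolding dist_real_def by linarith
        then show "\<exists>M. \<forall>m\<ge>M. \<forall>n\<ge>M. dist (?x m) (?x n) < \<epsilon>" by blast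
      qed
      then have "?x \<longlonglongrightarrow> y (z ` {..<n})"
        unfolding y_def using real_Cauchy_convergent convergent_LIMSEQ_iff by blast
      then have "(\<lambda>m. \<bar>?x m - ?x k\<bar>) \<longlonglongrightarrow> \<bar>y (z ` {..<n}) - ?x k\<bar>" by (intro tendsto_intros)
      then show ?case
        by (rule LIMSEQ_le_const2) (use tele' in blast)
    qed
  qed
  have "(y \<ominus> x k) \<in> K_space \<theta>" for k
    by (rule K_spaceI[OF _ K_norm_leI[OF _ yb]]) measurable
  note yxK = this
  have yK: "y \<in> K_space \<theta>" using K_space_add[OF yxK[of 0] xK[of 0]] by simp
  have nb: "K_nrm \<theta> (y \<ominus> x k) \<le> 2 * d k" for k
    by (rule K_nrm_leI[OF yxK yb])
  have "y \<in> Q_space a \<theta>"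
  proof (rule Q_spaceI[OF yK])
    fix e :: real assume e: "0 < e"
    then have "\<forall>\<^sub>F m in sequentially. d m < e / 4" using order_tendstoD(2)[OF d0, of "e / 4"] by simp
    then obtain k where k: "d k < e / 4" by (auto simp: eventually_sequentially)
    obtain v w where vw: "(v, w) \<in> adjoint_graph a \<theta>" "K_norm \<theta> (x k \<ominus> v) \<le> ereal (e / 2)"
      using Q_space_approx[OF x[of k], of "e / 2"] e by auto
    have vK: "v \<in> K_space \<theta>" using vw adjoint_graph_K_space by auto
    have "K_norm \<theta> (y \<ominus> x k) \<le> ereal (e / 2)"
      using nb[of k] k yxK[of k] by (simp add: K_norm_eq_nrm)
    then have "K_norm \<theta> (\<lambda>\<eta>. (y \<eta> - x k \<eta>) + (x k \<eta> - v \<eta>)) \<le> ereal (e / 2 + e / 2)"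
      using vK by (intro K_norm_triangle vw borel_measurable_diff) (auto dest: K_spaceD)
    then show "\<exists>v w. (v, w) \<in> adjoint_graph a \<theta> \<and> K_norm \<theta> (y \<ominus> v) \<le> ereal e"
      using vw by auto
  qed
  then show thesis using nb that by blast
qed

end

text \<open>Interpreted both for \<open>jump_sg\<close> and for the chosen
  \<open>sun_semigroup\<close>. The semigroup axioms and the generator are assumed, but no bound
  uniform in time.\<close>

locale sun_generated = jump_kernel a for a :: "'a::euclidean_space \<Rightarrow> real" +
  fixes \<theta> :: real and S :: "real \<Rightarrow> ('a set \<Rightarrow> real) \<Rightarrow> 'a set \<Rightarrow> real"
  assumes C0: "C0_semigroup \<theta> (Q_space a \<theta>) S"
    and gen: "generator_graph \<theta> (Q_space a \<theta>) S = sun_graph a \<theta>"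
begin

abbreviation "Q \<equiv> Q_space a \<theta>"
abbreviation "N \<equiv> K_nrm \<theta>"

lemma S_Q: "0 \<le> t \<Longrightarrow> u \<in> Q \<Longrightarrow> S t u \<in> Q"
  using C0 by (simp add: C0_semigroup_def)

lemma S_add: "0 \<le> t \<Longrightarrow> u \<in> Q \<Longrightarrow> v \<in> Q \<Longrightarrow> AE \<eta> in lebesgue_poisson. S t (\<lambda>\<zeta>. u \<zeta> + v \<zeta>) \<eta> = S t u \<eta> + S t v \<eta>"
  using C0 by (simp add: C0_semigroup_def)

lemma S_scale: "0 \<le> t \<Longrightarrow> u \<in> Q \<Longrightarrow> AE \<eta> in lebesgue_poisson. S t (\<lambda>\<zeta>. c * u \<zeta>) \<eta> = c * S t u \<eta>"
  using C0 by (simp add: C0_semigroup_def)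

lemma S_0: "u \<in> Q \<Longrightarrow> S 0 u \<doteq> u"
  using C0 by (simp add: C0_semigroup_def)

lemma S_semigroup: "0 \<le> s \<Longrightarrow> 0 \<le> t \<Longrightarrow> u \<in> Q \<Longrightarrow> S (s + t) u \<doteq> S s (S t u)"
  using C0 by (simp add: C0_semigroup_def)

lemma S_diff:
  assumes t: "0 \<le> t" and u: "u \<in> Q" and v: "v \<in> Q"
  shows "AE \<eta> in lebesgue_poisson. S t (u \<ominus> v) \<eta> = S t u \<eta> - S t v \<eta>"
  using S_add[OF t u Q_space_scale[OF v, of "-1"]] S_scale[OF t v, of "-1"] by eventually_elim simp

lemma N_cong:
  assumes "u \<in> K_space \<theta>" "v \<in> K_space \<theta>" "u \<doteq> v"
  shows "N u = N v"
proof (rule antisym)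
  show "N u \<le> N v" by (rule K_nrm_AE_cong_le[OF assms(2,1,3)])
  have "v \<doteq> u" using assms(3) by eventually_elim simp
  then show "N v \<le> N u" by (rule K_nrm_AE_cong_le[OF assms(1,2)])
qed

lemma S_bounded:
  assumes t: "0 \<le> t"
  obtains C where "0 < C" "\<And>u. u \<in> Q \<Longrightarrow> N (S t u) \<le> C * N u"
proof -
  have "\<forall>t\<ge>0. \<exists>C::real. \<forall>u\<in>Q. K_norm \<theta> (S t u) \<le> ereal C * K_norm \<theta> u"
    using C0 by (simp add: C0_semigroup_def)
  then obtain C :: real where C: "\<And>u. u \<in> Q \<Longrightarrow> K_norm \<theta> (S t u) \<le> ereal C * K_norm \<theta> u"
    using t by metis
  have "N (S t u) \<le> (\<bar>C\<bar> + 1) * N u" if u: "u \<in> Q" for u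
  proof -
    have "N (S t u) \<le> C * N u"
      using C[OF u] Q_spaceD(1)[OF u] Q_spaceD(1)[OF S_Q[OF t u]] by (simp add: K_norm_eq_nrm)
    also have "\<dots> \<le> (\<bar>C\<bar> + 1) * N u"
      using K_nrm_nonneg[OF Q_spaceD(1)[OF u]] by (intro mult_right_mono) auto
    finally show ?thesis .
  qed
  then show thesis using that[of "\<bar>C\<bar> + 1"] by simp
qed

lemma S_continuous_0:
  assumes u: "u \<in> Q"
  shows "((\<lambda>h. N (S h u \<ominus> u)) \<longlongrightarrow> 0) (at_right 0)"
proof -
  have "((\<lambda>t. K_norm \<theta> (S t u \<ominus> u)) \<longlongrightarrow> 0) (at_right 0)"
    using C0 u by (simp add: C0_semigroup_def)
  moreover have "\<forall>\<^sub>F t in at_right 0. (S t u \<ominus> u) \<in> K_space \<theta>"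
    using eventually_at_right_less[of 0]
    by eventually_elim (intro K_space_diff Q_spaceD(1) S_Q u, simp)
  ultimately show ?thesis by (subst (asm) K_nrm_tendsto_0_iff) auto
qed

text \<open>The uniform boundedness principle, by an adaptive gliding hump: if the operators \<open>S s\<close> were not
  bounded uniformly for small \<open>s\<close>, a series with rapidly decreasing terms would give an element at
  which \<open>S\<close> is unbounded near \<open>0\<close>.\<close>

lemma S_locally_bounded_0:
  "\<exists>d>0. \<exists>M. \<forall>s u. 0 \<le> s \<longrightarrow> s \<le> d \<longrightarrow> u \<in> Q \<longrightarrow> N (S s u) \<le> M * N u"
proof (rule ccontr)
  assume neg: "\<not> ?thesis"
  \<comment> \<open>By homogeneity a failure of the bound can be rescaled to a vector of prescribed
    small norm \<open>d\<close> whose image has prescribed large norm \<open>M\<close>.\<close>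
  have ex: "\<exists>s v. 0 \<le> s \<and> s \<le> e \<and> v \<in> Q \<and> N v \<le> d \<and> M \<le> N (S s v)" if "0 < e" "0 < d" for e d M :: real
  proof -
    have "\<not> (\<forall>s u. 0 \<le> s \<longrightarrow> s \<le> e \<longrightarrow> u \<in> Q \<longrightarrow> N (S s u) \<le> M / d * N u)"
      using neg that(1) by blast
    then obtain s u where su: "0 \<le> s" "s \<le> e" "u \<in> Q" "M / d * N u < N (S s u)"
      by (auto simp: not_le)
    have Nu: "0 < N u"
    proof (rule ccontr)
      assume "\<not> 0 < N u"
      then have "N u = 0" using K_nrm_nonneg[OF Q_spaceD(1)[OF su(3)]] by simp
      moreover obtain C where "N (S s u) \<le> C * N u" using S_bounded[OF su(1)] su(3) by metis
      ultimately show False using su(4) by simp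
    qed
    let ?v = "\<lambda>\<eta>. (d / N u) * u \<eta>"
    have vQ: "?v \<in> Q" by (rule Q_space_scale[OF su(3)])
    have "N ?v \<le> d" using Nu that K_nrm_mult[OF Q_spaceD(1)[OF su(3)], of "d / N u"] by simp
    moreover have "N (S s ?v) = d / N u * N (S s u)"
      using N_cong[OF Q_spaceD(1)[OF S_Q[OF su(1) vQ]] K_space_mult[OF Q_spaceD(1)[OF S_Q[OF su(1,3)]]] S_scale[OF su(1,3)]]
        K_nrm_mult[OF Q_spaceD(1)[OF S_Q[OF su(1,3)]], of "d / N u"] Nu that(2) by simp
    moreover have "M \<le> d / N u * N (S s u)"
      using su(4) Nu that(2) by (simp add: field_simps)
    ultimately show ?thesis using su(1,2) vQ by (intro exI[of _ s] exI[of _ ?v]) (simp only: simp_thms)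
  qed
  \<comment> \<open>\<open>x\<close> is the sum so far, \<open>s\<close> a time at which its image
    has norm at least \<open>n\<close>, and \<open>d\<close> limits the later terms: a total change
    of norm at most \<open>2 * d\<close> alters the image at time \<open>s\<close> by at most
    \<open>1\<close>.\<close>
  let ?P = "\<lambda>n (x, d, s). x \<in> Q \<and> 0 < d \<and> 0 \<le> s \<and> s \<le> 1 / real (Suc n) \<and> real n \<le> N (S s x) \<and>
     (\<forall>u\<in>Q. 2 * d * N (S s u) \<le> N u)"
  have start: "\<exists>xds. ?P 0 xds"
  proof -
    obtain C where C: "0 < C" "\<And>u. u \<in> Q \<Longrightarrow> N (S 0 u) \<le> C * N u" using S_bounded[of 0] by auto
    obtain v where v: "v \<in> Q" using ex[of 1 1] by auto
    have "?P 0 (v, 1 / (2 * C), 0)"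
      using v C K_nrm_nonneg[OF Q_spaceD(1)[OF S_Q[OF _ v]]] by (auto simp: field_simps)
    then show ?thesis by blast
  qed
  have nxt: "\<exists>y. ?P (Suc n) y \<and> (case xds of (x, d, s) \<Rightarrow> case y of (x', d', s') \<Rightarrow> N (x' \<ominus> x) \<le> d \<and> d' \<le> d / 2)"
    if "?P n xds" for xds n
  proof -
    obtain x d s where xds: "xds = (x, d, s)" by (cases xds)
    then have x: "x \<in> Q" and d: "0 < d" using that by auto
    obtain s' v where v: "0 \<le> s'" "s' \<le> 1 / real (Suc (Suc n))" "v \<in> Q" "N v \<le> d" "real (Suc n) \<le> N (S s' v)"
      using ex[of "1 / real (Suc (Suc n))" d "real (Suc n)"] d by auto
    obtain C where C: "0 < C" "\<And>u. u \<in> Q \<Longrightarrow> N (S s' u) \<le> C * N u" using S_bounded[OF v(1)] by metis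
    let ?p = "\<lambda>\<eta>. x \<eta> + v \<eta>" and ?m = "\<lambda>\<eta>. x \<eta> - v \<eta>"
    have pQ: "?p \<in> Q" and mQ: "?m \<in> Q" using x v by (auto intro: Q_space_add Q_space_diff)
    \<comment> \<open>The image of \<open>v\<close> is half the difference of the images of
      \<open>?p\<close> and \<open>?m\<close>, so one of the two is at least as large in norm; the
      sign of the new term is chosen accordingly.\<close>
    have "real (Suc n) \<le> N (S s' ?p) \<or> real (Suc n) \<le> N (S s' ?m)"
    proof (rule ccontr)
      assume "\<not> ?thesis"
      moreover have "2 * N (S s' v) \<le> N (S s' ?p) + N (S s' ?m)"
      proof -
        note K = Q_spaceD(1)[OF S_Q[OF v(1)]]
        have "AE \<eta> in lebesgue_poisson. 2 * S s' v \<eta> = S s' ?p \<eta> - S s' ?m \<eta>"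
          using S_add[OF v(1) x v(3)] S_diff[OF v(1) x v(3)] by eventually_elim simp
        then have "N (\<lambda>\<eta>. 2 * S s' v \<eta>) = N (S s' ?p \<ominus> S s' ?m)"
          by (intro N_cong K_space_mult K_space_diff K v pQ mQ)
        also have "\<dots> \<le> N (S s' ?p) + N (S s' ?m)" by (intro K_nrm_diff K pQ mQ)
        finally show ?thesis by (simp add: K_nrm_mult[OF K[OF v(3)]])
      qed
      ultimately show False using v(5) by linarith
    qed
    then obtain x' where x': "x' \<in> Q" "real (Suc n) \<le> N (S s' x')" "N (x' \<ominus> x) \<le> d"
    proof
      assume "real (Suc n) \<le> N (S s' ?p)"
      then show thesis using that[of ?p] pQ v by simp
    next
      assume "real (Suc n) \<le> N (S s' ?m)"
      moreover have "N (?m \<ominus> x) = N v"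
        using K_nrm_mult[OF Q_spaceD(1)[OF v(3)], of "-1"] by simp
      ultimately show thesis using that[of ?m] mQ v by simp
    qed
    \<comment> \<open>Halving is for convergence, the bound \<open>C\<close> of the operator at time
      \<open>s'\<close> for the last clause of \<open>?P\<close>.\<close>
    let ?d = "min (d / 2) (1 / (2 * C))"
    have "2 * ?d * N (S s' u) \<le> N u" if u: "u \<in> Q" for u
    proof -
      have "2 * ?d * N (S s' u) \<le> 2 * (1 / (2 * C)) * (C * N u)"
        using C u d K_nrm_nonneg[OF Q_spaceD(1)[OF S_Q[OF v(1) u]]] by (intro mult_mono) auto
      then show ?thesis using C by simp
    qed
    then have "?P (Suc n) (x', ?d, s')" using x' v d C by simp
    moreover have "?d \<le> d / 2" by simp
    ultimately show ?thesis using x'(3) unfolding xds by (intro exI[of _ "(x', ?d, s')"]) simp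
  qed
  let ?R = "\<lambda>xds y. case xds of (x, d, s) \<Rightarrow> case y of (x', d', s') \<Rightarrow> N (x' \<ominus> x) \<le> d \<and> d' \<le> d / 2"
  have "\<exists>f. \<forall>n. ?P n (f n) \<and> ?R (f n) (f (Suc n))"
    by (rule dependent_nat_choice[where P="?P" and Q="\<lambda>_. ?R"]) (rule start, rule nxt)
  then obtain f where fg: "\<forall>n. ?P n (f n) \<and> ?R (f n) (f (Suc n))" ..
  note f = spec[OF fg, THEN conjunct1] and g = spec[OF fg, THEN conjunct2]
  define x d s where "x n = fst (f n)" and "d n = fst (snd (f n))" and "s n = snd (snd (f n))" for n
  have F: "x n \<in> Q" "0 < d n" "0 \<le> s n" "s n \<le> 1 / real (Suc n)" "real n \<le> N (S (s n) (x n))" "\<And>u. u \<in> Q \<Longrightarrow> 2 * d n * N (S (s n) u) \<le> N u" for n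
    using f[of n] unfolding x_def d_def s_def by (auto simp: case_prod_beta)
  have G: "N (x (Suc n) \<ominus> x n) \<le> d n" "d (Suc n) \<le> d n / 2" for n
    using g[of n] unfolding x_def d_def s_def by (auto simp: case_prod_beta)
  obtain y where y: "y \<in> Q" "\<And>m. N (y \<ominus> x m) \<le> 2 * d m"
    using Q_space_complete[of x \<theta> d] F(1,2) G by blast
  have big: "real n - 1 \<le> N (S (s n) y)" for n
  proof -
    note K = Q_spaceD(1)[OF S_Q[OF F(3)[of n]]]
    have yx: "(y \<ominus> x n) \<in> Q" using y F(1) by (intro Q_space_diff)
    have "2 * d n * N (S (s n) (y \<ominus> x n)) \<le> 2 * d n * 1"
      using F(6)[OF yx, of n] y(2)[of n] by linarith
    then have 1: "N (S (s n) (y \<ominus> x n)) \<le> 1"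
      using F(2)[of n] by simp
    have "AE \<eta> in lebesgue_poisson. S (s n) (x n) \<eta> = S (s n) y \<eta> - S (s n) (y \<ominus> x n) \<eta>"
      using S_diff[OF F(3) y(1) F(1), of n n] by eventually_elim simp
    then have "N (S (s n) (x n)) = N (S (s n) y \<ominus> S (s n) (\<lambda>\<eta>. y \<eta> - x n \<eta>))"
      by (intro N_cong K_space_diff K F(1) y(1) yx)
    also have "\<dots> \<le> N (S (s n) y) + N (S (s n) (y \<ominus> x n))"
      by (intro K_nrm_diff K y(1) yx)
    finally show ?thesis using 1 F(5)[of n] by linarith
  qed
  have "\<forall>\<^sub>F h in at_right 0. N (S h y \<ominus> y) < 1"
    using order_tendstoD(2)[OF S_continuous_0[OF y(1)], of 1] by simp
  then obtain b where b: "0 < b" "\<And>h. 0 < h \<Longrightarrow> h < b \<Longrightarrow> N (S h y \<ominus> y) < 1"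
    unfolding eventually_at_right_field by auto
  have small: "N (S h y) \<le> 1 + N y" if "0 \<le> h" "h < b" for h
  proof (cases "h = 0")
    case True
    then show ?thesis using N_cong[OF Q_spaceD(1)[OF S_Q[OF _ y(1)]] Q_spaceD(1)[OF y(1)] S_0[OF y(1)]] by simp
  next
    case False
    have K: "S h y \<in> K_space \<theta>" "y \<in> K_space \<theta>" using S_Q[OF that(1) y(1)] y(1) Q_spaceD by auto
    have "N (\<lambda>\<eta>. (S h y \<eta> - y \<eta>) + y \<eta>) \<le> N (S h y \<ominus> y) + N y"
      by (intro K_nrm_add K_space_diff K)
    then show ?thesis using b(2)[of h] that False by simp
  qed
  \<comment> \<open>Large enough that \<open>s n < b\<close>, where the orbit of \<open>y\<close> is
    bounded by \<open>1 + N y\<close>, while at that very time the image of \<open>y\<close> has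
    norm at least \<open>n - 1\<close>.\<close>
  obtain n :: nat where n: "1 / b + N y + 2 < real n" using reals_Archimedean2 by blast
  have "1 / b < real (Suc n)" using n K_nrm_nonneg[OF Q_spaceD(1)[OF y(1)]] by simp
  then have "1 / real (Suc n) < b" using b(1) by (simp add: field_simps)
  then have "s n < b" using F(4)[of n] by linarith
  moreover have "0 < 1 / b" using b(1) by simp
  ultimately show False using small[OF F(3)[of n]] big[of n] n by linarith
qed

text \<open>Steps of length \<open>d\<close> cover the interval, each at the cost of a factor; the
  factor is taken at least \<open>1\<close> so that fewer steps cost no more.\<close>

lemma S_locally_bounded:
  assumes T: "0 \<le> T"
  obtains M where "0 < M" "\<And>s u. 0 \<le> s \<Longrightarrow> s \<le> T \<Longrightarrow> u \<in> Q \<Longrightarrow> N (S s u) \<le> M * N u"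
proof -
  obtain d M where d: "0 < d" and M: "\<And>s u. 0 \<le> s \<Longrightarrow> s \<le> d \<Longrightarrow> u \<in> Q \<Longrightarrow> N (S s u) \<le> M * N u"
    using S_locally_bounded_0 by blast
  define M1 where "M1 = \<bar>M\<bar> + 1"
  have M1: "1 \<le> M1" "\<And>s u. 0 \<le> s \<Longrightarrow> s \<le> d \<Longrightarrow> u \<in> Q \<Longrightarrow> N (S s u) \<le> M1 * N u"
  proof -
    show "1 \<le> M1" by (simp add: M1_def)
    fix s u assume *: "0 \<le> s" "s \<le> d" "u \<in> Q"
    have "M * N u \<le> M1 * N u" using K_nrm_nonneg[OF Q_spaceD(1)[OF *(3)]] by (intro mult_right_mono) (auto simp: M1_def)
    then show "N (S s u) \<le> M1 * N u" using M[OF *] by linarith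
  qed
  have *: "0 \<le> s \<Longrightarrow> s \<le> real (Suc k) * d \<Longrightarrow> u \<in> Q \<Longrightarrow> N (S s u) \<le> M1 ^ Suc k * N u" for k s u
  proof (induction k arbitrary: s)
    case 0
    then show ?case using M1(2)[of s u] by simp
  next
    case (Suc k)
    show ?case
    proof (cases "s \<le> d")
      case True
      have "N (S s u) \<le> M1 * N u" using M1(2) Suc.prems True by blast
      also have "\<dots> \<le> M1 ^ Suc (Suc k) * N u"
        using M1(1) K_nrm_nonneg[OF Q_spaceD(1)[OF Suc.prems(3)]] self_le_power[of M1 "Suc (Suc k)"] by (intro mult_right_mono) auto
      finally show ?thesis .
    next
      case False
      have s': "0 \<le> s - d" "s - d \<le> real (Suc k) * d" using False Suc.prems by (auto simp: algebra_simps)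
      have "N (S s u) = N (S d (S (s - d) u))"
        using S_semigroup[of d "s - d" u] d s' Suc.prems S_Q by (intro N_cong Q_spaceD(1)) auto
      also have "\<dots> \<le> M1 * N (S (s - d) u)" using d s' Suc.prems S_Q by (intro M1(2)) auto
      also have "\<dots> \<le> M1 * (M1 ^ Suc k * N u)" using Suc.IH[OF s' Suc.prems(3)] M1(1) by (intro mult_left_mono) auto
      finally show ?thesis by (simp add: mult.assoc)
    qed
  qed
  obtain k :: nat where k: "T / d < real k" using reals_Archimedean2 by blast
  then have k': "T \<le> real (Suc k) * d" using d by (simp add: field_simps)
  show thesis
  proof (rule that)
    show "0 < M1 ^ Suc k" using M1(1) by simp
    show "N (S s u) \<le> M1 ^ Suc k * N u" if "0 \<le> s" "s \<le> T" "u \<in> Q" for s u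
      using that k' by (intro *) auto
  qed
qed

lemma S_commute:
  assumes "0 \<le> s" "0 \<le> t" "u \<in> Q"
  shows "S s (S t u) \<doteq> S t (S s u)"
  using S_semigroup[OF assms] S_semigroup[OF assms(2,1,3)] unfolding add.commute[of t s]
  by eventually_elim simp

text \<open>Written with the earlier and the later time, so that left and right limits at
  \<open>t\<close> both reduce to the behaviour of the semigroup at \<open>0\<close> from the
  right.\<close>

lemma S_increment:
  assumes "0 \<le> s" "0 \<le> t" "u \<in> Q"
  shows "AE \<eta> in lebesgue_poisson. S (max s t) u \<eta> - S (min s t) u \<eta> = S (min s t) (\<lambda>\<zeta>. S \<bar>s - t\<bar> u \<zeta> - u \<zeta>) \<eta>"
proof -
  have 0: "0 \<le> min s t" "0 \<le> \<bar>s - t\<bar>" using assms by auto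
  have eq: "max s t = min s t + \<bar>s - t\<bar>" by (simp add: max_def min_def)
  show ?thesis
    unfolding eq using S_semigroup[OF 0 assms(3)] S_diff[OF 0(1) S_Q[OF 0(2) assms(3)] assms(3)]
    by eventually_elim simp
qed

lemma S_norm_increment:
  assumes M: "\<And>s u. 0 \<le> s \<Longrightarrow> s \<le> T \<Longrightarrow> u \<in> Q \<Longrightarrow> N (S s u) \<le> M * N u"
    and st: "0 \<le> s" "0 \<le> t" "t \<le> T" and u: "u \<in> Q"
  shows "N (S s u \<ominus> S t u) \<le> M * N (\<lambda>\<eta>. S \<bar>s - t\<bar> u \<eta> - u \<eta>)"
proof -
  let ?v = "\<lambda>\<eta>. S \<bar>s - t\<bar> u \<eta> - u \<eta>"
  have vQ: "?v \<in> Q" using u S_Q by (intro Q_space_diff) auto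
  have r: "0 \<le> min s t" "min s t \<le> T" using st by auto
  have K: "S s u \<in> K_space \<theta>" "S t u \<in> K_space \<theta>" "S (min s t) ?v \<in> K_space \<theta>" "S (max s t) u \<in> K_space \<theta>" "S (min s t) u \<in> K_space \<theta>"
    using st u vQ r S_Q by (auto intro!: Q_spaceD(1))
  have 1: "N (S s u \<ominus> S t u) = N (S (max s t) u \<ominus> S (min s t) u)"
  proof (cases "s \<le> t")
    case True
    then have "(S s u \<ominus> S t u) = (\<lambda>\<eta>. -1 * (S (max s t) u \<eta> - S (min s t) u \<eta>))" by (simp add: max_def min_def)
    then show ?thesis using K_nrm_mult[OF K_space_diff[OF K(4,5)], of "-1"] by simp
  qed (simp add: max_def min_def)
  also have "\<dots> = N (S (min s t) ?v)"
    using S_increment[OF st(1,2) u] K by (intro N_cong K_space_diff) auto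
  also have "\<dots> \<le> M * N ?v" by (rule M[OF r vQ])
  finally show ?thesis .
qed

lemma sun_graphD:
  assumes "(u, w) \<in> sun_graph a \<theta>"
  shows "u \<in> Q" "w \<in> Q" "((\<lambda>h. N (\<lambda>\<eta>. (S h u \<eta> - u \<eta>) / h - w \<eta>)) \<longlongrightarrow> 0) (at_right 0)"
proof -
  have g: "(u, w) \<in> generator_graph \<theta> Q S" using assms gen by simp
  then show u: "u \<in> Q" and w: "w \<in> Q" by (auto simp: generator_graph_def)
  have lim: "((\<lambda>h. K_norm \<theta> (\<lambda>\<eta>. (S h u \<eta> - u \<eta>) / h - w \<eta>)) \<longlongrightarrow> 0) (at_right 0)"
    using g by (simp add: generator_graph_def)
  have "\<forall>\<^sub>F h in at_right 0. (\<lambda>\<eta>. (S h u \<eta> - u \<eta>) / h - w \<eta>) \<in> K_space \<theta>"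
    using eventually_at_right_less[of 0]
  proof eventually_elim
    case (elim h)
    then have "(\<lambda>\<eta>. 1 / h * (S h u \<eta> - u \<eta>)) \<in> K_space \<theta>"
      by (intro K_space_mult K_space_diff Q_spaceD(1) S_Q u) simp
    then show ?case using K_space_diff[OF _ Q_spaceD(1)[OF w]] by simp
  qed
  with lim show "((\<lambda>h. N (\<lambda>\<eta>. (S h u \<eta> - u \<eta>) / h - w \<eta>)) \<longlongrightarrow> 0) (at_right 0)"
    by (subst (asm) K_nrm_tendsto_0_iff) auto
qed

lemma S_quotient_Q: "0 \<le> h \<Longrightarrow> u \<in> Q \<Longrightarrow> w \<in> Q \<Longrightarrow> (\<lambda>\<eta>. (S h u \<eta> - u \<eta>) / h - w \<eta>) \<in> Q"
  using Q_space_diff[OF Q_space_scale[OF Q_space_diff[OF S_Q], of h u u "1 / h"]] by simp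

lemma filterlim_abs_diff_at_right: "filterlim (\<lambda>s :: real. \<bar>s - t\<bar>) (at_right 0) (at t within A)"
proof -
  have "((\<lambda>s. \<bar>s - t\<bar>) \<longlongrightarrow> \<bar>t - t\<bar>) (at t within A)" by (intro tendsto_intros)
  then show ?thesis
    unfolding filterlim_at by (auto simp: eventually_at_filter)
qed

lemma S_K_space: "0 \<le> t \<Longrightarrow> u \<in> Q \<Longrightarrow> S t u \<in> K_space \<theta>"
  using S_Q by (rule Q_spaceD)

lemma S_continuous:
  assumes t: "0 \<le> t" and w: "w \<in> Q"
  shows "((\<lambda>s. N (S s w \<ominus> S t w)) \<longlongrightarrow> 0) (at t within {0..})"
proof -
  obtain M where M: "0 < M" "\<And>s u. 0 \<le> s \<Longrightarrow> s \<le> t \<Longrightarrow> u \<in> Q \<Longrightarrow> N (S s u) \<le> M * N u"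
    using S_locally_bounded[OF t] by metis
  have "((\<lambda>s. M * N (\<lambda>\<eta>. S \<bar>s - t\<bar> w \<eta> - w \<eta>)) \<longlongrightarrow> M * 0) (at t within {0..})"
    by (intro tendsto_mult tendsto_const filterlim_compose[OF S_continuous_0[OF w] filterlim_abs_diff_at_right])
  then have lim: "((\<lambda>s. M * N (\<lambda>\<eta>. S \<bar>s - t\<bar> w \<eta> - w \<eta>)) \<longlongrightarrow> 0) (at t within {0..})" by simp
  show ?thesis
    by (rule K_nrm_squeeze[OF lim]) (intro K_space_diff S_K_space w t, simp, rule S_norm_increment[OF M(2) _ t order_refl w], simp_all)
qed

text \<open>The difference quotient is \<open>S (min s t)\<close> applied to the quotient at
  \<open>0\<close> with step \<open>\<bar>s - t\<bar>\<close>. From the left the time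
  \<open>min s t\<close> moves; local boundedness controls the error of the quotient, and strong
  continuity the replacement of \<open>S (min s t) w\<close> by \<open>S t w\<close>.\<close>

lemma S_derivative:
  assumes uw: "(u, w) \<in> sun_graph a \<theta>" and t: "0 \<le> t"
  shows "((\<lambda>s. N (quot_error (\<lambda>s. S s u) (S t w) t s)) \<longlongrightarrow> 0) (at t within {0..})"
proof -
  note u = sun_graphD(1)[OF uw] and w = sun_graphD(2)[OF uw]
  let ?q = "\<lambda>h \<eta>. (S h u \<eta> - u \<eta>) / h - w \<eta>"
  obtain M where M: "0 < M" "\<And>s u. 0 \<le> s \<Longrightarrow> s \<le> t \<Longrightarrow> u \<in> Q \<Longrightarrow> N (S s u) \<le> M * N u"
    using S_locally_bounded[OF t] by metis
  let ?b = "\<lambda>s. M * N (?q \<bar>s - t\<bar>) + N (S (min s t) w \<ominus> S t w)"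
  have min: "filterlim (\<lambda>s. min s t) (nhds t) (at t within {0..})"
    using tendsto_min[OF tendsto_ident_at tendsto_const, of t t "{0..}"] by simp
  have "((\<lambda>s. N (S (min s t) w \<ominus> S t w)) \<longlongrightarrow> 0) (at t within {0..})"
  proof (rule K_nrm_squeeze[OF S_continuous[OF t w]])
    show "N (S (min s t) w \<ominus> S t w) \<le> N (S s w \<ominus> S t w)" if "s \<in> {0..}" for s
      using that K_nrm_self[OF S_K_space[OF t w]] K_nrm_nonneg[OF K_space_diff[OF S_K_space[OF _ w] S_K_space[OF t w]], of s]
      by (simp add: min_def)
  qed (intro K_space_diff S_K_space w t, simp add: t)
  moreover have "((\<lambda>s. M * N (?q \<bar>s - t\<bar>)) \<longlongrightarrow> M * 0) (at t within {0..})"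
    by (intro tendsto_mult tendsto_const filterlim_compose[OF sun_graphD(3)[OF uw] filterlim_abs_diff_at_right])
  ultimately have lim: "(?b \<longlongrightarrow> 0) (at t within {0..})" using tendsto_add by fastforce
  show ?thesis
  proof (rule K_nrm_squeeze[OF lim])
    show K0: "quot_error (\<lambda>s. S s u) (S t w) t s \<in> K_space \<theta>" if "s \<in> {0..}" for s
      using that by (intro quot_error_K_space S_K_space u w t) simp
    fix s assume "s \<in> {0..}" and st: "s \<noteq> t"
    then have s: "0 \<le> s" by simp
    let ?h = "\<bar>s - t\<bar>" and ?r = "min s t"
    have h: "0 < ?h" and r: "0 \<le> ?r" "?r \<le> t" using s st t by auto
    have qQ: "?q ?h \<in> Q" by (intro S_quotient_Q u w) simp
    have hQ: "S ?h u \<in> Q" using u by (intro S_Q) auto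
    have "AE \<eta> in lebesgue_poisson. quot_error (\<lambda>s. S s u) (S t w) t s \<eta> = S ?r (?q ?h) \<eta> + (S ?r w \<eta> - S t w \<eta>)"
      using S_increment[OF s t u] S_scale[OF r(1) Q_space_diff[OF hQ u], of "1 / ?h"]
        S_diff[OF r(1) Q_space_scale[OF Q_space_diff[OF hQ u], of "1 / ?h"] w]
    proof eventually_elim
      case (elim \<eta>)
      have "S ?r (?q ?h) \<eta> = 1 / ?h * (S (max s t) u \<eta> - S ?r u \<eta>) - S ?r w \<eta>"
        using elim by simp
      moreover have "1 / ?h * (S (max s t) u \<eta> - S ?r u \<eta>) = (S s u \<eta> - S t u \<eta>) / (s - t)"
        using st by (cases "s < t") (auto simp: max_def min_def abs_if divide_simps, simp_all add: algebra_simps)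
      ultimately show ?case by simp
    qed
    then have "N (quot_error (\<lambda>s. S s u) (S t w) t s) = N (\<lambda>\<eta>. S ?r (?q ?h) \<eta> + (S ?r w \<eta> - S t w \<eta>))"
      using s by (intro N_cong K0 K_space_add K_space_diff S_K_space qQ w r t) simp
    also have "\<dots> \<le> N (S ?r (?q ?h)) + N (S ?r w \<ominus> S t w)"
      by (intro K_nrm_add K_space_diff S_K_space qQ w r t)
    also have "N (S ?r (?q ?h)) \<le> M * N (?q ?h)" by (rule M(2)[OF r qQ])
    finally show "N (quot_error (\<lambda>s. S s u) (S t w) t s) \<le> ?b s" by simp
  qed
qed

text \<open>\<open>S t\<close> commutes with difference quotients and is bounded, so the limit
  defining the generator is carried along the orbit.\<close>

lemma S_sun_graph:
  assumes uw: "(u, w) \<in> sun_graph a \<theta>" and t: "0 \<le> t"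
  shows "(S t u, S t w) \<in> sun_graph a \<theta>"
proof -
  note u = sun_graphD(1)[OF uw] and w = sun_graphD(2)[OF uw]
  let ?q = "\<lambda>u w h \<eta>. (S h u \<eta> - u \<eta>) / h - w \<eta>"
  obtain C where C: "0 < C" "\<And>u. u \<in> Q \<Longrightarrow> N (S t u) \<le> C * N u" using S_bounded[OF t] by metis
  have K: "?q (S t u) (S t w) h \<in> K_space \<theta>" if "h \<in> {0<..}" for h
    using S_quotient_Q[OF _ S_Q[OF t u] S_Q[OF t w], of h] that by (intro Q_spaceD(1)) auto
  have "((\<lambda>h. C * N (?q u w h)) \<longlongrightarrow> C * 0) (at_right 0)" by (intro tendsto_mult tendsto_const sun_graphD(3)[OF uw])
  then have "((\<lambda>h. N (?q (S t u) (S t w) h)) \<longlongrightarrow> 0) (at_right 0)"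
  proof (intro K_nrm_squeeze[where g="\<lambda>h. C * N (?q u w h)"] K)
    fix h :: real assume h': "h \<in> {0<..}"
    then have h: "0 < h" by simp
    have qQ: "?q u w h \<in> Q" using h by (intro S_quotient_Q u w) simp
    have hQ: "S h u \<in> Q" using u h by (intro S_Q) auto
    have "?q (S t u) (S t w) h \<doteq> S t (?q u w h)"
      using S_commute[OF less_imp_le[OF h] t u] S_scale[OF t Q_space_diff[OF hQ u], of "1 / h"]
        S_diff[OF t Q_space_scale[OF Q_space_diff[OF hQ u], of "1 / h"] w] S_diff[OF t hQ u]
      by eventually_elim simp
    then have "N (?q (S t u) (S t w) h) = N (S t (?q u w h))"
      by (intro N_cong K h' S_K_space t qQ)
    then show "N (?q (S t u) (S t w) h) \<le> C * N (?q u w h)" using C(2)[OF qQ] by simp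
  qed simp
  moreover have "\<forall>\<^sub>F h in at_right 0. ?q (S t u) (S t w) h \<in> K_space \<theta>"
    using eventually_at_right_less[of 0] by eventually_elim (rule K, simp)
  ultimately have "(S t u, S t w) \<in> generator_graph \<theta> Q S"
    using S_Q[OF t u] S_Q[OF t w] by (simp add: generator_graph_def K_nrm_tendsto_0_iff)
  then show ?thesis using gen by simp
qed

theorem S_classical_solution:
  assumes uw: "(u, w) \<in> sun_graph a \<theta>"
  shows "classical_solution a \<theta> u (\<lambda>t. S t u)"
  unfolding classical_solution_def
proof (intro conjI exI[of _ "\<lambda>t. S t w"] allI impI)
  note u = sun_graphD(1)[OF uw] and w = sun_graphD(2)[OF uw]
  show "S 0 u \<doteq> u" by (rule S_0[OF u])
  fix t :: real assume t: "0 \<le> t"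
  show "((\<lambda>s. K_norm \<theta> (quot_error (\<lambda>s. S s u) (S t w) t s)) \<longlongrightarrow> 0) (at t within {0..})"
    by (rule K_nrm_tendsto_0_within[THEN iffD2, OF _ S_derivative[OF uw t]]) (intro quot_error_K_space S_K_space u w t)
  show "((\<lambda>s. K_norm \<theta> (S s w \<ominus> S t w)) \<longlongrightarrow> 0) (at t within {0..})"
    by (rule K_nrm_tendsto_0_within[THEN iffD2, OF _ S_continuous[OF t w]]) (intro K_space_diff S_K_space w t)
  show "(S t u, S t w) \<in> sun_graph a \<theta>" by (rule S_sun_graph[OF uw t])
qed

text \<open>Differentiating \<open>s \<mapsto> S (t - s) (k s)\<close> for a solution \<open>k\<close> gives \<open>0\<close>.\<close>

theorem classical_solution_eq:
  assumes k: "classical_solution a \<theta> k0 k" and t: "0 \<le> t"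
  shows "k t \<doteq> S t (k 0)"
proof -
  obtain k' where k': "\<And>t. 0 \<le> t \<Longrightarrow> ((\<lambda>s. K_norm \<theta> (quot_error k (k' t) t s)) \<longlongrightarrow> 0) (at t within {0..})"
    "\<And>t. 0 \<le> t \<Longrightarrow> (k t, k' t) \<in> sun_graph a \<theta>"
    using k unfolding classical_solution_def by blast
  note Q = sun_graphD(1,2)[OF k'(2)]
  note K = Q_spaceD(1)[OF Q(1)] Q_spaceD(1)[OF Q(2)]
  obtain M where M: "0 < M" "\<And>s u. 0 \<le> s \<Longrightarrow> s \<le> t \<Longrightarrow> u \<in> Q \<Longrightarrow> N (S s u) \<le> M * N u"
    using S_locally_bounded[OF t] by metis
  define f where "f s = S (t - s) (k s)" for s
  have fK: "f s \<in> K_space \<theta>" if "s \<in> {0..t}" for s unfolding f_def using that by (intro S_K_space Q) auto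
  let ?e = "\<lambda>r s. quot_error (\<lambda>s. S s (k r)) (S (t - r) (k' r)) (t - r) (t - s)"
  let ?c = "\<lambda>r s \<eta>. S (t - s) (k' r) \<eta> - S (t - r) (k' r) \<eta>"
  \<comment> \<open>The product rule: the error of the derivative of \<open>k\<close> under an
    operator bounded by \<open>M\<close>, the error of the derivative of the orbit of
    \<open>k r\<close>, and the continuity of the orbit of \<open>k' r\<close>, by which the two
    derivatives cancel in the limit.\<close>
  let ?b = "\<lambda>r s. M * N (quot_error k (k' r) r s) + (N (?e r s) + N (?c r s))"
  have incr: "N (f s \<ominus> f r) \<le> \<bar>s - r\<bar> * ?b r s" if rs: "r \<in> {0..t}" "s \<in> {0..t}" "s \<noteq> r" for r s
  proof -
    have 0: "0 \<le> r" "0 \<le> s" "0 \<le> t - r" "0 \<le> t - s" "t - s \<le> t" using rs by auto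
    let ?q = "quot_error k (k' r) r s"
    have dQ: "(k s \<ominus> k r) \<in> Q" by (intro Q_space_diff Q 0)
    have qQ: "?q \<in> Q" using Q_space_diff[OF Q_space_scale[OF dQ, of "1 / (s - r)"] Q(2)[OF 0(1)]] by simp
    have eK: "?e r s \<in> K_space \<theta>" and cK: "?c r s \<in> K_space \<theta>" and SqK: "S (t - s) ?q \<in> K_space \<theta>"
      by (intro quot_error_K_space K_space_diff S_K_space Q 0 qQ)+
    have "AE \<eta> in lebesgue_poisson. f s \<eta> - f r \<eta> = (s - r) * (S (t - s) ?q \<eta> - (?e r s \<eta> - ?c r s \<eta>))"
      using S_diff[OF 0(4) Q(1)[OF 0(2)] Q(1)[OF 0(1)]] S_scale[OF 0(4) dQ, of "1 / (s - r)"]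
        S_diff[OF 0(4) Q_space_scale[OF dQ, of "1 / (s - r)"] Q(2)[OF 0(1)]]
    proof eventually_elim
      case (elim \<eta>)
      then have "S (t - s) ?q \<eta> = (S (t - s) (k s) \<eta> - S (t - s) (k r) \<eta>) / (s - r) - S (t - s) (k' r) \<eta>" by simp
      moreover have "(S (t - s) (k r) \<eta> - S (t - r) (k r) \<eta>) / ((t - s) - (t - r)) = - ((S (t - s) (k r) \<eta> - S (t - r) (k r) \<eta>) / (s - r))"
        by (simp add: minus_divide_right)
      ultimately have "S (t - s) ?q \<eta> - (?e r s \<eta> - ?c r s \<eta>) = (S (t - s) (k s) \<eta> - S (t - r) (k r) \<eta>) / (s - r)"
        by (simp add: diff_divide_distrib)
      then show ?case using rs(3) by (simp add: f_def)
    qed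
    then have "N (f s \<ominus> f r) = N (\<lambda>\<eta>. (s - r) * (S (t - s) ?q \<eta> - (?e r s \<eta> - ?c r s \<eta>)))"
      by (intro N_cong K_space_mult K_space_diff[OF SqK K_space_diff[OF eK cK]] K_space_diff[OF fK fK] rs)
    also have "\<dots> = \<bar>s - r\<bar> * N (\<lambda>\<eta>. S (t - s) ?q \<eta> - (?e r s \<eta> - ?c r s \<eta>))"
      by (rule K_nrm_mult[OF K_space_diff[OF SqK K_space_diff[OF eK cK]]])
    also have "\<dots> \<le> \<bar>s - r\<bar> * ?b r s"
      using K_nrm_diff[OF SqK K_space_diff[OF eK cK]] K_nrm_diff[OF eK cK] M(2)[OF 0(4,5) qQ] by (intro mult_left_mono) linarith+
    finally show ?thesis .
  qed
  have b: "(?b r \<longlongrightarrow> 0) (at r within {0..t})" if r: "r \<in> {0..t}" for r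
  proof -
    have 0: "0 \<le> r" "0 \<le> t - r" using r by auto
    have "((\<lambda>s. t - s) \<longlongrightarrow> t - r) (at r within {0..t})" by (intro tendsto_intros)
    then have m: "filterlim (\<lambda>s. t - s) (at (t - r) within {0..}) (at r within {0..t})"
      by (auto simp: filterlim_at eventually_at_filter)
    have "((\<lambda>s. N (quot_error k (k' r) r s)) \<longlongrightarrow> 0) (at r within {0..})"
      by (rule K_nrm_tendsto_0_within[THEN iffD1, OF _ k'(1)[OF 0(1)]]) (intro quot_error_K_space K 0)
    then have "((\<lambda>s. N (quot_error k (k' r) r s)) \<longlongrightarrow> 0) (at r within {0..t})" by (rule tendsto_within_subset) auto
    from tendsto_add[OF tendsto_mult[OF tendsto_const[of M] this] tendsto_add[OF
        filterlim_compose[OF S_derivative[OF k'(2)[OF 0(1)] 0(2)] m] filterlim_compose[OF S_continuous[OF 0(2) Q(2)[OF 0(1)]] m]]]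
    show ?thesis by simp
  qed
  \<comment> \<open>The distance to the endpoint is a real function whose increments are dominated
    by those of \<open>f\<close>. Its derivative vanishes, so the mean value theorem is applied to
    real values only.\<close>
  define g where "g s = N (f s \<ominus> f t)" for s
  have "(g has_field_derivative 0) (at r within {0..t})" if r: "r \<in> {0..t}" for r
    unfolding has_field_derivative_iff
  proof (rule Lim_null_comparison[OF _ b[OF r]])
    have "norm ((g s - g r) / (s - r)) \<le> ?b r s" if s: "s \<in> {0..t}" "s \<noteq> r" for s
    proof -
      have "\<bar>g s - g r\<bar> \<le> N (f s \<ominus> f r)"
        unfolding g_def using K_nrm_abs_diff[OF K_space_diff[OF fK[OF s(1)] fK[of t]] K_space_diff[OF fK[OF r] fK[of t]]] t by simp
      also have "\<dots> \<le> \<bar>s - r\<bar> * ?b r s" by (rule incr[OF r s])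
      finally show ?thesis using s(2) by (simp add: field_simps)
    qed
    then show "\<forall>\<^sub>F s in at r within {0..t}. norm ((g s - g r) / (s - r)) \<le> ?b r s"
      by (simp add: eventually_at_filter always_eventually)
  qed
  then obtain c where "\<And>s. s \<in> {0..t} \<Longrightarrow> g s = c"
    using has_field_derivative_zero_constant[of "{0..t}" g] by auto
  then have "g 0 = g t" using t by simp
  also have "g t = 0" unfolding g_def using t by (intro K_nrm_self fK) simp
  finally have "f 0 \<doteq> f t"
    using K_nrm_0_AE[OF fK[of 0] fK[of t]] t by (simp add: g_def)
  then show ?thesis using S_0[OF Q(1)[OF t]] by eventually_elim (simp add: f_def)
qed

end

section \<open>Uniqueness of classical solutions and the chosen semigroup\<close>

context jump_kernel
begin

text \<open>Both solutions are orbits of \<open>jump_sg\<close>; their initial values agree only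
  almost everywhere, and \<open>jump_sg_cong\<close> carries this to later times.\<close>

theorem classical_solution_unique:
  assumes k: "classical_solution a \<theta> k0 k" and l: "classical_solution a \<theta> k0 l" and t: "0 \<le> t"
  shows "k t \<doteq> l t"
proof -
  interpret J: sun_generated a \<theta> jump_sg
    by standard (rule jump_sg_C0_semigroup, rule jump_sg_generator)
  have K: "m 0 \<in> Q_space a \<theta>" if "classical_solution a \<theta> k0 m" for m
    using that J.sun_graphD(1) unfolding classical_solution_def by blast
  have "AE \<eta> in lebesgue_poisson. k 0 \<eta> - l 0 \<eta> = 0"
    using k l unfolding classical_solution_def by (auto elim: AE_mp)
  then have "jump_sg t (k 0) \<doteq> jump_sg t (l 0)"
    using AE_lebesgue_poisson_eq_iff[of "k 0" "l 0"] AE_lebesgue_poisson_eq_iff[of "jump_sg t (k 0)" "jump_sg t (l 0)"]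
      jump_sg_cong[of "k 0" "l 0" _ t] Q_spaceD(2)[OF K[OF k]] Q_spaceD(2)[OF K[OF l]] jump_sg_measurable by simp
  then show ?thesis
    using J.classical_solution_eq[OF k t] J.classical_solution_eq[OF l t] by eventually_elim simp
qed

theorem Cauchy_problem:
  assumes k0: "k0 \<in> sun_domain a \<theta>"
  shows "classical_solution a \<theta> k0 (\<lambda>t. jump_sg t k0)"
    and "0 \<le> t \<Longrightarrow> AE \<eta> in lebesgue_poisson. jump_sg t k0 \<eta> = sun_semigroup a \<theta> t k0 \<eta>"
proof -
  obtain w where w: "(k0, w) \<in> sun_graph a \<theta>" using k0 by blast
  interpret J: sun_generated a \<theta> jump_sg
    by standard (rule jump_sg_C0_semigroup, rule jump_sg_generator)
  interpret S: sun_generated a \<theta> "sun_semigroup a \<theta>"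
    by standard (rule sun_semigroup_spec(1), rule sun_semigroup_spec(2))
  show "classical_solution a \<theta> k0 (\<lambda>t. jump_sg t k0)" by (rule J.S_classical_solution[OF w])
  then show "0 \<le> t \<Longrightarrow> AE \<eta> in lebesgue_poisson. jump_sg t k0 \<eta> = sun_semigroup a \<theta> t k0 \<eta>"
    by (rule classical_solution_unique) (rule S.S_classical_solution[OF w])
qed

end

section \<open>The vague Borel sigma-algebra\<close>

abbreviation vague_space :: "'a::euclidean_space set measure" where
  "vague_space \<equiv> borel_of_topology vague_topology"

definition avoiding :: "'a::euclidean_space set \<Rightarrow> 'a set set" where
  "avoiding B = {\<gamma> \<in> configurations. \<gamma> \<inter> B = {}}"

lemma configuration_finite_Int:
  assumes "\<gamma> \<in> configurations" "bounded B"
  shows "finite (\<gamma> \<inter> B)"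
proof -
  have "compact (closure B)" using assms(2) by simp
  then have "finite (\<gamma> \<inter> closure B)" using assms(1) by (simp add: configurations_def)
  then show ?thesis by (rule finite_subset[rotated]) (use closure_subset in blast)
qed

lemma space_vague: "space vague_space = configurations"
proof -
  have "configurations \<in> {{\<gamma> \<in> configurations. (\<Sum>\<^sub>\<infinity>x\<in>\<gamma>. f x) \<in> U} | (f :: 'a \<Rightarrow> real) U.
        continuous_on UNIV f \<and> compact (closure {x. f x \<noteq> 0}) \<and> open U}"
    by (rule CollectI, rule exI[of _ "\<lambda>_. 0"], rule exI[of _ UNIV]) auto
  then show ?thesis
    unfolding space_borel_of_topology vague_topology_def topology_generated_by_topspace by auto
qed

lemma vague_sum_eq:
  fixes f :: "'a::euclidean_space \<Rightarrow> real"
  assumes "\<gamma> \<in> configurations" "{x. f x \<noteq> 0} \<subseteq> K" "bounded K"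
  shows "(\<Sum>\<^sub>\<infinity>x\<in>\<gamma>. f x) = (\<Sum>x\<in>\<gamma> \<inter> K. f x)"
proof -
  have "(\<Sum>\<^sub>\<infinity>x\<in>\<gamma>. f x) = (\<Sum>\<^sub>\<infinity>x\<in>\<gamma> \<inter> K. f x)"
    using assms by (intro infsum_cong_neutral) auto
  then show ?thesis
    using configuration_finite_Int[OF assms(1,3)] by simp
qed

lemma vague_sum_measurable:
  fixes f :: "'a::euclidean_space \<Rightarrow> real"
  assumes "continuous_on UNIV f" "compact (closure {x. f x \<noteq> 0})"
  shows "(\<lambda>\<gamma>. \<Sum>\<^sub>\<infinity>x\<in>\<gamma>. f x) \<in> borel_measurable vague_space"
proof (rule borel_measurableI)
  fix U :: "real set" assume "open U"
  then have "openin vague_topology {\<gamma> \<in> configurations. (\<Sum>\<^sub>\<infinity>x\<in>\<gamma>. f x) \<in> U}"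
    unfolding vague_topology_def using assms by (intro topology_generated_by_Basis) auto
  then have "{\<gamma> \<in> configurations. (\<Sum>\<^sub>\<infinity>x\<in>\<gamma>. f x) \<in> U} \<in> sets vague_space"
    unfolding sets_borel_of_topology by (intro sigma_sets.Basic) simp
  moreover have "(\<lambda>\<gamma>. \<Sum>\<^sub>\<infinity>x\<in>\<gamma>. f x) -` U \<inter> space vague_space = {\<gamma> \<in> configurations. (\<Sum>\<^sub>\<infinity>x\<in>\<gamma>. f x) \<in> U}"
    by (auto simp: space_vague)
  ultimately show "(\<lambda>\<gamma>. \<Sum>\<^sub>\<infinity>x\<in>\<gamma>. f x) -` U \<inter> space vague_space \<in> sets vague_space" by simp
qed

text \<open>As a measure of \<open>\<gamma> \<inter> B\<close> it is countably additive in
  \<open>B\<close>, infinite counts included, which the passage to Borel sets uses.\<close>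

definition point_count :: "'a set \<Rightarrow> 'a set \<Rightarrow> ennreal" where
  "point_count B \<gamma> = emeasure (count_space UNIV) (\<gamma> \<inter> B)"

lemma point_count_finite: "\<gamma> \<in> configurations \<Longrightarrow> bounded B \<Longrightarrow> point_count B \<gamma> = of_nat (card (\<gamma> \<inter> B))"
  unfolding point_count_def by (simp add: configuration_finite_Int emeasure_count_space)

text \<open>The tent functions \<open>f m\<close> are continuous, supported in the closed
  neighbourhood \<open>D\<close> of radius \<open>1\<close>, and converge to the indicator of
  \<open>K\<close>; only the finitely many points of a configuration in \<open>D\<close> enter the
  sums.\<close>

lemma point_count_compact_measurable:
  assumes K: "compact (K :: 'a::euclidean_space set)"
  shows "point_count K \<in> borel_measurable vague_space"
proof (cases "K = {}")
  case True
  then show ?thesis by (simp add: point_count_def[abs_def])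
next
  case False
  define D where "D = {x. infdist x K \<le> 1}"
  have D: "compact D" unfolding D_def by (rule compact_infdist_le[OF False K]) simp
  define f where "f m x = max 0 (1 - real (Suc m) * infdist x K)" for m x
  have supp: "{x. f m x \<noteq> 0} \<subseteq> D" for m
  proof
    fix x assume "x \<in> {x. f m x \<noteq> 0}"
    then have "real (Suc m) * infdist x K < 1" by (auto simp: f_def max_def split: if_splits)
    moreover have "1 * infdist x K \<le> real (Suc m) * infdist x K" by (intro mult_right_mono infdist_nonneg) auto
    ultimately show "x \<in> D" by (simp add: D_def)
  qed
  have m: "(\<lambda>\<gamma>. \<Sum>\<^sub>\<infinity>x\<in>\<gamma>. f m x) \<in> borel_measurable vague_space" for m
  proof (rule vague_sum_measurable)
    show "continuous_on UNIV (f m)" unfolding f_def[abs_def] by (intro continuous_intros)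
    show "compact (closure {x. f m x \<noteq> 0})"
      using supp[of m] D by (meson bounded_subset compact_closure compact_imp_bounded)
  qed
  have "(\<lambda>\<gamma>. real (card (\<gamma> \<inter> K))) \<in> borel_measurable vague_space"
  proof (rule borel_measurable_LIMSEQ_real[OF _ m])
    fix \<gamma> assume "\<gamma> \<in> space (vague_space :: 'a set measure)"
    then have \<gamma>: "\<gamma> \<in> configurations" by (simp add: space_vague)
    have fin: "finite (\<gamma> \<inter> D)" by (rule configuration_finite_Int[OF \<gamma> compact_imp_bounded[OF D]])
    have "(\<lambda>m. f m x) \<longlonglongrightarrow> indicator K x" for x
    proof (cases "x \<in> K")
      case True
      then show ?thesis by (simp add: f_def)
    next
      case False
      then have "0 < infdist x K"
        using in_closed_iff_infdist_zero[OF compact_imp_closed[OF K] \<open>K \<noteq> {}\<close>, of x] infdist_nonneg[of x K] by linarith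
      then obtain M :: nat where M: "1 / infdist x K < real M" using reals_Archimedean2 by blast
      have "f m x = 0" if "M \<le> m" for m
      proof -
        have "1 / infdist x K < real (Suc m)" using M that by simp
        then have "1 < real (Suc m) * infdist x K" using \<open>0 < infdist x K\<close> by (simp only: pos_divide_less_eq)
        then show ?thesis by (simp add: f_def)
      qed
      then have "\<forall>\<^sub>F m in sequentially. f m x = 0" by (auto simp: eventually_sequentially)
      then show ?thesis using False by (simp add: tendsto_eventually)
    qed
    then have "(\<lambda>m. \<Sum>x\<in>\<gamma> \<inter> D. f m x) \<longlonglongrightarrow> (\<Sum>x\<in>\<gamma> \<inter> D. indicator K x)"
      by (intro tendsto_sum)
    moreover have "(\<Sum>x\<in>\<gamma> \<inter> D. indicator K x) = real (card (\<gamma> \<inter> K))"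
    proof -
      have "\<gamma> \<inter> D \<inter> K = \<gamma> \<inter> K" by (auto simp: D_def)
      then show ?thesis using sum.inter_restrict[OF fin, of "\<lambda>_. 1 :: real" K] by (simp add: indicator_def of_bool_def)
    qed
    ultimately show "(\<lambda>m. \<Sum>\<^sub>\<infinity>x\<in>\<gamma>. f m x) \<longlonglongrightarrow> real (card (\<gamma> \<inter> K))"
      by (simp add: vague_sum_eq[OF \<gamma> supp compact_imp_bounded[OF D]])
  qed
  then have "(\<lambda>\<gamma>. ennreal (real (card (\<gamma> \<inter> K)))) \<in> borel_measurable vague_space" by measurable
  then show ?thesis
    by (rule measurable_cong[THEN iffD1, rotated])
      (simp add: space_vague point_count_finite compact_imp_bounded[OF K] ennreal_of_nat_eq_real_of_nat)
qed

text \<open>Dynkin's argument starting from closed sets. Intersecting with one fixed ball keeps all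
  counts finite, so that complements correspond to differences.\<close>

lemma point_count_measurable:
  assumes B: "B \<in> sets borel" "bounded (B :: 'a::euclidean_space set)"
  shows "point_count B \<in> borel_measurable vague_space"
proof -
  obtain R where R: "B \<subseteq> cball 0 R" using B(2) by (auto simp: bounded_iff subset_eq)
  have "point_count (C \<inter> cball 0 R) \<in> borel_measurable vague_space" if "C \<in> sigma_sets UNIV (Collect closed)" for C :: "'a set"
  proof (rule sigma_sets_induct_disjoint[OF _ _ that])
    show "Int_stable (Collect closed :: 'a set set)" by (auto simp: Int_stable_def)
    show "point_count (A \<inter> cball 0 R) \<in> borel_measurable vague_space" if "A \<in> Collect closed" for A :: "'a set"
      using that by (intro point_count_compact_measurable closed_Int_compact) auto
    show "point_count ({} \<inter> cball 0 R) \<in> borel_measurable vague_space"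
      by (simp add: point_count_def[abs_def])
    show "point_count ((UNIV - A) \<inter> cball 0 R) \<in> borel_measurable vague_space"
      if "point_count (A \<inter> cball 0 R) \<in> borel_measurable vague_space" for A :: "'a set"
    proof -
      have "(\<lambda>\<gamma>. point_count (cball 0 R) \<gamma> - point_count (A \<inter> cball 0 R) \<gamma>) \<in> borel_measurable vague_space"
        using that point_count_compact_measurable[of "cball 0 R :: 'a set"] by (intro borel_measurable_minus_ennreal) auto
      moreover have "point_count (cball 0 R) \<gamma> - point_count (A \<inter> cball 0 R) \<gamma> = point_count ((UNIV - A) \<inter> cball 0 R) \<gamma>"
        if "\<gamma> \<in> space vague_space" for \<gamma>
      proof -
        have fin: "finite (\<gamma> \<inter> cball 0 R)" using that by (intro configuration_finite_Int) (auto simp: space_vague)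
        have "emeasure (count_space UNIV) (\<gamma> \<inter> cball 0 R - \<gamma> \<inter> (A \<inter> cball 0 R)) =
          emeasure (count_space UNIV) (\<gamma> \<inter> cball 0 R) - emeasure (count_space UNIV) (\<gamma> \<inter> (A \<inter> cball 0 R))"
        proof (rule emeasure_Diff)
          have "finite (\<gamma> \<inter> (A \<inter> cball 0 R))" by (rule finite_subset[OF _ fin]) auto
          then show "emeasure (count_space UNIV) (\<gamma> \<inter> (A \<inter> cball 0 R)) \<noteq> \<infinity>"
            by (simp add: emeasure_count_space)
        qed auto
        moreover have "\<gamma> \<inter> cball 0 R - \<gamma> \<inter> (A \<inter> cball 0 R) = \<gamma> \<inter> ((UNIV - A) \<inter> cball 0 R)" by blast
        ultimately show ?thesis by (simp add: point_count_def)
      qed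
      ultimately show ?thesis by (rule measurable_cong[THEN iffD1, rotated])
    qed
    show "point_count (\<Union>(range A) \<inter> cball 0 R) \<in> borel_measurable vague_space"
      if A: "disjoint_family A" and m: "\<And>i :: nat. point_count (A i \<inter> cball 0 R) \<in> borel_measurable vague_space" for A :: "nat \<Rightarrow> 'a set"
    proof -
      have "point_count (\<Union>(range A) \<inter> cball 0 R) \<gamma> = (\<Sum>i. point_count (A i \<inter> cball 0 R) \<gamma>)" for \<gamma>
      proof -
        have "(\<Sum>i. emeasure (count_space UNIV) (\<gamma> \<inter> (A i \<inter> cball 0 R))) = emeasure (count_space UNIV) (\<Union>i. \<gamma> \<inter> (A i \<inter> cball 0 R))"
          using A by (intro suminf_emeasure) (auto simp: disjoint_family_on_def)
        moreover have "(\<Union>i. \<gamma> \<inter> (A i \<inter> cball 0 R)) = \<gamma> \<inter> (\<Union>(range A) \<inter> cball 0 R)" by blast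
        ultimately show ?thesis by (simp add: point_count_def)
      qed
      then have "point_count (\<Union>(range A) \<inter> cball 0 R) = (\<lambda>\<gamma>. \<Sum>i. point_count (A i \<inter> cball 0 R) \<gamma>)" by (simp add: fun_eq_iff)
      then show ?thesis using m by simp
    qed
  qed auto
  moreover have "B \<in> sigma_sets UNIV (Collect closed)"
    using B(1) by (simp add: borel_eq_closed)
  moreover have "B \<inter> cball 0 R = B" using R by blast
  ultimately show ?thesis by metis
qed

lemma avoiding_sets:
  assumes B: "B \<in> sets borel" "bounded (B :: 'a::euclidean_space set)"
  shows "avoiding B \<in> sets vague_space"
proof -
  note [measurable] = point_count_measurable[OF B]
  have "{\<gamma> \<in> space vague_space. point_count B \<gamma> = 0} \<in> sets vague_space" by measurable
  moreover have "{\<gamma> \<in> space vague_space. point_count B \<gamma> = 0} = avoiding B"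
    using configuration_finite_Int[OF _ B(2)] by (auto simp: space_vague avoiding_def point_count_finite[OF _ B(2)])
  ultimately show ?thesis by simp
qed

section \<open>Void events generate the vague Borel sets\<close>

definition avoiding_events :: "'a::euclidean_space set set set" where
  "avoiding_events = {avoiding B | B. B \<in> sets borel \<and> bounded B}"

lemma avoiding_eventsI: "B \<in> sets borel \<Longrightarrow> bounded B \<Longrightarrow> avoiding B \<in> sigma_sets configurations avoiding_events"
  unfolding avoiding_events_def by (intro sigma_sets.Basic) auto

text \<open>Membership in a cell fixes the occupied basis sets inside a ball, each of them holding one point.
  There are countably many cells, and every vaguely open set is a union of finite intersections of
  cells, although the cells themselves are not open.\<close>

definition vague_cell :: "nat \<Rightarrow> 'a::euclidean_space set set \<Rightarrow> 'a set set" where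
  "vague_cell R \<C> = {\<gamma> \<in> configurations. \<gamma> \<inter> (cball 0 (real R) - \<Union>\<C>) = {} \<and> (\<forall>B\<in>\<C>. \<exists>x. \<gamma> \<inter> (cball 0 (real R) \<inter> B) = {x})}"

text \<open>A second point in \<open>B\<close> would be separated from the first by two disjoint
  basis sets, and there are only countably many such pairs; hitting a set is the complement of a
  void event.\<close>

lemma singleton_Int_sets:
  fixes B :: "'a::euclidean_space set"
  assumes B: "B \<in> sets borel" "bounded B"
  shows "{\<gamma> \<in> configurations. \<exists>x. \<gamma> \<inter> B = {x}} \<in> sigma_sets configurations avoiding_events"
proof -
  interpret sigma_algebra configurations "sigma_sets configurations (avoiding_events :: 'a set set set)"
    by (intro sigma_algebra_sigma_sets) (auto simp: avoiding_events_def avoiding_def)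
  obtain \<B> :: "'a set set" where \<B>: "countable \<B>" "topological_basis \<B>"
    using ex_countable_basis by auto
  have BI: "avoiding (B \<inter> C) \<in> sigma_sets configurations avoiding_events" if "C \<in> \<B>" for C
    using that B topological_basis_open[OF \<B>(2)] by (intro avoiding_eventsI) (auto intro: bounded_subset)
  let ?P = "{(C, D). C \<in> \<B> \<and> D \<in> \<B> \<and> C \<inter> D = {}}"
  have "countable ?P" by (rule countable_subset[of _ "\<B> \<times> \<B>"]) (auto simp: \<B>)
  have "{\<gamma> \<in> configurations. \<exists>x. \<gamma> \<inter> B = {x}} = (configurations - avoiding B) -
      (\<Union>p\<in>?P. (configurations - avoiding (B \<inter> fst p)) \<inter> (configurations - avoiding (B \<inter> snd p)))" (is "?L = ?R")
  proof (intro equalityI subsetI)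
    fix \<gamma> assume "\<gamma> \<in> ?L"
    then obtain x where x: "\<gamma> \<in> configurations" "\<gamma> \<inter> B = {x}" by blast
    have "\<not> (\<gamma> \<in> (configurations - avoiding (B \<inter> fst p)) \<inter> (configurations - avoiding (B \<inter> snd p)))" if "p \<in> ?P" for p
    proof
      assume *: "\<gamma> \<in> (configurations - avoiding (B \<inter> fst p)) \<inter> (configurations - avoiding (B \<inter> snd p))"
      have "x \<in> C" if "\<gamma> \<notin> avoiding (B \<inter> C)" for C
        using that x by (auto simp: avoiding_def)
      then have "x \<in> fst p \<inter> snd p" using * by blast
      then show False using that by auto
    qed
    moreover have "\<gamma> \<in> configurations - avoiding B" using x by (auto simp: avoiding_def)
    ultimately show "\<gamma> \<in> ?R" by blast
  next
    fix \<gamma> assume \<gamma>: "\<gamma> \<in> ?R"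
    then obtain x where x: "\<gamma> \<in> configurations" "x \<in> \<gamma> \<inter> B" by (auto simp: avoiding_def)
    have "y = x" if "y \<in> \<gamma> \<inter> B" for y
    proof (rule ccontr)
      assume "y \<noteq> x"
      then obtain U V where UV: "open U" "open V" "x \<in> U" "y \<in> V" "U \<inter> V = {}" by (metis hausdorff)
      obtain C where C: "C \<in> \<B>" "x \<in> C" "C \<subseteq> U" using topological_basisE[OF \<B>(2) UV(1,3)] by metis
      obtain D where D: "D \<in> \<B>" "y \<in> D" "D \<subseteq> V" using topological_basisE[OF \<B>(2) UV(2,4)] by metis
      have "(C, D) \<in> ?P" using C D UV(5) by auto
      moreover have "\<gamma> \<in> (configurations - avoiding (B \<inter> fst (C, D))) \<inter> (configurations - avoiding (B \<inter> snd (C, D)))"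
        using x that C D by (auto simp: avoiding_def)
      ultimately show False using \<gamma> by blast
    qed
    then have "\<gamma> \<inter> B = {x}" using x by blast
    then show "\<gamma> \<in> ?L" using x by blast
  qed
  also have "\<dots> \<in> sigma_sets configurations avoiding_events"
  proof (intro Diff top avoiding_eventsI[OF B] countable_UN''[OF \<open>countable ?P\<close>] Int)
    fix p assume "p \<in> ?P"
    then have "fst p \<in> \<B>" "snd p \<in> \<B>" by auto
    then show "avoiding (B \<inter> fst p) \<in> sigma_sets configurations avoiding_events" "avoiding (B \<inter> snd p) \<in> sigma_sets configurations avoiding_events"
      using BI by blast+
  qed
  finally show ?thesis .
qed

lemma vague_cell_sets:
  fixes \<C> :: "'a::euclidean_space set set"
  assumes "finite \<C>" "\<And>B. B \<in> \<C> \<Longrightarrow> open B"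
  shows "vague_cell R \<C> \<in> sigma_sets configurations avoiding_events"
proof -
  interpret sigma_algebra configurations "sigma_sets configurations (avoiding_events :: 'a set set set)"
    by (intro sigma_algebra_sigma_sets) (auto simp: avoiding_events_def avoiding_def)
  have "vague_cell R \<C> = avoiding (cball 0 (real R) - \<Union>\<C>) \<inter> {\<gamma> \<in> configurations. \<forall>B\<in>\<C>. \<exists>x. \<gamma> \<inter> (cball 0 (real R) \<inter> B) = {x}}"
    by (auto simp: vague_cell_def avoiding_def)
  also have "\<dots> \<in> sigma_sets configurations avoiding_events"
  proof (intro Int)
    have "open (\<Union>\<C>)" using assms by blast
    then show "avoiding (cball 0 (real R) - \<Union>\<C>) \<in> sigma_sets configurations avoiding_events"
      by (intro avoiding_eventsI) (auto intro: bounded_subset[OF bounded_cball])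
    show "{\<gamma> \<in> configurations. \<forall>B\<in>\<C>. \<exists>x. \<gamma> \<inter> (cball 0 (real R) \<inter> B) = {x}} \<in> sigma_sets configurations avoiding_events"
      using assms by (intro sets_Collect_finite_All singleton_Int_sets) (auto intro: bounded_subset[OF bounded_cball])
  qed
  finally show ?thesis .
qed

text \<open>The points of a configuration in the cell correspond one to one to those of
  \<open>\<gamma>\<close> in the ball, each lying in a basis set on which \<open>f\<close> stays
  within \<open>d\<close> of its value at the point of \<open>\<gamma>\<close>. So the sums differ
  by less than \<open>e\<close>.\<close>

lemma vague_basic_contains_cell:
  fixes f :: "'a::euclidean_space \<Rightarrow> real"
  assumes \<B>: "topological_basis \<B>" and f: "continuous_on UNIV f" "compact (closure {x. f x \<noteq> 0})" and U: "open U"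
    and \<gamma>: "\<gamma> \<in> configurations" "(\<Sum>\<^sub>\<infinity>x\<in>\<gamma>. f x) \<in> U"
  obtains R \<C> where "finite \<C>" "\<C> \<subseteq> \<B>" "\<gamma> \<in> vague_cell R \<C>"
    "\<And>\<gamma>'. \<gamma>' \<in> vague_cell R \<C> \<Longrightarrow> (\<Sum>\<^sub>\<infinity>x\<in>\<gamma>'. f x) \<in> U"
proof -
  obtain r where r: "closure {x. f x \<noteq> 0} \<subseteq> cball 0 r"
    using compact_imp_bounded[OF f(2)] by (auto simp: bounded_iff subset_eq)
  obtain R :: nat where R: "r < real R" using reals_Archimedean2 by blast
  let ?K = "cball (0 :: 'a) (real R)"
  have K: "{x. f x \<noteq> 0} \<subseteq> ?K" using r R closure_subset[of "{x. f x \<noteq> 0}"] by force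
  let ?F = "\<gamma> \<inter> ?K"
  have fin: "finite ?F" by (rule configuration_finite_Int[OF \<gamma>(1)]) simp
  obtain e where e: "0 < e" "ball (\<Sum>\<^sub>\<infinity>x\<in>\<gamma>. f x) e \<subseteq> U" using U \<gamma>(2) open_contains_ball by blast
  \<comment> \<open>Shares \<open>e\<close> among the points in the ball; the summand
    \<open>1\<close> covers the case of no point and makes the final inequality strict.\<close>
  define d where "d = e / (real (card ?F) + 1)"
  have d: "0 < d" using e by (simp add: d_def)
  let ?V = "\<lambda>x. f -` ball (f x) d"
  have V: "open (?V x)" for x using f(1) by (simp add: continuous_on_open_vimage open_vimage)
  obtain B where B: "\<And>x. x \<in> ?F \<Longrightarrow> B x \<in> \<B> \<and> x \<in> B x \<and> B x \<subseteq> ?V x"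
    "\<And>x y. x \<in> ?F \<Longrightarrow> y \<in> ?F \<Longrightarrow> x \<noteq> y \<Longrightarrow> B x \<inter> B y = {}"
    using finite_points_disjoint_basis[OF fin \<B>, of ?V] V d by (metis centre_in_ball vimageI)
  show thesis
  proof (rule that[of "B ` ?F" R])
    show "finite (B ` ?F)" using fin by blast
    show "B ` ?F \<subseteq> \<B>" using B(1) by blast
    have "\<gamma> \<inter> (?K \<inter> B x) = {x}" if "x \<in> ?F" for x
    proof (intro equalityI subsetI)
      fix y assume y: "y \<in> \<gamma> \<inter> (?K \<inter> B x)"
      then have "y \<in> ?F" "y \<in> B y \<inter> B x" using B(1)[of y] by auto
      then show "y \<in> {x}" using B(2)[OF \<open>y \<in> ?F\<close> that] by blast
    qed (use that B(1)[OF that] in auto)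
    moreover have "\<gamma> \<inter> (?K - \<Union>(B ` ?F)) = {}" using B(1) by blast
    ultimately show "\<gamma> \<in> vague_cell R (B ` ?F)"
      using \<gamma>(1) unfolding vague_cell_def by blast
    fix \<gamma>' assume \<gamma>': "\<gamma>' \<in> vague_cell R (B ` ?F)"
    then have c': "\<gamma>' \<in> configurations" and cov: "\<gamma>' \<inter> ?K \<subseteq> \<Union>(B ` ?F)" and "\<forall>x\<in>?F. \<exists>y. \<gamma>' \<inter> (?K \<inter> B x) = {y}"
      unfolding vague_cell_def by auto
    then obtain p where p: "\<And>x. x \<in> ?F \<Longrightarrow> \<gamma>' \<inter> (?K \<inter> B x) = {p x}" by metis
    have "inj_on p ?F"
    proof (rule inj_onI, rule ccontr)
      fix x y assume xy: "x \<in> ?F" "y \<in> ?F" "p x = p y" "x \<noteq> y"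
      have "p x \<in> B x" "p y \<in> B y" using p[OF xy(1)] p[OF xy(2)] by blast+
      then show False using B(2)[OF xy(1,2,4)] xy(3) by auto
    qed
    moreover have "\<gamma>' \<inter> ?K = p ` ?F"
    proof (intro equalityI subsetI)
      fix y assume y: "y \<in> \<gamma>' \<inter> ?K"
      then obtain x where "x \<in> ?F" "y \<in> B x" using cov by blast
      then have "y = p x" using y p[of x] by blast
      then show "y \<in> p ` ?F" using \<open>x \<in> ?F\<close> by blast
    qed (use p in blast)
    ultimately have "(\<Sum>\<^sub>\<infinity>x\<in>\<gamma>'. f x) = (\<Sum>x\<in>?F. f (p x))"
      unfolding vague_sum_eq[OF c' K bounded_cball] by (simp add: sum.reindex)
    then have "\<bar>(\<Sum>\<^sub>\<infinity>x\<in>\<gamma>'. f x) - (\<Sum>\<^sub>\<infinity>x\<in>\<gamma>. f x)\<bar> = \<bar>\<Sum>x\<in>?F. f (p x) - f x\<bar>"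
      unfolding vague_sum_eq[OF \<gamma>(1) K bounded_cball] by (simp add: sum_subtractf)
    also have "\<dots> \<le> (\<Sum>x\<in>?F. \<bar>f (p x) - f x\<bar>)" by (rule sum_abs)
    also have "\<dots> \<le> (\<Sum>x\<in>?F. d)"
    proof (rule sum_mono)
      fix x assume x: "x \<in> ?F"
      have "p x \<in> B x" using p[OF x] by blast
      then have "p x \<in> ?V x" using B(1)[OF x] by blast
      then show "\<bar>f (p x) - f x\<bar> \<le> d" by (simp add: dist_real_def abs_minus_commute)
    qed
    also have "\<dots> < e" using e by (simp add: d_def field_simps)
    finally show "(\<Sum>\<^sub>\<infinity>x\<in>\<gamma>'. f x) \<in> U"
      using e(2) by (auto simp: dist_real_def abs_minus_commute subset_eq)
  qed
qed

text \<open>The family \<open>\<G>\<close> of finite intersections of cells is countable, so every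
  union of its members is a countable union. Induction over the generation of the topology shows
  that each open set is such a union.\<close>

lemma sets_vague: "sets (vague_space :: 'a::euclidean_space set measure) = sigma_sets configurations avoiding_events"
proof
  have sub: "avoiding_events \<subseteq> sets (vague_space :: 'a set measure)"
    unfolding avoiding_events_def using avoiding_sets by blast
  show "sigma_sets configurations avoiding_events \<subseteq> sets (vague_space :: 'a set measure)"
    using sets.sigma_sets_subset[OF sub] by (simp add: space_vague)
  interpret sigma_algebra configurations "sigma_sets configurations (avoiding_events :: 'a set set set)"
    by (intro sigma_algebra_sigma_sets) (auto simp: avoiding_events_def avoiding_def)
  obtain \<B> :: "'a set set" where \<B>: "countable \<B>" "topological_basis \<B>"
    using ex_countable_basis by auto
  define \<F> where "\<F> = (\<lambda>(R, \<C>). vague_cell R \<C>) ` (UNIV \<times> {\<C>. finite \<C> \<and> \<C> \<subseteq> \<B>})"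
  define \<G> where "\<G> = (\<lambda>\<S>. configurations \<inter> \<Inter>\<S>) ` {\<S>. finite \<S> \<and> \<S> \<subseteq> \<F>}"
  have "countable {\<C>. finite \<C> \<and> \<C> \<subseteq> \<B>}"
    using countable_Collect_finite_subset[OF \<B>(1)] by (simp add: conj_commute)
  then have cF: "countable \<F>" unfolding \<F>_def by blast
  then have cG: "countable \<G>"
    unfolding \<G>_def using countable_Collect_finite_subset[OF cF] by (simp add: conj_commute)
  have Fm: "A \<in> sigma_sets configurations avoiding_events" if "A \<in> \<F>" for A
    using that topological_basis_open[OF \<B>(2)] unfolding \<F>_def by (auto intro!: vague_cell_sets)
  have Gm: "A \<in> sigma_sets configurations avoiding_events" if "A \<in> \<G>" for A
  proof -
    obtain \<S> where S: "A = configurations \<inter> \<Inter>\<S>" "finite \<S>" "\<S> \<subseteq> \<F>" using \<open>A \<in> \<G>\<close> unfolding \<G>_def by blast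
    have "configurations \<inter> \<Inter>\<S> \<in> sigma_sets configurations avoiding_events" using S(2,3)
    proof (induction rule: finite_induct)
      case (insert F \<S>)
      have "configurations \<inter> \<Inter>(insert F \<S>) = F \<inter> (configurations \<inter> \<Inter>\<S>)" by blast
      then show ?case using insert Fm by auto
    qed (simp add: top)
    then show ?thesis using S(1) by simp
  qed
  have GI: "A \<inter> A' \<in> \<G>" if "A \<in> \<G>" "A' \<in> \<G>" for A A'
  proof -
    obtain \<S> \<S>' where S: "A = configurations \<inter> \<Inter>\<S>" "finite \<S>" "\<S> \<subseteq> \<F>" "A' = configurations \<inter> \<Inter>\<S>'" "finite \<S>'" "\<S>' \<subseteq> \<F>"
      using \<open>A \<in> \<G>\<close> \<open>A' \<in> \<G>\<close> unfolding \<G>_def by blast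
    have "A \<inter> A' = configurations \<inter> \<Inter>(\<S> \<union> \<S>')" using S by blast
    then show ?thesis using S unfolding \<G>_def by (intro image_eqI[of _ _ "\<S> \<union> \<S>'"]) auto
  qed
  have cover: "W \<subseteq> configurations \<and> (\<forall>\<gamma>\<in>W. \<exists>G\<in>\<G>. \<gamma> \<in> G \<and> G \<subseteq> W)" if "openin vague_topology W" for W :: "'a set set"
  proof -
    have "generate_topology_on {{\<gamma> \<in> configurations. (\<Sum>\<^sub>\<infinity>x\<in>\<gamma>. f x) \<in> U} | (f :: 'a \<Rightarrow> real) U.
        continuous_on UNIV f \<and> compact (closure {x. f x \<noteq> 0}) \<and> open U} W"
      using that unfolding vague_topology_def by (rule openin_topology_generated_by)
    then show ?thesis
    proof induction
      case (Int W W')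
      show ?case
      proof (intro conjI ballI)
        fix \<gamma> assume \<gamma>: "\<gamma> \<in> W \<inter> W'"
        obtain G where G: "G \<in> \<G>" "\<gamma> \<in> G" "G \<subseteq> W" using Int(3) \<gamma> by blast
        obtain G' where G': "G' \<in> \<G>" "\<gamma> \<in> G'" "G' \<subseteq> W'" using Int(4) \<gamma> by blast
        show "\<exists>G\<in>\<G>. \<gamma> \<in> G \<and> G \<subseteq> W \<inter> W'" using G G' GI[OF G(1) G'(1)] by (intro bexI[of _ "G \<inter> G'"]) auto
      qed (use Int in blast)
    next
      case (UN K)
      then show ?case by (meson Sup_least Union_upper UnionE order_trans)
    next
      case (Basis W)
      then obtain f :: "'a \<Rightarrow> real" and U where W: "W = {\<gamma> \<in> configurations. (\<Sum>\<^sub>\<infinity>x\<in>\<gamma>. f x) \<in> U}"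
        "continuous_on UNIV f" "compact (closure {x. f x \<noteq> 0})" "open U" by blast
      show ?case
      proof (intro conjI ballI)
        fix \<gamma> assume "\<gamma> \<in> W"
        then have \<gamma>: "\<gamma> \<in> configurations" "(\<Sum>\<^sub>\<infinity>x\<in>\<gamma>. f x) \<in> U" using W(1) by auto
        obtain R \<C> where C: "finite \<C>" "\<C> \<subseteq> \<B>" "\<gamma> \<in> vague_cell R \<C>" "\<And>\<gamma>'. \<gamma>' \<in> vague_cell R \<C> \<Longrightarrow> (\<Sum>\<^sub>\<infinity>x\<in>\<gamma>'. f x) \<in> U"
          using vague_basic_contains_cell[OF \<B>(2) W(2-4) \<gamma>] by metis
        have "vague_cell R \<C> \<in> \<F>" unfolding \<F>_def using C(1,2) by blast
        then have "configurations \<inter> \<Inter>{vague_cell R \<C>} \<in> \<G>" unfolding \<G>_def by blast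
        moreover have "configurations \<inter> \<Inter>{vague_cell R \<C>} = vague_cell R \<C>" by (auto simp: vague_cell_def)
        moreover have "vague_cell R \<C> \<subseteq> W" using C(4) W(1) by (auto simp: vague_cell_def)
        ultimately show "\<exists>G\<in>\<G>. \<gamma> \<in> G \<and> G \<subseteq> W" using C(3) by metis
      qed (use W(1) in blast)
    qed simp
  qed
  have "W \<in> sigma_sets configurations avoiding_events" if W: "openin vague_topology W" for W :: "'a set set"
  proof -
    have "W = (\<Union>G\<in>{G \<in> \<G>. G \<subseteq> W}. G)" using cover[OF W] by blast
    also have "\<dots> \<in> sigma_sets configurations avoiding_events"
      using cG Gm by (intro countable_UN'') (auto intro: countable_subset[OF _ cG])
    finally show ?thesis .
  qed
  then have "{U :: 'a set set. openin vague_topology U} \<subseteq> sigma_sets configurations avoiding_events"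
    by (intro subsetI) (simp only: mem_Collect_eq)
  from sigma_sets_subset[OF this] show "sets (vague_space :: 'a set measure) \<subseteq> sigma_sets configurations avoiding_events"
    unfolding sets_borel_of_topology space_borel_of_topology[symmetric] space_vague .
qed

lemma measurable_vagueI:
  fixes T :: "'b \<Rightarrow> 'a::euclidean_space set"
  assumes "\<And>\<omega>. \<omega> \<in> space M \<Longrightarrow> T \<omega> \<in> configurations"
    and "\<And>B. B \<in> sets borel \<Longrightarrow> bounded B \<Longrightarrow> {\<omega> \<in> space M. T \<omega> \<inter> B = {}} \<in> sets M"
  shows "T \<in> M \<rightarrow>\<^sub>M vague_space"
proof -
  have "T \<in> M \<rightarrow>\<^sub>M sigma configurations avoiding_events"
  proof (rule measurable_measure_of)
    show "avoiding_events \<subseteq> Pow (configurations :: 'a set set)" by (auto simp: avoiding_events_def avoiding_def)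
    show "T \<in> space M \<rightarrow> configurations" using assms(1) by blast
    fix A :: "'a set set" assume "A \<in> avoiding_events"
    then obtain B where B: "A = avoiding B" "B \<in> sets borel" "bounded B" by (auto simp: avoiding_events_def)
    have "T -` A \<inter> space M = {\<omega> \<in> space M. T \<omega> \<inter> B = {}}" using assms(1) B(1) by (auto simp: avoiding_def)
    then show "T -` A \<inter> space M \<in> sets M" using assms(2)[OF B(2,3)] by simp
  qed
  moreover have "sets (sigma configurations avoiding_events) = sets (vague_space :: 'a set measure)"
    unfolding sets_vague by (rule sets_measure_of) (auto simp: avoiding_events_def avoiding_def)
  ultimately show ?thesis by (simp cong: measurable_cong_sets)
qed

text \<open>Renyi's theorem for simple point processes.\<close>

lemma config_probs_eqI:
  fixes \<mu> \<nu> :: "'a::euclidean_space set measure"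
  assumes "\<mu> \<in> config_probs" "\<nu> \<in> config_probs"
    and eq: "\<And>B. B \<in> sets borel \<Longrightarrow> bounded B \<Longrightarrow> emeasure \<mu> (avoiding B) = emeasure \<nu> (avoiding B)"
  shows "\<mu> = \<nu>"
proof -
  have s: "sets \<mu> = sigma_sets configurations avoiding_events" "sets \<nu> = sigma_sets configurations avoiding_events" and p: "prob_space \<mu>" "prob_space \<nu>"
    using assms by (auto simp: config_probs_def sets_vague)
  interpret \<mu>: prob_space \<mu> by fact
  show ?thesis
  proof (rule measure_eqI_generator_eq[OF _ _ _ s, where A="\<lambda>_. configurations"])
    show "Int_stable (avoiding_events :: 'a set set set)"
      unfolding Int_stable_def avoiding_events_def
    proof safe
      fix B C :: "'a set" assume "B \<in> sets borel" "bounded B" "C \<in> sets borel" "bounded C"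
      moreover have "avoiding B \<inter> avoiding C = avoiding (B \<union> C)" by (auto simp: avoiding_def)
      ultimately show "\<exists>D. avoiding B \<inter> avoiding C = avoiding D \<and> D \<in> sets borel \<and> bounded D"
        by (intro exI[of _ "B \<union> C"]) auto
    qed
    show "avoiding_events \<subseteq> Pow (configurations :: 'a set set)" by (auto simp: avoiding_events_def avoiding_def)
    show "emeasure \<mu> X = emeasure \<nu> X" if "X \<in> avoiding_events" for X
      using that eq by (auto simp: avoiding_events_def)
    have "configurations = avoiding ({} :: 'a set)" by (auto simp: avoiding_def)
    then show "range (\<lambda>_. configurations) \<subseteq> (avoiding_events :: 'a set set set)"
      by (auto simp: avoiding_events_def)
  qed auto
qed

section \<open>Labelling the points of a configuration\<close>

lemma bounded_countable_basis:
  "\<exists>c :: nat \<Rightarrow> 'a::euclidean_space set. (\<forall>j. open (c j) \<and> bounded (c j)) \<and> topological_basis (range c)"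
proof -
  obtain \<B> :: "'a set set" where \<B>: "countable \<B>" "topological_basis \<B>"
    using ex_countable_basis by auto
  let ?B = "{B \<in> \<B>. bounded B}"
  have near: "\<exists>B\<in>?B. x \<in> B \<and> B \<subseteq> W" if "open W" "x \<in> W" for W and x :: 'a
  proof -
    have W: "open (W \<inter> ball x 1)" "x \<in> W \<inter> ball x 1" using that by auto
    obtain B where B: "B \<in> \<B>" "x \<in> B" "B \<subseteq> W \<inter> ball x 1"
      by (rule topological_basisE[OF \<B>(2) W])
    have "bounded B" by (rule bounded_subset[OF bounded_ball[of x 1]]) (use B(3) in blast)
    then have "B \<in> ?B" "B \<subseteq> W" using B(1,3) by simp_all
    then show ?thesis using B(2) by blast
  qed
  have opn: "open B" if "B \<in> ?B" for B
    using topological_basis_open[OF \<B>(2), of B] that by simp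
  have basis: "topological_basis ?B"
    by (rule topological_basis_iff[OF opn, THEN iffD2]) (assumption, intro allI impI ballI near)
  have ne: "?B \<noteq> {}" using near[of UNIV 0] by auto
  have "countable ?B" using \<B>(1) by simp
  then have range: "range (from_nat_into ?B) = ?B" by (rule range_from_nat_into[OF ne])
  have "open (from_nat_into ?B j) \<and> bounded (from_nat_into ?B j)" for j
    using from_nat_into[OF ne, of j] opn by simp
  then show ?thesis using basis range by (intro exI[of _ "from_nat_into ?B"]) simp
qed

definition window :: "nat \<Rightarrow> 'a::euclidean_space set" where
  "window = (SOME c. (\<forall>j. open (c j) \<and> bounded (c j)) \<and> topological_basis (range c))"

lemma window: "open (window j)" "bounded (window j)" "topological_basis (range window)"
  using someI_ex[OF bounded_countable_basis] unfolding window_def by blast+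

text \<open>The label of a point is the least index of a window isolating it. Minimality makes
  labels unique, and both conditions are events about the points in bounded open sets, so labels
  depend measurably on the configuration.\<close>

definition labelled :: "'a::euclidean_space set \<Rightarrow> nat \<Rightarrow> bool" where
  "labelled \<gamma> j \<longleftrightarrow> (\<exists>x. \<gamma> \<inter> window j = {x}) \<and> (\<forall>i<j. \<gamma> \<inter> window i \<noteq> \<gamma> \<inter> window j)"

text \<open>The value \<open>0\<close> without a label is a default that makes the function total;
  sums restrict to labelled indices.\<close>

definition labelled_point :: "nat \<Rightarrow> 'a::euclidean_space set \<Rightarrow> 'a" where
  "labelled_point j \<gamma> = (if labelled \<gamma> j then the_elem (\<gamma> \<inter> window j) else 0)"

lemma labelled_point_eq: "labelled \<gamma> j \<Longrightarrow> \<gamma> \<inter> window j = {labelled_point j \<gamma>}"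
  unfolding labelled_def labelled_point_def by auto

text \<open>Local finiteness leaves finitely many points near \<open>x\<close>, which disjoint basis
  sets separate, so some window isolates \<open>x\<close> and there is a least one.\<close>

lemma labelled_bij:
  assumes \<gamma>: "\<gamma> \<in> configurations"
  shows "bij_betw (\<lambda>j. labelled_point j \<gamma>) {j. labelled \<gamma> j} \<gamma>"
  unfolding bij_betw_def
proof
  show "inj_on (\<lambda>j. labelled_point j \<gamma>) {j. labelled \<gamma> j}"
  proof (rule linorder_inj_onI)
    fix i j assume ij: "i < j" "i \<in> {j. labelled \<gamma> j}" "j \<in> {j. labelled \<gamma> j}"
    show "labelled_point i \<gamma> \<noteq> labelled_point j \<gamma>"
    proof
      assume "labelled_point i \<gamma> = labelled_point j \<gamma>"
      then have "\<gamma> \<inter> window i = \<gamma> \<inter> window j" using ij labelled_point_eq[of \<gamma> i] labelled_point_eq[of \<gamma> j] by simp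
      then show False using ij by (auto simp: labelled_def[of \<gamma> j])
    qed
  qed auto
  show "(\<lambda>j. labelled_point j \<gamma>) ` {j. labelled \<gamma> j} = \<gamma>"
  proof (intro equalityI subsetI)
    fix x assume "x \<in> (\<lambda>j. labelled_point j \<gamma>) ` {j. labelled \<gamma> j}"
    then show "x \<in> \<gamma>" using labelled_point_eq[of \<gamma>] by blast
  next
    fix x assume x: "x \<in> \<gamma>"
    let ?F = "\<gamma> \<inter> ball x 1"
    have fin: "finite ?F" by (rule configuration_finite_Int[OF \<gamma>]) simp
    obtain B where B: "\<And>y. y \<in> ?F \<Longrightarrow> B y \<in> range window \<and> y \<in> B y \<and> B y \<subseteq> ball x 1"
      "\<And>y z. y \<in> ?F \<Longrightarrow> z \<in> ?F \<Longrightarrow> y \<noteq> z \<Longrightarrow> B y \<inter> B z = {}"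
      using finite_points_disjoint_basis[OF fin window(3), of "\<lambda>_. ball x 1"] by auto
    have xF: "x \<in> ?F" using x by simp
    then obtain j0 where j0: "B x = window j0" using B(1) by blast
    have ex: "\<gamma> \<inter> window j0 = {x}"
    proof (intro equalityI subsetI)
      fix y assume y: "y \<in> \<gamma> \<inter> window j0"
      then have yF: "y \<in> ?F" using B(1)[OF xF] j0 by blast
      then have "y \<in> B y \<inter> B x" using B(1)[OF yF] y j0 by blast
      then show "y \<in> {x}" using B(2)[OF yF xF] by blast
    qed (use B(1)[OF xF] j0 x in auto)
    define j where "j = (LEAST j. \<gamma> \<inter> window j = {x})"
    have j: "\<gamma> \<inter> window j = {x}" unfolding j_def using ex by (rule LeastI)
    have "\<gamma> \<inter> window i \<noteq> {x}" if "i < j" for i using not_less_Least that unfolding j_def by blast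
    then have lab: "labelled \<gamma> j" using j unfolding labelled_def by auto
    then have "labelled_point j \<gamma> = x" using j labelled_point_eq by fastforce
    then show "x \<in> (\<lambda>j. labelled_point j \<gamma>) ` {j. labelled \<gamma> j}" using lab by blast
  qed
qed

lemma singleton_Int_vague_sets:
  "B \<in> sets borel \<Longrightarrow> bounded B \<Longrightarrow> {\<gamma> \<in> configurations. \<exists>x. \<gamma> \<inter> B = {x}} \<in> sets vague_space"
  unfolding sets_vague by (rule singleton_Int_sets)

lemma window_Int: "open U \<Longrightarrow> window i \<inter> U \<in> sets borel \<and> bounded (window i \<inter> U)"
  using borel_open[OF open_Int[OF window(1)[of i]], of U] bounded_subset[OF window(2)[of i], of "window i \<inter> U"] by simp

lemma labelled_sets: "{\<gamma> \<in> configurations. labelled \<gamma> j} \<in> sets (vague_space :: 'a::euclidean_space set measure)"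
proof -
  let ?S = "\<lambda>B. {\<gamma> \<in> configurations. \<exists>x. \<gamma> \<inter> B = {x}} :: 'a set set"
  \<comment> \<open>If \<open>window i\<close> and \<open>window j\<close> contain exactly one point
    each, these points coincide exactly when the intersection of the windows also contains exactly
    one point.\<close>
  have "{\<gamma> \<in> configurations. labelled \<gamma> j} = ?S (window j) - (\<Union>i\<in>{..<j}. ?S (window i) \<inter> ?S (window i \<inter> window j))"
  proof (intro equalityI subsetI)
    fix \<gamma> :: "'a set" assume g: "\<gamma> \<in> {\<gamma> \<in> configurations. labelled \<gamma> j}"
    then obtain x where x: "\<gamma> \<inter> window j = {x}" "\<gamma> \<in> configurations" by (auto simp: labelled_def)
    have "\<not> (\<gamma> \<in> ?S (window i) \<inter> ?S (window i \<inter> window j))" if "i < j" for i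
    proof
      assume "\<gamma> \<in> ?S (window i) \<inter> ?S (window i \<inter> window j)"
      then obtain y z where yz: "\<gamma> \<inter> window i = {y}" "\<gamma> \<inter> (window i \<inter> window j) = {z}" by blast
      then have "z = y" "z = x" using x by blast+
      then show False using g that x yz by (auto simp: labelled_def)
    qed
    then show "\<gamma> \<in> ?S (window j) - (\<Union>i\<in>{..<j}. ?S (window i) \<inter> ?S (window i \<inter> window j))" using x by blast
  next
    fix \<gamma> :: "'a set" assume g: "\<gamma> \<in> ?S (window j) - (\<Union>i\<in>{..<j}. ?S (window i) \<inter> ?S (window i \<inter> window j))"
    then obtain x where x: "\<gamma> \<inter> window j = {x}" "\<gamma> \<in> configurations" by blast
    have "\<gamma> \<inter> window i \<noteq> \<gamma> \<inter> window j" if "i < j" for i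
    proof
      assume e: "\<gamma> \<inter> window i = \<gamma> \<inter> window j"
      then have "\<gamma> \<inter> (window i \<inter> window j) = {x}" using x by blast
      then have "\<gamma> \<in> ?S (window i) \<inter> ?S (window i \<inter> window j)" using e x by auto
      then show False using g that by blast
    qed
    then show "\<gamma> \<in> {\<gamma> \<in> configurations. labelled \<gamma> j}" using x by (auto simp: labelled_def)
  qed
  also have "\<dots> \<in> sets vague_space"
  proof -
    have s1: "?S (window i) \<in> sets vague_space" for i :: nat
      by (intro singleton_Int_vague_sets borel_open window)
    have s2: "?S (window i \<inter> window j) \<in> sets vague_space" for i :: nat
      using window_Int[OF window(1)[of j], of i] by (intro singleton_Int_vague_sets) (rule conjunct1 conjunct2, assumption)+
    show ?thesis by (intro sets.Diff sets.finite_UN sets.Int s1 s2 finite_lessThan)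
  qed
  finally show ?thesis .
qed

lemma labelled_point_measurable: "labelled_point j \<in> vague_space \<rightarrow>\<^sub>M (borel :: 'a::euclidean_space measure)"
proof (rule borel_measurableI)
  fix U :: "'a set" assume U: "open U"
  let ?L = "{\<gamma> \<in> configurations. labelled \<gamma> j} :: 'a set set"
  let ?S = "{\<gamma> \<in> configurations. \<exists>x. \<gamma> \<inter> (window j \<inter> U) = {x}} :: 'a set set"
  have "labelled_point j -` U \<inter> space vague_space = (?L \<inter> ?S) \<union> (if 0 \<in> U then configurations - ?L else {})"
  proof (intro equalityI subsetI)
    fix \<gamma> :: "'a set" assume g: "\<gamma> \<in> labelled_point j -` U \<inter> space vague_space"
    show "\<gamma> \<in> (?L \<inter> ?S) \<union> (if 0 \<in> U then configurations - ?L else {})"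
    proof (cases "labelled \<gamma> j")
      case True
      then have "\<gamma> \<inter> (window j \<inter> U) = {labelled_point j \<gamma>}" using labelled_point_eq[OF True] g by auto
      then show ?thesis using True g by (auto simp: space_vague)
    qed (use g in \<open>auto simp: labelled_point_def space_vague\<close>)
  next
    fix \<gamma> :: "'a set" assume g: "\<gamma> \<in> (?L \<inter> ?S) \<union> (if 0 \<in> U then configurations - ?L else {})"
    show "\<gamma> \<in> labelled_point j -` U \<inter> space vague_space"
    proof (cases "labelled \<gamma> j")
      case True
      then obtain x where "\<gamma> \<inter> (window j \<inter> U) = {x}" using g by (auto split: if_splits)
      then have "x \<in> U" "x = labelled_point j \<gamma>" using labelled_point_eq[OF True] by blast+
      then show ?thesis using g by (auto simp: space_vague split: if_splits)
    qed (use g in \<open>auto simp: labelled_point_def space_vague split: if_splits\<close>)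
  qed
  also have "\<dots> \<in> sets vague_space"
    using labelled_sets[of j] singleton_Int_vague_sets[of "window j \<inter> U"] window_Int[OF U, of j]
      sets.compl_sets[OF labelled_sets[of j]] by (auto simp: space_vague)
  finally show "labelled_point j -` U \<inter> space vague_space \<in> sets vague_space" .
qed

section \<open>Sums over tuples of points\<close>

definition tuples_in :: "nat \<Rightarrow> 'a::euclidean_space set \<Rightarrow> (nat \<Rightarrow> 'a) set" where
  "tuples_in n \<gamma> = {x \<in> distinct_tuples n. x ` {..<n} \<subseteq> \<gamma>}"

text \<open>The integrand of the factorial moment measure of order \<open>n\<close>. Ordered tuples
  and values in the extended nonnegative reals give a meaning to the sum for every \<open>G\<close>,
  symmetric or not.\<close>

definition tuple_sum :: "nat \<Rightarrow> ((nat \<Rightarrow> 'a::euclidean_space) \<Rightarrow> ennreal) \<Rightarrow> 'a set \<Rightarrow> ennreal" where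
  "tuple_sum n G \<gamma> = (\<integral>\<^sup>+x. G x \<partial>count_space (tuples_in n \<gamma>))"

definition label_tuples :: "nat \<Rightarrow> (nat \<Rightarrow> nat) set" where
  "label_tuples n = {j \<in> {..<n} \<rightarrow>\<^sub>E UNIV. inj_on j {..<n}}"

definition label_term :: "nat \<Rightarrow> ((nat \<Rightarrow> 'a::euclidean_space) \<Rightarrow> ennreal) \<Rightarrow> (nat \<Rightarrow> bool) \<Rightarrow> (nat \<Rightarrow> 'a) \<Rightarrow> (nat \<Rightarrow> nat) \<Rightarrow> ennreal" where
  "label_term n G E X j = (if \<forall>i<n. E (j i) then G (\<lambda>i\<in>{..<n}. X (j i)) else 0)"

text \<open>The index set does not depend on the configuration, which gives measurability and allows
  expectations to be exchanged with the sum. Positions \<open>X j\<close> may coincide here: for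
  displaced points this sum can be evaluated before coincidences are excluded.\<close>

definition label_sum :: "nat \<Rightarrow> ((nat \<Rightarrow> 'a::euclidean_space) \<Rightarrow> ennreal) \<Rightarrow> (nat \<Rightarrow> bool) \<Rightarrow> (nat \<Rightarrow> 'a) \<Rightarrow> ennreal" where
  "label_sum n G E X = (\<integral>\<^sup>+j. label_term n G E X j \<partial>count_space (label_tuples n))"

lemma countable_label_tuples: "countable (label_tuples n)"
  by (rule countable_subset[of _ "{..<n} \<rightarrow>\<^sub>E UNIV"]) (auto simp: label_tuples_def intro!: countable_PiE)

text \<open>If \<open>X\<close> enumerates the points without repetition, tuples of distinct labels
  correspond to tuples of distinct points.\<close>

lemma tuple_sum_labels:
  assumes X: "bij_betw X {j. E j} \<gamma>"
  shows "tuple_sum n G \<gamma> = label_sum n G E X"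
proof -
  let ?J = "{j \<in> label_tuples n. \<forall>i<n. E (j i)}"
  let ?h = "\<lambda>j. \<lambda>i\<in>{..<n}. X (j i)"
  have inj: "inj_on X {j. E j}" and img: "X ` {j. E j} = \<gamma>" using X by (auto simp: bij_betw_def)
  have "bij_betw ?h ?J (tuples_in n \<gamma>)"
    unfolding bij_betw_def
  proof
    show "inj_on ?h ?J"
    proof (rule inj_onI)
      fix j j' assume *: "j \<in> ?J" "j' \<in> ?J" "?h j = ?h j'"
      have "j i = j' i" for i
      proof (cases "i < n")
        case True
        have "X (j i) = X (j' i)" using fun_cong[OF *(3), of i] True by simp
        then show ?thesis using inj_onD[OF inj, of "j i" "j' i"] * True by blast
      next
        case False
        then show ?thesis using * by (auto simp: label_tuples_def PiE_iff extensional_def)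
      qed
      then show "j = j'" by blast
    qed
    show "?h ` ?J = tuples_in n \<gamma>"
    proof (intro equalityI subsetI)
      fix x assume "x \<in> ?h ` ?J"
      then obtain j where j: "j \<in> label_tuples n" "\<And>i. i < n \<Longrightarrow> E (j i)" "x = ?h j" by blast
      have "inj_on x {..<n}"
      proof (rule inj_onI)
        fix i i' assume i: "i \<in> {..<n}" "i' \<in> {..<n}" "x i = x i'"
        then have "j i = j i'" using inj_onD[OF inj, of "j i" "j i'"] j by simp
        then show "i = i'" using j(1) i by (auto simp: label_tuples_def inj_on_def)
      qed
      moreover have "x ` {..<n} \<subseteq> \<gamma>" using j img by auto
      ultimately show "x \<in> tuples_in n \<gamma>" using j(3) by (auto simp: tuples_in_def distinct_tuples_def)
    next
      fix x assume x: "x \<in> tuples_in n \<gamma>"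
      then have xd: "inj_on x {..<n}" "x \<in> extensional {..<n}" and xg: "\<And>i. i < n \<Longrightarrow> x i \<in> \<gamma>"
        by (auto simp: tuples_in_def distinct_tuples_def PiE_iff)
      let ?j = "\<lambda>i\<in>{..<n}. inv_into {j. E j} X (x i)"
      have jj: "E (?j i)" "X (?j i) = x i" if "i < n" for i
      proof -
        have "x i \<in> X ` {j. E j}" using xg[OF that] img by simp
        then show "E (?j i)" "X (?j i) = x i" using inv_into_into[of "x i" X "{j. E j}"] f_inv_into_f[of "x i" X "{j. E j}"] that by auto
      qed
      have "inj_on ?j {..<n}"
      proof (rule inj_onI)
        fix i i' assume i: "i \<in> {..<n}" "i' \<in> {..<n}" "?j i = ?j i'"
        then have "x i = x i'" using jj(2)[of i] jj(2)[of i'] by simp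
        then show "i = i'" using xd(1) i by (auto simp: inj_on_def)
      qed
      then have "?j \<in> ?J" using jj by (auto simp: label_tuples_def)
      moreover have "x = ?h ?j" using jj xd(2) by (auto simp: fun_eq_iff extensional_def)
      ultimately show "x \<in> ?h ` ?J" by blast
    qed
  qed
  from nn_integral_bij_count_space[OF this, of G]
  have "tuple_sum n G \<gamma> = (\<integral>\<^sup>+j. G (?h j) \<partial>count_space ?J)" by (simp add: tuple_sum_def)
  also have "\<dots> = (\<integral>\<^sup>+j. label_term n G E X j \<partial>count_space ?J)"
    by (intro nn_integral_cong) (simp add: label_term_def)
  also have "\<dots> = (\<integral>\<^sup>+j. label_term n G E X j \<partial>count_space (label_tuples n))"
  proof (rule nn_integral_count_space_eq)
    show "label_term n G E X j = 0" if "j \<in> label_tuples n - ?J" for j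
    proof -
      have "\<not> (\<forall>i<n. E (j i))" using that by simp
      then show ?thesis unfolding label_term_def by (rule if_not_P)
    qed
    show "label_term n G E X j = 0" if "j \<in> ?J - label_tuples n" for j
      using that by blast
  qed
  finally show ?thesis by (simp add: label_sum_def)
qed

lemma label_term_measurable:
  assumes E: "\<And>j. {\<omega> \<in> space M. E \<omega> j} \<in> sets M" and X: "\<And>j. (\<lambda>\<omega>. X \<omega> j) \<in> borel_measurable M"
    and G: "G \<in> (tuple_borel n :: ((nat \<Rightarrow> 'a::euclidean_space) \<Rightarrow> _) set)"
  shows "(\<lambda>\<omega>. label_term n G (E \<omega>) (X \<omega>) j) \<in> borel_measurable M"
  unfolding label_term_def
proof (rule measurable_If)
  have "(\<lambda>\<omega>. \<lambda>i\<in>{..<n}. X \<omega> (j i)) \<in> M \<rightarrow>\<^sub>M tuple_lborel n"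
    using X by (intro measurable_restrict) simp
  then show "(\<lambda>\<omega>. G (\<lambda>i\<in>{..<n}. X \<omega> (j i))) \<in> borel_measurable M" by (rule measurable_compose[OF _ G])
  have "{\<omega> \<in> space M. \<forall>i\<in>{..<n}. E \<omega> (j i)} \<in> sets M"
    using E by (intro sets.sets_Collect_finite_All) auto
  then show "{\<omega> \<in> space M. \<forall>i<n. E \<omega> (j i)} \<in> sets M" by (simp only: Ball_def lessThan_iff)
qed simp

lemma label_sum_measurable:
  assumes E: "\<And>j. {\<omega> \<in> space M. E \<omega> j} \<in> sets M" and X: "\<And>j. (\<lambda>\<omega>. X \<omega> j) \<in> borel_measurable M"
    and G: "G \<in> (tuple_borel n :: ((nat \<Rightarrow> 'a::euclidean_space) \<Rightarrow> _) set)"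
  shows "(\<lambda>\<omega>. label_sum n G (E \<omega>) (X \<omega>)) \<in> borel_measurable M"
    and "sigma_finite_measure M \<Longrightarrow> (\<integral>\<^sup>+\<omega>. label_sum n G (E \<omega>) (X \<omega>) \<partial>M) =
       (\<integral>\<^sup>+j. \<integral>\<^sup>+\<omega>. label_term n G (E \<omega>) (X \<omega>) j \<partial>M \<partial>count_space (label_tuples n))"
proof -
  have m: "(\<lambda>w. label_term n G (E (snd w)) (X (snd w)) (fst w)) \<in> borel_measurable (count_space (label_tuples n) \<Otimes>\<^sub>M M)"
    using label_term_measurable[OF E X G] by (intro measurable_pair_measure_countable1 countable_label_tuples) simp
  interpret C: sigma_finite_measure "count_space (label_tuples n)"
    by (rule sigma_finite_measure_count_space_countable[OF countable_label_tuples])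
  show "(\<lambda>\<omega>. label_sum n G (E \<omega>) (X \<omega>)) \<in> borel_measurable M"
    unfolding label_sum_def using measurable_compose[OF measurable_pair_swap' m]
    by (intro C.borel_measurable_nn_integral) (simp add: case_prod_beta)
  assume "sigma_finite_measure M"
  then interpret P: pair_sigma_finite "count_space (label_tuples n)" M
    by (intro pair_sigma_finite.intro C.sigma_finite_measure_axioms)
  show "(\<integral>\<^sup>+\<omega>. label_sum n G (E \<omega>) (X \<omega>) \<partial>M) =
       (\<integral>\<^sup>+j. \<integral>\<^sup>+\<omega>. label_term n G (E \<omega>) (X \<omega>) j \<partial>M \<partial>count_space (label_tuples n))"
    unfolding label_sum_def using m by (intro P.Fubini') (simp add: case_prod_beta)
qed

lemma tuple_sum_labelled: "\<gamma> \<in> configurations \<Longrightarrow> tuple_sum n G \<gamma> = label_sum n G (labelled \<gamma>) (\<lambda>j. labelled_point j \<gamma>)"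
  by (rule tuple_sum_labels[OF labelled_bij])

lemma tuple_sum_measurable:
  assumes G: "G \<in> (tuple_borel n :: ((nat \<Rightarrow> 'a::euclidean_space) \<Rightarrow> _) set)"
  shows "tuple_sum n G \<in> borel_measurable vague_space"
proof -
  have "(\<lambda>\<gamma>. label_sum n G (labelled \<gamma>) (\<lambda>j. labelled_point j \<gamma>)) \<in> borel_measurable vague_space"
    using labelled_sets labelled_point_measurable by (intro label_sum_measurable(1) G) (auto simp: space_vague)
  then show ?thesis
    by (rule measurable_cong[THEN iffD1, rotated]) (simp add: space_vague tuple_sum_labelled)
qed

lemma tuple_sum_sum: "tuple_sum n (\<lambda>x. \<Sum>i\<in>I. G i x) \<gamma> = (\<Sum>i\<in>I. tuple_sum n (G i) \<gamma>)"
  unfolding tuple_sum_def by (rule nn_integral_sum) simp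

lemma tuple_sum_SUP: "incseq G \<Longrightarrow> tuple_sum n (\<lambda>x. SUP m. G m x) \<gamma> = (SUP m. tuple_sum n (G m) \<gamma>)"
  unfolding tuple_sum_def by (rule nn_integral_monotone_convergence_SUP) auto

lemma tuple_compose_permutes:
  assumes "\<pi> permutes {..<n}" "x \<in> space (tuple_lborel n :: (nat \<Rightarrow> 'a::euclidean_space) measure)"
  shows "x \<circ> \<pi> \<in> space (tuple_lborel n)" "(x \<circ> \<pi>) ` {..<n} = x ` {..<n}"
    "x \<in> distinct_tuples n \<Longrightarrow> x \<circ> \<pi> \<in> distinct_tuples n"
proof -
  show "x \<circ> \<pi> \<in> space (tuple_lborel n)"
    using assms by (auto simp: space_PiM PiE_iff extensional_def permutes_def)
  show "(x \<circ> \<pi>) ` {..<n} = x ` {..<n}"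
    using permutes_image[OF assms(1)] by (metis image_comp)
  assume x: "x \<in> distinct_tuples n"
  have "inj_on (x \<circ> \<pi>) {..<n}"
    using distinct_tuplesD(1)[OF x] permutes_inj_on[OF assms(1)] permutes_image[OF assms(1)] by (intro comp_inj_on) auto
  then show "x \<circ> \<pi> \<in> distinct_tuples n"
    using \<open>x \<circ> \<pi> \<in> space (tuple_lborel n)\<close> by (simp add: distinct_tuples_def space_tuple)
qed

lemma tuple_sum_permute:
  assumes \<pi>: "\<pi> permutes {..<n}"
  shows "tuple_sum n (\<lambda>x. G (x \<circ> \<pi>)) \<gamma> = tuple_sum n G (\<gamma> :: 'a::euclidean_space set)"
  unfolding tuple_sum_def
proof (rule nn_integral_bij_count_space)
  show "bij_betw (\<lambda>x. x \<circ> \<pi>) (tuples_in n \<gamma>) (tuples_in n \<gamma>)"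
  proof (rule bij_betwI[where g="\<lambda>x. x \<circ> inv \<pi>"])
    have *: "(\<lambda>x. x \<circ> \<sigma>) \<in> tuples_in n \<gamma> \<rightarrow> tuples_in n \<gamma>" if "\<sigma> permutes {..<n}" for \<sigma>
    proof
      fix x assume "x \<in> tuples_in n \<gamma>"
      then have x: "x \<in> distinct_tuples n" "x ` {..<n} \<subseteq> \<gamma>" by (simp_all add: tuples_in_def)
      note s = distinct_tuplesD(3)[OF x(1)]
      show "x \<circ> \<sigma> \<in> tuples_in n \<gamma>"
        using tuple_compose_permutes(2,3)[OF that s] x by (simp only: tuples_in_def mem_Collect_eq)
    qed
    show "(\<lambda>x. x \<circ> \<pi>) \<in> tuples_in n \<gamma> \<rightarrow> tuples_in n \<gamma>" by (rule *[OF \<pi>])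
    show "(\<lambda>x. x \<circ> inv \<pi>) \<in> tuples_in n \<gamma> \<rightarrow> tuples_in n \<gamma>" by (rule *[OF permutes_inv[OF \<pi>]])
  qed (auto simp: comp_assoc permutes_inv_o[OF \<pi>])
qed

lemma tuple_permute_measurable:
  assumes \<pi>: "\<pi> permutes {..<n}"
  shows "(\<lambda>x. x \<circ> \<pi>) \<in> tuple_lborel n \<rightarrow>\<^sub>M (tuple_lborel n :: (nat \<Rightarrow> 'a::euclidean_space) measure)"
proof -
  have m: "(\<lambda>x. \<lambda>i\<in>{..<n}. x (\<pi> i)) \<in> tuple_lborel n \<rightarrow>\<^sub>M (tuple_lborel n :: (nat \<Rightarrow> 'a) measure)"
    using permutes_in_image[OF \<pi>] by (intro measurable_restrict measurable_component_singleton) auto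
  have "(\<lambda>i\<in>{..<n}. x (\<pi> i)) = x \<circ> \<pi>" if "x \<in> space (tuple_lborel n)" for x :: "nat \<Rightarrow> 'a"
    using tuple_compose_permutes(1)[OF \<pi> that] by (auto simp: space_PiM PiE_iff extensional_def fun_eq_iff)
  then show ?thesis by (rule measurable_cong[THEN iffD1, OF _ m])
qed

lemma distr_tuple_permute:
  assumes \<pi>: "\<pi> permutes {..<n}"
  shows "distr (tuple_lborel n) (tuple_lborel n) (\<lambda>x. x \<circ> \<pi>) = (tuple_lborel n :: (nat \<Rightarrow> 'a::euclidean_space) measure)"
proof (rule lborel_product.PiM_eqI)
  note m = tuple_permute_measurable[OF \<pi>]
  note \<pi>' = permutes_inv[OF \<pi>]
  fix A :: "nat \<Rightarrow> 'a set" assume A: "\<And>i. i \<in> {..<n} \<Longrightarrow> A i \<in> sets lborel"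
  have A': "A (inv \<pi> i) \<in> sets lborel" if "i \<in> {..<n}" for i using A that permutes_in_image[OF \<pi>'] by blast
  have "(\<lambda>x. x \<circ> \<pi>) -` PiE {..<n} A \<inter> space (tuple_lborel n) = PiE {..<n} (\<lambda>i. A (inv \<pi> i))"
  proof (intro equalityI subsetI)
    fix x assume x: "x \<in> (\<lambda>x. x \<circ> \<pi>) -` PiE {..<n} A \<inter> space (tuple_lborel n)"
    have "x i \<in> A (inv \<pi> i)" if "i \<in> {..<n}" for i
    proof -
      have "(x \<circ> \<pi>) (inv \<pi> i) \<in> A (inv \<pi> i)"
        using PiE_mem[of "x \<circ> \<pi>" "{..<n}" A "inv \<pi> i"] x permutes_in_image[OF \<pi>', of i] that by simp
      then show ?thesis by (simp add: permutes_inverses[OF \<pi>])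
    qed
    then show "x \<in> PiE {..<n} (\<lambda>i. A (inv \<pi> i))" using x by (auto simp: space_PiM intro: PiE_arb intro!: PiE_I)
  next
    fix x assume x: "x \<in> PiE {..<n} (\<lambda>i. A (inv \<pi> i))"
    then have xs: "x \<in> space (tuple_lborel n)" by (auto simp: space_PiM PiE_iff)
    have "(x \<circ> \<pi>) i \<in> A i" if "i \<in> {..<n}" for i
      using PiE_mem[OF x, of "\<pi> i"] permutes_in_image[OF \<pi>, of i] that by (simp add: permutes_inverses[OF \<pi>])
    then have "x \<circ> \<pi> \<in> PiE {..<n} A"
      using tuple_compose_permutes(1)[OF \<pi> xs] by (auto simp: space_PiM intro: PiE_arb intro!: PiE_I)
    then show "x \<in> (\<lambda>x. x \<circ> \<pi>) -` PiE {..<n} A \<inter> space (tuple_lborel n)" using xs by simp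
  qed
  then have "emeasure (distr (tuple_lborel n) (tuple_lborel n) (\<lambda>x. x \<circ> \<pi>)) (PiE {..<n} A) = (\<Prod>i<n. emeasure lborel (A (inv \<pi> i)))"
    using A A' by (simp only: emeasure_distr[OF m] sets_PiM_I_finite finite_lessThan lborel_product.emeasure_PiM)
  also have "\<dots> = (\<Prod>i<n. emeasure lborel (A i))"
    using prod.permute[OF \<pi>', of "\<lambda>i. emeasure lborel (A i)"] by (simp add: comp_def)
  finally show "emeasure (distr (tuple_lborel n) (tuple_lborel n) (\<lambda>x. x \<circ> \<pi>)) (PiE {..<n} A) = (\<Prod>i\<in>{..<n}. emeasure lborel (A i))" .
qed simp_all

lemma nn_integral_tuple_permute:
  assumes \<pi>: "\<pi> permutes {..<n}" and G: "G \<in> (tuple_borel n :: ((nat \<Rightarrow> 'a::euclidean_space) \<Rightarrow> _) set)"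
  shows "(\<integral>\<^sup>+x. G (x \<circ> \<pi>) \<partial>tuple_lborel n) = (\<integral>\<^sup>+x. G x \<partial>tuple_lborel n)"
  using nn_integral_distr[OF tuple_permute_measurable[OF \<pi>], of G] G unfolding distr_tuple_permute[OF \<pi>] by simp

section \<open>Correlation functions as densities of factorial moment measures\<close>

lemma ex_enumeration:
  assumes "finite (\<eta> :: 'a::euclidean_space set)" "card \<eta> = n"
  obtains x where "x \<in> distinct_tuples n" "x ` {..<n} = \<eta>"
proof -
  obtain h where h: "bij_betw h {0..<card \<eta>} \<eta>" using ex_bij_betw_nat_finite[OF assms(1)] by blast
  then have h: "inj_on h {..<n}" "h ` {..<n} = \<eta>" using assms(2) by (simp_all add: bij_betw_def atLeast0LessThan)
  have "restrict h {..<n} \<in> distinct_tuples n"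
    using h(1) by (simp add: distinct_tuples_def inj_on_restrict_eq)
  moreover have "restrict h {..<n} ` {..<n} = \<eta>" using h(2) by (simp only: image_restrict_eq)
  ultimately show ?thesis by (rule that)
qed

lemma enum_config:
  assumes "finite (\<eta> :: 'a::euclidean_space set)" "card \<eta> = n"
  shows "enum_config n \<eta> \<in> distinct_tuples n" "enum_config n \<eta> ` {..<n} = \<eta>"
proof -
  obtain x where "x \<in> distinct_tuples n \<and> x ` {..<n} = \<eta>" using ex_enumeration[OF assms] by metis
  from someI[where P="\<lambda>x. x \<in> distinct_tuples n \<and> x ` {..<n} = \<eta>", OF this]
  show "enum_config n \<eta> \<in> distinct_tuples n" "enum_config n \<eta> ` {..<n} = \<eta>" by (simp_all only: enum_config_def)
qed

lemma enumerations:
  assumes \<eta>: "finite (\<eta> :: 'a::euclidean_space set)" "card \<eta> = n"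
  shows "bij_betw (\<lambda>\<pi>. enum_config n \<eta> \<circ> \<pi>) {\<pi>. \<pi> permutes {..<n}} {x \<in> distinct_tuples n. x ` {..<n} = \<eta>}"
proof -
  let ?e = "enum_config n \<eta>"
  note e = enum_config[OF \<eta>]
  show ?thesis
    unfolding bij_betw_def
  proof (intro conjI equalityI subsetI inj_onI)
    fix \<pi> \<sigma> assume *: "\<pi> \<in> {\<pi>. \<pi> permutes {..<n}}" "\<sigma> \<in> {\<pi>. \<pi> permutes {..<n}}" "?e \<circ> \<pi> = ?e \<circ> \<sigma>"
    show "\<pi> = \<sigma>"
    proof
      fix i
      have p: "\<pi> permutes {..<n}" "\<sigma> permutes {..<n}" using * by simp_all
      show "\<pi> i = \<sigma> i"
      proof (cases "i \<in> {..<n}")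
        case True
        have "?e (\<pi> i) = ?e (\<sigma> i)" using fun_cong[OF *(3), of i] by simp
        then show ?thesis
          using inj_onD[OF distinct_tuplesD(1)[OF e(1)]] permutes_in_image[OF p(1), of i] permutes_in_image[OF p(2), of i] True by blast
      next
        case False
        then show ?thesis using permutes_not_in[OF p(1)] permutes_not_in[OF p(2)] by simp
      qed
    qed
  next
    fix y assume "y \<in> (\<lambda>\<pi>. ?e \<circ> \<pi>) ` {\<pi>. \<pi> permutes {..<n}}"
    then obtain \<pi> where \<pi>: "\<pi> permutes {..<n}" "y = ?e \<circ> \<pi>" by blast
    show "y \<in> {x \<in> distinct_tuples n. x ` {..<n} = \<eta>}"
      using tuple_compose_permutes(2,3)[OF \<pi>(1) distinct_tuplesD(3)[OF e(1)]] e \<pi>(2) by simp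
  next
    fix y assume y: "y \<in> {x \<in> distinct_tuples n. x ` {..<n} = \<eta>}"
    then have "y \<in> distinct_tuples n" "?e ` {..<n} = y ` {..<n}" using e(2) by simp_all
    then obtain \<pi> where "\<pi> permutes {..<n}" "y = ?e \<circ> \<pi>" using tuples_same_image[OF e(1)] by metis
    then show "y \<in> (\<lambda>\<pi>. ?e \<circ> \<pi>) ` {\<pi>. \<pi> permutes {..<n}}" by blast
  qed
qed

text \<open>Each \<open>n\<close>-point subset of a configuration is enumerated by \<open>n!\<close> tuples.\<close>

lemma tuple_sum_symmetric:
  fixes \<gamma> :: "'a::euclidean_space set"
  assumes \<gamma>: "\<gamma> \<in> configurations" and K: "bounded K"
    and sym: "\<And>\<pi> x. \<pi> permutes {..<n} \<Longrightarrow> x \<in> space (tuple_lborel n) \<Longrightarrow> G (x \<circ> \<pi>) = G x"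
    and supp: "\<And>x. x \<in> distinct_tuples n \<Longrightarrow> \<not> x ` {..<n} \<subseteq> K \<Longrightarrow> G x = 0"
  shows "tuple_sum n G \<gamma> = of_nat (fact n) * (\<Sum>\<eta>\<in>{\<eta>. \<eta> \<subseteq> \<gamma> \<inter> K \<and> card \<eta> = n}. G (enum_config n \<eta>))"
proof -
  let ?T = "tuples_in n (\<gamma> \<inter> K)" and ?S = "{\<eta>. \<eta> \<subseteq> \<gamma> \<inter> K \<and> card \<eta> = n}"
  have fin: "finite (\<gamma> \<inter> K)" by (rule configuration_finite_Int[OF \<gamma> K])
  have fT: "finite ?T"
  proof (rule finite_subset)
    show "?T \<subseteq> {..<n} \<rightarrow>\<^sub>E (\<gamma> \<inter> K)"
    proof
      fix x assume "x \<in> ?T"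
      then have x: "x \<in> {..<n} \<rightarrow>\<^sub>E UNIV" "x ` {..<n} \<subseteq> \<gamma> \<inter> K" by (simp_all add: tuples_in_def distinct_tuples_def)
      show "x \<in> {..<n} \<rightarrow>\<^sub>E (\<gamma> \<inter> K)"
        by (rule PiE_I) (use x PiE_arb[OF x(1)] in blast)+
    qed
    show "finite ({..<n} \<rightarrow>\<^sub>E (\<gamma> \<inter> K))" using fin by (intro finite_PiE) auto
  qed
  have fS: "finite ?S" by (rule finite_subset[OF _ finite_Pow_iff[THEN iffD2, OF fin]]) blast
  have "tuple_sum n G \<gamma> = (\<integral>\<^sup>+x. G x \<partial>count_space ?T)"
    unfolding tuple_sum_def
  proof (rule nn_integral_count_space_eq)
    show "G x = 0" if "x \<in> tuples_in n \<gamma> - ?T" for x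
      using that by (intro supp) (simp_all add: tuples_in_def)
    show "G x = 0" if "x \<in> ?T - tuples_in n \<gamma>" for x
      using that by (auto simp: tuples_in_def)
  qed
  also have "\<dots> = (\<Sum>x\<in>?T. G x)" by (rule nn_integral_count_space_finite[OF fT])
  also have "\<dots> = (\<Sum>\<eta>\<in>?S. \<Sum>x\<in>{x. x \<in> ?T \<and> x ` {..<n} = \<eta>}. G x)"
    by (rule sum.group[OF fT fS, symmetric]) (auto simp: tuples_in_def distinct_tuplesD(2))
  also have "\<dots> = (\<Sum>\<eta>\<in>?S. of_nat (fact n) * G (enum_config n \<eta>))"
  proof (rule sum.cong[OF refl])
    fix \<eta> assume "\<eta> \<in> ?S"
    then have \<eta>: "\<eta> \<subseteq> \<gamma> \<inter> K" "card \<eta> = n" by simp_all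
    have f\<eta>: "finite \<eta>" by (rule finite_subset[OF \<eta>(1) fin])
    have "{x. x \<in> ?T \<and> x ` {..<n} = \<eta>} = {x \<in> distinct_tuples n. x ` {..<n} = \<eta>}"
      using \<eta>(1) by (auto simp: tuples_in_def)
    then have "(\<Sum>x\<in>{x. x \<in> ?T \<and> x ` {..<n} = \<eta>}. G x) = (\<Sum>\<pi>\<in>{\<pi>. \<pi> permutes {..<n}}. G (enum_config n \<eta> \<circ> \<pi>))"
      using sum.reindex_bij_betw[OF enumerations[OF f\<eta> \<eta>(2)], of G] by simp
    also have "\<dots> = (\<Sum>\<pi>\<in>{\<pi>. \<pi> permutes {..<n}}. G (enum_config n \<eta>))"
      by (rule sum.cong[OF refl]) (use sym[OF _ distinct_tuplesD(3)[OF enum_config(1)[OF f\<eta> \<eta>(2)]]] in simp)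
    also have "\<dots> = of_nat (fact n) * G (enum_config n \<eta>)"
      using card_permutations[of "{..<n}" n] by simp
    finally show "(\<Sum>x\<in>{x. x \<in> ?T \<and> x ` {..<n} = \<eta>}. G x) = of_nat (fact n) * G (enum_config n \<eta>)" .
  qed
  finally show ?thesis by (simp only: sum_distrib_left)
qed

lemma config_sum_finite:
  fixes \<gamma> :: "'a::euclidean_space set"
  assumes \<gamma>: "\<gamma> \<in> configurations" and K: "bounded K"
    and supp: "\<And>x. x \<in> distinct_tuples n \<Longrightarrow> \<not> x ` {..<n} \<subseteq> K \<Longrightarrow> g x = 0"
  shows "config_sum n g \<gamma> = (\<Sum>\<eta>\<in>{\<eta>. \<eta> \<subseteq> \<gamma> \<inter> K \<and> card \<eta> = n}. g (enum_config n \<eta>))"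
proof -
  have fin: "finite (\<gamma> \<inter> K)" by (rule configuration_finite_Int[OF \<gamma> K])
  have fS: "finite {\<eta>. \<eta> \<subseteq> \<gamma> \<inter> K \<and> card \<eta> = n}"
    by (rule finite_subset[OF _ finite_Pow_iff[THEN iffD2, OF fin]]) blast
  have "config_sum n g \<gamma> = infsum (\<lambda>\<eta>. g (enum_config n \<eta>)) {\<eta>. \<eta> \<subseteq> \<gamma> \<inter> K \<and> card \<eta> = n}"
    unfolding config_sum_def
  proof (rule infsum_cong_neutral)
    fix \<eta> assume "\<eta> \<in> {\<eta>. \<eta> \<subseteq> \<gamma> \<inter> K \<and> card \<eta> = n} - {\<eta>. \<eta> \<subseteq> \<gamma> \<and> finite \<eta> \<and> card \<eta> = n}"
    then show "g (enum_config n \<eta>) = 0" using finite_subset[OF _ fin, of \<eta>] by blast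
  next
    fix \<eta> assume "\<eta> \<in> {\<eta>. \<eta> \<subseteq> \<gamma> \<and> finite \<eta> \<and> card \<eta> = n} - {\<eta>. \<eta> \<subseteq> \<gamma> \<inter> K \<and> card \<eta> = n}"
    then have \<eta>: "finite \<eta>" "card \<eta> = n" "\<not> \<eta> \<subseteq> K" by blast+
    show "g (enum_config n \<eta>) = 0" using enum_config[OF \<eta>(1,2)] \<eta>(3) by (intro supp) simp_all
  qed simp
  then show ?thesis using fS by simp
qed

text \<open>The coordinate projections of a compact set of tuples are compact, and finitely many of
  them have a bounded union.\<close>

lemma test_function_support:
  assumes "g \<in> test_functions n"
  obtains K :: "'a::euclidean_space set" where "bounded K" "\<And>x. x \<in> space (tuple_lborel n) \<Longrightarrow> \<not> x ` {..<n} \<subseteq> K \<Longrightarrow> g x = 0"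
proof -
  obtain \<Lambda> where \<Lambda>: "compactin (tuple_topology n) \<Lambda>" "\<And>x. x \<in> ({..<n} \<rightarrow>\<^sub>E UNIV) - \<Lambda> \<Longrightarrow> g x = 0"
    using assms unfolding test_functions_def by blast
  have "compact ((\<lambda>x. x i) ` \<Lambda>)" if "i < n" for i
    using image_compactin[OF \<Lambda>(1) continuous_map_product_projection[of i]] that by simp
  then have b: "bounded (\<Union>i\<in>{..<n}. (\<lambda>x. x i) ` \<Lambda>)"
    by (intro bounded_UN ballI compact_imp_bounded) auto
  show ?thesis
  proof (rule that[OF b])
    fix x assume x: "x \<in> space (tuple_lborel n :: (nat \<Rightarrow> 'a) measure)" "\<not> x ` {..<n} \<subseteq> (\<Union>i\<in>{..<n}. (\<lambda>x. x i) ` \<Lambda>)"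
    then have "x \<notin> \<Lambda>" by blast
    then show "g x = 0" using x(1) by (intro \<Lambda>(2)) (simp add: space_tuple)
  qed
qed

lemma tuple_sum_test_function:
  fixes \<gamma> :: "'a::euclidean_space set"
  assumes g: "g \<in> test_functions n" "\<And>x. 0 \<le> g x" and \<gamma>: "\<gamma> \<in> configurations"
  shows "tuple_sum n (\<lambda>x. ennreal (g x)) \<gamma> = ennreal (fact n * config_sum n g \<gamma>)" "0 \<le> config_sum n g \<gamma>"
proof -
  obtain K :: "'a set" where K: "bounded K" "\<And>x. x \<in> space (tuple_lborel n) \<Longrightarrow> \<not> x ` {..<n} \<subseteq> K \<Longrightarrow> g x = 0"
    using test_function_support[OF g(1)] by metis
  have sym: "g (x \<circ> \<pi>) = g x" if "\<pi> permutes {..<n}" "x \<in> space (tuple_lborel n)" for \<pi> x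
    using g(1) that by (simp add: test_functions_def space_tuple)
  have s: "config_sum n g \<gamma> = (\<Sum>\<eta>\<in>{\<eta>. \<eta> \<subseteq> \<gamma> \<inter> K \<and> card \<eta> = n}. g (enum_config n \<eta>))"
    by (rule config_sum_finite[OF \<gamma> K(1)]) (rule K(2)[OF distinct_tuplesD(3)])
  show "0 \<le> config_sum n g \<gamma>" unfolding s by (intro sum_nonneg g(2))
  have "tuple_sum n (\<lambda>x. ennreal (g x)) \<gamma> = of_nat (fact n) * (\<Sum>\<eta>\<in>{\<eta>. \<eta> \<subseteq> \<gamma> \<inter> K \<and> card \<eta> = n}. ennreal (g (enum_config n \<eta>)))"
    by (rule tuple_sum_symmetric[OF \<gamma> K(1)]) (simp_all add: sym K(2)[OF distinct_tuplesD(3)])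
  also have "\<dots> = ennreal (fact n) * ennreal (config_sum n g \<gamma>)"
    unfolding s using g(2) by (simp add: sum_ennreal ennreal_of_nat_eq_real_of_nat)
  finally show "tuple_sum n (\<lambda>x. ennreal (g x)) \<gamma> = ennreal (fact n * config_sum n g \<gamma>)"
    using g(2) by (simp add: ennreal_mult sum_nonneg s)
qed

lemma test_functionsI:
  assumes m: "g \<in> (tuple_borel n :: ((nat \<Rightarrow> 'a::euclidean_space) \<Rightarrow> _) set)"
    and C: "\<And>x. x \<in> space (tuple_lborel n) \<Longrightarrow> \<bar>g x\<bar> \<le> C"
    and R: "\<And>x. x \<in> space (tuple_lborel n) \<Longrightarrow> \<not> x ` {..<n} \<subseteq> cball 0 R \<Longrightarrow> g x = 0"
    and sym: "\<And>\<pi> x. \<pi> permutes {..<n} \<Longrightarrow> x \<in> space (tuple_lborel n) \<Longrightarrow> g (x \<circ> \<pi>) = g x"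
  shows "g \<in> test_functions n"
  unfolding test_functions_def mem_Collect_eq space_tuple[symmetric]
proof (intro conjI exI ballI allI impI)
  show "g \<in> tuple_borel n" by fact
  show "\<bar>g x\<bar> \<le> C" if "x \<in> space (tuple_lborel n)" for x by (rule C[OF that])
  show "compactin (tuple_topology n) (PiE {..<n} (\<lambda>_. cball 0 R))"
    by (simp add: compactin_PiE)
  show "g x = 0" if "x \<in> space (tuple_lborel n) - PiE {..<n} (\<lambda>_. cball 0 R)" for x
  proof (rule R)
    show xs: "x \<in> space (tuple_lborel n)" using that by blast
    show "\<not> x ` {..<n} \<subseteq> cball 0 R"
    proof
      assume *: "x ` {..<n} \<subseteq> cball 0 R"
      have "x \<in> PiE {..<n} (\<lambda>_. cball 0 R)"
        by (rule PiE_I) (use * PiE_arb[OF xs[unfolded space_tuple]] in blast)+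
      then show False using that by blast
    qed
  qed
  show "g (x \<circ> \<pi>) = g x" if "\<pi> permutes {..<n}" "x \<in> space (tuple_lborel n)" for \<pi> x by (rule sym[OF that])
qed

lemma space_config_probs: "\<mu> \<in> config_probs \<Longrightarrow> space \<mu> = configurations"
  using sets_eq_imp_space_eq[of \<mu> vague_space] by (simp add: config_probs_def space_vague)

lemma measurable_config_probs: "\<mu> \<in> config_probs \<Longrightarrow> f \<in> vague_space \<rightarrow>\<^sub>M N \<Longrightarrow> f \<in> \<mu> \<rightarrow>\<^sub>M N"
  by (simp add: config_probs_def cong: measurable_cong_sets)

text \<open>The sum over tuples is \<open>fact n\<close> times the sum over subsets, which cancels
  the factor \<open>1 / fact n\<close> in the definition of the correlation measure.\<close>

lemma correlation_nn_integral_test: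
  fixes \<mu> :: "'a::euclidean_space set measure"
  assumes \<mu>: "\<mu> \<in> config_probs" "is_correlation_function \<mu> k" and n: "1 \<le> n"
    and g: "g \<in> test_functions n" "\<And>x. 0 \<le> g x"
  shows "(\<integral>\<^sup>+\<gamma>. tuple_sum n (\<lambda>x. ennreal (g x)) \<gamma> \<partial>\<mu>) = (\<integral>\<^sup>+x. ennreal (g x) * ennreal (k (x ` {..<n})) \<partial>tuple_lborel n)"
proof -
  let ?\<rho> = "density (tuple_lborel n) (\<lambda>x. ennreal (k (x ` {..<n})))"
  have k[measurable]: "k \<in> config_borel" using \<mu>(2) by (simp add: is_correlation_function_def)
  have "is_correlation_measure \<mu> n ?\<rho>" using \<mu>(2) n unfolding is_correlation_function_def by metis
  then have c: "integrable \<mu> (config_sum n g)" "integrable ?\<rho> g" "(LINT \<gamma>|\<mu>. config_sum n g \<gamma>) = 1 / fact n * (LINT x|?\<rho>. g x)"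
    using g(1) by (simp_all add: is_correlation_measure_def)
  have gm: "g \<in> tuple_borel n" using g(1) by (simp add: test_functions_def)
  have "(\<integral>\<^sup>+\<gamma>. tuple_sum n (\<lambda>x. ennreal (g x)) \<gamma> \<partial>\<mu>) = (\<integral>\<^sup>+\<gamma>. ennreal (fact n * config_sum n g \<gamma>) \<partial>\<mu>)"
    by (rule nn_integral_cong) (simp add: space_config_probs[OF \<mu>(1)] tuple_sum_test_function[OF g])
  also have "\<dots> = ennreal (LINT \<gamma>|\<mu>. fact n * config_sum n g \<gamma>)"
    using c(1) tuple_sum_test_function(2)[OF g] space_config_probs[OF \<mu>(1)]
    by (intro nn_integral_eq_integral integrable_mult_right AE_I2 mult_nonneg_nonneg) auto
  also have "(LINT \<gamma>|\<mu>. fact n * config_sum n g \<gamma>) = (LINT x|?\<rho>. g x)" by (simp add: c(3))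
  also have "ennreal (LINT x|?\<rho>. g x) = (\<integral>\<^sup>+x. ennreal (g x) \<partial>?\<rho>)"
    using c(2) g(2) by (intro nn_integral_eq_integral[symmetric]) auto
  also have "\<dots> = (\<integral>\<^sup>+x. ennreal (k (x ` {..<n})) * ennreal (g x) \<partial>tuple_lborel n)"
    by (rule nn_integral_density) (use gm in measurable)
  finally show ?thesis by (simp only: mult.commute)
qed

text \<open>Test functions are symmetric and \<open>G\<close> need not be, so \<open>G\<close> is
  summed over all permutations. Both sides are invariant under a permutation of the variables, so
  each is multiplied by \<open>fact n\<close>, which is then cancelled.\<close>

lemma correlation_nn_integral_bounded:
  fixes \<mu> :: "'a::euclidean_space set measure"
  assumes \<mu>: "\<mu> \<in> config_probs" "is_correlation_function \<mu> k" and n: "1 \<le> n"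
    and G: "G \<in> tuple_borel n" and C: "\<And>x. G x \<le> of_nat C"
    and R: "\<And>x. \<not> x ` {..<n} \<subseteq> cball 0 R \<Longrightarrow> G x = 0"
  shows "(\<integral>\<^sup>+\<gamma>. tuple_sum n G \<gamma> \<partial>\<mu>) = correlation_integral n k G"
proof -
  let ?P = "{\<pi>. \<pi> permutes {..<n}}"
  have finP: "finite ?P" by (rule finite_permutations) simp
  have cardP: "card ?P = fact n" by (rule card_permutations) auto
  have k[measurable]: "k \<in> config_borel" using \<mu>(2) by (simp add: is_correlation_function_def)
  define g where "g x = (\<Sum>\<pi>\<in>?P. enn2real (G (x \<circ> \<pi>)))" for x
  have eG: "ennreal (enn2real (G x)) = G x" for x
  proof -
    have "G x < top" by (rule le_less_trans[OF C]) (simp add: of_nat_less_top)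
    then show ?thesis by simp
  qed
  have g0: "0 \<le> g x" for x unfolding g_def by (intro sum_nonneg) simp
  have eg: "ennreal (g x) = (\<Sum>\<pi>\<in>?P. G (x \<circ> \<pi>))" for x
    unfolding g_def by (simp only: sum_ennreal[symmetric] enn2real_nonneg eG)
  have Gm: "(\<lambda>x. G (x \<circ> \<pi>)) \<in> tuple_borel n" if "\<pi> permutes {..<n}" for \<pi>
    by (rule measurable_compose[OF tuple_permute_measurable[OF that] G])
  have gt: "g \<in> test_functions n"
  proof (rule test_functionsI)
    show "g \<in> tuple_borel n"
      unfolding g_def[abs_def] using Gm by (intro borel_measurable_sum borel_measurable_enn2real) simp
    have "enn2real (G x) \<le> real C" for x using C[of x] by (intro enn2real_leI) (simp_all add: ennreal_of_nat_eq_real_of_nat)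
    then have "g x \<le> real (card ?P) * real C" for x unfolding g_def by (intro sum_bounded_above) simp
    then show "\<bar>g x\<bar> \<le> real (card ?P) * real C" for x using g0[of x] by simp
    show "g x = 0" if "x \<in> space (tuple_lborel n)" "\<not> x ` {..<n} \<subseteq> cball 0 R" for x
    proof -
      have "G (x \<circ> \<pi>) = 0" if "\<pi> permutes {..<n}" for \<pi>
        using R[of "x \<circ> \<pi>"] \<open>\<not> x ` {..<n} \<subseteq> cball 0 R\<close> unfolding tuple_compose_permutes(2)[OF that \<open>x \<in> _\<close>] by blast
      then show ?thesis by (simp add: g_def)
    qed
    fix \<sigma> x assume \<sigma>: "\<sigma> permutes {..<n}"
    have "g (x \<circ> \<sigma>) = (\<Sum>\<pi>\<in>?P. enn2real (G (x \<circ> (\<sigma> \<circ> \<pi>))))" by (simp add: g_def comp_assoc)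
    also have "\<dots> = g x"
      unfolding g_def
    proof (rule sum.reindex_bij_witness[where i="\<lambda>\<pi>. inv \<sigma> \<circ> \<pi>" and j="\<lambda>\<pi>. \<sigma> \<circ> \<pi>"])
      show "inv \<sigma> \<circ> (\<sigma> \<circ> \<pi>) = \<pi>" "\<sigma> \<circ> (inv \<sigma> \<circ> \<pi>) = \<pi>" for \<pi> :: "nat \<Rightarrow> nat"
        by (simp_all add: comp_assoc[symmetric] permutes_inv_o[OF \<sigma>])
      show "\<sigma> \<circ> \<pi> \<in> ?P" if "\<pi> \<in> ?P" for \<pi> using permutes_compose[OF _ \<sigma>] that by simp
      show "inv \<sigma> \<circ> \<pi> \<in> ?P" if "\<pi> \<in> ?P" for \<pi> using permutes_compose[OF _ permutes_inv[OF \<sigma>]] that by simp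
    qed simp
    finally show "g (x \<circ> \<sigma>) = g x" .
  qed
  have "of_nat (fact n) * (\<integral>\<^sup>+\<gamma>. tuple_sum n G \<gamma> \<partial>\<mu>) = (\<integral>\<^sup>+\<gamma>. of_nat (fact n) * tuple_sum n G \<gamma> \<partial>\<mu>)"
    by (intro nn_integral_cmult[symmetric] measurable_config_probs[OF \<mu>(1)] tuple_sum_measurable G)
  also have "\<dots> = (\<integral>\<^sup>+\<gamma>. tuple_sum n (\<lambda>x. ennreal (g x)) \<gamma> \<partial>\<mu>)"
    unfolding eg tuple_sum_sum by (intro nn_integral_cong) (simp add: tuple_sum_permute cardP)
  also have "\<dots> = (\<integral>\<^sup>+x. ennreal (g x) * ennreal (k (x ` {..<n})) \<partial>tuple_lborel n)"
    by (rule correlation_nn_integral_test[OF \<mu> n gt g0])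
  also have "\<dots> = (\<integral>\<^sup>+x. (\<Sum>\<pi>\<in>?P. G (x \<circ> \<pi>) * ennreal (k ((x \<circ> \<pi>) ` {..<n}))) \<partial>tuple_lborel n)"
    unfolding eg sum_distrib_right
    by (intro nn_integral_cong sum.cong refl) (simp only: mem_Collect_eq tuple_compose_permutes(2))
  also have "\<dots> = (\<Sum>\<pi>\<in>?P. \<integral>\<^sup>+x. G (x \<circ> \<pi>) * ennreal (k ((x \<circ> \<pi>) ` {..<n})) \<partial>tuple_lborel n)"
  proof (rule nn_integral_sum)
    fix \<pi> assume "\<pi> \<in> ?P"
    then have \<pi>: "\<pi> permutes {..<n}" by simp
    have [measurable]: "(\<lambda>x. G x * ennreal (k (x ` {..<n}))) \<in> tuple_borel n" using G by measurable
    show "(\<lambda>x. G (x \<circ> \<pi>) * ennreal (k ((x \<circ> \<pi>) ` {..<n}))) \<in> tuple_borel n"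
      by (rule measurable_compose[OF tuple_permute_measurable[OF \<pi>], of "\<lambda>x. G x * ennreal (k (x ` {..<n}))"]) measurable
  qed
  also have "\<dots> = (\<Sum>\<pi>\<in>?P. \<integral>\<^sup>+x. G x * ennreal (k (x ` {..<n})) \<partial>tuple_lborel n)"
  proof (rule sum.cong[OF refl])
    fix \<pi> assume "\<pi> \<in> ?P"
    then have \<pi>: "\<pi> permutes {..<n}" by simp
    have m: "(\<lambda>x. G x * ennreal (k (x ` {..<n}))) \<in> tuple_borel n" using G by measurable
    show "(\<integral>\<^sup>+x. G (x \<circ> \<pi>) * ennreal (k ((x \<circ> \<pi>) ` {..<n})) \<partial>tuple_lborel n) = correlation_integral n k G"
      by (rule nn_integral_tuple_permute[OF \<pi> m])
  qed
  also have "\<dots> = of_nat (fact n) * correlation_integral n k G"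
    by (simp add: cardP)
  finally show ?thesis
    by (subst (asm) ennreal_mult_cancel_left) (simp add: of_nat_less_top less_top[symmetric])
qed

text \<open>Campbell's formula for arbitrary nonnegative \<open>G\<close>, by monotone convergence.
  The truncation \<open>H m\<close> cuts the values at \<open>m\<close> and the support at the ball
  of radius \<open>m\<close> in each coordinate.\<close>

lemma correlation_nn_integral:
  fixes \<mu> :: "'a::euclidean_space set measure"
  assumes \<mu>: "\<mu> \<in> config_probs" "is_correlation_function \<mu> k" and n: "1 \<le> n"
    and G: "G \<in> tuple_borel n"
  shows "(\<integral>\<^sup>+\<gamma>. tuple_sum n G \<gamma> \<partial>\<mu>) = correlation_integral n k G"
proof -
  have k[measurable]: "k \<in> config_borel" using \<mu>(2) by (simp add: is_correlation_function_def)
  define H :: "nat \<Rightarrow> (nat \<Rightarrow> 'a) \<Rightarrow> ennreal" where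
    "H m x = (if \<forall>i\<in>{..<n}. norm (x i) \<le> real m then min (G x) (of_nat m) else 0)" for m x
  have Hm: "H m \<in> tuple_borel n" for m
    unfolding H_def
  proof (rule measurable_If)
    show "(\<lambda>x. min (G x) (of_nat m)) \<in> tuple_borel n" using G by measurable
    show "{x \<in> space (tuple_lborel n). \<forall>i\<in>{..<n}. norm (x i :: 'a) \<le> real m} \<in> sets (tuple_lborel n)"
      by (intro sets.sets_Collect_finite_All) measurable
  qed simp
  have inc: "incseq H"
  proof (rule incseq_SucI, rule le_funI)
    fix m x
    show "H m x \<le> H (Suc m) x"
    proof (cases "\<forall>i\<in>{..<n}. norm (x i) \<le> real m")
      case True
      then have "\<forall>i\<in>{..<n}. norm (x i) \<le> real (Suc m)" by force
      moreover have "min (G x) (of_nat m) \<le> min (G x) (of_nat (Suc m))"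
        by (intro min.mono order_refl of_nat_mono) simp
      ultimately show ?thesis using True unfolding H_def by (simp only: if_True simp_thms if_P)
    next
      case False
      then have "H m x = 0" unfolding H_def by (rule if_not_P)
      then show ?thesis by simp
    qed
  qed
  have sup: "(SUP m. H m x) = G x" for x
  proof (rule antisym)
    show "(SUP m. H m x) \<le> G x" by (intro SUP_least) (simp add: H_def)
    show "G x \<le> (SUP m. H m x)"
      unfolding le_SUP_iff
    proof (intro allI impI)
      fix y assume y: "y < G x"
      then have "y < top" by (rule less_le_trans) simp
      then obtain m1 where m1: "y < of_nat m1" using ennreal_Ex_less_of_nat by blast
      obtain m2 where m2: "(\<Sum>i<n. norm (x i)) \<le> real m2" using real_arch_simple by blast
      let ?m = "max m1 m2"
      have "norm (x i) \<le> real ?m" if "i < n" for i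
        using member_le_sum[of i "{..<n}" "\<lambda>i. norm (x i)"] m2 that by simp
      moreover have "y < of_nat ?m" by (rule less_le_trans[OF m1]) (intro of_nat_mono, simp)
      ultimately have "y < H ?m x" using y by (simp add: H_def)
      then show "\<exists>i\<in>UNIV. y < H i x" by blast
    qed
  qed
  have "(\<integral>\<^sup>+\<gamma>. tuple_sum n G \<gamma> \<partial>\<mu>) = (\<integral>\<^sup>+\<gamma>. (SUP m. tuple_sum n (H m) \<gamma>) \<partial>\<mu>)"
    using tuple_sum_SUP[OF inc, of n] by (simp add: sup)
  also have "\<dots> = (SUP m. \<integral>\<^sup>+\<gamma>. tuple_sum n (H m) \<gamma> \<partial>\<mu>)"
  proof (rule nn_integral_monotone_convergence_SUP)
    show "incseq (\<lambda>m. tuple_sum n (H m))"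
      by (intro monoI le_funI) (auto simp: tuple_sum_def intro!: nn_integral_mono le_funD[OF monoD[OF inc]])
  qed (intro measurable_config_probs[OF \<mu>(1)] tuple_sum_measurable Hm)
  also have "\<dots> = (SUP m. \<integral>\<^sup>+x. H m x * ennreal (k (x ` {..<n})) \<partial>tuple_lborel n)"
  proof (rule SUP_cong[OF refl])
    fix m
    show "(\<integral>\<^sup>+\<gamma>. tuple_sum n (H m) \<gamma> \<partial>\<mu>) = correlation_integral n k (H m)"
    proof (rule correlation_nn_integral_bounded[OF \<mu> n Hm])
      show "H m x \<le> of_nat m" for x by (simp add: H_def)
      show "H m x = 0" if "\<not> x ` {..<n} \<subseteq> cball 0 (real m)" for x
      proof -
        have "\<not> (\<forall>i\<in>{..<n}. norm (x i) \<le> real m)" using that by auto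
        then show ?thesis unfolding H_def by (rule if_not_P)
      qed
    qed
  qed
  also have "\<dots> = (\<integral>\<^sup>+x. (SUP m. H m x * ennreal (k (x ` {..<n}))) \<partial>tuple_lborel n)"
  proof (rule nn_integral_monotone_convergence_SUP[symmetric])
    show "incseq (\<lambda>m x. H m x * ennreal (k (x ` {..<n})))"
      by (intro monoI le_funI mult_right_mono le_funD[OF monoD[OF inc]]) simp_all
    show "(\<lambda>x. H m x * ennreal (k (x ` {..<n}))) \<in> tuple_borel n" for m using Hm[of m] by measurable
  qed
  also have "\<dots> = correlation_integral n k G"
    by (simp only: SUP_mult_right_ennreal[symmetric] sup)
  finally show ?thesis .
qed

text \<open>The density is bounded and the test function is bounded and vanishes outside a box of
  finite volume.\<close>

lemma test_function_integrable:
  fixes k :: "'a::euclidean_space set \<Rightarrow> real"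
  assumes k[measurable]: "k \<in> config_borel"
    and nn: "AE x in tuple_lborel n. 0 \<le> k (x ` {..<n})" and b: "sector_bound n k c"
    and h: "h \<in> test_functions n" "\<And>x. 0 \<le> h x"
  shows "integrable (density (tuple_lborel n) (\<lambda>x. ennreal (k (x ` {..<n})))) h"
proof (rule integrableI_nonneg)
  have hm[measurable]: "h \<in> tuple_borel n" using h(1) by (simp add: test_functions_def)
  show "h \<in> borel_measurable (density (tuple_lborel n) (\<lambda>x. ennreal (k (x ` {..<n}))))" by simp
  obtain C where C: "\<And>x. x \<in> space (tuple_lborel n) \<Longrightarrow> \<bar>h x\<bar> \<le> C"
    using h(1) unfolding test_functions_def space_tuple[symmetric] by blast
  obtain K :: "'a set" where K: "bounded K" "\<And>x. x \<in> space (tuple_lborel n) \<Longrightarrow> \<not> x ` {..<n} \<subseteq> K \<Longrightarrow> h x = 0"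
    using test_function_support[OF h(1)] by metis
  obtain R where R: "K \<subseteq> cball 0 R" using K(1) by (auto simp: bounded_iff subset_eq)
  let ?Q = "PiE {..<n} (\<lambda>_. cball 0 R) :: (nat \<Rightarrow> 'a) set"
  have "(\<integral>\<^sup>+x. ennreal (h x) \<partial>density (tuple_lborel n) (\<lambda>x. ennreal (k (x ` {..<n})))) =
     (\<integral>\<^sup>+x. ennreal (k (x ` {..<n})) * ennreal (h x) \<partial>tuple_lborel n)"
    by (rule nn_integral_density) measurable
  also have "\<dots> \<le> (\<integral>\<^sup>+x. ennreal (c * C) * indicator ?Q x \<partial>tuple_lborel n)"
  proof (rule nn_integral_mono_AE)
    show "AE x in tuple_lborel n. ennreal (k (x ` {..<n})) * ennreal (h x) \<le> ennreal (c * C) * indicator ?Q x"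
      using AE_space b[unfolded sector_bound_def] nn
    proof eventually_elim
      case (elim x)
      show ?case
      proof (cases "x \<in> ?Q")
        case True
        have "k (x ` {..<n}) * h x \<le> c * C"
          using elim C[OF elim(1)] h(2)[of x] by (intro mult_mono) auto
        then show ?thesis using True elim(3) h(2) by (simp add: ennreal_mult[symmetric] ennreal_leI)
      next
        case False
        have "\<not> x ` {..<n} \<subseteq> K"
        proof
          assume "x ` {..<n} \<subseteq> K"
          then have "x \<in> ?Q" by (intro PiE_I) (use R PiE_arb[OF elim(1)[unfolded space_tuple]] in blast)+
          then show False using False by blast
        qed
        then show ?thesis using K(2)[OF elim(1)] by simp
      qed
    qed
  qed
  also have "\<dots> = ennreal (c * C) * emeasure (tuple_lborel n) ?Q"
    by (intro nn_integral_cmult_indicator sets_PiM_I_finite) auto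
  also have "emeasure (tuple_lborel n) ?Q = (\<Prod>i<n. emeasure lborel (cball (0 :: 'a) R))"
    by (intro lborel_product.emeasure_PiM) auto
  also have "ennreal (c * C) * \<dots> < \<infinity>"
    using emeasure_lborel_cball_finite[of "0 :: 'a" R] by (simp add: ennreal_mult_less_top power_less_top_ennreal)
  finally show "(\<integral>\<^sup>+x. ennreal (h x) \<partial>density (tuple_lborel n) (\<lambda>x. ennreal (k (x ` {..<n})))) < \<infinity>" .
qed (use h(2) in simp)

text \<open>Converse of \<open>correlation_nn_integral\<close>. A signed test function is split into
  its positive and negative part, which are again test functions; the bounds on \<open>k\<close>
  make all integrals finite, so the two identities may be subtracted.\<close>

lemma is_correlation_functionI:
  fixes \<mu> :: "'a::euclidean_space set measure"
  assumes \<mu>: "\<mu> \<in> config_probs" and k[measurable]: "k \<in> config_borel" and k0: "k {} = 1"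
    and nn: "\<And>n. AE x in tuple_lborel n. 0 \<le> k (x ` {..<n})" and b: "\<And>n. sector_bound n k (c n)"
    and eq: "\<And>n G. 1 \<le> n \<Longrightarrow> G \<in> tuple_borel n \<Longrightarrow>
      (\<integral>\<^sup>+\<gamma>. tuple_sum n G \<gamma> \<partial>\<mu>) = correlation_integral n k G"
  shows "is_correlation_function \<mu> k"
  unfolding is_correlation_function_def
proof (intro conjI allI impI exI)
  fix n :: nat assume n: "1 \<le> n"
  let ?\<rho> = "density (tuple_lborel n) (\<lambda>x. ennreal (k (x ` {..<n})))"
  have km: "(\<lambda>x. ennreal (k (x ` {..<n}))) \<in> tuple_borel n" by measurable
  show "AE x in tuple_lborel n. 0 \<le> k (x ` {..<n})" by (rule nn)
  have "(\<lambda>x. ereal \<bar>k (x ` {..<n})\<bar>) \<in> tuple_borel n" by measurable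
  then have "esssup (tuple_lborel n) (\<lambda>x. ereal \<bar>k (x ` {..<n})\<bar>) \<le> ereal (c n)"
    by (rule esssup_I) (use b[of n, unfolded sector_bound_def] in simp)
  then show "esssup (tuple_lborel n) (\<lambda>x. ereal \<bar>k (x ` {..<n})\<bar>) < \<infinity>" by (rule le_less_trans) simp
  have pos: "integrable \<mu> (config_sum n h) \<and> (LINT \<gamma>|\<mu>. config_sum n h \<gamma>) = 1 / fact n * (LINT x|?\<rho>. h x)"
    if h: "h \<in> test_functions n" "\<And>x. 0 \<le> h x" for h
  proof -
    have "h \<in> tuple_borel n" using h(1) by (simp add: test_functions_def)
    then have hm: "(\<lambda>x. ennreal (h x)) \<in> tuple_borel n" by measurable
    have i: "integrable ?\<rho> h" by (rule test_function_integrable[OF k nn b h])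
    let ?F = "\<lambda>\<gamma>. fact n * config_sum n h \<gamma>"
    have F: "tuple_sum n (\<lambda>x. ennreal (h x)) \<gamma> = ennreal (?F \<gamma>)" "0 \<le> ?F \<gamma>" if "\<gamma> \<in> space \<mu>" for \<gamma>
      using tuple_sum_test_function[OF h, of \<gamma>] that by (simp_all add: space_config_probs[OF \<mu>])
    have tm: "(\<lambda>\<gamma>. tuple_sum n (\<lambda>x. ennreal (h x)) \<gamma>) \<in> borel_measurable \<mu>"
      by (rule measurable_config_probs[OF \<mu> tuple_sum_measurable[OF hm]])
    have "(\<lambda>\<gamma>. enn2real (tuple_sum n (\<lambda>x. ennreal (h x)) \<gamma>)) \<in> borel_measurable \<mu>"
      using tm by (rule borel_measurable_enn2real)
    then have Fm: "?F \<in> borel_measurable \<mu>"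
      by (rule measurable_cong[THEN iffD1, rotated]) (use F in simp)
    have "(\<integral>\<^sup>+\<gamma>. ennreal (?F \<gamma>) \<partial>\<mu>) = (\<integral>\<^sup>+\<gamma>. tuple_sum n (\<lambda>x. ennreal (h x)) \<gamma> \<partial>\<mu>)"
      by (intro nn_integral_cong) (simp only: F)
    also have "\<dots> = (\<integral>\<^sup>+x. ennreal (h x) * ennreal (k (x ` {..<n})) \<partial>tuple_lborel n)"
      by (rule eq[OF n hm])
    also have "\<dots> = (\<integral>\<^sup>+x. ennreal (h x) \<partial>?\<rho>)"
      by (subst nn_integral_density[OF km hm]) (simp only: mult.commute)
    finally have e: "(\<integral>\<^sup>+\<gamma>. ennreal (?F \<gamma>) \<partial>\<mu>) = (\<integral>\<^sup>+x. ennreal (h x) \<partial>?\<rho>)" .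
    have fin: "(\<integral>\<^sup>+x. ennreal (h x) \<partial>?\<rho>) < \<infinity>"
      using i h(2) by (simp add: integrable_iff_bounded)
    have "integrable \<mu> ?F"
      by (rule integrableI_nonneg[OF Fm AE_I2[OF F(2)]]) (simp_all only: e fin)
    then have iF: "integrable \<mu> (config_sum n h)" by simp
    have "(LINT \<gamma>|\<mu>. ?F \<gamma>) = enn2real (\<integral>\<^sup>+\<gamma>. ennreal (?F \<gamma>) \<partial>\<mu>)"
      by (rule integral_eq_nn_integral[OF Fm AE_I2[OF F(2)]])
    also have "\<dots> = (LINT x|?\<rho>. h x)"
      unfolding e using i h(2) by (intro integral_eq_nn_integral[symmetric]) auto
    finally show ?thesis using iF by (simp add: field_simps)
  qed
  show "is_correlation_measure \<mu> n ?\<rho>"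
    unfolding is_correlation_measure_def
  proof (intro conjI allI impI ballI)
    fix \<pi> assume \<pi>: "\<pi> permutes {..<n}"
    show "distr ?\<rho> ?\<rho> (\<lambda>x. x \<circ> \<pi>) = ?\<rho>"
    proof (rule measure_eqI)
      fix A assume "A \<in> sets (distr ?\<rho> ?\<rho> (\<lambda>x. x \<circ> \<pi>))"
      then have A: "A \<in> sets (tuple_lborel n)" by simp
      let ?f = "\<lambda>x. ennreal (k (x ` {..<n})) * indicator A x"
      have fm: "?f \<in> tuple_borel n" using km A by measurable
      have pm: "(\<lambda>x. x \<circ> \<pi>) \<in> ?\<rho> \<rightarrow>\<^sub>M ?\<rho>" using tuple_permute_measurable[OF \<pi>] by simp
      have B: "(\<lambda>x. x \<circ> \<pi>) -` A \<inter> space (tuple_lborel n) \<in> sets (tuple_lborel n)"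
        by (rule measurable_sets[OF tuple_permute_measurable[OF \<pi>] A])
      have "emeasure (distr ?\<rho> ?\<rho> (\<lambda>x. x \<circ> \<pi>)) A = emeasure ?\<rho> ((\<lambda>x. x \<circ> \<pi>) -` A \<inter> space (tuple_lborel n))"
        using A by (subst emeasure_distr[OF pm]) simp_all
      also have "\<dots> = (\<integral>\<^sup>+x. ennreal (k (x ` {..<n})) * indicator ((\<lambda>x. x \<circ> \<pi>) -` A \<inter> space (tuple_lborel n)) x \<partial>tuple_lborel n)"
        by (rule emeasure_density[OF km B])
      also have "\<dots> = (\<integral>\<^sup>+x. ?f (x \<circ> \<pi>) \<partial>tuple_lborel n)"
        by (intro nn_integral_cong) (simp only: tuple_compose_permutes(2)[OF \<pi>], simp add: indicator_def)
      also have "\<dots> = (\<integral>\<^sup>+x. ?f x \<partial>tuple_lborel n)" by (rule nn_integral_tuple_permute[OF \<pi> fm])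
      also have "\<dots> = emeasure ?\<rho> A" by (rule emeasure_density[OF km A, symmetric])
      finally show "emeasure (distr ?\<rho> ?\<rho> (\<lambda>x. x \<circ> \<pi>)) A = emeasure ?\<rho> A" .
    qed simp
  next
    fix g :: "(nat \<Rightarrow> 'a) \<Rightarrow> real" assume g: "g \<in> test_functions n"
    let ?p = "\<lambda>x. max 0 (g x)" and ?q = "\<lambda>x. max 0 (- g x)"
    have gm: "g \<in> tuple_borel n" using g by (simp add: test_functions_def)
    note gD = g[unfolded test_functions_def mem_Collect_eq]
    obtain C where "\<forall>x\<in>{..<n} \<rightarrow>\<^sub>E UNIV. \<bar>g x\<bar> \<le> C" using gD by (elim conjE exE)
    then have C: "\<bar>g x\<bar> \<le> C" if "x \<in> {..<n} \<rightarrow>\<^sub>E UNIV" for x using that by (rule bspec)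
    obtain \<Lambda> where \<Lambda>: "compactin (tuple_topology n) \<Lambda>" "\<forall>x\<in>({..<n} \<rightarrow>\<^sub>E UNIV) - \<Lambda>. g x = 0"
      using gD by (elim conjE exE)
    have sym: "g (x \<circ> \<pi>) = g x" if "\<pi> permutes {..<n}" "x \<in> {..<n} \<rightarrow>\<^sub>E UNIV" for \<pi> x
      using gD that by simp
    \<comment> \<open>The values \<open>s = 1\<close> and \<open>s = -1\<close> give the positive
      and the negative part.\<close>
    have "(\<lambda>x. max 0 (s * g x)) \<in> test_functions n" if "\<bar>s\<bar> = 1" for s
      unfolding test_functions_def mem_Collect_eq
    proof (intro conjI allI impI ballI exI)
      show "(\<lambda>x. max 0 (s * g x)) \<in> tuple_borel n" using gm by measurable
      show "\<bar>max 0 (s * g x)\<bar> \<le> C" if "x \<in> {..<n} \<rightarrow>\<^sub>E UNIV" for x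
        using C[OF that] \<open>\<bar>s\<bar> = 1\<close> by (auto simp: max_def abs_if split: if_splits)
      show "compactin (tuple_topology n) \<Lambda>" by (rule \<Lambda>(1))
      show "max 0 (s * g x) = 0" if "x \<in> ({..<n} \<rightarrow>\<^sub>E UNIV) - \<Lambda>" for x by (simp add: bspec[OF \<Lambda>(2) that])
      show "max 0 (s * g (x \<circ> \<pi>)) = max 0 (s * g x)" if "\<pi> permutes {..<n}" "x \<in> {..<n} \<rightarrow>\<^sub>E UNIV" for \<pi> x
        by (simp only: sym[OF that])
    qed
    from this[of 1] this[of "-1"] have pt: "?p \<in> test_functions n" and qt: "?q \<in> test_functions n" by simp_all
    have p: "integrable ?\<rho> ?p" and q: "integrable ?\<rho> ?q"
      by (intro test_function_integrable[OF k nn b] pt qt max.cobounded1)+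
    note P = pos[OF pt max.cobounded1] and Q = pos[OF qt max.cobounded1]
    have g_eq: "g = (\<lambda>x. ?p x - ?q x)" by (auto simp: fun_eq_iff max_def)
    have split: "config_sum n g \<gamma> = config_sum n ?p \<gamma> - config_sum n ?q \<gamma>" if "\<gamma> \<in> space \<mu>" for \<gamma>
    proof -
      have \<gamma>: "\<gamma> \<in> configurations" using that by (simp add: space_config_probs[OF \<mu>])
      obtain K :: "'a set" where K: "bounded K" "\<And>x. x \<in> space (tuple_lborel n) \<Longrightarrow> \<not> x ` {..<n} \<subseteq> K \<Longrightarrow> g x = 0"
        using test_function_support[OF g] by metis
      note z = K(2)[OF distinct_tuplesD(3)]
      note c = config_sum_finite[OF \<gamma> K(1)]
      have "config_sum n ?p \<gamma> = (\<Sum>\<eta>\<in>{\<eta>. \<eta> \<subseteq> \<gamma> \<inter> K \<and> card \<eta> = n}. ?p (enum_config n \<eta>))"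
        and "config_sum n ?q \<gamma> = (\<Sum>\<eta>\<in>{\<eta>. \<eta> \<subseteq> \<gamma> \<inter> K \<and> card \<eta> = n}. ?q (enum_config n \<eta>))"
        and "config_sum n g \<gamma> = (\<Sum>\<eta>\<in>{\<eta>. \<eta> \<subseteq> \<gamma> \<inter> K \<and> card \<eta> = n}. g (enum_config n \<eta>))"
        by (rule c, simp add: z)+
      then show ?thesis
        by (simp only: sum_subtractf[symmetric]) (intro sum.cong refl, simp add: max_def)
    qed
    have "integrable \<mu> (\<lambda>\<gamma>. config_sum n g \<gamma>) \<longleftrightarrow> integrable \<mu> (\<lambda>\<gamma>. config_sum n ?p \<gamma> - config_sum n ?q \<gamma>)"
      by (rule Bochner_Integration.integrable_cong[OF refl split])
    then show "integrable \<mu> (config_sum n g)"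
      using Bochner_Integration.integrable_diff[OF conjunct1[OF P] conjunct1[OF Q]] by blast
    show "integrable ?\<rho> g"
      using Bochner_Integration.integrable_diff[OF p q] by (simp only: g_eq[symmetric])
    have "(LINT \<gamma>|\<mu>. config_sum n g \<gamma>) = (LINT \<gamma>|\<mu>. config_sum n ?p \<gamma> - config_sum n ?q \<gamma>)"
      by (rule Bochner_Integration.integral_cong[OF refl split])
    also have "\<dots> = (LINT \<gamma>|\<mu>. config_sum n ?p \<gamma>) - (LINT \<gamma>|\<mu>. config_sum n ?q \<gamma>)"
      using P Q by (intro Bochner_Integration.integral_diff) blast+
    also have "\<dots> = 1 / fact n * (LINT x|?\<rho>. ?p x) - 1 / fact n * (LINT x|?\<rho>. ?q x)"
      using P Q by simp
    also have "\<dots> = 1 / fact n * (LINT x|?\<rho>. ?p x - ?q x)"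
      using Bochner_Integration.integral_diff[OF p q] by (simp only: right_diff_distrib)
    finally show "(LINT \<gamma>|\<mu>. config_sum n g \<gamma>) = 1 / fact n * (LINT x|?\<rho>. g x)"
      by (simp only: g_eq[symmetric])
  qed simp
qed (use k0 in simp_all)

section \<open>Uniqueness of the measure with a given correlation function\<close>

lemma tuple_sum_box:
  assumes "\<gamma> \<in> configurations" "bounded (B :: 'a::euclidean_space set)"
  shows "tuple_sum n (\<lambda>x. if x ` {..<n} \<subseteq> B then 1 else 0) \<gamma> = of_nat (fact n) * of_nat (card (\<gamma> \<inter> B) choose n)"
proof -
  have fin: "finite (\<gamma> \<inter> B)" by (rule configuration_finite_Int[OF assms])
  have "tuple_sum n (\<lambda>x. if x ` {..<n} \<subseteq> B then 1 else 0) \<gamma> =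
    of_nat (fact n) * (\<Sum>\<eta>\<in>{\<eta>. \<eta> \<subseteq> \<gamma> \<inter> B \<and> card \<eta> = n}. if enum_config n \<eta> ` {..<n} \<subseteq> B then 1 else 0)"
    by (rule tuple_sum_symmetric[OF assms]) (simp_all only: tuple_compose_permutes(2) if_False)
  also have "(\<Sum>\<eta>\<in>{\<eta>. \<eta> \<subseteq> \<gamma> \<inter> B \<and> card \<eta> = n}. if enum_config n \<eta> ` {..<n} \<subseteq> B then 1 else 0) =
    (\<Sum>\<eta>\<in>{\<eta>. \<eta> \<subseteq> \<gamma> \<inter> B \<and> card \<eta> = n}. 1 :: ennreal)"
  proof (rule sum.cong[OF refl])
    fix \<eta> assume "\<eta> \<in> {\<eta>. \<eta> \<subseteq> \<gamma> \<inter> B \<and> card \<eta> = n}"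
    then have "\<eta> \<subseteq> \<gamma> \<inter> B" "card \<eta> = n" by simp_all
    then show "(if enum_config n \<eta> ` {..<n} \<subseteq> B then 1 else 0) = (1 :: ennreal)"
      using enum_config(2)[OF finite_subset[OF _ fin], of \<eta> n] by simp
  qed
  also have "\<dots> = of_nat (card (\<gamma> \<inter> B) choose n)" using n_subsets[OF fin, of n] by simp
  finally show ?thesis .
qed

lemma box_measurable:
  fixes B :: "'a::euclidean_space set"
  assumes B: "B \<in> sets borel"
  shows "(\<lambda>x. if x ` {..<n} \<subseteq> B then 1 else 0 :: ennreal) \<in> tuple_borel n"
proof (rule measurable_If)
  have "{x \<in> space (tuple_lborel n). x i \<in> B} \<in> sets (tuple_lborel n)" if "i \<in> {..<n}" for i
  proof -
    have "(\<lambda>x. x i) \<in> tuple_lborel n \<rightarrow>\<^sub>M lborel" using that by (rule measurable_component_singleton)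
    from measurable_sets[OF this, of B] show ?thesis using B by (simp add: vimage_def Int_def conj_commute)
  qed
  then have "{x \<in> space (tuple_lborel n). \<forall>i\<in>{..<n}. x i \<in> B} \<in> sets (tuple_lborel n)"
    by (intro sets.sets_Collect_finite_All finite_lessThan)
  then show "{x \<in> space (tuple_lborel n). x ` {..<n} \<subseteq> B} \<in> sets (tuple_lborel n)"
    by (simp only: image_subset_iff)
qed simp_all

text \<open>The factorial moment of order \<open>n\<close> of the number of points in
  \<open>B\<close>. The case \<open>n = 0\<close> is set apart because the correlation identities
  start at \<open>n = 1\<close>.\<close>

definition box_moment :: "'a::euclidean_space set \<Rightarrow> ('a set \<Rightarrow> real) \<Rightarrow> nat \<Rightarrow> ennreal" where
  "box_moment B k n = (if n = 0 then 1 else \<integral>\<^sup>+x. (if x ` {..<n} \<subseteq> B then 1 else 0) * ennreal (k (x ` {..<n})) \<partial>tuple_lborel n)"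

text \<open>The density is at most \<open>C * exp (- \<theta> * n)\<close> and the box has volume
  \<open>measure lborel B ^ n\<close>; the maximum with \<open>1\<close> covers
  \<open>n = 0\<close>.\<close>

lemma box_moment_bound:
  fixes B :: "'a::euclidean_space set"
  assumes B: "B \<in> sets borel" "bounded B" and k: "sector_bound n k (C * exp (- \<theta> * real n))"
  shows "box_moment B k n \<le> ennreal (max 1 C * (exp (- \<theta>) * measure lborel B) ^ n)"
proof (cases "n = 0")
  case True
  then show ?thesis by (simp add: box_moment_def ennreal_leI flip: ennreal_1)
next
  case False
  let ?Q = "PiE {..<n} (\<lambda>_. B)"
  have fin: "emeasure lborel B < \<infinity>" by (rule emeasure_bounded_finite[OF B(2)])
  have "box_moment B k n = (\<integral>\<^sup>+x. (if x ` {..<n} \<subseteq> B then 1 else 0) * ennreal (k (x ` {..<n})) \<partial>tuple_lborel n)"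
    using False by (simp add: box_moment_def)
  also have "\<dots> \<le> (\<integral>\<^sup>+x. ennreal (C * exp (- \<theta> * real n)) * indicator ?Q x \<partial>tuple_lborel n)"
  proof (rule nn_integral_mono_AE)
    show "AE x in tuple_lborel n. (if x ` {..<n} \<subseteq> B then 1 else 0) * ennreal (k (x ` {..<n})) \<le> ennreal (C * exp (- \<theta> * real n)) * indicator ?Q x"
      using AE_space k[unfolded sector_bound_def]
    proof eventually_elim
      case (elim x)
      show ?case
      proof (cases "x ` {..<n} \<subseteq> B")
        case True
        have "x \<in> ?Q" by (rule PiE_I) (use True PiE_arb[OF elim(1)[unfolded space_tuple]] in blast)+
        then show ?thesis using True elim(2) by (simp add: ennreal_leI abs_le_iff)
      qed simp
    qed
  qed
  also have "\<dots> = ennreal (C * exp (- \<theta> * real n)) * emeasure (tuple_lborel n) ?Q"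
    using B(1) by (intro nn_integral_cmult_indicator sets_PiM_I_finite) auto
  also have "emeasure (tuple_lborel n) ?Q = (\<Prod>i<n. emeasure lborel B)"
    using B(1) by (intro lborel_product.emeasure_PiM) auto
  also have "\<dots> = ennreal (measure lborel B ^ n)"
    using fin by (simp add: emeasure_eq_ennreal_measure less_top[symmetric] ennreal_power)
  also have "ennreal (C * exp (- \<theta> * real n)) * \<dots> = ennreal (C * exp (- \<theta> * real n) * measure lborel B ^ n)"
    using sector_bound_nonneg[OF k] by (simp only: ennreal_mult zero_le_power measure_nonneg)
  also have "\<dots> = ennreal (C * (exp (- \<theta>) * measure lborel B) ^ n)"
    by (simp add: power_mult_distrib exp_of_nat_mult[symmetric] mult.commute mult.left_commute)
  also have "\<dots> \<le> ennreal (max 1 C * (exp (- \<theta>) * measure lborel B) ^ n)"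
    by (intro ennreal_leI mult_right_mono) auto
  finally show ?thesis .
qed

text \<open>The alternating sum of the binomial coefficients of \<open>N\<close> is \<open>1\<close>
  for \<open>N = 0\<close> and \<open>0\<close> otherwise, so the indicator of the void event is a
  series of factorial moments. Division by \<open>fact n\<close> turns the geometric bound of
  \<open>box_moment_bound\<close> into an exponential series, which justifies integrating term by
  term.\<close>

lemma void_probability:
  fixes \<mu> :: "'a::euclidean_space set measure"
  assumes \<mu>: "\<mu> \<in> config_probs" "is_correlation_function \<mu> k" and k: "k \<in> K_space \<theta>"
    and B: "B \<in> sets borel" "bounded B"
  shows "measure \<mu> (avoiding B) = (\<Sum>n. (-1) ^ n * (enn2real (box_moment B k n) / fact n))"
proof -
  interpret \<mu>: prob_space \<mu> using \<mu>(1) by (simp add: config_probs_def)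
  note sp = space_config_probs[OF \<mu>(1)]
  obtain C where C: "0 \<le> C" "K_norm \<theta> k \<le> ereal C" using K_spaceD(2)[OF k] by blast
  have kb: "sector_bound n k (C * exp (- \<theta> * real n))" for n
    using K_norm_le_iff[of k \<theta> C] K_spaceD(1)[OF k] C(2) by simp
  let ?N = "\<lambda>\<gamma>. card (\<gamma> \<inter> B)" and ?G = "\<lambda>n x. (if x ` {..<n} \<subseteq> B then 1 else 0 :: ennreal)"
  have box: "tuple_sum n (?G n) \<gamma> = of_nat (fact n) * of_nat (?N \<gamma> choose n)" if "\<gamma> \<in> space \<mu>" for n \<gamma>
    using tuple_sum_box[OF _ B(2), of \<gamma> n] that unfolding sp .
  have tm: "tuple_sum n (?G n) \<in> borel_measurable \<mu>" for n
    by (intro measurable_config_probs[OF \<mu>(1)] tuple_sum_measurable box_measurable B(1))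
  have real_box: "real (?N \<gamma> choose n) = enn2real (tuple_sum n (?G n) \<gamma>) / fact n" if "\<gamma> \<in> space \<mu>" for n \<gamma>
    unfolding box[OF that] by (simp add: ennreal_of_nat_eq_real_of_nat enn2real_mult)
  have Nm: "(\<lambda>\<gamma>. real (?N \<gamma> choose n)) \<in> borel_measurable \<mu>" for n
  proof -
    have "(\<lambda>\<gamma>. enn2real (tuple_sum n (?G n) \<gamma>) / fact n) \<in> borel_measurable \<mu>" using tm[of n] by measurable
    then show ?thesis by (rule measurable_cong[THEN iffD1, rotated]) (simp only: real_box)
  qed
  have moment: "of_nat (fact n) * (\<integral>\<^sup>+\<gamma>. ennreal (real (?N \<gamma> choose n)) \<partial>\<mu>) = box_moment B k n" for n
  proof -
    have "of_nat (fact n) * (\<integral>\<^sup>+\<gamma>. ennreal (real (?N \<gamma> choose n)) \<partial>\<mu>) = (\<integral>\<^sup>+\<gamma>. of_nat (fact n) * ennreal (real (?N \<gamma> choose n)) \<partial>\<mu>)"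
      by (intro nn_integral_cmult[symmetric] measurable_compose[OF Nm measurable_ennreal])
    also have "\<dots> = (\<integral>\<^sup>+\<gamma>. tuple_sum n (?G n) \<gamma> \<partial>\<mu>)"
      by (intro nn_integral_cong) (simp add: box ennreal_of_nat_eq_real_of_nat)
    also have "\<dots> = box_moment B k n"
    proof (cases "n = 0")
      case True
      have "(\<integral>\<^sup>+\<gamma>. tuple_sum n (?G n) \<gamma> \<partial>\<mu>) = (\<integral>\<^sup>+\<gamma>. 1 \<partial>\<mu>)"
        using box[of _ 0] by (intro nn_integral_cong) (simp add: True)
      then show ?thesis using \<mu>.emeasure_space_1 by (simp add: box_moment_def True)
    next
      case False
      then show ?thesis
        using correlation_nn_integral[OF \<mu> _ box_measurable[OF B(1)], of n] by (simp add: box_moment_def)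
    qed
    finally show ?thesis .
  qed
  have bnd: "box_moment B k n \<le> ennreal (max 1 C * (exp (- \<theta>) * measure lborel B) ^ n)" for n
    by (rule box_moment_bound[OF B kb])
  have fin: "box_moment B k n < \<infinity>" for n
    using bnd[of n] by (rule le_less_trans) simp
  have real_moment: "enn2real (\<integral>\<^sup>+\<gamma>. ennreal (real (?N \<gamma> choose n)) \<partial>\<mu>) = enn2real (box_moment B k n) / fact n" for n
    unfolding moment[symmetric] by (simp add: enn2real_mult ennreal_of_nat_eq_real_of_nat)
  have int: "integrable \<mu> (\<lambda>\<gamma>. real (?N \<gamma> choose n))" for n
  proof (rule integrableI_nonneg[OF Nm])
    show "(\<integral>\<^sup>+\<gamma>. ennreal (real (?N \<gamma> choose n)) \<partial>\<mu>) < \<infinity>"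
      using fin[of n] unfolding moment[symmetric] by (auto simp: ennreal_mult_less_top)
  qed simp
  have val: "(LINT \<gamma>|\<mu>. real (?N \<gamma> choose n)) = enn2real (box_moment B k n) / fact n" for n
    unfolding real_moment[symmetric] by (rule integral_eq_nn_integral[OF Nm]) simp
  let ?f = "\<lambda>n \<gamma>. (-1) ^ n * real (?N \<gamma> choose n)"
  have zero: "?f n \<gamma> = 0" if "n \<notin> {..?N \<gamma>}" for n \<gamma> using that by simp
  have "(\<Sum>n. ?f n \<gamma>) = indicator (avoiding B) \<gamma>" if "\<gamma> \<in> space \<mu>" for \<gamma>
  proof -
    have \<gamma>: "\<gamma> \<in> configurations" using that by (simp add: sp)
    have "(\<Sum>n. ?f n \<gamma>) = (\<Sum>n\<le>?N \<gamma>. ?f n \<gamma>)"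
      by (rule suminf_finite) (simp_all add: zero)
    also have "\<dots> = (if ?N \<gamma> = 0 then 1 else 0)"
      using choose_alternating_sum[of "?N \<gamma>", where 'a=real] by auto
    also have "\<dots> = indicator (avoiding B) \<gamma>"
      using configuration_finite_Int[OF \<gamma> B(2)] \<gamma> by (simp add: avoiding_def indicator_def)
    finally show ?thesis .
  qed
  then have "(LINT \<gamma>|\<mu>. (\<Sum>n. ?f n \<gamma>)) = (LINT \<gamma>|\<mu>. indicator (avoiding B) \<gamma>)"
    by (intro Bochner_Integration.integral_cong refl)
  also have "\<dots> = measure \<mu> (avoiding B)"
    using sets.sets_into_space[of "avoiding B" \<mu>] by (simp add: sp Int_absorb2 avoiding_def)
  finally have "measure \<mu> (avoiding B) = (LINT \<gamma>|\<mu>. (\<Sum>n. ?f n \<gamma>))" by simp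
  also have "\<dots> = (\<Sum>n. LINT \<gamma>|\<mu>. ?f n \<gamma>)"
  proof (rule integral_suminf)
    show "integrable \<mu> (?f n)" for n using int by (intro integrable_mult_right)
    show "AE \<gamma> in \<mu>. summable (\<lambda>n. norm (?f n \<gamma>))"
    proof (rule AE_I2)
      show "summable (\<lambda>n. norm (?f n \<gamma>))" for \<gamma>
        by (rule summable_finite[of "{..?N \<gamma>}"]) (use zero in simp_all)
    qed
    have "(LINT \<gamma>|\<mu>. norm (?f n \<gamma>)) = enn2real (box_moment B k n) / fact n" for n
      using val[of n] by (simp add: abs_mult)
    moreover have "summable (\<lambda>n. enn2real (box_moment B k n) / fact n)"
    proof (rule summable_comparison_test[OF exI[of _ 0]])
      show "summable (\<lambda>n. max 1 C * ((exp (- \<theta>) * measure lborel B) ^ n /\<^sub>R fact n))"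
        by (intro summable_mult summable_exp_generic)
      have "enn2real (box_moment B k n) \<le> max 1 C * (exp (- \<theta>) * measure lborel B) ^ n" for n
        by (rule enn2real_leI[OF _ bnd]) simp
      then show "\<forall>n\<ge>0. norm (enn2real (box_moment B k n) / fact n) \<le> max 1 C * ((exp (- \<theta>) * measure lborel B) ^ n /\<^sub>R fact n)"
        by (simp add: divide_simps scaleR_conv_of_real)
    qed
    ultimately show "summable (\<lambda>n. LINT \<gamma>|\<mu>. norm (?f n \<gamma>))" by simp
  qed
  also have "\<dots> = (\<Sum>n. (-1) ^ n * (enn2real (box_moment B k n) / fact n))"
    using val by simp
  finally show ?thesis .
qed

lemma correlation_function_unique:
  fixes \<mu> \<nu> :: "'a::euclidean_space set measure"
  assumes "k \<in> K_space \<theta>" "\<mu> \<in> config_probs" "is_correlation_function \<mu> k" "\<nu> \<in> config_probs" "is_correlation_function \<nu> k"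
  shows "\<mu> = \<nu>"
proof (rule config_probs_eqI[OF assms(2,4)])
  fix B :: "'a set" assume B: "B \<in> sets borel" "bounded B"
  interpret \<mu>: prob_space \<mu> using assms(2) by (simp add: config_probs_def)
  interpret \<nu>: prob_space \<nu> using assms(4) by (simp add: config_probs_def)
  show "emeasure \<mu> (avoiding B) = emeasure \<nu> (avoiding B)"
    unfolding \<mu>.emeasure_eq_measure \<nu>.emeasure_eq_measure
      void_probability[OF assms(2,3,1) B] void_probability[OF assms(4,5,1) B] ..
qed

section \<open>Displacement of the points of a configuration\<close>

text \<open>For \<open>n = 1\<close> the sum counts the labels whose position lies in
  \<open>B\<close>.\<close>

lemma label_sum_finite:
  assumes "label_sum 1 (\<lambda>x. if x ` {..<1} \<subseteq> B then 1 else 0) E X < \<infinity>"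
  shows "finite {j. E j \<and> X j \<in> (B :: 'a::euclidean_space set)}"
proof -
  let ?h = "\<lambda>j :: nat. \<lambda>i\<in>{..<1 :: nat}. j"
  let ?S = "?h ` {j. E j \<and> X j \<in> B}"
  have "?h j \<in> label_tuples 1" for j by (simp add: label_tuples_def inj_on_def)
  then have S: "?S \<subseteq> label_tuples 1" by blast
  have "emeasure (count_space (label_tuples 1)) ?S = (\<integral>\<^sup>+j. indicator ?S j \<partial>count_space (label_tuples 1))"
    using S by (intro nn_integral_indicator[symmetric]) simp
  also have "\<dots> \<le> label_sum 1 (\<lambda>x. if x ` {..<1} \<subseteq> B then 1 else 0) E X"
    unfolding label_sum_def
  proof (rule nn_integral_mono)
    fix l
    show "indicator ?S l \<le> label_term 1 (\<lambda>x. if x ` {..<1} \<subseteq> B then 1 else 0) E X l"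
    proof (cases "l \<in> ?S")
      case True
      then obtain j where "l = ?h j" "E j" "X j \<in> B" by blast
      then show ?thesis by (simp add: label_term_def image_subset_iff)
    qed simp
  qed
  finally have "emeasure (count_space (label_tuples 1)) ?S < \<infinity>" using assms by simp
  then have "finite ?S" using emeasure_count_space_infinite[OF S] by fastforce
  moreover have "inj_on ?h {j. E j \<and> X j \<in> B}" by (rule inj_onI) (drule fun_cong[of _ _ 0], simp)
  ultimately show ?thesis by (rule finite_imageD)
qed

abbreviation coincident :: "(nat \<Rightarrow> 'a::euclidean_space) set" where
  "coincident \<equiv> space (tuple_lborel 2) - distinct_tuples 2"

text \<open>Two distinct labels at the same position would form a label tuple that contributes
  \<open>1\<close>.\<close>

lemma label_sum_inj:
  assumes "label_sum 2 (indicator coincident) E X = 0"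
  shows "inj_on (X :: nat \<Rightarrow> 'a::euclidean_space) {j. E j}"
proof (rule inj_onI, rule ccontr)
  fix i j assume ij: "i \<in> {j. E j}" "j \<in> {j. E j}" "X i = X j" "i \<noteq> j"
  let ?l = "\<lambda>m\<in>{..<2 :: nat}. if m = 0 then i else j"
  let ?y = "\<lambda>m\<in>{..<2}. X (?l m)"
  have l: "?l \<in> label_tuples 2" using ij(4) by (auto simp: label_tuples_def inj_on_def less_2_cases_iff)
  have "?y 0 = ?y 1" using ij(3) by simp
  then have "\<not> inj_on ?y {..<2}" using inj_onD[of ?y "{..<2}" 0 1] by auto
  then have "?y \<in> coincident" by (auto simp: distinct_tuples_def space_tuple)
  then have "label_term 2 (indicator coincident) E X ?l = 1"
    using ij(1,2) by (simp add: label_term_def)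
  moreover have "label_term 2 (indicator coincident) E X ?l = 0"
    using assms l unfolding label_sum_def by (simp add: nn_integral_0_iff_AE AE_count_space)
  ultimately show False by simp
qed

section \<open>Independent displacement of labelled points\<close>

context jump_kernel
begin

abbreviation tuple_back :: "nat \<Rightarrow> (nat \<Rightarrow> 'a) \<Rightarrow> (nat \<Rightarrow> 'a) \<Rightarrow> nat \<Rightarrow> 'a" where
  "tuple_back n x z \<equiv> (\<lambda>i\<in>{..<n}. x i - z i)"

text \<open>Dual to \<open>jump_sg\<close>: the displacement is applied to the test function, with
  the sign that lets a translation move it over to the correlation function.\<close>

definition jump_back :: "real \<Rightarrow> nat \<Rightarrow> ((nat \<Rightarrow> 'a) \<Rightarrow> ennreal) \<Rightarrow> (nat \<Rightarrow> 'a) \<Rightarrow> ennreal" where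
  "jump_back t n G x = (\<integral>\<^sup>+z. G (tuple_back n x z) \<partial>tuple_law t n)"

lemma tuple_back_measurable:
  "(\<lambda>w. tuple_back n (fst w) (snd w)) \<in> shift_space t n \<rightarrow>\<^sub>M tuple_lborel n"
proof (intro measurable_restrict)
  fix i assume i: "i \<in> {..<n}"
  have "(\<lambda>w. fst w i) \<in> borel_measurable (shift_space t n)"
    "(\<lambda>w. snd w i) \<in> borel_measurable (shift_space t n)"
    using i by (auto intro!: tuple_component_measurable[of i n] simp: measurable_cong_sets[OF refl sets_tuple_law[symmetric]])
  from borel_measurable_diff[OF this]
  show "(\<lambda>w. fst w i - snd w i) \<in> shift_space t n \<rightarrow>\<^sub>M lborel" by simp
qed

lemma tuple_back_sections:
  assumes "x \<in> space (tuple_lborel n)"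
  shows "tuple_back n x \<in> tuple_law t n \<rightarrow>\<^sub>M tuple_lborel n"
    and "(\<lambda>y. tuple_back n y x) \<in> tuple_lborel n \<rightarrow>\<^sub>M tuple_lborel n"
proof -
  show "tuple_back n x \<in> tuple_law t n \<rightarrow>\<^sub>M tuple_lborel n"
    using measurable_compose[OF measurable_Pair1'[OF assms] tuple_back_measurable] by simp
  have "x \<in> space (tuple_law t n)" using assms by (simp only: space_tuple_law)
  from measurable_compose[OF measurable_Pair2'[OF this] tuple_back_measurable]
  show "(\<lambda>y. tuple_back n y x) \<in> tuple_lborel n \<rightarrow>\<^sub>M tuple_lborel n" by simp
qed

lemma jump_back_measurable:
  assumes G: "G \<in> tuple_borel n"
  shows "jump_back t n G \<in> tuple_borel n"
  unfolding jump_back_def[abs_def]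
  using measurable_compose[OF tuple_back_measurable G]
  by (intro tl.borel_measurable_nn_integral) (simp add: case_prod_beta)

lemma nn_integral_jump_sg:
  assumes u: "u \<in> config_borel" and nn: "AE x in tuple_lborel n. 0 \<le> u (x ` {..<n})" and b: "sector_bound n u c"
  shows "AE x in tuple_lborel n. (\<integral>\<^sup>+z. ennreal (u (tuple_shift n x z ` {..<n})) \<partial>tuple_law t n) = ennreal (jump_sg t u (x ` {..<n}))"
  using AE_distinct[of n] AE_tuple_shift[OF b[unfolded sector_bound_def], where t=t] AE_tuple_shift[OF nn, where t=t]
proof eventually_elim
  case (elim x)
  note m = config_shift_section_measurable[OF u distinct_tuplesD(3)[OF elim(1)], where t=t]
  have "integrable (tuple_law t n) (\<lambda>z. u (tuple_shift n x z ` {..<n}))"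
    using elim(2) m by (intro tl.integrable_const_bound[of _ c]) auto
  then have "(\<integral>\<^sup>+z. ennreal (u (tuple_shift n x z ` {..<n})) \<partial>tuple_law t n) = ennreal (LINT z|tuple_law t n. u (tuple_shift n x z ` {..<n}))"
    using elim(3) by (rule nn_integral_eq_integral)
  then show ?case unfolding jump_sg_tuple[OF u elim(1)] .
qed

text \<open>For a fixed displacement \<open>z\<close>, substituting \<open>x + z\<close> for
  \<open>x\<close> moves the shift from \<open>G\<close> to \<open>u\<close>; Tonelli is used before
  and after. In terms of factorial moments, displacing the points applies the semigroup to the
  correlation function.\<close>

lemma jump_back_duality:
  assumes u: "u \<in> config_borel" and nn: "AE x in tuple_lborel n. 0 \<le> u (x ` {..<n})" and b: "sector_bound n u c"
    and G: "G \<in> tuple_borel n"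
  shows "correlation_integral n u (jump_back t n G) = correlation_integral n (jump_sg t u) G"
proof -
  have um: "(\<lambda>x. ennreal (u (x ` {..<n}))) \<in> tuple_borel n"
    by (rule measurable_compose[OF measurable_compose[OF measurable_image_config u] measurable_ennreal])
  have "correlation_integral n u (jump_back t n G) =
    (\<integral>\<^sup>+x. \<integral>\<^sup>+z. G (tuple_back n x z) * ennreal (u (x ` {..<n})) \<partial>tuple_law t n \<partial>tuple_lborel n)"
    unfolding jump_back_def
    by (intro nn_integral_cong nn_integral_multc[symmetric] measurable_compose[OF tuple_back_sections(1) G])
  also have "\<dots> = (\<integral>\<^sup>+z. \<integral>\<^sup>+x. G (tuple_back n x z) * ennreal (u (x ` {..<n})) \<partial>tuple_lborel n \<partial>tuple_law t n)"
  proof (rule tlp.Fubini'[symmetric])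
    have "(\<lambda>w. G (tuple_back n (fst w) (snd w)) * ennreal (u (fst w ` {..<n}))) \<in> borel_measurable (shift_space t n)"
      by (intro borel_measurable_times_ennreal measurable_compose[OF tuple_back_measurable G] measurable_compose[OF measurable_fst um])
    then show "(\<lambda>(x, z). G (tuple_back n x z) * ennreal (u (x ` {..<n}))) \<in> borel_measurable (shift_space t n)"
      by (simp only: case_prod_beta')
  qed
  also have "\<dots> = (\<integral>\<^sup>+z. \<integral>\<^sup>+x. G x * ennreal (u (tuple_shift n x z ` {..<n})) \<partial>tuple_lborel n \<partial>tuple_law t n)"
  proof (rule nn_integral_cong)
    fix z assume "z \<in> space (tuple_law t n)"
    then have z: "z \<in> space (tuple_lborel n)" by (simp only: space_tuple_law)
    have m: "(\<lambda>x. G (tuple_back n x z) * ennreal (u (x ` {..<n}))) \<in> tuple_borel n"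
      by (intro borel_measurable_times_ennreal measurable_compose[OF tuple_back_sections(2)[OF z] G] um)
    have r: "tuple_back n (tuple_shift n x z) z = x" if "x \<in> space (tuple_lborel n)" for x
    proof
      show "tuple_back n (tuple_shift n x z) z i = x i" for i
        using PiE_arb[OF that[unfolded space_tuple], of i] by simp
    qed
    show "(\<integral>\<^sup>+x. G (tuple_back n x z) * ennreal (u (x ` {..<n})) \<partial>tuple_lborel n) =
      (\<integral>\<^sup>+x. G x * ennreal (u (tuple_shift n x z ` {..<n})) \<partial>tuple_lborel n)"
      unfolding nn_integral_tuple_translate[OF z m, symmetric] by (intro nn_integral_cong) (simp only: r)
  qed
  also have "\<dots> = (\<integral>\<^sup>+x. \<integral>\<^sup>+z. G x * ennreal (u (tuple_shift n x z ` {..<n})) \<partial>tuple_law t n \<partial>tuple_lborel n)"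
  proof (rule tlp.Fubini')
    have "(\<lambda>w. G (fst w) * ennreal (u (tuple_shift n (fst w) (snd w) ` {..<n}))) \<in> borel_measurable (shift_space t n)"
      by (intro borel_measurable_times_ennreal measurable_compose[OF measurable_fst G] measurable_compose[OF tuple_shift_measurable um])
    then show "(\<lambda>(x, z). G x * ennreal (u (tuple_shift n x z ` {..<n}))) \<in> borel_measurable (shift_space t n)"
      by (simp only: case_prod_beta')
  qed
  also have "\<dots> = (\<integral>\<^sup>+x. G x * (\<integral>\<^sup>+z. ennreal (u (tuple_shift n x z ` {..<n})) \<partial>tuple_law t n) \<partial>tuple_lborel n)"
    by (intro nn_integral_cong nn_integral_cmult measurable_compose[OF config_shift_section_measurable[OF u] measurable_ennreal])
  also have "\<dots> = correlation_integral n (jump_sg t u) G"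
    by (rule nn_integral_cong_AE) (use nn_integral_jump_sg[OF u nn b, where t=t] in \<open>eventually_elim, simp\<close>)
  finally show ?thesis .
qed

text \<open>The jumps are symmetric, so the points may move by \<open>-\<xi>\<close> instead of \<open>\<xi>\<close>; with this sign the
  expectation is computed from translation invariance of Lebesgue measure alone.\<close>

abbreviation jump_noise :: "real \<Rightarrow> (nat \<Rightarrow> 'a) measure" where
  "jump_noise t \<equiv> (\<Pi>\<^sub>M j\<in>UNIV. jump_law t)"

abbreviation moved_point :: "'a set \<times> (nat \<Rightarrow> 'a) \<Rightarrow> nat \<Rightarrow> 'a" where
  "moved_point \<omega> j \<equiv> labelled_point j (fst \<omega>) - snd \<omega> j"

abbreviation moved_sum :: "nat \<Rightarrow> ((nat \<Rightarrow> 'a) \<Rightarrow> ennreal) \<Rightarrow> 'a set \<times> (nat \<Rightarrow> 'a) \<Rightarrow> ennreal" where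
  "moved_sum n G \<omega> \<equiv> label_sum n G (labelled (fst \<omega>)) (moved_point \<omega>)"

lemma noise_component: "(\<lambda>\<xi>. \<xi> j) \<in> borel_measurable (jump_noise t)"
  using measurable_component_singleton[of j UNIV "\<lambda>_. jump_law t"] by (simp cong: measurable_cong_sets)

lemma moved_labelled_sets:
  assumes \<mu>: "\<mu> \<in> config_probs"
  shows "{\<omega> \<in> space (\<mu> \<Otimes>\<^sub>M jump_noise t). labelled (fst \<omega>) j} \<in> sets (\<mu> \<Otimes>\<^sub>M jump_noise t)"
proof -
  have "{\<gamma> \<in> configurations. labelled \<gamma> j} \<in> sets \<mu>" using \<mu> labelled_sets[of j] by (simp add: config_probs_def)
  from measurable_sets[OF measurable_fst this, of "jump_noise t"]
  have "fst -` {\<gamma> \<in> configurations. labelled \<gamma> j} \<inter> space (\<mu> \<Otimes>\<^sub>M jump_noise t) \<in> sets (\<mu> \<Otimes>\<^sub>M jump_noise t)" .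
  moreover have "fst -` {\<gamma> \<in> configurations. labelled \<gamma> j} \<inter> space (\<mu> \<Otimes>\<^sub>M jump_noise t) = {\<omega> \<in> space (\<mu> \<Otimes>\<^sub>M jump_noise t). labelled (fst \<omega>) j}"
    by (auto simp: space_pair_measure space_config_probs[OF \<mu>])
  ultimately show ?thesis by (simp only:)
qed

lemma moved_point_measurable:
  assumes \<mu>: "\<mu> \<in> config_probs"
  shows "(\<lambda>\<omega>. moved_point \<omega> j) \<in> borel_measurable (\<mu> \<Otimes>\<^sub>M jump_noise t)"
  by (intro borel_measurable_diff measurable_compose[OF measurable_fst measurable_config_probs[OF \<mu> labelled_point_measurable]]
      measurable_compose[OF measurable_snd noise_component])

text \<open>The labels in \<open>l\<close> are distinct, so the \<open>n\<close> jumps involved are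
  independent and have the joint law \<open>tuple_law t n\<close>.\<close>

lemma nn_integral_noise_label_term:
  assumes l: "l \<in> label_tuples n" and G: "G \<in> tuple_borel n"
  shows "(\<integral>\<^sup>+\<xi>. label_term n G E (\<lambda>j. X j - \<xi> j) l \<partial>jump_noise t) = label_term n (jump_back t n G) E X l"
proof (cases "\<forall>i<n. E (l i)")
  case True
  let ?x = "\<lambda>i\<in>{..<n}. X (l i)"
  have x: "?x \<in> space (tuple_lborel n)" by (simp add: space_tuple)
  have d: "distr (jump_noise t) (tuple_law t n) (\<lambda>\<xi>. \<lambda>i\<in>{..<n}. \<xi> (l i)) = tuple_law t n"
    by (rule distr_PiM_reindex) (use l prob_space_jump_law in \<open>auto simp: label_tuples_def\<close>)
  have m: "(\<lambda>\<xi>. \<lambda>i\<in>{..<n}. \<xi> (l i)) \<in> jump_noise t \<rightarrow>\<^sub>M tuple_law t n"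
    by (intro measurable_restrict measurable_component_singleton UNIV_I)
  have Gm: "(\<lambda>z. G (tuple_back n ?x z)) \<in> borel_measurable (tuple_law t n)"
    by (rule measurable_compose[OF tuple_back_sections(1)[OF x] G])
  have "jump_back t n G ?x = (\<integral>\<^sup>+z. G (tuple_back n ?x z) \<partial>distr (jump_noise t) (tuple_law t n) (\<lambda>\<xi>. \<lambda>i\<in>{..<n}. \<xi> (l i)))"
    by (simp only: d jump_back_def)
  also have "\<dots> = (\<integral>\<^sup>+\<xi>. G (tuple_back n ?x (\<lambda>i\<in>{..<n}. \<xi> (l i))) \<partial>jump_noise t)"
    by (rule nn_integral_distr[OF m]) (use Gm in \<open>simp only: measurable_distr_eq1\<close>)
  also have "\<dots> = (\<integral>\<^sup>+\<xi>. G (\<lambda>i\<in>{..<n}. X (l i) - \<xi> (l i)) \<partial>jump_noise t)"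
    by (simp cong: restrict_cong)
  finally show ?thesis using True by (simp add: label_term_def)
next
  case False
  then have "label_term n H E Y l = 0" for H :: "(nat \<Rightarrow> 'a) \<Rightarrow> ennreal" and Y unfolding label_term_def by (rule if_not_P)
  then show ?thesis by simp
qed

lemma nn_integral_noise_label_sum:
  assumes G: "G \<in> tuple_borel n"
  shows "(\<integral>\<^sup>+\<xi>. label_sum n G E (\<lambda>j. X j - \<xi> j) \<partial>jump_noise t) = label_sum n (jump_back t n G) E X"
proof -
  interpret N: prob_space "jump_noise t" by (intro prob_space_PiM prob_space_jump_law)
  have "(\<integral>\<^sup>+\<xi>. label_sum n G E (\<lambda>j. X j - \<xi> j) \<partial>jump_noise t) =
    (\<integral>\<^sup>+l. \<integral>\<^sup>+\<xi>. label_term n G E (\<lambda>j. X j - \<xi> j) l \<partial>jump_noise t \<partial>count_space (label_tuples n))"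
    by (rule label_sum_measurable(2)[where E="\<lambda>_. E" and X="\<lambda>\<xi> j. X j - \<xi> j"])
      (intro borel_measurable_diff borel_measurable_const noise_component G N.sigma_finite_measure_axioms sets.sets_Collect_const)+
  also have "\<dots> = label_sum n (jump_back t n G) E X"
    unfolding label_sum_def by (intro nn_integral_cong) (simp add: nn_integral_noise_label_term[OF _ G])
  finally show ?thesis .
qed

text \<open>Given \<open>\<gamma>\<close>, the noise is averaged first, which turns \<open>G\<close>
  into \<open>jump_back t n G\<close>; after that the labelled sum is a sum over the points of
  \<open>\<gamma>\<close> itself, whose positions are distinct.\<close>

lemma moved_label_sum:
  assumes \<mu>: "\<mu> \<in> config_probs" and G: "G \<in> tuple_borel n"
  shows "(\<lambda>\<omega>. moved_sum n G \<omega>) \<in> borel_measurable (\<mu> \<Otimes>\<^sub>M jump_noise t)"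
    and "(\<integral>\<^sup>+\<omega>. moved_sum n G \<omega> \<partial>(\<mu> \<Otimes>\<^sub>M jump_noise t)) = (\<integral>\<^sup>+\<gamma>. tuple_sum n (jump_back t n G) \<gamma> \<partial>\<mu>)"
proof -
  interpret N: prob_space "jump_noise t" by (intro prob_space_PiM prob_space_jump_law)
  show m: "(\<lambda>\<omega>. moved_sum n G \<omega>) \<in> borel_measurable (\<mu> \<Otimes>\<^sub>M jump_noise t)"
  proof (rule label_sum_measurable(1)[OF _ _ G])
    show "{\<omega> \<in> space (\<mu> \<Otimes>\<^sub>M jump_noise t). labelled (fst \<omega>) j} \<in> sets (\<mu> \<Otimes>\<^sub>M jump_noise t)" for j
      by (rule moved_labelled_sets[OF \<mu>])
    show "(\<lambda>\<omega>. moved_point \<omega> j) \<in> borel_measurable (\<mu> \<Otimes>\<^sub>M jump_noise t)" for j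
      by (rule moved_point_measurable[OF \<mu>])
  qed
  have "(\<integral>\<^sup>+\<omega>. moved_sum n G \<omega> \<partial>(\<mu> \<Otimes>\<^sub>M jump_noise t)) =
    (\<integral>\<^sup>+\<gamma>. \<integral>\<^sup>+\<xi>. label_sum n G (labelled \<gamma>) (\<lambda>j. labelled_point j \<gamma> - \<xi> j) \<partial>jump_noise t \<partial>\<mu>)"
    using N.nn_integral_fst[OF m] by simp
  also have "\<dots> = (\<integral>\<^sup>+\<gamma>. tuple_sum n (jump_back t n G) \<gamma> \<partial>\<mu>)"
    by (intro nn_integral_cong) (simp only: nn_integral_noise_label_sum[OF G] tuple_sum_labelled space_config_probs[OF \<mu>])
  finally show "(\<integral>\<^sup>+\<omega>. moved_sum n G \<omega> \<partial>(\<mu> \<Otimes>\<^sub>M jump_noise t)) = (\<integral>\<^sup>+\<gamma>. tuple_sum n (jump_back t n G) \<gamma> \<partial>\<mu>)" .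
qed

theorem jump_correlation_function:
  assumes \<mu>: "\<mu> \<in> config_probs" "is_correlation_function \<mu> u" and u: "u \<in> K_space \<theta>"
  shows "\<exists>\<nu>\<in>config_probs. is_correlation_function \<nu> (jump_sg t u)"
proof -
  interpret \<mu>: prob_space \<mu> using \<mu>(1) by (simp add: config_probs_def)
  interpret N: prob_space "jump_noise t" by (intro prob_space_PiM prob_space_jump_law)
  interpret P: pair_prob_space \<mu> "jump_noise t" by unfold_locales
  let ?\<Omega> = "\<mu> \<Otimes>\<^sub>M jump_noise t" and ?v = "jump_sg t u"
  have um: "u \<in> config_borel" by (rule K_spaceD(1)[OF u])
  have vK: "?v \<in> K_space \<theta>" by (rule K_space_jump_sg[OF u])
  obtain C where C: "K_norm \<theta> u \<le> ereal C" using K_spaceD(2)[OF u] by blast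
  have ub: "sector_bound n u (C * exp (- \<theta> * real n))" for n
    using K_norm_le_iff[of u \<theta> C] um C by simp
  have vb: "sector_bound n ?v (C * exp (- \<theta> * real n))" for n
    by (rule sector_bound_jump_sg[OF um ub])
  have u0: "u {} = 1" using \<mu>(2) by (simp add: is_correlation_function_def)
  have un: "AE x in tuple_lborel n. 0 \<le> u (x ` {..<n})" for n
  proof (cases "1 \<le> n")
    case True
    then show ?thesis using \<mu>(2) unfolding is_correlation_function_def by metis
  next
    case False
    then have "u (x ` {..<n}) = 1" for x :: "nat \<Rightarrow> 'a" using u0 by (simp add: not_less_eq_eq)
    then show ?thesis by simp
  qed
  \<comment> \<open>This concerns the labelled sum, for which the displaced points may still
    accumulate or coincide; the cases \<open>n = 1\<close> and \<open>n = 2\<close> are used below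
    to exclude both.\<close>
  have ex: "(\<integral>\<^sup>+\<omega>. moved_sum n G \<omega> \<partial>?\<Omega>) = correlation_integral n ?v G"
    if "1 \<le> n" "G \<in> tuple_borel n" for n G
    unfolding moved_label_sum(2)[OF \<mu>(1) that(2)]
      correlation_nn_integral[OF \<mu> that(1) jump_back_measurable[OF that(2)]]
    by (rule jump_back_duality[OF um un ub that(2)])
  let ?L = "\<lambda>n G \<omega>. moved_sum n G \<omega>"
  let ?box = "\<lambda>m x. if x ` {..<1} \<subseteq> cball 0 (real m) then 1 else 0 :: ennreal"
  \<comment> \<open>Both conditions are phrased by labelled sums, so that their probability can be
    read off from \<open>ex\<close>: the first excludes accumulation in balls, the second
    coincidence.\<close>
  define good where "good \<omega> \<longleftrightarrow> (\<forall>m :: nat. ?L 1 (?box m) \<omega> < \<infinity>) \<and> ?L 2 (indicator coincident) \<omega> = 0" for \<omega>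
  have box1: "?box m \<in> borel_measurable (tuple_lborel 1)" for m by (rule box_measurable) simp
  have coi: "coincident \<in> sets (tuple_lborel 2 :: (nat \<Rightarrow> 'a) measure)"
    by (intro sets.Diff sets.top distinct_tuples_sets)
  have co: "(indicator coincident :: _ \<Rightarrow> ennreal) \<in> borel_measurable (tuple_lborel 2 :: (nat \<Rightarrow> 'a) measure)"
    by (rule borel_measurable_indicator[OF coi])
  note L1[measurable] = moved_label_sum(1)[OF \<mu>(1) box1] and L2[measurable] = moved_label_sum(1)[OF \<mu>(1) co]
  have good_sets: "{\<omega> \<in> space ?\<Omega>. good \<omega>} \<in> sets ?\<Omega>"
    unfolding good_def by (intro sets.sets_Collect_conj sets.sets_Collect_countable_All borel_measurable_less borel_measurable_eq L1 L2) auto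
  have AE_good: "AE \<omega> in ?\<Omega>. good \<omega>"
    unfolding good_def
  proof (intro AE_conjI AE_all_countable[THEN iffD2] allI)
    fix m :: nat
    have "(\<integral>\<^sup>+\<omega>. ?L 1 (?box m) \<omega> \<partial>?\<Omega>) = box_moment (cball 0 (real m)) ?v 1"
      unfolding ex[OF order_refl box1] by (simp add: box_moment_def)
    also have "\<dots> < \<infinity>"
      by (rule le_less_trans[OF box_moment_bound[OF _ _ vb]]) auto
    finally show "AE \<omega> in ?\<Omega>. ?L 1 (?box m) \<omega> < \<infinity>"
      using nn_integral_PInf_AE[OF L1[of m]] by (simp add: less_top)
  next
    have "(\<integral>\<^sup>+\<omega>. ?L 2 (indicator coincident) \<omega> \<partial>?\<Omega>) = (\<integral>\<^sup>+x. indicator coincident x * ennreal (?v (x ` {..<2})) \<partial>tuple_lborel 2)"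
      by (rule ex[OF _ co]) simp
    also have "\<dots> = (\<integral>\<^sup>+x. 0 \<partial>(tuple_lborel 2 :: (nat \<Rightarrow> 'a) measure))"
      by (rule nn_integral_cong_AE) (use AE_distinct[of 2] in \<open>eventually_elim, simp\<close>)
    finally show "AE \<omega> in ?\<Omega>. ?L 2 (indicator coincident) \<omega> = 0"
      using nn_integral_0_iff_AE[OF L2] by simp
  qed
  \<comment> \<open>The empty configuration on the exceptional null set makes \<open>T\<close> take
    values in configurations everywhere.\<close>
  define T where "T \<omega> = (if good \<omega> then moved_point \<omega> ` {j. labelled (fst \<omega>) j} else {})" for \<omega>
  have bij: "bij_betw (moved_point \<omega>) {j. labelled (fst \<omega>) j} (T \<omega>)" if "good \<omega>" for \<omega>
    using label_sum_inj[of "labelled (fst \<omega>)" "moved_point \<omega>"] that by (simp add: bij_betw_def T_def good_def)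
  have T: "T \<in> ?\<Omega> \<rightarrow>\<^sub>M vague_space"
  proof (rule measurable_vagueI)
    fix \<omega>
    show "T \<omega> \<in> configurations"
    proof (cases "good \<omega>")
      case True
      show ?thesis
        unfolding configurations_def
      proof (intro CollectI allI impI)
        fix K :: "'a set" assume "compact K"
        then obtain R where "\<forall>x\<in>K. norm x \<le> R" using bounded_iff[THEN iffD1, OF compact_imp_bounded] by blast
        then have R: "K \<subseteq> cball 0 R" by auto
        obtain m :: nat where m: "R \<le> real m" using real_arch_simple by blast
        have "finite {j. labelled (fst \<omega>) j \<and> moved_point \<omega> j \<in> cball 0 (real m)}"
          using True by (intro label_sum_finite) (simp add: good_def)
        moreover have "T \<omega> \<inter> K \<subseteq> moved_point \<omega> ` {j. labelled (fst \<omega>) j \<and> moved_point \<omega> j \<in> cball 0 (real m)}"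
        proof
          fix y assume y: "y \<in> T \<omega> \<inter> K"
          then obtain j where j: "labelled (fst \<omega>) j" "y = moved_point \<omega> j" using True by (auto simp: T_def)
          have "y \<in> cball 0 R" using y R by blast
          then have "y \<in> cball 0 (real m)" using m by simp
          then show "y \<in> moved_point \<omega> ` {j. labelled (fst \<omega>) j \<and> moved_point \<omega> j \<in> cball 0 (real m)}"
            using j by blast
        qed
        ultimately show "finite (T \<omega> \<inter> K)" by (rule finite_surj)
      qed
    qed (simp add: T_def configurations_def)
  next
    fix B :: "'a set" assume B: "B \<in> sets borel" "bounded B"
    have hit: "{\<omega> \<in> space ?\<Omega>. moved_point \<omega> j \<in> B} \<in> sets ?\<Omega>" for j
      using measurable_sets[OF moved_point_measurable[OF \<mu>(1)] B(1)] by (simp add: vimage_def Int_def conj_commute)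
    have "{\<omega> \<in> space ?\<Omega>. T \<omega> \<inter> B = {}} = {\<omega> \<in> space ?\<Omega>. good \<omega> \<longrightarrow> (\<forall>j. labelled (fst \<omega>) j \<longrightarrow> \<not> moved_point \<omega> j \<in> B)}"
      by (auto simp: T_def)
    also have "\<dots> \<in> sets ?\<Omega>"
      by (intro sets.sets_Collect_imp sets.sets_Collect_countable_All sets.sets_Collect_neg hit good_sets moved_labelled_sets[OF \<mu>(1)])
    finally show "{\<omega> \<in> space ?\<Omega>. T \<omega> \<inter> B = {}} \<in> sets ?\<Omega>" .
  qed
  let ?\<nu> = "distr ?\<Omega> vague_space T"
  have \<nu>: "?\<nu> \<in> config_probs"
    using P.prob_space_distr[OF T] by (simp add: config_probs_def)
  moreover have "is_correlation_function ?\<nu> ?v"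
  proof (rule is_correlation_functionI[OF \<nu> jump_sg_measurable[OF um] _ jump_sg_nonneg[OF um un] vb])
    show "?v {} = 1"
    proof -
      interpret E: prob_space "(\<Pi>\<^sub>M x\<in>({} :: 'a set). jump_law t)" by (intro prob_space_PiM prob_space_jump_law)
      show ?thesis using E.prob_space by (simp add: jump_sg_def u0)
    qed
    fix n :: nat and G :: "(nat \<Rightarrow> 'a) \<Rightarrow> ennreal" assume n: "1 \<le> n" and G: "G \<in> tuple_borel n"
    have "(\<integral>\<^sup>+\<gamma>. tuple_sum n G \<gamma> \<partial>?\<nu>) = (\<integral>\<^sup>+\<omega>. tuple_sum n G (T \<omega>) \<partial>?\<Omega>)"
      using tuple_sum_measurable[OF G] by (intro nn_integral_distr[OF T]) (simp only: measurable_distr_eq1)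
    also have "\<dots> = (\<integral>\<^sup>+\<omega>. ?L n G \<omega> \<partial>?\<Omega>)"
    proof (rule nn_integral_cong_AE)
      show "AE \<omega> in ?\<Omega>. tuple_sum n G (T \<omega>) = ?L n G \<omega>"
        using AE_good
      proof eventually_elim
        case (elim \<omega>)
        show ?case by (rule tuple_sum_labels[OF bij[OF elim]])
      qed
    qed
    also have "\<dots> = correlation_integral n ?v G" by (rule ex[OF n G])
    finally show "(\<integral>\<^sup>+\<gamma>. tuple_sum n G \<gamma> \<partial>?\<nu>) = correlation_integral n ?v G" .
  qed
  ultimately show ?thesis by (rule bexI[rotated])
qed

end

theorem theorem2p5:
  fixes a :: "real ^ 'd \<Rightarrow> real" and \<theta> :: real
  assumes "a \<in> borel_measurable borel"
    and "\<And>x. 0 \<le> a x"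
    and "\<And>x. a x = a (- x)"
    and "integrable lborel a"
  shows "(\<forall>k0 \<in> sun_domain a \<theta>. \<exists>k.
            classical_solution a \<theta> k0 k \<and>
            (\<forall>l. classical_solution a \<theta> k0 l \<longrightarrow>
               (\<forall>t\<ge>0. AE \<eta> in lebesgue_poisson. l t \<eta> = k t \<eta>)) \<and>
            (\<forall>t>0. AE \<eta> in lebesgue_poisson. k t \<eta> = sun_semigroup a \<theta> t k0 \<eta>) \<and>
            (\<forall>\<mu>0 \<in> config_probs. is_correlation_function \<mu>0 k0 \<longrightarrow>
               (\<forall>t>0. \<exists>!\<mu>. \<mu> \<in> config_probs \<and> is_correlation_function \<mu> (k t)))) \<and>
         (\<forall>\<theta>'>\<theta>. K_space \<theta>' \<subseteq> sun_domain a \<theta>)"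
proof -
  interpret jump_kernel a
    by unfold_locales (use assms in simp_all)
  show ?thesis
  proof (intro conjI ballI allI impI exI)
    fix k0 assume k0: "k0 \<in> sun_domain a \<theta>"
    have kK: "k0 \<in> K_space \<theta>" using k0 by (auto simp: sun_graph_def adjoint_graph_def)
    \<comment> \<open>The witness is the explicit \<open>jump_sg\<close>, for which the correlation
      function property is proved by displacement; the chosen \<open>sun_semigroup\<close> agrees
      with it up to null sets.\<close>
    show s: "classical_solution a \<theta> k0 (\<lambda>t. jump_sg t k0)" by (rule Cauchy_problem(1)[OF k0])
    show "AE \<eta> in lebesgue_poisson. l t \<eta> = jump_sg t k0 \<eta>" if "classical_solution a \<theta> k0 l" "0 \<le> t" for l t
      by (rule classical_solution_unique[OF that(1) s that(2)])
    show "AE \<eta> in lebesgue_poisson. jump_sg t k0 \<eta> = sun_semigroup a \<theta> t k0 \<eta>" if "0 < t" for t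
      by (rule Cauchy_problem(2)[OF k0]) (use that in simp)
    show "\<exists>!\<mu>. \<mu> \<in> config_probs \<and> is_correlation_function \<mu> (jump_sg t k0)"
      if "\<mu>0 \<in> config_probs" "is_correlation_function \<mu>0 k0" for \<mu>0 t
      using jump_correlation_function[OF that kK, of t] correlation_function_unique[OF K_space_jump_sg[OF kK, of t]] by blast
  next
    show "K_space \<theta>' \<subseteq> sun_domain a \<theta>" if "\<theta> < \<theta>'" for \<theta>' by (rule K_space_sun_domain[OF that])
  qed
qed

end
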